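(* Suppose the linear independence, set-$B$, projection, Hölder and stability conditions (defined in the context) hold. Then for each $\alpha\in U$ there exists a unique stationary distribution of the joint process $\Xi^\alpha=(Z^\alpha,\mathcal{J}^\alpha)$ associated with $\alpha$; that is, there is exactly one probability measure $\mu^\alpha$ on $(\mathbb{X},\mathcal{B}(\mathbb{X}))$ such that $\mu^\alpha(A)=\int_{\mathbb{X}}P_t^\alpha(\xi,A)\,\mu^\alpha(d\xi)$ for all $A\in\mathcal{B}(\mathbb{X})$ and $t\ge0$, where $P_t^\alpha(\xi,A)=\mathbb{P}(\Xi^{\alpha,\xi}(t)\in A)$.
   Context: Geometry. $J\in\mathbb{N}$, $\mathcal{I}=\{1,\dots,J\}$; $n_1,\dots,n_J\in\mathbb{R}^J$ are linearly independent unit vectors; $G=\{x\in\mathbb{R}^J:\langle x,n_i\rangle\ge0\ \forall i\in\mathcal{I}\}$ with interior $G^\circ$; $F_i=\{x\in\partial G:\langle x,n_i\rangle=0\}$; $\mathcal{I}(x)=\{i\in\mathcal{I}:x\in F_i\}$ for $x\in G$. $U\subset\mathbb{R}$ is open; for each $i\in\mathcal{I}$, $d_i:U\to\mathbb{R}^J$ is continuously differentiable with $\langle d_i(\alpha),n_i\rangle=1$ for all $\alpha$. $R(\alpha)$ is the $J\times J$ matrix with columns $d_1(\alpha),\dots,d_J(\alpha)$. $\mathrm{cone}(E)$ is the set of finite nonnegative linear combinations of elements of $E$; $\mathrm{cone}(\emptyset)=\mathrm{span}(\emptyset)=\{0\}$. $d(\alpha,x)=\mathrm{cone}(\{d_i(\alpha):i\in\mathcal{I}(x)\})$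 for $x\in G$ (so $\{0\}$ if $x\in G^\circ$). $\mathbb{H}_x=\{y\in\mathbb{R}^J:\langle y,n_i\rangle=0\ \forall i\in\mathcal{I}(x)\}$ (so $\mathbb{R}^J$ if $x\in G^\circ$). Conditions. Linear independence condition: for each $\alpha\in U$, $\{d_i(\alpha)\}_{i\in\mathcal{I}}$ is linearly independent. Set-$B$ condition: for each $\alpha\in U$ there are $\theta(\alpha)>0$ and a compact, convex, symmetric set $B^\alpha\subset\mathbb{R}^J$ with $0$ in its interior such that for every $i\in\mathcal{I}$: if $z\in\partial B^\alpha$ and $|\langle z,n_i\rangle|<\theta(\alpha)$ then $\langle\nu,d_i(\alpha)\rangle=0$ for every unit vector $\nu$ with $\langle\nu,y-z\rangle\ge0$ for all $y\in B^\alpha$; moreover $\alpha\mapsto B^\alpha$ is continuous in the Hausdorff metric. Projection condition: for each $\alpha\in U$ there is $\pi^\alpha:\mathbb{R}^J\to G$ with $\pi^\alpha(x)=x$ for $x\in G$ and $\pi^\alpha(x)-x\in d(\alpha,\pi^\alpha(x))$ for $x\notin G$. Coefficients. $a$ is a continuously differentiable map from $U$ to the symmetric positive-definite $J\times J$ matrices, $b:U\to\mathbb{R}^J$ is continuously differentiable, $\sigma(\alpha)$ is the unique symmetric positive-definite square root of $a(\alpha)$; primes denote derivatives in $\alpha$. Hölder condition: there are $\kappa'<\infty$, $\gamma\in(0,1]$ with $|b'(\alpha)-b'(\tilde\alpha)|+\|\sigma'(\alpha)-\sigma'(\tilde\alpha)\|+\|R'(\alpha)-R'(\tilde\alpha)\|\le\kappa'|\alpha-\tilde\alpha|^\gamma$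 for all $\alpha,\tilde\alpha\in U$. Stability condition: for each $\alpha\in U$, $b(\alpha)$ lies in the interior of $\mathrm{cone}(\{-d_i(\alpha):i\in\mathcal{I}\})$. Processes. $(\Omega,\mathcal{F},\{\mathcal{F}_t\},\mathbb{P})$ is a filtered probability space satisfying the usual conditions, $W$ a $J$-dimensional $\{\mathcal{F}_t\}$-Brownian motion started at $0$. An RBM associated with $\alpha$ is a continuous $\{\mathcal{F}_t\}$-adapted process $Z^\alpha$ such that a.s. for all $t\ge0$, $Z^\alpha(t)\in G$ and $Z^\alpha(t)=Z^\alpha(0)+b(\alpha)t+\sigma(\alpha)W(t)+Y^\alpha(t)$, where $Y^\alpha$ is continuous, adapted and a.s. $Y^\alpha(t)-Y^\alpha(s)\in\mathrm{cone}[\bigcup_{u\in(s,t]}d(\alpha,Z^\alpha(u))]$ for all $0\le s<t$. Put $L^\alpha=R(\alpha)^{-1}Y^\alpha$. A derivative process along $Z^\alpha$ is a right-continuous with left limits (RCLL) adapted $\mathbb{R}^J$-valued process $\mathcal{J}^\alpha$ such that a.s. for all $t\ge0$, $\mathcal{J}^\alpha(t)\in\mathbb{H}_{Z^\alpha(t)}$ and $\mathcal{J}^\alpha(t)=\mathcal{J}^\alpha(0)+b'(\alpha)t+\sigma'(\alpha)W(t)+R'(\alpha)L^\alpha(t)+\mathcal{K}^\alpha(t)$, where $\mathcal{K}^\alpha$ is RCLL, adapted, $\mathcal{K}^\alpha(0)=0$ and a.s. $\mathcal{K}^\alpha(t)-\mathcal{K}^\alpha(s)\in\mathrm{span}[\bigcup_{u\in(s,t]}d(\alpha,Z^\alpha(u))]$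 for all $0\le s<t$. It is known that under the first four conditions, for $\alpha\in U$, $x\in G$, $y\in\mathbb{H}_x$, there are a pathwise unique RBM $Z^{\alpha,x}$ with $Z^{\alpha,x}(0)=x$ and, with $\xi=(x,y)$, a pathwise unique derivative process $\mathcal{J}^{\alpha,\xi}$ along $Z^{\alpha,x}$ with $\mathcal{J}^{\alpha,\xi}(0)=y$. The joint process is $\Xi^{\alpha,\xi}=(Z^{\alpha,x},\mathcal{J}^{\alpha,\xi})$, taking values in $\mathbb{X}=\bigcup_{x\in G}(\{x\}\times\mathbb{H}_x)\subseteq G\times\mathbb{R}^J$ (with the subspace topology). *)

theory Defs
  imports "HOL-Probability.Probability"
begin

text \<open>
  The index set \<open>{1,\<dots>,J}\<close> is a finite type \<open>'n\<close>, so \<open>\<real>\<^sup>J\<close> is \<open>real^'n\<close>. The normals are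
  \<open>n :: 'n \<Rightarrow> real^'n\<close> and the reflection directions \<open>d :: 'n \<Rightarrow> real \<Rightarrow> real^'n\<close> (index first,
  then the parameter \<open>\<alpha>\<close>). Functions of \<open>\<alpha>\<close> are total on \<open>real\<close>, and constrained on \<open>U\<close> only.
\<close>

section \<open>Linear algebra\<close>

text \<open>Linear independence of a family; unlike \<open>independent (range v)\<close> this rules out repetitions.\<close>

definition lin_indep_family :: "('n::finite \<Rightarrow> 'v::real_vector) \<Rightarrow> bool" where
  "lin_indep_family v \<longleftrightarrow> (\<forall>c. (\<Sum>i\<in>UNIV. c i *\<^sub>R v i) = 0 \<longrightarrow> (\<forall>i. c i = 0))"

text \<open>The library's \<open>cone\<close> is a predicate on sets. The empty combination gives \<open>fin_cone {} = {0}\<close>.\<close>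

definition fin_cone :: "'v::real_vector set \<Rightarrow> 'v set" where
  "fin_cone E = {y. \<exists>S c. finite S \<and> S \<subseteq> E \<and> (\<forall>v\<in>S. 0 \<le> c v) \<and> y = (\<Sum>v\<in>S. c v *\<^sub>R v)}"

definition sym_posdef :: "real^'n^'n \<Rightarrow> bool" where
  "sym_posdef A \<longleftrightarrow> transpose A = A \<and> (\<forall>x. x \<noteq> 0 \<longrightarrow> 0 < x \<bullet> (A *v x))"

definition posdef_sqrt :: "real^'n^'n \<Rightarrow> real^'n^'n" where
  "posdef_sqrt A = (THE S. sym_posdef S \<and> S ** S = A)"

section \<open>Geometry\<close>

definition polyhedron_G :: "('n \<Rightarrow> real^'n) \<Rightarrow> (real^'n) set" where
  "polyhedron_G n = {x. \<forall>i. 0 \<le> x \<bullet> n i}"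

definition face_F :: "('n \<Rightarrow> real^'n) \<Rightarrow> 'n \<Rightarrow> (real^'n) set" where
  "face_F n i = {x \<in> frontier (polyhedron_G n). x \<bullet> n i = 0}"

definition active :: "('n \<Rightarrow> real^'n) \<Rightarrow> real^'n \<Rightarrow> 'n set" where
  "active n x = {i. x \<in> face_F n i}"

definition refl_matrix :: "('n \<Rightarrow> real \<Rightarrow> real^'n) \<Rightarrow> real \<Rightarrow> real^'n^'n" where
  "refl_matrix d \<alpha> = (\<chi> r c. d c \<alpha> $ r)"

definition refl_cone ::
    "('n \<Rightarrow> real^'n) \<Rightarrow> ('n \<Rightarrow> real \<Rightarrow> real^'n) \<Rightarrow> real \<Rightarrow> real^'n \<Rightarrow> (real^'n) set" where
  "refl_cone n d \<alpha> x = fin_cone ((\<lambda>i. d i \<alpha>) ` active n x)"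

definition tangent_H :: "('n \<Rightarrow> real^'n) \<Rightarrow> real^'n \<Rightarrow> (real^'n) set" where
  "tangent_H n x = {y. \<forall>i\<in>active n x. y \<bullet> n i = 0}"

definition joint_space :: "('n \<Rightarrow> real^'n) \<Rightarrow> ((real^'n) \<times> (real^'n)) set" where
  "joint_space n = (\<Union>x\<in>polyhedron_G n. {x} \<times> tangent_H n x)"

section \<open>Conditions on the coefficients\<close>

definition lin_indep_condition :: "real set \<Rightarrow> ('n::finite \<Rightarrow> real \<Rightarrow> real^'n) \<Rightarrow> bool" where
  "lin_indep_condition U d \<longleftrightarrow> (\<forall>\<alpha>\<in>U. lin_indep_family (\<lambda>i. d i \<alpha>))"

definition hausdorff_distance :: "'v::metric_space set \<Rightarrow> 'v set \<Rightarrow> real" where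
  "hausdorff_distance A B = max (SUP x\<in>A. infdist x B) (SUP y\<in>B. infdist y A)"

definition set_B_condition ::
    "real set \<Rightarrow> ('n \<Rightarrow> real^'n) \<Rightarrow> ('n \<Rightarrow> real \<Rightarrow> real^'n) \<Rightarrow> bool" where
  "set_B_condition U n d \<longleftrightarrow>
    (\<exists>(\<theta> :: real \<Rightarrow> real) (B :: real \<Rightarrow> (real^'n) set).
      (\<forall>\<alpha>\<in>U. 0 < \<theta> \<alpha> \<and> compact (B \<alpha>) \<and> convex (B \<alpha>) \<and> (\<forall>z\<in>B \<alpha>. - z \<in> B \<alpha>) \<and>
        0 \<in> interior (B \<alpha>) \<and>
        (\<forall>i. \<forall>z\<in>frontier (B \<alpha>). \<bar>z \<bullet> n i\<bar> < \<theta> \<alpha> \<longrightarrow>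
          (\<forall>\<nu>. norm \<nu> = 1 \<and> (\<forall>y\<in>B \<alpha>. 0 \<le> \<nu> \<bullet> (y - z)) \<longrightarrow> \<nu> \<bullet> d i \<alpha> = 0))) \<and>
      (\<forall>\<alpha>\<in>U. ((\<lambda>\<beta>. hausdorff_distance (B \<beta>) (B \<alpha>)) \<longlongrightarrow> 0) (at \<alpha> within U)))"

definition projection_condition ::
    "real set \<Rightarrow> ('n \<Rightarrow> real^'n) \<Rightarrow> ('n \<Rightarrow> real \<Rightarrow> real^'n) \<Rightarrow> bool" where
  "projection_condition U n d \<longleftrightarrow>
    (\<forall>\<alpha>\<in>U. \<exists>\<pi>. (\<forall>x. \<pi> x \<in> polyhedron_G n) \<and> (\<forall>x\<in>polyhedron_G n. \<pi> x = x) \<and>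
      (\<forall>x. x \<notin> polyhedron_G n \<longrightarrow> \<pi> x - x \<in> refl_cone n d \<alpha> (\<pi> x)))"

text \<open>The matrix norm is the library's Frobenius norm; as \<open>\<kappa>\<close> is existentially quantified, any
  other matrix norm gives an equivalent condition.\<close>

definition holder_condition ::
    "real set \<Rightarrow> ('n \<Rightarrow> real \<Rightarrow> real^'n) \<Rightarrow> (real \<Rightarrow> real^'n) \<Rightarrow> (real \<Rightarrow> real^'n^'n) \<Rightarrow> bool" where
  "holder_condition U d b \<sigma> \<longleftrightarrow>
    (\<exists>\<kappa> \<gamma>. 0 < \<gamma> \<and> \<gamma> \<le> 1 \<and> (\<forall>\<alpha>\<in>U. \<forall>\<beta>\<in>U.
      norm (vector_derivative b (at \<alpha>) - vector_derivative b (at \<beta>)) +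
      norm (vector_derivative \<sigma> (at \<alpha>) - vector_derivative \<sigma> (at \<beta>)) +
      norm (vector_derivative (refl_matrix d) (at \<alpha>) - vector_derivative (refl_matrix d) (at \<beta>))
        \<le> \<kappa> * \<bar>\<alpha> - \<beta>\<bar> powr \<gamma>))"

definition stability_condition ::
    "real set \<Rightarrow> ('n \<Rightarrow> real \<Rightarrow> real^'n) \<Rightarrow> (real \<Rightarrow> real^'n) \<Rightarrow> bool" where
  "stability_condition U d b \<longleftrightarrow> (\<forall>\<alpha>\<in>U. b \<alpha> \<in> interior (fin_cone (range (\<lambda>i. - d i \<alpha>))))"

section \<open>Stochastic processes\<close>

text \<open>Time is \<open>[0,\<infinity>) \<subseteq> real\<close>. Path regularity and adaptedness are required literally (for every
  sample point), the defining identities and inclusions almost surely.\<close>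

definition usual_filtered_prob_space :: "'w measure \<Rightarrow> (real \<Rightarrow> 'w measure) \<Rightarrow> bool" where
  "usual_filtered_prob_space M F \<longleftrightarrow>
    prob_space M \<and>
    (\<forall>t\<ge>0. subalgebra M (F t)) \<and>
    (\<forall>s\<ge>0. \<forall>t\<ge>s. sets (F s) \<subseteq> sets (F t)) \<and>
    (\<forall>t\<ge>0. sets (F t) = (\<Inter>s\<in>{t<..}. sets (F s))) \<and>
    (\<forall>N\<in>null_sets M. \<forall>A\<subseteq>N. A \<in> sets (F 0))"

definition adapted_process ::
    "(real \<Rightarrow> 'w measure) \<Rightarrow> (real \<Rightarrow> 'w \<Rightarrow> 'v::topological_space) \<Rightarrow> bool" where
  "adapted_process F X \<longleftrightarrow> (\<forall>t\<ge>0. X t \<in> borel_measurable (F t))"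

definition continuous_process ::
    "'w measure \<Rightarrow> (real \<Rightarrow> 'w \<Rightarrow> 'v::topological_space) \<Rightarrow> bool" where
  "continuous_process M X \<longleftrightarrow> (\<forall>\<omega>\<in>space M. continuous_on {0..} (\<lambda>t. X t \<omega>))"

definition rcll_process ::
    "'w measure \<Rightarrow> (real \<Rightarrow> 'w \<Rightarrow> 'v::topological_space) \<Rightarrow> bool" where
  "rcll_process M X \<longleftrightarrow> (\<forall>\<omega>\<in>space M.
    (\<forall>t\<ge>0. ((\<lambda>s. X s \<omega>) \<longlongrightarrow> X t \<omega>) (at_right t)) \<and>
    (\<forall>t>0. \<exists>l. ((\<lambda>s. X s \<omega>) \<longlongrightarrow> l) (at_left t)))"

text \<open>For \<open>s < t\<close> the increment over \<open>[s,t]\<close> is centred Gaussian with covariance \<open>t - s\<close> times the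
  identity (product density; \<open>normal_density\<close> takes the standard deviation), and independent of
  \<open>F s\<close>.\<close>

definition brownian_motion ::
    "'w measure \<Rightarrow> (real \<Rightarrow> 'w measure) \<Rightarrow> (real \<Rightarrow> 'w \<Rightarrow> real^'n) \<Rightarrow> bool" where
  "brownian_motion M F W \<longleftrightarrow>
    continuous_process M W \<and> adapted_process F W \<and> (AE \<omega> in M. W 0 \<omega> = 0) \<and>
    (\<forall>s t. 0 \<le> s \<and> s < t \<longrightarrow>
      distributed M lborel (\<lambda>\<omega>. W t \<omega> - W s \<omega>)
        (\<lambda>x. ennreal (\<Prod>i\<in>UNIV. normal_density 0 (sqrt (t - s)) (x $ i))) \<and>
      prob_space.indep_set M (sets (F s))
        {(\<lambda>\<omega>. W t \<omega> - W s \<omega>) -` A \<inter> space M | A. A \<in> sets borel})"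

text \<open>\<open>Z\<close> is a reflected Brownian motion associated with \<open>\<alpha>\<close> and \<open>Y\<close> is its pushing term.\<close>

definition reflected_BM ::
    "'w measure \<Rightarrow> (real \<Rightarrow> 'w measure) \<Rightarrow> (real \<Rightarrow> 'w \<Rightarrow> real^'n) \<Rightarrow>
     ('n \<Rightarrow> real^'n) \<Rightarrow> ('n \<Rightarrow> real \<Rightarrow> real^'n) \<Rightarrow> (real \<Rightarrow> real^'n) \<Rightarrow> (real \<Rightarrow> real^'n^'n) \<Rightarrow>
     real \<Rightarrow> (real \<Rightarrow> 'w \<Rightarrow> real^'n) \<Rightarrow> (real \<Rightarrow> 'w \<Rightarrow> real^'n) \<Rightarrow> bool" where
  "reflected_BM M F W n d b \<sigma> \<alpha> Z Y \<longleftrightarrow>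
    continuous_process M Z \<and> adapted_process F Z \<and>
    continuous_process M Y \<and> adapted_process F Y \<and>
    (AE \<omega> in M. \<forall>t\<ge>0. Z t \<omega> \<in> polyhedron_G n \<and>
      Z t \<omega> = Z 0 \<omega> + t *\<^sub>R b \<alpha> + \<sigma> \<alpha> *v W t \<omega> + Y t \<omega>) \<and>
    (AE \<omega> in M. \<forall>s t. 0 \<le> s \<and> s < t \<longrightarrow>
      Y t \<omega> - Y s \<omega> \<in> fin_cone (\<Union>u\<in>{s<..t}. refl_cone n d \<alpha> (Z u \<omega>)))"

text \<open>\<open>D\<close> is a derivative process along the reflected Brownian motion \<open>Z\<close> with pushing term \<open>Y\<close>;
  the local-time term \<open>L\<close> is \<open>matrix_inv (refl_matrix d \<alpha>) *v Y\<close>.\<close>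

definition derivative_process ::
    "'w measure \<Rightarrow> (real \<Rightarrow> 'w measure) \<Rightarrow> (real \<Rightarrow> 'w \<Rightarrow> real^'n) \<Rightarrow>
     ('n \<Rightarrow> real^'n) \<Rightarrow> ('n \<Rightarrow> real \<Rightarrow> real^'n) \<Rightarrow> (real \<Rightarrow> real^'n) \<Rightarrow> (real \<Rightarrow> real^'n^'n) \<Rightarrow>
     real \<Rightarrow> (real \<Rightarrow> 'w \<Rightarrow> real^'n) \<Rightarrow> (real \<Rightarrow> 'w \<Rightarrow> real^'n) \<Rightarrow>
     (real \<Rightarrow> 'w \<Rightarrow> real^'n) \<Rightarrow> bool" where
  "derivative_process M F W n d b \<sigma> \<alpha> Z Y D \<longleftrightarrow>
    rcll_process M D \<and> adapted_process F D \<and>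
    (\<exists>K. rcll_process M K \<and> adapted_process F K \<and>
      (AE \<omega> in M. K 0 \<omega> = 0) \<and>
      (AE \<omega> in M. \<forall>t\<ge>0. D t \<omega> \<in> tangent_H n (Z t \<omega>) \<and>
        D t \<omega> = D 0 \<omega> + t *\<^sub>R vector_derivative b (at \<alpha>) + vector_derivative \<sigma> (at \<alpha>) *v W t \<omega>
          + vector_derivative (refl_matrix d) (at \<alpha>) *v (matrix_inv (refl_matrix d \<alpha>) *v Y t \<omega>)
          + K t \<omega>) \<and>
      (AE \<omega> in M. \<forall>s t. 0 \<le> s \<and> s < t \<longrightarrow>
        K t \<omega> - K s \<omega> \<in> span (\<Union>u\<in>{s<..t}. refl_cone n d \<alpha> (Z u \<omega>))))"

section \<open>Joint process and stationary distributions\<close>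

definition joint_process ::
    "('v \<Rightarrow> real \<Rightarrow> 'w \<Rightarrow> 'v) \<Rightarrow> ('v \<times> 'v \<Rightarrow> real \<Rightarrow> 'w \<Rightarrow> 'v) \<Rightarrow> 'v \<times> 'v \<Rightarrow> real \<Rightarrow> 'w \<Rightarrow> 'v \<times> 'v"
  where "joint_process Z D \<xi> t \<omega> = (Z (fst \<xi>) t \<omega>, D \<xi> t \<omega>)"

definition transition_function ::
    "'w measure \<Rightarrow> ('s \<Rightarrow> real \<Rightarrow> 'w \<Rightarrow> 's) \<Rightarrow> real \<Rightarrow> 's \<Rightarrow> 's set \<Rightarrow> real" where
  "transition_function M X t \<xi> A = measure M {\<omega> \<in> space M. X \<xi> t \<omega> \<in> A}"

text \<open>Stationary distributions, on the Borel \<open>\<sigma>\<close>-algebra of the subspace \<open>S\<close>, of a family of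
  processes \<open>X \<xi>\<close> started at \<open>\<xi> \<in> S\<close>.\<close>

definition stationary_distribution ::
    "'w measure \<Rightarrow> 's::topological_space set \<Rightarrow> ('s \<Rightarrow> real \<Rightarrow> 'w \<Rightarrow> 's) \<Rightarrow> 's measure \<Rightarrow> bool" where
  "stationary_distribution M S X \<mu> \<longleftrightarrow>
    prob_space \<mu> \<and> sets \<mu> = sets (restrict_space borel S) \<and>
    (\<forall>A\<in>sets (restrict_space borel S). \<forall>t\<ge>0.
      emeasure \<mu> A = (\<integral>\<^sup>+\<xi>. ennreal (transition_function M X t \<xi> A) \<partial>\<mu>))"

end

theory Submission
  imports Defs
begin

text \<open>
  The gauge \<open>N\<close> of \<open>B\<close> is a norm for which the reflected path and its derivative are nonexpansive in
  their initial values: by the condition on \<open>B\<close>, pushing along \<open>d i\<close> does not change \<open>N\<close> to first order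
  at vectors almost orthogonal to \<open>n i\<close>. If in addition every face is visited, compactness turns this
  into a contraction by a factor less than one, uniformly in the path.

  Stability yields a Lyapunov function comparable with the time in which the fluid model drains, hence
  exponential moments; from a bounded set every face is visited with positive probability before a fixed
  time \<open>T\<close>. So the chain observed at the multiples of \<open>T\<close> iterates random maps that contract on average
  in a weighted distance. As the derivative process need not be continuous in the initial point of \<open>Z\<close>,
  the pair is treated in two stages: coupling from the past gives a stationary \<open>Z\<close>, and then a stationary
  derivative along it, and uniqueness is obtained in the same order. Since the transition operators for
  \<open>t\<close> and \<open>T\<close> commute, the unique invariant law of the chain is invariant for every \<open>t\<close>.
\<close>

subsection \<open>The gauge of the set B\<close>

text \<open>Most estimates in \<open>N\<close> come from one maximum principle,
  \<open>N_jump\<close>: coordinates may rise where the normal component is at most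
  \<open>\<eta>\<close> and fall where it is at least \<open>- \<eta>\<close>, and \<open>N\<close>
  stays below a level \<open>c\<close> whenever \<open>\<eta> < \<theta> * c\<close>. A perturbation
  of size \<open>\<eta>\<close> thus costs about \<open>\<eta> / \<theta>\<close>, however long the
  time horizon; schemes converge, the path stays near its fluid model and the derivative is bounded
  by its driver, without factors growing in the number of steps. The contraction factor does not
  depend on the path, because only the order of the last zeros of the normal components of a
  difference matters; the faces are treated in this order, latest first. The processes are given for
  each initial state separately, up to null sets depending on it. To be measurable in the initial
  state, they are rewritten as explicit functions of it and of countably many values of
  \<open>W\<close>. The maps contract only from a bounded set and the drift helps only outside it.
  In the weight \<open>U x = 1 / 2 + \<delta> * V x\<close> the constant keeps the contraction, the
  small multiple of \<open>V\<close> the drift.\<close>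

locale set_B =
  fixes n d :: "'n::finite \<Rightarrow> real^'n" and B :: "(real^'n) set" and \<theta> :: real
  assumes norm_n: "\<And>i. norm (n i) = 1"
    and d_n: "\<And>i. d i \<bullet> n i = 1"
    and lin_d: "lin_indep_family d"
    and \<theta>_pos: "0 < \<theta>"
    and compact_B: "compact B" and convex_B: "convex B"
    and sym_B: "\<And>z. z \<in> B \<Longrightarrow> - z \<in> B"
    and zero_B: "0 \<in> interior B"
    and set_B: "\<And>i z \<nu>. z \<in> frontier B \<Longrightarrow> \<bar>z \<bullet> n i\<bar> < \<theta> \<Longrightarrow> norm \<nu> = 1 \<Longrightarrow>
                 (\<And>y. y \<in> B \<Longrightarrow> 0 \<le> \<nu> \<bullet> (y - z)) \<Longrightarrow> \<nu> \<bullet> d i = 0"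
begin

text \<open>The polar of \<open>B\<close>; by the bipolar theorem its support function
  \<open>N\<close> is the gauge of \<open>B\<close>. The dual form supplies a supporting functional
  \<open>f\<close> for each \<open>z\<close>, and such an \<open>f\<close>, reversed and normalised,
  is the normal vector of which the condition on \<open>B\<close> speaks.\<close>

definition Fs :: "(real^'n) set" where "Fs = {f. \<forall>y\<in>B. f \<bullet> y \<le> 1}"

definition N :: "real^'n \<Rightarrow> real" where "N z = (SUP f\<in>Fs. f \<bullet> z)"

lemma Fs_bounded: obtains C where "C > 0" "\<And>f. f \<in> Fs \<Longrightarrow> norm f \<le> C"
proof -
  obtain e where e: "e > 0" "cball 0 e \<subseteq> B"
    using zero_B mem_interior_cball by blast
  have "norm f \<le> 1 / e" if f: "f \<in> Fs" for f
  proof (cases "f = 0")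
    case False
    let ?y = "(e / norm f) *\<^sub>R f"
    have "?y \<in> B" using e False by (intro subsetD[OF e(2)]) (simp add: mem_cball)
    then have "f \<bullet> ?y \<le> 1" using f by (auto simp: Fs_def)
    moreover have "f \<bullet> ?y = e * norm f" using False
      by (simp add: power2_norm_eq_inner[symmetric] power2_eq_square)
    ultimately show ?thesis using e by (simp add: field_simps)
  qed (use e in auto)
  then show thesis using e that[of "1 / e"] by simp
qed

lemma zero_Fs: "0 \<in> Fs" by (simp add: Fs_def)

lemma compact_Fs: "compact Fs"
proof -
  have "Fs = (\<Inter>y\<in>B. {f. y \<bullet> f \<le> 1})" by (auto simp: Fs_def inner_commute)
  then have "closed Fs" by (auto intro!: closed_INT simp: closed_halfspace_le)
  moreover have "bounded Fs" using Fs_bounded bounded_iff by metis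
  ultimately show ?thesis by (simp add: compact_eq_bounded_closed)
qed

lemma Fs_uminus: "f \<in> Fs \<Longrightarrow> - f \<in> Fs"
  unfolding Fs_def
proof safe
  fix y assume "\<forall>y\<in>B. f \<bullet> y \<le> 1" "y \<in> B"
  then show "- f \<bullet> y \<le> 1" using sym_B[of y] by (metis inner_minus_left inner_minus_right)
qed

lemma N_attained: obtains f where "f \<in> Fs" "f \<bullet> z = N z"
proof -
  have "continuous_on Fs (\<lambda>f. f \<bullet> z)" by (intro continuous_intros)
  then obtain f where f: "f \<in> Fs" "\<forall>g\<in>Fs. g \<bullet> z \<le> f \<bullet> z"
    using continuous_attains_sup[OF compact_Fs] zero_Fs by blast
  then have "N z = f \<bullet> z" unfolding N_def by (intro cSup_eq_maximum) auto
  with f that show thesis by auto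
qed

lemma Fs_le_N: assumes "f \<in> Fs" shows "f \<bullet> z \<le> N z"
proof -
  have "continuous_on Fs (\<lambda>f. f \<bullet> z)" by (intro continuous_intros)
  then have "bdd_above ((\<lambda>f. f \<bullet> z) ` Fs)"
    by (intro bounded_imp_bdd_above compact_imp_bounded compact_continuous_image compact_Fs)
  then show ?thesis unfolding N_def using assms by (rule cSUP_upper[rotated])
qed

lemma N_leI: "(\<And>f. f \<in> Fs \<Longrightarrow> f \<bullet> z \<le> c) \<Longrightarrow> N z \<le> c"
  using N_attained by metis

lemma N_nonneg: "0 \<le> N z" using Fs_le_N[OF zero_Fs] by simp

lemma N_zero [simp]: "N 0 = 0" using N_attained[of 0] by (metis inner_zero_right)

lemma N_triangle: "N (x + y) \<le> N x + N y"
  by (rule N_leI) (simp add: inner_add_right add_mono Fs_le_N)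

lemma N_minus [simp]: "N (- x) = N x"
proof -
  have "N (- x) \<le> N x" for x
    by (rule N_leI) (metis Fs_le_N Fs_uminus inner_minus_left inner_minus_right)
  from this[of x] this[of "- x"] show ?thesis by simp
qed

lemma N_diff_commute: "N (x - y) = N (y - x)"
  using N_minus[of "x - y"] by simp

lemma N_triangle_diff: "N (x - z) \<le> N (x - y) + N (y - z)"
  using N_triangle[of "x - y" "y - z"] by simp

lemma N_diff_le: "N (x - y) \<le> N x + N y"
  using N_triangle[of x "- y"] by simp

lemma N_scale: assumes "c \<ge> 0" shows "N (c *\<^sub>R x) = c * N x"
proof (cases "c = 0")
  case False
  with assms have c: "c > 0" by simp
  have *: "N (c *\<^sub>R x) \<le> c * N x" if "c > 0" for c x
    by (rule N_leI) (use that in \<open>auto intro: mult_left_mono Fs_le_N\<close>)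
  from *[of "1/c" "c *\<^sub>R x"] c have "N x \<le> (1/c) * N (c *\<^sub>R x)" by simp
  with c have "c * N x \<le> N (c *\<^sub>R x)" by (simp add: field_simps)
  with *[OF c, of x] show ?thesis by simp
qed simp

lemma N_equiv: obtains C where "C > 0" "\<And>z. N z \<le> C * norm z" "\<And>z. norm z \<le> C * N z"
proof -
  obtain C1 where C1: "C1 > 0" "\<And>f. f \<in> Fs \<Longrightarrow> norm f \<le> C1" using Fs_bounded by blast
  obtain C2 where C2: "C2 > 0" "\<And>y. y \<in> B \<Longrightarrow> norm y \<le> C2"
    using compact_imp_bounded[OF compact_B] bounded_pos by metis
  have 1: "N z \<le> C1 * norm z" for z
    by (rule N_leI) (meson C1 Cauchy_Schwarz_ineq2 abs_le_D1 mult_right_mono norm_ge_zero order_trans)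
  have 2: "norm z \<le> C2 * N z" for z
  proof (cases "z = 0")
    case False
    let ?f = "(1 / (C2 * norm z)) *\<^sub>R z"
    have "?f \<in> Fs" unfolding Fs_def
    proof safe
      fix y assume "y \<in> B"
      then have "z \<bullet> y \<le> C2 * norm z"
        using C2(2)[of y] norm_cauchy_schwarz[of z y] mult_left_mono[of "norm y" C2 "norm z"]
        by (simp add: mult.commute)
      then show "?f \<bullet> y \<le> 1" using C2 False by (simp add: field_simps)
    qed
    from Fs_le_N[OF this, of z] have "norm z / C2 \<le> N z" using False C2
      by (simp add: power2_norm_eq_inner[symmetric] power2_eq_square)
    then show ?thesis using C2 by (simp add: field_simps)
  qed simp
  have "N z \<le> max C1 C2 * norm z" for z
    using 1[of z] mult_right_mono[of C1 "max C1 C2" "norm z"] by auto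
  moreover have "norm z \<le> max C1 C2 * N z" for z
    using 2[of z] mult_right_mono[of C2 "max C1 C2" "N z"] N_nonneg by auto
  ultimately show thesis using C1(1) that[of "max C1 C2"] by auto
qed

lemma N_eq_0 [simp]: "N z = 0 \<longleftrightarrow> z = 0"
  by (metis N_equiv N_zero mult_zero_right norm_le_zero_iff)

lemma N_pos: "z \<noteq> 0 \<Longrightarrow> 0 < N z"
  using N_nonneg[of z] N_eq_0[of z] by linarith

lemma continuous_on_N [continuous_intros]:
  assumes "continuous_on A g" shows "continuous_on A (\<lambda>x. N (g x))"
proof -
  obtain C where C: "C > 0" "\<And>z. N z \<le> C * norm z" using N_equiv by metis
  have "C-lipschitz_on UNIV N"
  proof (rule lipschitz_onI)
    fix x y :: "real^'n"
    have "N x - N y \<le> N (x - y)" "N y - N x \<le> N (x - y)"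
      using N_triangle[of "x - y" y] N_triangle[of "y - x" x] N_diff_commute[of x y] by simp_all
    then show "dist (N x) (N y) \<le> C * dist x y"
      using C(2)[of "x - y"] by (simp add: dist_norm)
  qed (use C in auto)
  from continuous_on_compose2[OF lipschitz_on_continuous_on[OF this] assms] show ?thesis by auto
qed

text \<open>One half of the bipolar theorem: a hyperplane separating \<open>z\<close> from
  \<open>B\<close>, scaled by \<open>1 / b\<close> with \<open>b < 0\<close>, is an element of the
  polar that exceeds 1 at \<open>z\<close>.\<close>

lemma N_le_1_imp_B: assumes "N z \<le> 1" shows "z \<in> B"
proof (rule ccontr)
  assume "z \<notin> B"
  then obtain a b where ab: "a \<bullet> z < b" "\<And>x. x \<in> B \<Longrightarrow> b < a \<bullet> x"
    using separating_hyperplane_closed_point[OF convex_B compact_imp_closed[OF compact_B]] by blast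
  have "b < 0" using ab(2)[of 0] zero_B interior_subset by auto
  have "(1 / b) *\<^sub>R a \<in> Fs" unfolding Fs_def
    using ab(2) \<open>b < 0\<close> by (auto simp: divide_simps less_imp_le)
  from Fs_le_N[OF this, of z] have "(a \<bullet> z) / b \<le> N z" by simp
  moreover have "1 < (a \<bullet> z) / b" using ab(1) \<open>b < 0\<close> by (simp add: divide_simps)
  ultimately show False using assms by simp
qed

text \<open>Scaled to the unit sphere of \<open>N\<close>, \<open>z\<close> is a boundary point of
  \<open>B\<close> with small normal component. The condition on \<open>B\<close> is stated for
  inward unit normals, whereas \<open>f\<close> points outwards; hence the minus sign below.\<close>

lemma support_orthogonal:
  assumes f: "f \<in> Fs" "f \<bullet> z = N z" and z: "0 < N z" "\<bar>z \<bullet> n i\<bar> < \<theta> * N z"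
  shows "f \<bullet> d i = 0"
proof -
  let ?z = "(1 / N z) *\<^sub>R z"
  have z0: "z \<noteq> 0" using z(1) by auto
  have "N ?z = 1" using z0 N_nonneg[of z] by (subst N_scale) auto
  then have zB: "?z \<in> B" by (intro N_le_1_imp_B) simp
  have fz: "f \<bullet> ?z = 1" using f z0 by simp
  \<comment> \<open>From an interior point one could move a little along \<open>f\<close> and exceed
    the value 1 inside \<open>B\<close>.\<close>
  have "?z \<notin> interior B"
  proof
    assume "?z \<in> interior B"
    then obtain e where e: "e > 0" "cball ?z e \<subseteq> B" using mem_interior_cball by blast
    have "f \<noteq> 0" using fz by auto
    have "?z + (e / norm f) *\<^sub>R f \<in> B" using e by (intro subsetD[OF e(2)]) (auto simp: dist_norm)
    then have "f \<bullet> (?z + (e / norm f) *\<^sub>R f) \<le> 1" using f by (auto simp: Fs_def)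
    moreover have "f \<bullet> ((e / norm f) *\<^sub>R f) > 0" using e \<open>f \<noteq> 0\<close> by simp
    ultimately show False using fz by (simp only: inner_add_right)
  qed
  then have fr: "?z \<in> frontier B" using zB closure_subset by (auto simp: frontier_def)
  have zn: "\<bar>?z \<bullet> n i\<bar> < \<theta>" using z by (simp add: field_simps abs_mult)
  have f0: "f \<noteq> 0" using fz by auto
  have "(- (1 / norm f) *\<^sub>R f) \<bullet> d i = 0"
  proof (rule set_B[OF fr zn])
    show "norm (- (1 / norm f) *\<^sub>R f) = 1" using f0 by simp
    fix y assume "y \<in> B"
    then have "f \<bullet> y \<le> 1" using f by (auto simp: Fs_def)
    then have "(1 / norm f) * (f \<bullet> y) \<le> (1 / norm f) * (f \<bullet> ?z)" using fz by (intro mult_left_mono) auto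
    then show "0 \<le> (- (1 / norm f) *\<^sub>R f) \<bullet> (y - ?z)"
      by (simp only: inner_diff_right inner_scaleR_left)
  qed
  then show ?thesis using f0 by simp
qed

text \<open>If \<open>z\<close> lies far on the negative side of the hyperplane, it is carried along
  \<open>d i\<close> onto it. A functional supporting the end point is orthogonal to
  \<open>d i\<close>, so \<open>N\<close> has not grown on the way, and \<open>f\<close> cannot
  increase along \<open>d i\<close>.\<close>

lemma support_nonpos:
  assumes f: "f \<in> Fs" "f \<bullet> z = N z" and z: "0 < N z" "z \<bullet> n i < \<theta> * N z"
  shows "f \<bullet> d i \<le> 0"
proof (cases "- \<theta> * N z < z \<bullet> n i")
  case True
  then show ?thesis using support_orthogonal[OF f z(1), of i] z(2) by auto
next
  case False
  moreover have "0 < \<theta> * N z" using \<theta>_pos z by simp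
  ultimately have neg: "z \<bullet> n i < 0" by linarith
  let ?s = "- (z \<bullet> n i)" let ?z = "z + ?s *\<^sub>R d i"
  have z'n: "?z \<bullet> n i = 0" by (simp add: inner_diff_left d_n)
  have "N ?z \<le> N z"
  proof (cases "?z = 0")
    case False
    obtain g where g: "g \<in> Fs" "g \<bullet> ?z = N ?z" using N_attained by metis
    have "g \<bullet> d i = 0"
      using support_orthogonal[OF g N_pos[OF False], of i] z'n \<theta>_pos N_pos[OF False] by simp
    then show ?thesis using g Fs_le_N[of g z] by (simp add: inner_diff_right)
  qed (simp add: N_nonneg)
  with Fs_le_N[OF f(1), of ?z] f(2) have "?s * (f \<bullet> d i) \<le> 0" by (simp add: inner_diff_right)
  with neg show ?thesis by (simp add: mult_le_0_iff not_le zero_le_mult_iff)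
qed

lemma support_nonneg:
  assumes f: "f \<in> Fs" "f \<bullet> z = N z" and z: "0 < N z" "- \<theta> * N z < z \<bullet> n i"
  shows "0 \<le> f \<bullet> d i"
  using support_nonpos[OF Fs_uminus[OF f(1)], of "- z" i] f z by simp

text \<open>A quantitative form of \<open>support_orthogonal\<close>: \<open>f\<close> only almost supports \<open>v\<close>.\<close>

lemma near_support:
  assumes f: "f \<in> Fs" and v: "N v \<le> m" "v \<bullet> n i = 0"
  shows "m * \<theta> * \<bar>f \<bullet> d i\<bar> \<le> m - f \<bullet> v"
proof -
  have m: "0 \<le> m" using v N_nonneg[of v] by linarith
  \<comment> \<open>While \<open>s\<close>, which is the normal component of the shifted vector,
    stays within \<open>m * \<theta>\<close>, the shift cannot leave the ball of radius
    \<open>m\<close>: a support at an outside point would be orthogonal to \<open>d i\<close>, hence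
    bounded by its value at \<open>v\<close>.\<close>
  have *: "N (v + s *\<^sub>R d i) \<le> m" if s: "\<bar>s\<bar> \<le> m * \<theta>" for s
  proof (rule ccontr)
    assume a: "\<not> ?thesis"
    then have pos: "0 < N (v + s *\<^sub>R d i)" using m by linarith
    obtain g where g: "g \<in> Fs" "g \<bullet> (v + s *\<^sub>R d i) = N (v + s *\<^sub>R d i)" using N_attained by metis
    have "\<bar>(v + s *\<^sub>R d i) \<bullet> n i\<bar> = \<bar>s\<bar>" by (simp add: inner_add_left v d_n)
    also have "\<dots> < \<theta> * N (v + s *\<^sub>R d i)" using s a \<theta>_pos
      by (smt (verit) mult.commute mult_strict_left_mono)
    finally have "g \<bullet> d i = 0" by (rule support_orthogonal[OF g pos])
    then have "N (v + s *\<^sub>R d i) \<le> N v" using g Fs_le_N[of g v] by (simp add: inner_add_right)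
    with v a show False by simp
  qed
  have "f \<bullet> (v + s *\<^sub>R d i) \<le> m" if "\<bar>s\<bar> \<le> m * \<theta>" for s
    using *[OF that] Fs_le_N[OF f, of "v + s *\<^sub>R d i"] by linarith
  from this[of "m * \<theta>"] this[of "- (m * \<theta>)"] have
    "m * \<theta> * (f \<bullet> d i) \<le> m - f \<bullet> v" "- (m * \<theta> * (f \<bullet> d i)) \<le> m - f \<bullet> v"
    using m \<theta>_pos by (simp_all add: inner_add_right inner_diff_right)
  then show ?thesis by (cases "0 \<le> f \<bullet> d i") simp_all
qed

subsection \<open>Coordinates in the basis of reflection directions\<close>

text \<open>The coordinates use the same inverse reflection matrix as the local time, with
  \<open>d\<close> regarded as constant in the parameter; so \<open>co i (y t)\<close> is the
  \<open>i\<close>-th local time.\<close>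

definition co :: "'n \<Rightarrow> real^'n \<Rightarrow> real" where
  "co i v = (matrix_inv (refl_matrix (\<lambda>i _. d i) 0) *v v) $ i"

lemma refl_matrix_mult: "refl_matrix (\<lambda>i _. d i) 0 *v c = (\<Sum>i\<in>UNIV. (c $ i) *\<^sub>R d i)"
  by (simp add: vec_eq_iff refl_matrix_def matrix_vector_mult_def mult.commute)

lemma invertible_refl_matrix: "invertible (refl_matrix (\<lambda>i _. d i) 0)"
  unfolding invertible_left_inverse matrix_left_invertible_ker refl_matrix_mult
  using lin_d[unfolded lin_indep_family_def] by (auto simp: vec_eq_iff)

lemma matrix_inv_refl_matrix:
  shows matrix_inv_right: "refl_matrix (\<lambda>i _. d i) 0 ** matrix_inv (refl_matrix (\<lambda>i _. d i) 0) = mat 1"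
    and matrix_inv_left: "matrix_inv (refl_matrix (\<lambda>i _. d i) 0) ** refl_matrix (\<lambda>i _. d i) 0 = mat 1"
  using someI_ex[OF invertible_refl_matrix[unfolded invertible_def]] unfolding matrix_inv_def by auto

lemma co_sum: "(\<Sum>i\<in>UNIV. co i v *\<^sub>R d i) = v"
  using refl_matrix_mult[of "matrix_inv (refl_matrix (\<lambda>i _. d i) 0) *v v"]
    invertible_refl_matrix
  by (simp add: co_def matrix_vector_mul_assoc matrix_inv_right)

lemma co_of_sum: "co i (\<Sum>j\<in>UNIV. c j *\<^sub>R d j) = c i"
proof -
  have "(\<Sum>j\<in>UNIV. c j *\<^sub>R d j) = refl_matrix (\<lambda>i _. d i) 0 *v (\<chi> j. c j)"
    by (simp add: refl_matrix_mult)
  then show ?thesis using invertible_refl_matrix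
    by (simp add: co_def matrix_vector_mul_assoc matrix_inv_left)
qed

lemma co_add: "co i (u + v) = co i u + co i v"
  by (simp add: co_def matrix_vector_right_distrib)

lemma co_diff: "co i (u - v) = co i u - co i v"
  by (simp add: co_def matrix_vector_mult_diff_distrib)

lemma co_scale: "co i (c *\<^sub>R v) = c * co i v"
  by (simp add: co_def matrix_vector_mult_scaleR)

lemma co_minus: "co i (- v) = - co i v"
  using co_scale[of i "-1" v] by simp

lemma co_zero [simp]: "co i 0 = 0" by (simp add: co_def)

lemma co_d: "co i (d j) = (if i = j then 1 else 0)"
proof -
  have "d j = (\<Sum>k\<in>UNIV. (if k = j then 1 else 0) *\<^sub>R d k)"
    by (simp add: if_distrib[of "\<lambda>c. c *\<^sub>R _"] cong: if_cong)
  then have "co i (d j) = co i (\<Sum>k\<in>UNIV. (if k = j then 1 else 0) *\<^sub>R d k)" by (rule arg_cong)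
  also have "\<dots> = (if i = j then 1 else 0)" by (rule co_of_sum)
  finally show ?thesis .
qed

lemma inner_co: "f \<bullet> v = (\<Sum>i\<in>UNIV. co i v * (f \<bullet> d i))"
proof -
  have "f \<bullet> v = f \<bullet> (\<Sum>i\<in>UNIV. co i v *\<^sub>R d i)" by (simp add: co_sum)
  then show ?thesis by (simp add: inner_sum_right)
qed

lemma co_bound: obtains C where "C > 0" "\<And>i v. \<bar>co i v\<bar> \<le> C * N v"
proof -
  let ?A = "matrix_inv (refl_matrix (\<lambda>i _. d i) 0)"
  obtain K where K: "K > 0" "\<And>v. norm (?A *v v) \<le> norm v * K"
    using bounded_linear.pos_bounded[OF matrix_vector_mul_bounded_linear, of ?A] by blast
  obtain C where C: "C > 0" "\<And>v. norm v \<le> C * N v" using N_equiv by metis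
  have "\<bar>co i v\<bar> \<le> C * K * N v" for i v
  proof -
    have "\<bar>co i v\<bar> \<le> norm (?A *v v)" unfolding co_def by (rule component_le_norm_cart)
    also have "\<dots> \<le> norm v * K" by (rule K)
    also have "\<dots> \<le> C * N v * K" using C K by (intro mult_right_mono) auto
    finally show ?thesis by (simp add: mult_ac)
  qed
  then show thesis using that[of "C * K"] C K by auto
qed

lemma span_co: "v \<in> span (d ` I) \<Longrightarrow> i \<notin> I \<Longrightarrow> co i v = 0"
proof (induction rule: span_induct_alt)
  case base then show ?case by simp
next
  case (step c x y)
  then have "co i x = 0" by (auto simp: co_d)
  with step show ?case by (simp add: co_add co_scale)
qed

lemma fin_cone_co:
  assumes "v \<in> fin_cone (d ` I)"
  shows "0 \<le> co i v" "i \<notin> I \<Longrightarrow> co i v = 0"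
proof -
  obtain S c where S: "finite S" "S \<subseteq> d ` I" "\<forall>u\<in>S. 0 \<le> c u" "v = (\<Sum>u\<in>S. c u *\<^sub>R u)"
    using assms by (auto simp: fin_cone_def)
  have co_S: "co i v = (\<Sum>u\<in>S. c u * co i u)"
    unfolding S(4) using S(1) by (induction S rule: finite_induct) (auto simp: co_add co_scale)
  show "0 \<le> co i v" unfolding co_S using S by (auto intro!: sum_nonneg simp: co_d)
  show "co i v = 0" if "i \<notin> I" unfolding co_S using S that by (auto intro!: sum.neutral simp: co_d)
qed

text \<open>If the support \<open>f\<close> of a vector \<open>e\<close> is followed backwards along a path, it almost supports
  every point that lies on one of the hyperplanes orthogonal to the normals, and hence is almost
  orthogonal to every reflection direction.\<close>

definition contraction_const :: "real \<Rightarrow> bool" where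
  "contraction_const \<epsilon> \<longleftrightarrow> 0 < \<epsilon> \<and> \<epsilon> < 1 \<and>
    (\<forall>(\<tau> :: 'n \<Rightarrow> real) v e m. (\<forall>i. N (v i) \<le> m \<and> v i \<bullet> n i = 0) \<longrightarrow> N e \<le> m \<longrightarrow>
       (\<forall>i j. \<tau> j \<le> \<tau> i \<longrightarrow> co j (e - v i) * (e \<bullet> n j) \<le> 0) \<longrightarrow> N e \<le> (1 - \<epsilon>) * m)"

text \<open>Think of \<open>\<tau> i\<close> as the last time at which component \<open>i\<close> of
  a difference vanishes, of \<open>v i\<close> as the difference at that time and of
  \<open>e\<close> as its final value. With \<open>\<delta> = 1 - N e / m\<close>, a face with the
  largest \<open>\<tau>\<close> satisfies
  \<open>\<bar>f \<bullet> d i\<bar> \<le> \<delta> / \<theta>\<close>, and each earlier face uses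
  the bounds for the later ones. If all \<open>f \<bullet> d i\<close> are of order
  \<open>\<delta>\<close>, then so is \<open>f \<bullet> e / m = 1 - \<delta>\<close>, which bounds
  \<open>\<delta>\<close> from below.\<close>

lemma contraction: "\<exists>\<epsilon>. contraction_const \<epsilon>"
proof -
  obtain C where C: "C > 0" "\<And>i v. \<bar>co i v\<bar> \<le> C * N v" using co_bound by blast
  define J where "J = real CARD('n)"
  have J: "J \<ge> 1" unfolding J_def using one_le_card_finite[where 'a='n] by simp
  \<comment> \<open>The base dominates \<open>1 / \<theta>\<close>, the bound for the latest faces,
    and the factor \<open>(1 + 2 * C * J) / \<theta>\<close> lost with each earlier one;
    \<open>min \<theta> 1\<close> keeps it above 1.\<close>
  define K where "K r = ((1 + 2 * C * J) / min \<theta> 1 + 1) ^ Suc r" for r :: nat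
  define a where "a = (1 + 2 * C * J) / min \<theta> 1 + 1"
  have a1: "a \<ge> 1" unfolding a_def using C J \<theta>_pos by simp
  have Kpos: "K r > 0" for r using a1 unfolding K_def a_def[symmetric] by simp
  have Kmono: "K r \<le> K s" if "r \<le> s" for r s
    using a1 that unfolding K_def a_def[symmetric] by (intro power_increasing) auto
  have Kstep: "(1 + 2 * C * J * K r) / \<theta> \<le> K (Suc r)" for r
  proof -
    have K1: "1 \<le> K r" using a1 unfolding K_def a_def[symmetric] by (intro one_le_power)
    have "1 + 2 * C * J * K r \<le> K r * (1 + 2 * C * J)" using K1 by (simp add: algebra_simps)
    then have "(1 + 2 * C * J * K r) / \<theta> \<le> K r * (1 + 2 * C * J) / \<theta>"
      using \<theta>_pos by (intro divide_right_mono) auto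
    also have "\<dots> \<le> K r * (1 + 2 * C * J) / min \<theta> 1"
      using \<theta>_pos C J Kpos[of r] by (intro divide_left_mono mult_nonneg_nonneg) auto
    also have "\<dots> = K r * ((1 + 2 * C * J) / min \<theta> 1)" by simp
    also have "\<dots> \<le> K r * a" unfolding a_def using Kpos[of r] by (intro mult_left_mono) auto
    finally show ?thesis unfolding K_def a_def[symmetric] by (simp add: mult_ac)
  qed
  have K0: "1 / \<theta> \<le> K 0"
  proof -
    have "1 / \<theta> \<le> (1 + 2 * C * J) / min \<theta> 1" using \<theta>_pos C J by (intro frac_le) auto
    then show ?thesis by (simp add: K_def)
  qed
  \<comment> \<open>The value of \<open>\<delta>\<close> with equality in
    \<open>1 - \<delta> \<le> J * C * K (CARD('n)) * \<delta>\<close>, the inequality reached at the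
    end.\<close>
  define \<epsilon> where "\<epsilon> = 1 / (1 + J * C * K (CARD('n)))"
  have JCK: "0 < J * C * K (CARD('n))" using J C Kpos[of "CARD('n)"] by simp
  show ?thesis unfolding contraction_const_def
  proof (rule exI[of _ \<epsilon>], intro conjI allI impI)
    show "0 < \<epsilon>" and \<epsilon>1: "\<epsilon> < 1" unfolding \<epsilon>_def using JCK by simp_all
    fix \<tau> :: "'n \<Rightarrow> real" and v e m
    assume "\<forall>i. N (v i) \<le> m \<and> v i \<bullet> n i = 0" and e: "N e \<le> m"
      and "\<forall>i j. \<tau> j \<le> \<tau> i \<longrightarrow> co j (e - v i) * (e \<bullet> n j) \<le> 0"
    then have v: "\<And>i. N (v i) \<le> m" "\<And>i. v i \<bullet> n i = 0"
      and \<tau>: "\<And>i j. \<tau> j \<le> \<tau> i \<Longrightarrow> co j (e - v i) * (e \<bullet> n j) \<le> 0" by simp_all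
    show "N e \<le> (1 - \<epsilon>) * m"
    proof (cases "N e = 0")
      case True
      then have "m \<ge> 0" using e by simp
      then show ?thesis using True \<epsilon>1 by (simp only: True) simp
    next
      case False
      then have Ne: "0 < N e" using N_nonneg[of e] by linarith
      then have m: "m > 0" using e by simp
      obtain f where f: "f \<in> Fs" "f \<bullet> e = N e" using N_attained by metis
      define \<delta> where "\<delta> = 1 - N e / m"
      have Nem: "N e = (1 - \<delta>) * m" using m by (simp add: \<delta>_def)
      have \<delta>: "\<delta> \<ge> 0" using e m by (simp add: \<delta>_def)
      \<comment> \<open>Induction on the number of strictly later faces; those with equal
        \<open>\<tau>\<close> do not count as later and fall under the sign condition.\<close>
      have bnd: "\<bar>f \<bullet> d i\<bar> \<le> K (card {j. \<tau> i < \<tau> j}) * \<delta>" for i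
      proof (induction "card {j. \<tau> i < \<tau> j}" arbitrary: i rule: less_induct)
        case less
        let ?L = "{j. \<tau> i < \<tau> j}"
        define Q where "Q = (if ?L = {} then 0 else K (card ?L - 1))"
        have Q0: "Q \<ge> 0" using Kpos by (simp add: Q_def less_imp_le)
        have "co j (e - v i) * (f \<bullet> d j) \<le> C * 2 * m * (Q * \<delta>)" for j
        proof (cases "j \<in> ?L")
          case True
          have sub: "{k. \<tau> j < \<tau> k} \<subset> ?L" using True by auto
          then have lt: "card {k. \<tau> j < \<tau> k} < card ?L" by (intro psubset_card_mono) auto
          then have "\<bar>f \<bullet> d j\<bar> \<le> K (card {k. \<tau> j < \<tau> k}) * \<delta>" by (rule less)
          also have "\<dots> \<le> K (card ?L - 1) * \<delta>" using lt \<delta> by (intro mult_right_mono Kmono) auto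
          also have "\<dots> = Q * \<delta>" using True by (auto simp: Q_def)
          finally have 1: "\<bar>f \<bullet> d j\<bar> \<le> Q * \<delta>" .
          have "N (e - v i) \<le> 2 * m" using N_diff_le[of e "v i"] e v(1)[of i] by simp
          then have "\<bar>co j (e - v i)\<bar> \<le> C * (2 * m)"
            using C(2)[of j "e - v i"] C(1) by (meson less_imp_le mult_left_mono order_trans)
          then have "\<bar>co j (e - v i)\<bar> * \<bar>f \<bullet> d j\<bar> \<le> C * (2 * m) * (Q * \<delta>)"
            using 1 C m by (intro mult_mono) auto
          then show ?thesis
            by (metis abs_le_D1 abs_mult mult.assoc)
        next
          case False
          then have c: "co j (e - v i) * (e \<bullet> n j) \<le> 0" by (intro \<tau>) simp
          \<comment> \<open>The support \<open>f\<close> has on \<open>d j\<close> the sign of the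
            component \<open>e \<bullet> n j\<close>, or vanishes there, and the coordinate of
            \<open>e - v i\<close> has the opposite sign.\<close>
          have "co j (e - v i) * (f \<bullet> d j) \<le> 0"
          proof -
            consider "e \<bullet> n j = 0" | "e \<bullet> n j > 0" | "e \<bullet> n j < 0" by linarith
            then show ?thesis
            proof cases
              case 1
              then have "f \<bullet> d j = 0" using support_orthogonal[OF f Ne, of j] \<theta>_pos Ne by simp
              then show ?thesis by simp
            next
              case 2
              have "0 < \<theta> * N e" using \<theta>_pos Ne by simp
              then have "0 \<le> f \<bullet> d j" using support_nonneg[OF f Ne, of j] 2 by simp
              moreover have "co j (e - v i) \<le> 0" using c 2 by (simp add: mult_le_0_iff)
              ultimately show ?thesis by (simp add: mult_nonpos_nonneg)
            next
              case 3
              have "0 < \<theta> * N e" using \<theta>_pos Ne by simp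
              then have "f \<bullet> d j \<le> 0" using support_nonpos[OF f Ne, of j] 3 by simp
              moreover have "co j (e - v i) \<ge> 0" using c 3 by (simp add: mult_le_0_iff)
              ultimately show ?thesis by (simp add: mult_nonneg_nonpos)
            qed
          qed
          also have "0 \<le> C * 2 * m * (Q * \<delta>)" using C m Q0 \<delta> by simp
          finally show ?thesis .
        qed
        then have "(\<Sum>j\<in>UNIV. co j (e - v i) * (f \<bullet> d j)) \<le> J * (C * 2 * m * (Q * \<delta>))"
          unfolding J_def by (rule sum_bounded_above[of UNIV, simplified])
        then have "f \<bullet> (e - v i) \<le> J * (C * 2 * m * (Q * \<delta>))" by (simp add: inner_co[symmetric])
        then have fv: "m - f \<bullet> v i \<le> m * (\<delta> * (1 + 2 * C * J * Q))"
          using f(2) Nem by (simp add: inner_diff_right algebra_simps)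
        have "m * \<theta> * \<bar>f \<bullet> d i\<bar> \<le> m * (\<delta> * (1 + 2 * C * J * Q))"
          using near_support[OF f(1) v(1) v(2), of i] fv by linarith
        then have "\<theta> * \<bar>f \<bullet> d i\<bar> \<le> \<delta> * (1 + 2 * C * J * Q)" using m by (simp add: mult.assoc)
        then have "\<bar>f \<bullet> d i\<bar> \<le> (1 + 2 * C * J * Q) / \<theta> * \<delta>" using \<theta>_pos by (simp add: field_simps)
        also have "\<dots> \<le> K (card ?L) * \<delta>"
        proof (rule mult_right_mono[OF _ \<delta>])
          show "(1 + 2 * C * J * Q) / \<theta> \<le> K (card ?L)"
          proof (cases "?L = {}")
            case True then show ?thesis using K0 by (simp add: Q_def)
          next
            case False
            then have "card ?L = Suc (card ?L - 1)" by (simp add: card_gt_0_iff)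
            then show ?thesis using Kstep[of "card ?L - 1"] by (simp only: Q_def False if_False)
          qed
        qed
        finally show ?case .
      qed
      have "co i e * (f \<bullet> d i) \<le> C * m * (K (CARD('n)) * \<delta>)" for i
      proof -
        have "\<bar>co i e\<bar> \<le> C * m" using C(2)[of i e] e C(1) by (meson less_imp_le mult_left_mono order_trans)
        moreover have "\<bar>f \<bullet> d i\<bar> \<le> K (CARD('n)) * \<delta>"
          using bnd[of i] mult_right_mono[OF Kmono \<delta>, OF card_mono[of UNIV "{j. \<tau> i < \<tau> j}"]]
          by (auto intro: order_trans)
        ultimately have "\<bar>co i e\<bar> * \<bar>f \<bullet> d i\<bar> \<le> C * m * (K (CARD('n)) * \<delta>)"
          using C m by (intro mult_mono) auto
        then show ?thesis by (metis abs_le_D1 abs_mult)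
      qed
      then have "(\<Sum>i\<in>UNIV. co i e * (f \<bullet> d i)) \<le> J * (C * m * (K (CARD('n)) * \<delta>))"
        unfolding J_def by (rule sum_bounded_above[of UNIV, simplified])
      then have "(1 - \<delta>) * m \<le> J * (C * m * (K (CARD('n)) * \<delta>))"
        using f Nem by (simp add: inner_co[symmetric])
      then have "1 - \<delta> \<le> J * C * K (CARD('n)) * \<delta>" using m
        by (simp add: mult.left_commute mult.commute) (metis mult.assoc mult.commute mult_le_cancel_left_pos)
      then have "1 \<le> \<delta> * (1 + J * C * K (CARD('n)))" by (simp add: algebra_simps)
      then have "\<epsilon> \<le> \<delta>" unfolding \<epsilon>_def using JCK by (simp add: field_simps)
      then show ?thesis using Nem m by (simp add: mult_right_mono)
    qed
  qed
qed

subsection \<open>Oblique projections\<close>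

text \<open>If \<open>N g'\<close> exceeded \<open>c\<close>, a functional \<open>f\<close>
  supporting \<open>g'\<close> would be nonpositive on each \<open>d i\<close> whose coordinate has
  risen and nonnegative on each whose coordinate has fallen. Then
  \<open>f \<bullet> g' \<le> f \<bullet> g\<close>, contrary to \<open>N g \<le> c\<close>.\<close>

lemma N_jump:
  assumes "\<And>i. 0 < co i (g' - g) \<Longrightarrow> g' \<bullet> n i \<le> \<eta>"
    and "\<And>i. co i (g' - g) < 0 \<Longrightarrow> - \<eta> \<le> g' \<bullet> n i"
    and "\<eta> < \<theta> * c" and "N g \<le> c"
  shows "N g' \<le> c"
proof (rule ccontr)
  assume a: "\<not> ?thesis"
  have c: "0 \<le> c" using assms(4) N_nonneg[of g] by linarith
  obtain f where f: "f \<in> Fs" "f \<bullet> g' = N g'" using N_attained by blast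
  have g': "0 < N g'" using a c by simp
  have "\<theta> * c \<le> \<theta> * N g'" using a \<theta>_pos by simp
  then have \<eta>: "\<eta> < \<theta> * N g'" using assms(3) by simp
  have "co i (g' - g) * (f \<bullet> d i) \<le> 0" for i
  proof -
    consider "co i (g' - g) = 0" | "co i (g' - g) > 0" | "co i (g' - g) < 0" by linarith
    then show ?thesis
    proof cases
      case 2
      then have "f \<bullet> d i \<le> 0" using support_nonpos[OF f g', of i] assms(1)[of i] \<eta> by linarith
      with 2 show ?thesis by (simp add: mult_nonneg_nonpos)
    next
      case 3
      then have "0 \<le> f \<bullet> d i" using support_nonneg[OF f g', of i] assms(2)[of i] \<eta> by simp
      with 3 show ?thesis by (simp add: mult_nonpos_nonneg)
    qed simp
  qed
  then have "f \<bullet> (g' - g) \<le> 0" unfolding inner_co[of f "g' - g"] by (intro sum_nonpos) auto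
  then show False using f Fs_le_N[OF f(1), of g] a assms(4) by (simp add: inner_diff_right)
qed

text \<open>At tolerance 0 a level slightly above \<open>N g\<close> is taken, because
  \<open>0 < \<theta> * c\<close> fails for \<open>c = 0\<close>.\<close>

lemma N_jump0:
  assumes "\<And>i. 0 < co i (g' - g) \<Longrightarrow> g' \<bullet> n i \<le> 0"
    and "\<And>i. co i (g' - g) < 0 \<Longrightarrow> 0 \<le> g' \<bullet> n i"
  shows "N g' \<le> N g"
proof (rule field_le_epsilon)
  fix e :: real assume "e > 0"
  then show "N g' \<le> N g + e"
    using assms \<theta>_pos N_nonneg[of g]
    by (intro N_jump[of g' g 0]) (auto intro!: mult_pos_pos add_nonneg_pos)
qed

lemma N_add_span_le:
  assumes "\<And>i. i \<in> I \<Longrightarrow> \<bar>w \<bullet> n i\<bar> \<le> \<eta>" and "w - u \<in> span (d ` I)" and "\<eta> < \<theta> * c" and "N u \<le> c"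
  shows "N w \<le> c"
proof (rule N_jump[OF _ _ assms(3,4)])
  have "i \<in> I" if "co i (w - u) \<noteq> 0" for i using span_co[OF assms(2)] that by blast
  then show "w \<bullet> n i \<le> \<eta>" if "0 < co i (w - u)" for i using assms(1)[of i] that by fastforce
  show "- \<eta> \<le> w \<bullet> n i" if "co i (w - u) < 0" for i
    using assms(1)[of i] span_co[OF assms(2), of i] that by fastforce
qed

lemma N_add_span_le0:
  assumes "\<And>i. i \<in> I \<Longrightarrow> w \<bullet> n i = 0" and "w - u \<in> span (d ` I)"
  shows "N w \<le> N u"
proof (rule field_le_epsilon)
  fix e :: real assume "e > 0"
  show "N w \<le> N u + e"
    using assms \<open>e > 0\<close> \<theta>_pos N_nonneg[of u]
    by (intro N_add_span_le[of I w 0 u]) (auto intro!: mult_pos_pos add_nonneg_pos)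
qed

text \<open>The linear system for the coefficients in \<open>I\<close> is padded with the identity
  outside \<open>I\<close> to become square. It is injective, since a combination \<open>u\<close>
  of the directions in \<open>I\<close> that is orthogonal to the normals in \<open>I\<close>
  satisfies \<open>N u \<le> N 0\<close>.\<close>

lemma oblique_exists: "\<exists>w. w - v \<in> span (d ` I) \<and> (\<forall>i\<in>I. w \<bullet> n i = 0)"
proof -
  define L where "L c = (\<chi> i. if i \<in> I then (\<Sum>j\<in>I. (c $ j) *\<^sub>R d j) \<bullet> n i else c $ i)" for c :: "real^'n"
  have lin: "linear L"
    by (rule linearI) (auto simp: L_def vec_eq_iff inner_add_left sum.distrib scaleR_add_left
        inner_sum_left sum_distrib_left mult.assoc)
  have "inj L"
    unfolding linear_injective_0[OF lin]
  proof safe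
    fix c assume Lc: "L c = 0"
    let ?u = "\<Sum>j\<in>I. (c $ j) *\<^sub>R d j"
    have "N ?u \<le> N 0"
    proof (rule N_add_span_le0)
      show "?u \<bullet> n i = 0" if "i \<in> I" for i
        using arg_cong[OF Lc, of "\<lambda>x. x $ i"] that by (simp add: L_def)
      show "?u - 0 \<in> span (d ` I)" by (auto intro: span_sum span_scale span_base)
    qed
    then have u0: "?u = 0" using N_nonneg[of ?u] N_eq_0[of ?u] by simp
    have "c $ i = 0" for i
    proof (cases "i \<in> I")
      case True
      have "(\<Sum>j\<in>UNIV. (if j \<in> I then c $ j else 0) *\<^sub>R d j) = ?u"
        by (simp add: if_distrib[of "\<lambda>c. c *\<^sub>R _"] sum.If_cases cong: if_cong)
      then show ?thesis using co_of_sum[of i "\<lambda>j. if j \<in> I then c $ j else 0"] u0 True by simp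
    next
      case False
      then show ?thesis using arg_cong[OF Lc, of "\<lambda>x. x $ i"] by (simp add: L_def)
    qed
    then show "c = 0" by (simp add: vec_eq_iff)
  qed
  then have "surj L" using lin linear_injective_imp_surjective by blast
  then obtain c where c: "L c = (\<chi> i. if i \<in> I then - (v \<bullet> n i) else 0)" by (metis surjD)
  let ?w = "v + (\<Sum>j\<in>I. (c $ j) *\<^sub>R d j)"
  have "?w \<bullet> n i = 0" if "i \<in> I" for i
    using arg_cong[OF c, of "\<lambda>x. x $ i"] that by (simp add: L_def inner_add_left)
  moreover have "?w - v \<in> span (d ` I)" by (auto intro: span_sum span_scale span_base)
  ultimately show ?thesis by blast
qed

definition oblique :: "'n set \<Rightarrow> real^'n \<Rightarrow> real^'n" where
  "oblique I v = (SOME w. w - v \<in> span (d ` I) \<and> (\<forall>i\<in>I. w \<bullet> n i = 0))"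

lemma oblique:
  shows oblique_span: "oblique I v - v \<in> span (d ` I)"
    and oblique_normal: "i \<in> I \<Longrightarrow> oblique I v \<bullet> n i = 0"
proof -
  have "oblique I v - v \<in> span (d ` I) \<and> (\<forall>i\<in>I. oblique I v \<bullet> n i = 0)"
    unfolding oblique_def by (rule someI_ex[OF oblique_exists])
  then show "oblique I v - v \<in> span (d ` I)" "i \<in> I \<Longrightarrow> oblique I v \<bullet> n i = 0" by simp_all
qed

text \<open>As \<open>w\<close> is any projection of \<open>v'\<close>, the case
  \<open>v = v'\<close> shows that the projection is unique, so the choice made in
  \<open>oblique\<close> is immaterial.\<close>

lemma oblique_nonexpansive:
  assumes "w - v' \<in> span (d ` I)" "\<And>i. i \<in> I \<Longrightarrow> w \<bullet> n i = 0"
  shows "N (oblique I v - w) \<le> N (v - v')"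
proof (rule N_add_span_le0[of I])
  show "oblique I v - w - (v - v') \<in> span (d ` I)"
  proof -
    have eq: "oblique I v - w - (v - v') = oblique I v - v - (w - v')"
      by (simp add: algebra_simps)
    show ?thesis unfolding eq by (rule span_diff[OF oblique_span[of I v] assms(1)])
  qed
  show "(oblique I v - w) \<bullet> n i = 0" if "i \<in> I" for i
    using that by (simp add: inner_diff_left oblique_normal assms)
qed

lemma N_lipschitz_continuous:
  fixes g :: "real^'n \<Rightarrow> real^'n"
  assumes "\<And>x y. N (g x - g y) \<le> N (x - y)"
  shows "continuous_on UNIV g"
proof -
  obtain C where C: "C > 0" "\<And>z. N z \<le> C * norm z" "\<And>z. norm z \<le> C * N z" using N_equiv by blast
  have "(C * C)-lipschitz_on UNIV g"
  proof (rule lipschitz_onI)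
    fix x y :: "real^'n"
    have "norm (g x - g y) \<le> C * N (x - y)"
      using C(3)[of "g x - g y"] mult_left_mono[OF assms[of x y], of C] C(1) by linarith
    also have "\<dots> \<le> C * (C * norm (x - y))" using C by (intro mult_left_mono) auto
    finally show "dist (g x) (g y) \<le> C * C * dist x y" by (simp add: dist_norm mult.assoc)
  qed (use C in auto)
  then show ?thesis by (rule lipschitz_on_continuous_on)
qed

lemma continuous_oblique: "continuous_on UNIV (oblique I)"
  by (intro N_lipschitz_continuous oblique_nonexpansive oblique_span oblique_normal)

subsection \<open>The polyhedral cone and its discrete projection\<close>

text \<open>Faces are defined through the frontier; a move along \<open>- n i\<close> leaves the
  cone, so a vanishing component already puts a point of the cone on the frontier.\<close>

lemma active_iff: assumes "x \<in> polyhedron_G n" shows "i \<in> active n x \<longleftrightarrow> x \<bullet> n i = 0"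
proof
  assume x0: "x \<bullet> n i = 0"
  have "x \<notin> interior (polyhedron_G n)"
  proof
    assume "x \<in> interior (polyhedron_G n)"
    then obtain e where e: "e > 0" "cball x e \<subseteq> polyhedron_G n" using mem_interior_cball by blast
    have "x - e *\<^sub>R n i \<in> polyhedron_G n"
      using e norm_n by (intro subsetD[OF e(2)]) (auto simp: dist_norm)
    then have "0 \<le> (x - e *\<^sub>R n i) \<bullet> n i" by (auto simp: polyhedron_G_def)
    then show False using e x0 norm_n[of i] by (simp add: inner_diff_left norm_eq_1)
  qed
  then show "i \<in> active n x" using x0 assms closure_subset
    by (auto simp: active_def face_F_def frontier_def)
qed (auto simp: active_def face_F_def)

lemma zero_polyhedron: "0 \<in> polyhedron_G n" by (simp add: polyhedron_G_def)

lemma closed_polyhedron: "closed (polyhedron_G n)"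
proof -
  have "polyhedron_G n = (\<Inter>i. {x. n i \<bullet> x \<ge> 0})" by (auto simp: polyhedron_G_def inner_commute)
  have "closed (\<Inter>i. {x. n i \<bullet> x \<ge> 0})" by (intro closed_INT ballI closed_halfspace_ge)
  then show ?thesis using \<open>polyhedron_G n = _\<close> by simp
qed

end

text \<open>Continuous induction: the infimum of all failures has the property by
  \<open>left\<close>, and \<open>right\<close> keeps the failures away from it. It serves for paths
  that are only right-continuous, where a maximum need not be attained.\<close>

lemma real_creep:
  fixes P :: "real \<Rightarrow> bool"
  assumes left: "\<And>t. 0 \<le> t \<Longrightarrow> (\<And>s. 0 \<le> s \<Longrightarrow> s < t \<Longrightarrow> P s) \<Longrightarrow> P t"
    and right: "\<And>t. 0 \<le> t \<Longrightarrow> P t \<Longrightarrow> \<exists>e>0. \<forall>s. t < s \<and> s < t + e \<longrightarrow> P s"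
    and "0 \<le> t"
  shows "P t"
proof (rule ccontr)
  assume "\<not> P t"
  define S where "S = {s. 0 \<le> s \<and> \<not> P s}"
  have S: "S \<noteq> {}" "bdd_below S" using \<open>\<not> P t\<close> assms(3) by (auto simp: S_def intro!: bdd_belowI[of _ 0])
  have i0: "0 \<le> Inf S" using S(1) by (intro cInf_greatest) (auto simp: S_def)
  have below: "P s" if "0 \<le> s" "s < Inf S" for s
    using cInf_lower[OF _ S(2), of s] that by (force simp: S_def)
  have "P (Inf S)" using left[OF i0] below by blast
  then obtain e where e: "e > 0" "\<forall>s. Inf S < s \<and> s < Inf S + e \<longrightarrow> P s" using right[OF i0] by blast
  obtain s where s: "s \<in> S" "s < Inf S + e" using cInf_lessD[OF S(1), of "Inf S + e"] e(1) by auto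
  have "Inf S \<le> s" using cInf_lower[OF s(1) S(2)] .
  then have "P s" using e(2) s(2) \<open>P (Inf S)\<close> by (cases "s = Inf S") auto
  then show False using s(1) by (simp add: S_def)
qed

context set_B
begin

subsection \<open>Constrained paths\<close>

lemma N_path_le:
  fixes g :: "real \<Rightarrow> real^'n"
  assumes st: "s \<le> t" and cont: "continuous_on {s..t} g" and start: "N (g s) \<le> c" and \<eta>: "\<eta> < \<theta> * c"
    and down: "\<And>u v i. s \<le> u \<Longrightarrow> u < v \<Longrightarrow> v \<le> t \<Longrightarrow> (\<And>r. u < r \<Longrightarrow> r \<le> v \<Longrightarrow> \<eta> < g r \<bullet> n i) \<Longrightarrow> co i (g v - g u) \<le> 0"
    and up: "\<And>u v i. s \<le> u \<Longrightarrow> u < v \<Longrightarrow> v \<le> t \<Longrightarrow> (\<And>r. u < r \<Longrightarrow> r \<le> v \<Longrightarrow> g r \<bullet> n i < - \<eta>) \<Longrightarrow> 0 \<le> co i (g v - g u)"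
  shows "N (g t) \<le> c"
proof (rule ccontr)
  assume a: "\<not> ?thesis"
  have contN: "continuous_on {s..t} (\<lambda>r. N (g r))" by (intro continuous_intros cont)
  obtain M where M: "M \<in> {s..t}" "\<And>r. r \<in> {s..t} \<Longrightarrow> N (g r) \<le> N (g M)"
    using continuous_attains_sup[OF _ _ contN] st by fastforce
  define A where "A = {r \<in> {s..t}. N (g r) = N (g M)}"
  have "closed A" unfolding A_def by (rule continuous_closed_preimage_constant[OF contN]) simp
  moreover have "bounded A" unfolding A_def by (rule bounded_subset[of "{s..t}"]) auto
  ultimately have "compact A" by (simp add: compact_eq_bounded_closed)
  moreover have "A \<noteq> {}" using M by (auto simp: A_def)
  ultimately obtain p where p: "p \<in> A" "\<And>r. r \<in> A \<Longrightarrow> p \<le> r" using compact_attains_inf by metis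
  have pst: "s \<le> p" "p \<le> t" and Np: "N (g p) = N (g M)" using p(1) by (auto simp: A_def)
  have Mc: "c < N (g M)" using M(2)[of t] a st by simp
  have less: "N (g r) < N (g M)" if "s \<le> r" "r < p" for r
    using M(2)[of r] p(2)[of r] that pst by (force simp: A_def)
  have sp: "s < p" using pst Mc start Np by (cases "s = p") auto
  have ev: "\<forall>\<^sub>F r in at p within {s..t}. \<forall>i. (\<eta> < g p \<bullet> n i \<longrightarrow> \<eta> < g r \<bullet> n i) \<and> (g p \<bullet> n i < - \<eta> \<longrightarrow> g r \<bullet> n i < - \<eta>)"
  proof (rule eventually_all_finite)
    fix i
    have "((\<lambda>r. g r \<bullet> n i) \<longlongrightarrow> g p \<bullet> n i) (at p within {s..t})"
      using cont pst by (intro tendsto_intros) (auto simp: continuous_on_def)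
    then show "\<forall>\<^sub>F r in at p within {s..t}. (\<eta> < g p \<bullet> n i \<longrightarrow> \<eta> < g r \<bullet> n i) \<and> (g p \<bullet> n i < - \<eta> \<longrightarrow> g r \<bullet> n i < - \<eta>)"
      by (intro eventually_conj) (auto dest: order_tendstoD simp: eventually_mono)
  qed
  then obtain e where e: "e > 0" "\<And>r i. r \<in> {s..t} \<Longrightarrow> r \<noteq> p \<Longrightarrow> dist r p < e \<Longrightarrow>
      (\<eta> < g p \<bullet> n i \<longrightarrow> \<eta> < g r \<bullet> n i) \<and> (g p \<bullet> n i < - \<eta> \<longrightarrow> g r \<bullet> n i < - \<eta>)"
    unfolding eventually_at by metis
  define u where "u = max s (p - e / 2)"
  have u: "s \<le> u" "u < p" using sp e(1) by (auto simp: u_def)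
  have near: "(\<eta> < g p \<bullet> n i \<longrightarrow> \<eta> < g r \<bullet> n i) \<and> (g p \<bullet> n i < - \<eta> \<longrightarrow> g r \<bullet> n i < - \<eta>)"
    if "u < r" "r \<le> p" for r i
  proof (cases "r = p")
    case False
    have "dist r p < e" using that e(1) by (auto simp: dist_real_def u_def)
    then show ?thesis using e(2)[of r i] that u pst False by auto
  qed auto
  \<comment> \<open>The level is a maximum because the path may already lie above \<open>c\<close>
    at time \<open>u\<close>.\<close>
  have "N (g p) \<le> max c (N (g u))"
  proof (rule N_jump)
    show "\<eta> < \<theta> * max c (N (g u))" using \<eta> \<theta>_pos
      by (smt (verit) max.cobounded1 mult_left_mono)
    show "g p \<bullet> n i \<le> \<eta>" if "0 < co i (g p - g u)" for i
      using down[of u p i] u pst that near[of _ i] by fastforce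
    show "- \<eta> \<le> g p \<bullet> n i" if "co i (g p - g u) < 0" for i
      using up[of u p i] u pst that near[of _ i] by fastforce
  qed simp
  then show False using less[OF u] Np Mc by simp
qed

section \<open>Pairs of solutions of the Skorokhod problem\<close>

definition skorokhod_path :: "(real \<Rightarrow> real^'n) \<Rightarrow> (real \<Rightarrow> real^'n) \<Rightarrow> (real \<Rightarrow> real^'n) \<Rightarrow> bool" where
  "skorokhod_path \<psi> z y \<longleftrightarrow> continuous_on {0..} z \<and> continuous_on {0..} y \<and> y 0 = 0 \<and>
    (\<forall>t\<ge>0. z t \<in> polyhedron_G n \<and> z t = \<psi> t + y t) \<and>
    (\<forall>s t. 0 \<le> s \<and> s < t \<longrightarrow> y t - y s \<in> fin_cone (\<Union>u\<in>{s<..t}. fin_cone (d ` active n (z u))))"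

lemma skorokhod_pathD:
  assumes "skorokhod_path \<psi> z y"
  shows "continuous_on {0..} z" "continuous_on {0..} y" "y 0 = 0"
    "0 \<le> t \<Longrightarrow> z t \<in> polyhedron_G n" "0 \<le> t \<Longrightarrow> z t = \<psi> t + y t" "0 \<le> t \<Longrightarrow> 0 \<le> z t \<bullet> n i"
  using assms unfolding skorokhod_path_def polyhedron_G_def by auto

lemma fin_cone_co_nonneg:
  assumes "v \<in> fin_cone E" "\<And>e. e \<in> E \<Longrightarrow> 0 \<le> co i e" shows "0 \<le> co i v"
proof -
  obtain S c where S: "finite S" "S \<subseteq> E" "\<forall>u\<in>S. 0 \<le> c u" "v = (\<Sum>u\<in>S. c u *\<^sub>R u)"
    using assms by (auto simp: fin_cone_def)
  have "co i v = (\<Sum>u\<in>S. c u * co i u)"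
    unfolding S(4) using S(1) by (induction S rule: finite_induct) (auto simp: co_add co_scale)
  also have "\<dots> \<ge> 0" using S assms(2) by (auto intro!: sum_nonneg)
  finally show ?thesis .
qed

lemma fin_cone_co_zero:
  assumes "v \<in> fin_cone E" "\<And>e. e \<in> E \<Longrightarrow> co i e = 0" shows "co i v = 0"
proof -
  obtain S c where S: "finite S" "S \<subseteq> E" "\<forall>u\<in>S. 0 \<le> c u" "v = (\<Sum>u\<in>S. c u *\<^sub>R u)"
    using assms by (auto simp: fin_cone_def)
  have "co i v = (\<Sum>u\<in>S. c u * co i u)"
    unfolding S(4) using S(1) by (induction S rule: finite_induct) (auto simp: co_add co_scale)
  also have "\<dots> = 0" using S assms(2) by (auto intro!: sum.neutral)
  finally show ?thesis .
qed

lemma push_mono: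
  assumes "skorokhod_path \<psi> z y" "0 \<le> s" "s \<le> t" shows "0 \<le> co i (y t - y s)"
proof (cases "s = t")
  case False
  then have "y t - y s \<in> fin_cone (\<Union>u\<in>{s<..t}. fin_cone (d ` active n (z u)))"
    using assms by (auto simp: skorokhod_path_def)
  then show ?thesis by (rule fin_cone_co_nonneg) (auto intro: fin_cone_co)
qed simp

lemma push_const:
  assumes "skorokhod_path \<psi> z y" "0 \<le> s" "s \<le> t" "\<And>u. s < u \<Longrightarrow> u \<le> t \<Longrightarrow> z u \<bullet> n i \<noteq> 0"
  shows "co i (y t - y s) = 0"
proof (cases "s = t")
  case False
  then have "y t - y s \<in> fin_cone (\<Union>u\<in>{s<..t}. fin_cone (d ` active n (z u)))"
    using assms by (auto simp: skorokhod_path_def)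
  moreover have "i \<notin> active n (z u)" if "s < u" "u \<le> t" for u
    using assms(4)[OF that] by (auto simp: active_def face_F_def)
  then have "co i e = 0" if e: "e \<in> (\<Union>u\<in>{s<..t}. fin_cone (d ` active n (z u)))" for e
  proof -
    obtain u where "s < u" "u \<le> t" "e \<in> fin_cone (d ` active n (z u))" using e by auto
    then show ?thesis using \<open>\<And>u. s < u \<Longrightarrow> u \<le> t \<Longrightarrow> i \<notin> active n (z u)\<close> by (intro fin_cone_co(2))
  qed
  ultimately show ?thesis by (rule fin_cone_co_zero)
qed simp

text \<open>Where component \<open>i\<close> of the difference is positive, the first path is off
  face \<open>i\<close>, so along \<open>d i\<close> only the second path is pushed, which lowers
  the coordinate of the difference.\<close>

lemma pair_monotone:
  assumes z: "skorokhod_path \<psi> z y" "skorokhod_path \<psi>' z' y'"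
    and \<psi>: "\<And>t. 0 \<le> t \<Longrightarrow> \<psi> t - \<psi>' t = \<psi> 0 - \<psi>' 0"
    and uv: "0 \<le> u" "u \<le> v"
  shows "(\<And>r. u < r \<Longrightarrow> r \<le> v \<Longrightarrow> 0 < (z r - z' r) \<bullet> n i) \<Longrightarrow> co i ((z v - z' v) - (z u - z' u)) \<le> 0"
    and "(\<And>r. u < r \<Longrightarrow> r \<le> v \<Longrightarrow> (z r - z' r) \<bullet> n i < 0) \<Longrightarrow> 0 \<le> co i ((z v - z' v) - (z u - z' u))"
proof -
  have eq: "(z v - z' v) - (z u - z' u) = (y v - y u) - (y' v - y' u)"
  proof -
    have e: "z u = \<psi> u + y u" "z v = \<psi> v + y v" "z' u = \<psi>' u + y' u" "z' v = \<psi>' v + y' v"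
      using uv by (auto intro: skorokhod_pathD(5)[OF z(1)] skorokhod_pathD(5)[OF z(2)])
    have "(z v - z' v) - (z u - z' u) = (y v - y u) - (y' v - y' u) + ((\<psi> v - \<psi>' v) - (\<psi> u - \<psi>' u))"
      unfolding e by (simp add: algebra_simps)
    also have "(\<psi> v - \<psi>' v) - (\<psi> u - \<psi>' u) = 0" using \<psi>[of u] \<psi>[of v] uv by simp
    finally show ?thesis by simp
  qed
  show "co i ((z v - z' v) - (z u - z' u)) \<le> 0" if "\<And>r. u < r \<Longrightarrow> r \<le> v \<Longrightarrow> 0 < (z r - z' r) \<bullet> n i"
  proof -
    have "co i (y v - y u) = 0"
    proof (rule push_const[OF z(1) uv])
      fix r assume "u < r" "r \<le> v"
      then show "z r \<bullet> n i \<noteq> 0" using that[of r] skorokhod_pathD(6)[OF z(2), of r i] uv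
        by (auto simp: inner_diff_left)
    qed
    then show ?thesis unfolding eq using push_mono[OF z(2) uv, of i] by (simp add: co_diff)
  qed
  show "0 \<le> co i ((z v - z' v) - (z u - z' u))" if "\<And>r. u < r \<Longrightarrow> r \<le> v \<Longrightarrow> (z r - z' r) \<bullet> n i < 0"
  proof -
    have "co i (y' v - y' u) = 0"
    proof (rule push_const[OF z(2) uv])
      fix r assume "u < r" "r \<le> v"
      then show "z' r \<bullet> n i \<noteq> 0" using that[of r] skorokhod_pathD(6)[OF z(1), of r i] uv
        by (auto simp: inner_diff_left)
    qed
    then show ?thesis unfolding eq using push_mono[OF z(1) uv, of i] by (simp add: co_diff)
  qed
qed

lemma pair_nonexpansive:
  assumes z: "skorokhod_path \<psi> z y" "skorokhod_path \<psi>' z' y'"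
    and \<psi>: "\<And>t. 0 \<le> t \<Longrightarrow> \<psi> t - \<psi>' t = \<psi> 0 - \<psi>' 0" and t: "0 \<le> t"
  shows "N (z t - z' t) \<le> N (z 0 - z' 0)"
proof (rule field_le_epsilon)
  fix e :: real assume e: "e > 0"
  show "N (z t - z' t) \<le> N (z 0 - z' 0) + e"
  proof (rule N_path_le[of 0 t "\<lambda>t. z t - z' t" _ 0, OF t])
    show "continuous_on {0..t} (\<lambda>t. z t - z' t)"
      using continuous_on_subset[OF skorokhod_pathD(1)[OF z(1)], of "{0..t}"]
        continuous_on_subset[OF skorokhod_pathD(1)[OF z(2)], of "{0..t}"]
      by (auto intro!: continuous_intros)
    show "0 < \<theta> * (N (z 0 - z' 0) + e)" using e \<theta>_pos N_nonneg by (simp add: add_nonneg_pos)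
  qed (use e pair_monotone[OF z \<psi>] in auto)
qed

text \<open>The zero set is compact, so there is a last zero; after it the sign is constant by the
  intermediate value theorem.\<close>

lemma last_zero:
  fixes g :: "real \<Rightarrow> real"
  assumes "continuous_on {0..T} g" "u \<in> {0..T}" "g u = 0"
  obtains \<tau> where "\<tau> \<in> {0..T}" "g \<tau> = 0" "\<And>r. \<tau> < r \<Longrightarrow> r \<le> T \<Longrightarrow> g r \<noteq> 0"
    "0 < g T \<Longrightarrow> (\<And>r. \<tau> < r \<Longrightarrow> r \<le> T \<Longrightarrow> 0 < g r)" "g T < 0 \<Longrightarrow> (\<And>r. \<tau> < r \<Longrightarrow> r \<le> T \<Longrightarrow> g r < 0)"
proof -
  define A where "A = {r \<in> {0..T}. g r = 0}"
  have "closed A" unfolding A_def by (rule continuous_closed_preimage_constant[OF assms(1)]) simp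
  moreover have "bounded A" unfolding A_def by (rule bounded_subset[of "{0..T}"]) auto
  ultimately have "compact A" by (simp add: compact_eq_bounded_closed)
  moreover have "A \<noteq> {}" using assms by (auto simp: A_def)
  ultimately obtain p where p: "p \<in> A" "\<And>r. r \<in> A \<Longrightarrow> r \<le> p" using compact_attains_sup by metis
  have nz: "g r \<noteq> 0" if "p < r" "r \<le> T" for r
  proof
    assume "g r = 0"
    then have "r \<in> A" using that p(1) by (simp add: A_def)
    then show False using p(2) that by fastforce
  qed
  show thesis
  proof (rule that[of p])
    show "p \<in> {0..T}" "g p = 0" using p(1) by (auto simp: A_def)
    show "g r \<noteq> 0" if "p < r" "r \<le> T" for r using nz[OF that] .
    fix r assume r: "p < r" "r \<le> T"
    have cont: "continuous_on {r..T} g" using continuous_on_subset[OF assms(1)] r p(1) by (auto simp: A_def)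
    show "0 < g r" if gT: "0 < g T"
    proof (rule ccontr)
      assume "\<not> ?thesis"
      then obtain x where "r \<le> x" "x \<le> T" "g x = 0" using IVT'[of g r 0 T] gT cont r by auto
      with nz[of x] r show False by auto
    qed
    show "g r < 0" if gT: "g T < 0"
    proof (rule ccontr)
      assume "\<not> ?thesis"
      then obtain x where "r \<le> x" "x \<le> T" "g x = 0" using IVT2'[of g T 0 r] gT cont r by auto
      with nz[of x] r show False by auto
    qed
  qed
qed

definition contr :: real where "contr = (SOME \<epsilon>. contraction_const \<epsilon>)"

lemma contr_const: "contraction_const contr"
  unfolding contr_def by (rule someI_ex[OF contraction])

lemma contr: "0 < contr" "contr < 1"
  using contr_const by (simp_all add: contraction_const_def)

lemma contr_contraction:
  fixes \<tau> :: "'n \<Rightarrow> real"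
  assumes "\<And>i. N (v i) \<le> m" "\<And>i. v i \<bullet> n i = 0" "N e \<le> m"
    "\<And>i j. \<tau> j \<le> \<tau> i \<Longrightarrow> co j (e - v i) * (e \<bullet> n j) \<le> 0"
  shows "N e \<le> (1 - contr) * m"
proof -
  have "\<forall>(\<tau> :: 'n \<Rightarrow> real) v e m. (\<forall>i. N (v i) \<le> m \<and> v i \<bullet> n i = 0) \<longrightarrow> N e \<le> m \<longrightarrow>
       (\<forall>i j. \<tau> j \<le> \<tau> i \<longrightarrow> co j (e - v i) * (e \<bullet> n j) \<le> 0) \<longrightarrow> N e \<le> (1 - contr) * m"
    using contr_const unfolding contraction_const_def by (elim conjE)
  from this[rule_format, of v m e \<tau>] assms show ?thesis by blast
qed

text \<open>When the first path visits face \<open>i\<close>, component \<open>i\<close> of the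
  difference is nonpositive, when the second does, it is nonnegative; so it vanishes at some time.
  After its last zero it keeps the sign it has at \<open>T\<close>, and \<open>pair_monotone\<close>
  yields the sign condition of the contraction from that time on.\<close>

lemma pair_contraction:
  assumes z: "skorokhod_path \<psi> z y" "skorokhod_path \<psi>' z' y'"
    and \<psi>: "\<And>t. 0 \<le> t \<Longrightarrow> \<psi> t - \<psi>' t = \<psi> 0 - \<psi>' 0"
    and hit: "\<And>i. \<exists>u\<in>{0..T}. z u \<bullet> n i = 0" "\<And>i. \<exists>u\<in>{0..T}. z' u \<bullet> n i = 0"
  shows "N (z T - z' T) \<le> (1 - contr) * N (z 0 - z' 0)"
proof -
  have T: "0 \<le> T" using hit(1)[of undefined] by auto
  define g where "g t = z t - z' t" for t
  have contg: "continuous_on {0..T} g" unfolding g_def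
    using continuous_on_subset[OF skorokhod_pathD(1)[OF z(1)], of "{0..T}"]
      continuous_on_subset[OF skorokhod_pathD(1)[OF z(2)], of "{0..T}"]
    by (auto intro!: continuous_intros)
  have contn: "continuous_on {0..T} (\<lambda>t. g t \<bullet> n i)" for i by (intro continuous_intros contg)
  have "\<exists>u\<in>{0..T}. g u \<bullet> n i = 0" for i
  proof -
    obtain a where a: "a \<in> {0..T}" "z a \<bullet> n i = 0" using hit(1)[of i] by blast
    obtain b where b: "b \<in> {0..T}" "z' b \<bullet> n i = 0" using hit(2)[of i] by blast
    have "g a \<bullet> n i \<le> 0" "0 \<le> g b \<bullet> n i"
      using a b skorokhod_pathD(6)[OF z(2), of a i] skorokhod_pathD(6)[OF z(1), of b i]
      by (auto simp: g_def inner_diff_left)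
    then have "0 \<in> closed_segment (g a \<bullet> n i) (g b \<bullet> n i)" by (auto simp: closed_segment_eq_real_ivl)
    moreover have "is_interval ((\<lambda>t. g t \<bullet> n i) ` {0..T})"
      unfolding is_interval_connected_1 by (intro connected_continuous_image contn) auto
    ultimately have "0 \<in> (\<lambda>t. g t \<bullet> n i) ` {0..T}"
      using a(1) b(1) \<open>g a \<bullet> n i \<le> 0\<close> \<open>0 \<le> g b \<bullet> n i\<close> unfolding is_interval_1 by blast
    then show ?thesis by auto
  qed
  then have "\<exists>\<tau>\<in>{0..T}. g \<tau> \<bullet> n i = 0 \<and> (0 < g T \<bullet> n i \<longrightarrow> (\<forall>r. \<tau> < r \<longrightarrow> r \<le> T \<longrightarrow> 0 < g r \<bullet> n i)) \<and>
     (g T \<bullet> n i < 0 \<longrightarrow> (\<forall>r. \<tau> < r \<longrightarrow> r \<le> T \<longrightarrow> g r \<bullet> n i < 0))" for i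
    by (meson last_zero[OF contn])
  then obtain \<tau> where \<tau>: "\<And>i. \<tau> i \<in> {0..T}" "\<And>i. g (\<tau> i) \<bullet> n i = 0"
    "\<And>i r. 0 < g T \<bullet> n i \<Longrightarrow> \<tau> i < r \<Longrightarrow> r \<le> T \<Longrightarrow> 0 < g r \<bullet> n i"
    "\<And>i r. g T \<bullet> n i < 0 \<Longrightarrow> \<tau> i < r \<Longrightarrow> r \<le> T \<Longrightarrow> g r \<bullet> n i < 0" by metis
  have mono: "N (g t) \<le> N (g 0)" if "0 \<le> t" for t
    unfolding g_def by (rule pair_nonexpansive[OF z \<psi> that])
  have "N (g T) \<le> (1 - contr) * N (g 0)"
  proof (rule contr_contraction[of "\<lambda>i. g (\<tau> i)" _ _ \<tau>])
    show "N (g (\<tau> i)) \<le> N (g 0)" for i using mono[of "\<tau> i"] \<tau>(1)[of i] by simp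
    show "g (\<tau> i) \<bullet> n i = 0" for i by (rule \<tau>)
    show "N (g T) \<le> N (g 0)" using mono T by simp
    show "co j (g T - g (\<tau> i)) * (g T \<bullet> n j) \<le> 0" if "\<tau> j \<le> \<tau> i" for i j
    proof -
      have \<tau>i: "0 \<le> \<tau> i" "\<tau> i \<le> T" using \<tau>(1)[of i] by auto
      consider "g T \<bullet> n j = 0" | "0 < g T \<bullet> n j" | "g T \<bullet> n j < 0" by linarith
      then show ?thesis
      proof cases
        case 2
        then have "co j (g T - g (\<tau> i)) \<le> 0" unfolding g_def
          using \<tau>(3)[of j, OF 2] that by (intro pair_monotone(1)[OF z \<psi> \<tau>i]) (auto simp: g_def)
        with 2 show ?thesis by (simp add: mult_nonpos_nonneg)
      next
        case 3
        then have "0 \<le> co j (g T - g (\<tau> i))" unfolding g_def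
          using \<tau>(4)[of j, OF 3] that by (intro pair_monotone(2)[OF z \<psi> \<tau>i]) (auto simp: g_def)
        with 3 show ?thesis by (simp add: mult_nonneg_nonpos)
      qed simp
    qed
  qed
  then show ?thesis by (simp add: g_def)
qed

subsection \<open>Derivative paths\<close>

text \<open>Nearby, faces can be lost but not gained. So over a short interval around
  \<open>t\<close> all pushing takes place in the span belonging to the faces active at
  \<open>t\<close>.\<close>

lemma near_active:
  fixes z :: "real \<Rightarrow> real^'n"
  assumes "continuous_on {0..} z" "\<And>t. 0 \<le> t \<Longrightarrow> z t \<in> polyhedron_G n" "0 \<le> t"
  obtains r where "r > 0" "\<And>u. 0 \<le> u \<Longrightarrow> \<bar>u - t\<bar> < r \<Longrightarrow> active n (z u) \<subseteq> active n (z t)"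
proof -
  have ev: "\<forall>\<^sub>F u in at t within {0..}. \<forall>i. 0 < z t \<bullet> n i \<longrightarrow> 0 < z u \<bullet> n i"
  proof (rule eventually_all_finite)
    fix i
    have "((\<lambda>u. z u \<bullet> n i) \<longlongrightarrow> z t \<bullet> n i) (at t within {0..})"
      using assms by (intro tendsto_intros) (auto simp: continuous_on_def)
    then show "\<forall>\<^sub>F u in at t within {0..}. 0 < z t \<bullet> n i \<longrightarrow> 0 < z u \<bullet> n i"
      by (cases "0 < z t \<bullet> n i") (auto dest: order_tendstoD(1))
  qed
  then obtain r where r: "r > 0" "\<And>u i. 0 \<le> u \<Longrightarrow> u \<noteq> t \<Longrightarrow> dist u t < r \<Longrightarrow> 0 < z t \<bullet> n i \<Longrightarrow> 0 < z u \<bullet> n i"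
    unfolding eventually_at by (metis atLeast_iff)
  show thesis
  proof (rule that[OF r(1)])
    fix u assume u: "0 \<le> u" "\<bar>u - t\<bar> < r"
    show "active n (z u) \<subseteq> active n (z t)"
    proof
      fix i assume "i \<in> active n (z u)"
      then have "z u \<bullet> n i = 0" using active_iff assms(2) u by blast
      moreover have "0 \<le> z t \<bullet> n i" using assms(2)[OF assms(3)] by (auto simp: polyhedron_G_def)
      ultimately have "z t \<bullet> n i = 0" using r(2)[of u i] u by (cases "u = t") (force simp: dist_real_def)+
      then show "i \<in> active n (z t)" using active_iff assms by blast
    qed
  qed
qed

definition hits :: "(real \<Rightarrow> real^'n) \<Rightarrow> real set \<Rightarrow> 'n set" where
  "hits z A = (\<Union>u\<in>A. active n (z u))"

definition derivative_path :: "(real \<Rightarrow> real^'n) \<Rightarrow> (real \<Rightarrow> real^'n) \<Rightarrow> (real \<Rightarrow> real^'n) \<Rightarrow> bool" where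
  "derivative_path z h \<phi> \<longleftrightarrow>
    (\<forall>t\<ge>0. (\<phi> \<longlongrightarrow> \<phi> t) (at_right t)) \<and> (\<forall>t\<ge>0. \<forall>i\<in>active n (z t). \<phi> t \<bullet> n i = 0) \<and>
    (\<forall>s t. 0 \<le> s \<and> s < t \<longrightarrow> \<phi> t - \<phi> s - (h t - h s) \<in> span (d ` hits z {s<..t}))"

lemma span_d_mono: "v \<in> span (d ` I) \<Longrightarrow> I \<subseteq> I' \<Longrightarrow> v \<in> span (d ` I')"
  using span_mono[of "d ` I" "d ` I'"] by blast

text \<open>From the left, the increments shortly before \<open>t\<close> lie in the span of the
  faces active at \<open>t\<close>, and \<open>act\<close> controls the components at
  \<open>t\<close> itself, so a jump at \<open>t\<close> does no harm. To the right, right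
  continuity keeps these components below some \<open>\<eta>'\<close> between \<open>\<eta>\<close>
  and \<open>\<theta> * c\<close>.\<close>

lemma N_hits_path_le:
  fixes g :: "real \<Rightarrow> real^'n"
  assumes z: "continuous_on {0..} z" "\<And>t. 0 \<le> t \<Longrightarrow> z t \<in> polyhedron_G n"
    and rc: "\<And>t. 0 \<le> t \<Longrightarrow> (g \<longlongrightarrow> g t) (at_right t)"
    and act: "\<And>t i. 0 \<le> t \<Longrightarrow> i \<in> active n (z t) \<Longrightarrow> \<bar>g t \<bullet> n i\<bar> \<le> \<eta>"
    and inc: "\<And>s t. 0 \<le> s \<Longrightarrow> s < t \<Longrightarrow> g t - g s \<in> span (d ` hits z {s<..t})"
    and c: "\<eta> < \<theta> * c" "N (g 0) \<le> c" and t: "0 \<le> t"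
  shows "N (g t) \<le> c"
proof (rule real_creep[of "\<lambda>t. N (g t) \<le> c", OF _ _ t])
  fix t :: real assume t: "0 \<le> t"
  obtain r where r: "r > 0" "\<And>u. 0 \<le> u \<Longrightarrow> \<bar>u - t\<bar> < r \<Longrightarrow> active n (z u) \<subseteq> active n (z t)"
    using near_active[OF z t] by blast
  show "N (g t) \<le> c" if IH: "\<And>s. 0 \<le> s \<Longrightarrow> s < t \<Longrightarrow> N (g s) \<le> c"
  proof (cases "t = 0")
    case False
    define s where "s = max 0 (t - r / 2)"
    have s: "0 \<le> s" "s < t" "t - s < r" using r False t by (auto simp: s_def)
    have "hits z {s<..t} \<subseteq> active n (z t)" unfolding hits_def
    proof (rule UN_least)
      fix u assume "u \<in> {s<..t}" then show "active n (z u) \<subseteq> active n (z t)" using s by (intro r(2)) auto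
    qed
    then have "g t - g s \<in> span (d ` active n (z t))" using inc[OF s(1,2)] span_d_mono by blast
    then show ?thesis using act[OF t] c(1) IH[OF s(1,2)] by (intro N_add_span_le[of "active n (z t)" "g t" \<eta> "g s"])
  qed (use c in simp)
  show "\<exists>e>0. \<forall>s. t < s \<and> s < t + e \<longrightarrow> N (g s) \<le> c" if "N (g t) \<le> c"
  proof -
    obtain \<eta>' where \<eta>': "\<eta> < \<eta>'" "\<eta>' < \<theta> * c" using dense c(1) by blast
    have "\<forall>\<^sub>F s in at_right t. \<forall>i. i \<in> active n (z t) \<longrightarrow> \<bar>g s \<bullet> n i\<bar> < \<eta>'"
    proof (rule eventually_all_finite)
      fix i
      have "((\<lambda>s. \<bar>g s \<bullet> n i\<bar>) \<longlongrightarrow> \<bar>g t \<bullet> n i\<bar>) (at_right t)" by (intro tendsto_intros rc t)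
      then show "\<forall>\<^sub>F s in at_right t. i \<in> active n (z t) \<longrightarrow> \<bar>g s \<bullet> n i\<bar> < \<eta>'"
        using act[OF t, of i] \<eta>'(1) order_tendstoD(2)[of "\<lambda>s. \<bar>g s \<bullet> n i\<bar>" _ _ \<eta>']
        by (cases "i \<in> active n (z t)") auto
    qed
    then obtain b where b: "b > t" "\<And>s i. t < s \<Longrightarrow> s < b \<Longrightarrow> i \<in> active n (z t) \<Longrightarrow> \<bar>g s \<bullet> n i\<bar> < \<eta>'"
      unfolding eventually_at_right_field by metis
    show ?thesis
    proof (intro exI conjI allI impI)
      show "0 < min r (b - t)" using r b by simp
      fix s assume s: "t < s \<and> s < t + min r (b - t)"
      have "hits z {t<..s} \<subseteq> active n (z t)" unfolding hits_def
      proof (rule UN_least)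
        fix u assume "u \<in> {t<..s}" then show "active n (z u) \<subseteq> active n (z t)" using s t by (intro r(2)) auto
      qed
      then have "g s - g t \<in> span (d ` active n (z t))" using inc[OF t, of s] s span_d_mono by blast
      then show "N (g s) \<le> c" using b(2)[of s] s \<eta>'(2) that
        by (intro N_add_span_le[of "active n (z t)" "g s" \<eta>' "g t"]) (auto intro: less_imp_le)
    qed
  qed
qed

lemma derivative_diff:
  assumes "derivative_path z h \<phi>" "derivative_path z h \<phi>'"
  defines "g \<equiv> \<lambda>t. \<phi> t - \<phi>' t"
  shows "\<And>t. 0 \<le> t \<Longrightarrow> (g \<longlongrightarrow> g t) (at_right t)"
    "\<And>t i. 0 \<le> t \<Longrightarrow> i \<in> active n (z t) \<Longrightarrow> g t \<bullet> n i = 0"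
    "\<And>s t. 0 \<le> s \<Longrightarrow> s < t \<Longrightarrow> g t - g s \<in> span (d ` hits z {s<..t})"
proof -
  show "\<And>t. 0 \<le> t \<Longrightarrow> (g \<longlongrightarrow> g t) (at_right t)" unfolding g_def
    using assms(1,2) by (auto simp: derivative_path_def intro!: tendsto_diff)
  show "\<And>t i. 0 \<le> t \<Longrightarrow> i \<in> active n (z t) \<Longrightarrow> g t \<bullet> n i = 0"
    using assms(1,2) by (simp add: derivative_path_def g_def inner_diff_left)
  fix s t :: real assume "0 \<le> s" "s < t"
  then have "(\<phi> t - \<phi> s - (h t - h s)) - (\<phi>' t - \<phi>' s - (h t - h s)) \<in> span (d ` hits z {s<..t})"
    using assms(1,2) by (intro span_diff[of "\<phi> t - \<phi> s - (h t - h s)"]) (simp_all add: derivative_path_def)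
  moreover have "(\<phi> t - \<phi> s - (h t - h s)) - (\<phi>' t - \<phi>' s - (h t - h s)) = g t - g s" by (simp add: g_def)
  ultimately show "g t - g s \<in> span (d ` hits z {s<..t})" by simp
qed

lemma derivative_nonexpansive:
  assumes z: "continuous_on {0..} z" "\<And>t. 0 \<le> t \<Longrightarrow> z t \<in> polyhedron_G n"
    and \<phi>: "derivative_path z h \<phi>" "derivative_path z h \<phi>'" and t: "0 \<le> t"
  shows "N (\<phi> t - \<phi>' t) \<le> N (\<phi> 0 - \<phi>' 0)"
proof (rule field_le_epsilon)
  fix e :: real assume e: "e > 0"
  show "N (\<phi> t - \<phi>' t) \<le> N (\<phi> 0 - \<phi>' 0) + e"
  proof (rule N_hits_path_le[of z "\<lambda>t. \<phi> t - \<phi>' t" 0, OF z _ _ _ _ _ t])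
    show "0 < \<theta> * (N (\<phi> 0 - \<phi>' 0) + e)" using e \<theta>_pos N_nonneg by (simp add: add_nonneg_pos)
    show "\<bar>(\<phi> t - \<phi>' t) \<bullet> n i\<bar> \<le> 0" if "0 \<le> t" "i \<in> active n (z t)" for t i
      using derivative_diff(2)[OF \<phi> that] by simp
  qed (use e derivative_diff(1,3)[OF \<phi>] in auto)
qed

text \<open>Both derivative paths live along the same \<open>z\<close>, so after its last visit to
  face \<open>j\<close> neither is pushed along \<open>d j\<close>: the coordinate \<open>j\<close>
  of the difference is constant, and the sign condition holds with equality.\<close>

lemma derivative_contraction:
  assumes z: "continuous_on {0..} z" "\<And>t. 0 \<le> t \<Longrightarrow> z t \<in> polyhedron_G n"
    and \<phi>: "derivative_path z h \<phi>" "derivative_path z h \<phi>'"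
    and hit: "\<And>i. \<exists>u\<in>{0..T}. z u \<bullet> n i = 0"
  shows "N (\<phi> T - \<phi>' T) \<le> (1 - contr) * N (\<phi> 0 - \<phi>' 0)"
proof -
  have T: "0 \<le> T" using hit[of undefined] by auto
  define g where "g t = \<phi> t - \<phi>' t" for t
  have contn: "continuous_on {0..T} (\<lambda>t. z t \<bullet> n i)" for i
    using continuous_on_subset[OF z(1), of "{0..T}"] by (auto intro!: continuous_intros)
  have "\<exists>\<tau>\<in>{0..T}. z \<tau> \<bullet> n i = 0 \<and> (\<forall>r. \<tau> < r \<longrightarrow> r \<le> T \<longrightarrow> z r \<bullet> n i \<noteq> 0)" for i
    using hit[of i] by (meson last_zero[OF contn])
  then obtain \<tau> where \<tau>: "\<And>i. \<tau> i \<in> {0..T}" "\<And>i. z (\<tau> i) \<bullet> n i = 0"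
    "\<And>i r. \<tau> i < r \<Longrightarrow> r \<le> T \<Longrightarrow> z r \<bullet> n i \<noteq> 0" by metis
  have mono: "N (g t) \<le> N (g 0)" if "0 \<le> t" for t
    unfolding g_def by (rule derivative_nonexpansive[OF z \<phi> that])
  have "N (g T) \<le> (1 - contr) * N (g 0)"
  proof (rule contr_contraction[of "\<lambda>i. g (\<tau> i)" _ _ \<tau>])
    show "N (g (\<tau> i)) \<le> N (g 0)" for i using mono[of "\<tau> i"] \<tau>(1)[of i] by simp
    show "g (\<tau> i) \<bullet> n i = 0" for i
      using derivative_diff(2)[OF \<phi>, of "\<tau> i" i] \<tau>(1,2)[of i] active_iff[OF z(2), of "\<tau> i" i] by (auto simp: g_def)
    show "N (g T) \<le> N (g 0)" using mono T by simp
    show "co j (g T - g (\<tau> i)) * (g T \<bullet> n j) \<le> 0" if "\<tau> j \<le> \<tau> i" for i j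
    proof (cases "\<tau> i = T")
      case False
      then have \<tau>i: "0 \<le> \<tau> i" "\<tau> i < T" using \<tau>(1)[of i] by auto
      have "j \<notin> hits z {\<tau> i<..T}"
        using \<tau>(3)[of j] that active_iff[OF z(2)] \<tau>i by (auto simp: hits_def)
      then have "co j (g T - g (\<tau> i)) = 0"
        using span_co[OF derivative_diff(3)[OF \<phi> \<tau>i]] by (simp add: g_def)
      then show ?thesis by simp
    qed simp
  qed
  then show ?thesis by (simp add: g_def)
qed

text \<open>Without its driver the path moves only along reflection directions, and on active faces
  its normal components are, up to sign, those of the driver, hence at most \<open>\<eta>\<close>.
  The summand 1 makes the inequality \<open>\<eta> < \<theta> * c\<close> strict.\<close>

lemma derivative_bound:
  assumes z: "continuous_on {0..} z" "\<And>t. 0 \<le> t \<Longrightarrow> z t \<in> polyhedron_G n"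
    and \<phi>: "derivative_path z h \<phi>" and h: "continuous_on {0..} h"
    and t: "0 \<le> t" and \<eta>: "\<And>s. 0 \<le> s \<Longrightarrow> s \<le> t \<Longrightarrow> norm (h s - h 0) \<le> \<eta>"
  shows "N (\<phi> t) \<le> N (\<phi> 0) + \<eta> / \<theta> + 1 + N (h t - h 0)"
proof -
  \<comment> \<open>Frozen after \<open>t\<close>, because the driver is bounded by
    \<open>\<eta>\<close> only up to \<open>t\<close>, whereas the comparison is made on the whole
    half-line.\<close>
  define k where "k s = h (min s t) - h 0" for s
  have \<eta>0: "0 \<le> \<eta>" using \<eta>[of 0] t by simp
  define g where "g s = \<phi> (min s t) - k s" for s
  have "N (g t) \<le> N (\<phi> 0) + \<eta> / \<theta> + 1"
  proof (rule N_hits_path_le[of "\<lambda>s. z (min s t)" g \<eta>, OF _ _ _ _ _ _ _ t])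
    show "continuous_on {0..} (\<lambda>s. z (min s t))"
      by (rule continuous_on_compose2[OF z(1)]) (use t in \<open>auto intro!: continuous_intros\<close>)
    show "\<And>s. 0 \<le> s \<Longrightarrow> z (min s t) \<in> polyhedron_G n" using z(2) t by simp
    show "(g \<longlongrightarrow> g s) (at_right s)" if s: "0 \<le> s" for s
    proof (cases "s < t")
      case True
      have "(h \<longlongrightarrow> h s) (at s within {0..})" using h s by (auto simp: continuous_on_def)
      then have "(h \<longlongrightarrow> h s) (at_right s)" by (rule tendsto_within_subset) (use s in auto)
      moreover have "(\<phi> \<longlongrightarrow> \<phi> s) (at_right s)" using \<phi> s by (auto simp: derivative_path_def)
      ultimately have t1: "((\<lambda>s. \<phi> s - (h s - h 0)) \<longlongrightarrow> \<phi> s - (h s - h 0)) (at_right s)" by (intro tendsto_intros)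
      have t2: "\<forall>\<^sub>F r in at_right s. \<phi> r - (h r - h 0) = g r"
        unfolding eventually_at_right_field using True by (auto simp: g_def k_def intro!: exI[of _ t])
      have t3: "\<phi> s - (h s - h 0) = g s" using True by (simp add: g_def k_def)
      from Lim_transform_eventually[OF t1 t2] show ?thesis by (simp only: t3)
    next
      case False
      have "\<forall>\<^sub>F r in at_right s. g s = g r"
        unfolding eventually_at_right_field using False by (auto simp: g_def k_def min_def intro!: exI[of _ "s + 1"])
      then show ?thesis using Lim_transform_eventually[OF tendsto_const] by fast
    qed
    show "\<bar>g s \<bullet> n i\<bar> \<le> \<eta>" if "0 \<le> s" "i \<in> active n (z (min s t))" for s i
    proof -
      have "\<phi> (min s t) \<bullet> n i = 0" using \<phi> that t by (auto simp: derivative_path_def)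
      then have "\<bar>g s \<bullet> n i\<bar> = \<bar>k s \<bullet> n i\<bar>" by (simp add: g_def inner_diff_left)
      also have "\<dots> \<le> norm (k s)" using Cauchy_Schwarz_ineq2[of "k s" "n i"] norm_n by simp
      also have "\<dots> \<le> \<eta>" unfolding k_def using that t by (intro \<eta>) auto
      finally show ?thesis .
    qed
    show "g s' - g s \<in> span (d ` hits (\<lambda>s. z (min s t)) {s<..s'})" if "0 \<le> s" "s < s'" for s s'
    proof (cases "s < t")
      case True
      have "g s' - g s = \<phi> (min s' t) - \<phi> s - (h (min s' t) - h s)" using True by (simp add: g_def k_def)
      also have "\<dots> \<in> span (d ` hits z {s<..min s' t})" using \<phi> that True by (auto simp: derivative_path_def)
      finally show ?thesis
      proof (rule span_d_mono)
        show "hits z {s<..min s' t} \<subseteq> hits (\<lambda>s. z (min s t)) {s<..s'}"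
          unfolding hits_def
        proof (rule UN_least)
          fix u assume u: "u \<in> {s<..min s' t}"
          then have "min u t = u" by simp
          then have "active n (z u) = active n (z (min u t))" by simp
          then show "active n (z u) \<subseteq> (\<Union>u\<in>{s<..s'}. active n (z (min u t)))" using u by auto
        qed
      qed
    next
      case False
      then have "g s' - g s = 0" using that by (simp add: g_def k_def min_def)
      then show ?thesis by (simp add: span_zero)
    qed
    show "\<eta> < \<theta> * (N (\<phi> 0) + \<eta> / \<theta> + 1)"
      using \<theta>_pos mult_nonneg_nonneg[OF less_imp_le[OF \<theta>_pos] N_nonneg[of "\<phi> 0"]] by (simp add: algebra_simps)
    show "N (g 0) \<le> N (\<phi> 0) + \<eta> / \<theta> + 1" using t \<eta>0 \<theta>_pos by (simp add: g_def k_def)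
  qed
  moreover have "\<phi> t = g t + (h t - h 0)" by (simp add: g_def k_def)
  ultimately show ?thesis using N_triangle[of "g t" "h t - h 0"] by simp
qed

end

subsection \<open>Time discretisation\<close>

locale skorokhod = set_B n d B \<theta>
  for n d :: "'n::finite \<Rightarrow> real^'n" and B :: "(real^'n) set" and \<theta> :: real +
  fixes pr :: "real^'n \<Rightarrow> real^'n"
  assumes pr_in: "\<And>x. pr x \<in> polyhedron_G n"
    and pr_id: "\<And>x. x \<in> polyhedron_G n \<Longrightarrow> pr x = x"
    and pr_dir: "\<And>x. x \<notin> polyhedron_G n \<Longrightarrow> pr x - x \<in> fin_cone (d ` active n (pr x))"
begin

lemma pr_co:
  shows pr_co_nonneg: "0 \<le> co i (pr x - x)"
    and pr_co_zero: "pr x \<bullet> n i \<noteq> 0 \<Longrightarrow> co i (pr x - x) = 0"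
proof -
  show "0 \<le> co i (pr x - x)"
    using pr_dir[of x] pr_id[of x] fin_cone_co(1) by (cases "x \<in> polyhedron_G n") auto
  show "co i (pr x - x) = 0" if "pr x \<bullet> n i \<noteq> 0"
  proof (cases "x \<in> polyhedron_G n")
    case False
    then show ?thesis
      using pr_dir[of x] active_iff[OF pr_in, of i x] that by (intro fin_cone_co(2)[of _ "active n (pr x)"]) auto
  qed (simp add: pr_id)
qed

lemma pr_normal: "0 \<le> pr x \<bullet> n i"
  using pr_in[of x] by (auto simp: polyhedron_G_def)

text \<open>Complementarity: the correction at \<open>u\<close> has a positive coordinate
  \<open>i\<close> only if \<open>pr u\<close> lies on face \<open>i\<close>, and there
  \<open>pr u - pr v\<close> has a nonpositive component; symmetrically for
  \<open>v\<close>.\<close>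

lemma pr_nonexpansive: "N (pr u - pr v) \<le> N (u - v)"
proof (rule N_jump0)
  fix i
  have eq: "pr u - pr v - (u - v) = (pr u - u) - (pr v - v)" by simp
  show "(pr u - pr v) \<bullet> n i \<le> 0" if "0 < co i (pr u - pr v - (u - v))"
    using that pr_co_zero[of u i] pr_co_nonneg[of i v] pr_normal[of v i]
    unfolding eq co_diff[of i "pr u - u"] inner_diff_left by fastforce
  show "0 \<le> (pr u - pr v) \<bullet> n i" if "co i (pr u - pr v - (u - v)) < 0"
    using that pr_co_zero[of v i] pr_co_nonneg[of i u] pr_normal[of u i]
    unfolding eq co_diff[of i "pr u - u"] inner_diff_left by fastforce
qed

lemma continuous_pr: "continuous_on UNIV pr"
  by (rule N_lipschitz_continuous) (rule pr_nonexpansive)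

fun scheme :: "real^'n \<Rightarrow> (nat \<Rightarrow> real^'n) \<Rightarrow> nat \<Rightarrow> real^'n" where
  "scheme x \<delta> 0 = x"
| "scheme x \<delta> (Suc k) = pr (scheme x \<delta> k + \<delta> k)"

lemma scheme_in: "x \<in> polyhedron_G n \<Longrightarrow> scheme x \<delta> k \<in> polyhedron_G n"
  by (cases k) (auto simp: pr_in)

lemma scheme_nonexpansive: "N (scheme x \<delta> k - scheme x' \<delta> k) \<le> N (x - x')"
proof (induction k)
  case (Suc k)
  have "N (scheme x \<delta> (Suc k) - scheme x' \<delta> (Suc k)) \<le> N ((scheme x \<delta> k + \<delta> k) - (scheme x' \<delta> k + \<delta> k))"
    unfolding scheme.simps by (rule pr_nonexpansive)
  with Suc show ?case by simp
qed simp

lemma scheme_add: "scheme x \<delta> (j + k) = scheme (scheme x \<delta> j) (\<lambda>i. \<delta> (j + i)) k"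
  by (induction k) auto

text \<open>What is compared is the accumulated push, not the position. On each grid interval the
  push of the path moves first while the scheme is frozen, then the scheme jumps. Either move keeps
  \<open>N\<close> below \<open>c\<close>, so errors do not add up over the steps.\<close>

lemma scheme_close:
  assumes z: "skorokhod_path \<psi> z y" and x: "x \<in> polyhedron_G n" and h: "0 \<le> h"
    and close: "\<And>k t i. k < K \<Longrightarrow> real k * h \<le> t \<Longrightarrow> t \<le> real (Suc k) * h \<Longrightarrow>
                  \<bar>(\<psi> t - (x + (\<Sum>j<k. \<delta> j))) \<bullet> n i\<bar> \<le> \<eta>"
    and last: "\<And>k i. k \<le> K \<Longrightarrow> \<bar>(\<psi> (real k * h) - (x + (\<Sum>j<k. \<delta> j))) \<bullet> n i\<bar> \<le> \<eta>"
    and c: "\<eta> < \<theta> * c" "0 \<le> c"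
  shows "k \<le> K \<Longrightarrow> N (y (real k * h) - (scheme x \<delta> k - (x + (\<Sum>j<k. \<delta> j)))) \<le> c"
proof (induction k)
  case 0
  then show ?case using skorokhod_pathD(3)[OF z] c by simp
next
  case (Suc k)
  define q where "q = scheme x \<delta>"
  define p where "p k = x + (\<Sum>j<k. \<delta> j)" for k
  have q: "q k \<in> polyhedron_G n" unfolding q_def by (rule scheme_in[OF x])
  have kh: "real k * h \<le> real (Suc k) * h" "0 \<le> real k * h" using h by (auto intro: mult_right_mono)
  have zq: "z r = q k + (\<psi> r - p k) + (y r - (q k - p k))" if "0 \<le> r" for r
    using skorokhod_pathD(5)[OF z that] by simp
  have pre: "N (y (real (Suc k) * h) - (q k - p k)) \<le> c"
  proof (rule N_path_le[of "real k * h" "real (Suc k) * h" "\<lambda>t. y t - (q k - p k)" c \<eta>])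
    show "continuous_on {real k * h..real (Suc k) * h} (\<lambda>t. y t - (q k - p k))"
      using kh by (intro continuous_intros continuous_on_subset[OF skorokhod_pathD(2)[OF z]]) auto
    show "N (y (real k * h) - (q k - p k)) \<le> c" using Suc by (simp add: q_def p_def)
    fix u v :: real and i assume uv: "real k * h \<le> u" "u < v" "v \<le> real (Suc k) * h"
    then have u0: "0 \<le> u" using kh by linarith
    have eq: "y v - (q k - p k) - (y u - (q k - p k)) = y v - y u" by simp
    show "0 \<le> co i (y v - (q k - p k) - (y u - (q k - p k)))"
      unfolding eq using push_mono[OF z u0] uv by simp
    show "co i (y v - (q k - p k) - (y u - (q k - p k))) \<le> 0"
      if g: "\<And>r. u < r \<Longrightarrow> r \<le> v \<Longrightarrow> \<eta> < (y r - (q k - p k)) \<bullet> n i"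
    proof -
      \<comment> \<open>The scheme lies in the cone and the drivers differ by at most
        \<open>\<eta>\<close>; if the push of the path is ahead by more than \<open>\<eta>\<close>,
        the path must be off the face.\<close>
      have "co i (y v - y u) = 0"
      proof (rule push_const[OF z u0])
        fix r assume r: "u < r" "r \<le> v"
        have "\<bar>(\<psi> r - p k) \<bullet> n i\<bar> \<le> \<eta>" unfolding p_def using Suc r uv by (intro close) auto
        moreover have "0 \<le> q k \<bullet> n i" using q by (auto simp: polyhedron_G_def)
        moreover have "z r \<bullet> n i = q k \<bullet> n i + (\<psi> r - p k) \<bullet> n i + (y r - (q k - p k)) \<bullet> n i"
          using zq[of r] r u0 by (simp add: inner_add_left[symmetric])
        ultimately show "z r \<bullet> n i \<noteq> 0" using g[OF r] by linarith
      qed (use uv in simp)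
      then show ?thesis unfolding eq by simp
    qed
  qed (use kh c in auto)
  have "N (y (real (Suc k) * h) - (q (Suc k) - p (Suc k))) \<le> c"
  proof (rule N_jump[OF _ _ c(1) pre])
    let ?y = "y (real (Suc k) * h)"
    have eq: "?y - (q (Suc k) - p (Suc k)) - (?y - (q k - p k)) = - (pr (q k + \<delta> k) - (q k + \<delta> k))"
      by (simp add: q_def p_def algebra_simps)
    show "(?y - (q (Suc k) - p (Suc k))) \<bullet> n i \<le> \<eta>"
      if "0 < co i (?y - (q (Suc k) - p (Suc k)) - (?y - (q k - p k)))" for i
      using that pr_co_nonneg[of i "q k + \<delta> k"] unfolding eq by (simp only: co_minus)
    show "- \<eta> \<le> (?y - (q (Suc k) - p (Suc k))) \<bullet> n i"
      if "co i (?y - (q (Suc k) - p (Suc k)) - (?y - (q k - p k))) < 0" for i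
    proof -
      have "co i (pr (q k + \<delta> k) - (q k + \<delta> k)) \<noteq> 0" using that unfolding eq by (auto simp only: co_minus)
      then have "q (Suc k) \<bullet> n i = 0" using pr_co_zero[of "q k + \<delta> k" i] by (auto simp: q_def)
      moreover have "z (real (Suc k) * h) = \<psi> (real (Suc k) * h) + ?y"
        using skorokhod_pathD(5)[OF z] h by simp
      then have "?y - (q (Suc k) - p (Suc k)) = z (real (Suc k) * h) - (\<psi> (real (Suc k) * h) - p (Suc k)) - q (Suc k)"
        by simp
      moreover have "\<bar>(\<psi> (real (Suc k) * h) - p (Suc k)) \<bullet> n i\<bar> \<le> \<eta>" unfolding p_def by (rule last[OF Suc.prems])
      moreover have "0 \<le> z (real (Suc k) * h) \<bullet> n i" using skorokhod_pathD(6)[OF z] h by simp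
      ultimately show ?thesis by (simp only: inner_diff_left)
    qed
  qed
  then show ?case by (simp add: q_def p_def)
qed

text \<open>The reflected path at a fixed time becomes a limit of continuous functions of finitely
  many values of the driver; its measurability in state and noise rests on this.\<close>

lemma scheme_limit:
  assumes z: "skorokhod_path \<psi> z y" and \<psi>: "continuous_on {0..} \<psi>" and t: "0 \<le> t"
    and step: "\<And>m. real (K m) * h m = t" "\<And>m. 0 \<le> h m" "h \<longlonglongrightarrow> 0"
  shows "(\<lambda>m. scheme (\<psi> 0) (\<lambda>k. \<psi> (real (Suc k) * h m) - \<psi> (real k * h m)) (K m)) \<longlonglongrightarrow> z t"
proof -
  obtain C where C: "C > 0" "\<And>v. norm v \<le> C * N v" using N_equiv by metis
  have x: "\<psi> 0 \<in> polyhedron_G n" using skorokhod_pathD(4,5)[OF z, of 0] skorokhod_pathD(3)[OF z] by simp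
  have uc: "uniformly_continuous_on {0..t} \<psi>"
    using \<psi> by (intro compact_uniformly_continuous continuous_on_subset[OF \<psi>]) auto
  show ?thesis
  proof (rule LIMSEQ_I)
    fix r :: real assume r: "0 < r"
    define c where "c = r / (2 * C)"
    have c: "0 < c" using r C by (simp add: c_def)
    define \<eta> where "\<eta> = \<theta> * c / 2"
    have \<eta>: "0 < \<eta>" "\<eta> < \<theta> * c" using c \<theta>_pos by (auto simp: \<eta>_def)
    obtain e where e: "e > 0" "\<And>u v. u \<in> {0..t} \<Longrightarrow> v \<in> {0..t} \<Longrightarrow> dist u v < e \<Longrightarrow> dist (\<psi> u) (\<psi> v) < \<eta>"
      using uc \<eta>(1) unfolding uniformly_continuous_on_def by metis
    obtain m0 where m0: "\<And>m. m0 \<le> m \<Longrightarrow> h m < e"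
      using order_tendstoD(2)[OF step(3) e(1)] unfolding eventually_sequentially by blast
    show "\<exists>m0. \<forall>m\<ge>m0. norm (scheme (\<psi> 0) (\<lambda>k. \<psi> (real (Suc k) * h m) - \<psi> (real k * h m)) (K m) - z t) < r"
    proof (intro exI allI impI)
      fix m assume m: "m0 \<le> m"
      define \<delta> where "\<delta> k = \<psi> (real (Suc k) * h m) - \<psi> (real k * h m)" for k
      have tel: "\<psi> 0 + (\<Sum>j<k. \<delta> j) = \<psi> (real k * h m)" for k
        using sum_lessThan_telescope[of "\<lambda>k. \<psi> (real k * h m)" k] by (simp add: \<delta>_def)
      have "N (y (real (K m) * h m) - (scheme (\<psi> 0) \<delta> (K m) - (\<psi> 0 + (\<Sum>j<K m. \<delta> j)))) \<le> c"
      proof (rule scheme_close[OF z x step(2)])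
        show "\<bar>(\<psi> (real k * h m) - (\<psi> 0 + (\<Sum>j<k. \<delta> j))) \<bullet> n i\<bar> \<le> \<eta>" for k i
          using \<eta> by (simp add: tel)
        fix k s i assume k: "k < K m" and s: "real k * h m \<le> s" "s \<le> real (Suc k) * h m"
        have "real (Suc k) * h m \<le> real (K m) * h m" using k step(2) by (intro mult_right_mono) auto
        then have kt: "real (Suc k) * h m \<le> t" by (simp add: step(1))
        have "s - real k * h m \<le> h m" using s by (simp add: algebra_simps)
        then have "dist s (real k * h m) < e" using s m0[OF m] by (simp add: dist_real_def)
        then have "dist (\<psi> s) (\<psi> (real k * h m)) < \<eta>"
          using s kt step(2)[of m] by (intro e(2)) (auto intro: order_trans[rotated, OF s(1)])
        then have "norm (\<psi> s - \<psi> (real k * h m)) \<le> \<eta>" by (simp add: dist_norm)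
        then show "\<bar>(\<psi> s - (\<psi> 0 + (\<Sum>j<k. \<delta> j))) \<bullet> n i\<bar> \<le> \<eta>"
          using Cauchy_Schwarz_ineq2[of "\<psi> s - \<psi> (real k * h m)" "n i"] norm_n[of i] by (simp add: tel)
      qed (use \<eta> c in auto)
      moreover have "y (real (K m) * h m) - (scheme (\<psi> 0) \<delta> (K m) - (\<psi> 0 + (\<Sum>j<K m. \<delta> j))) = z t - scheme (\<psi> 0) \<delta> (K m)"
        unfolding tel step(1) using skorokhod_pathD(5)[OF z t] by simp
      ultimately have "N (scheme (\<psi> 0) \<delta> (K m) - z t) \<le> c" using N_diff_commute by simp
      then have "norm (scheme (\<psi> 0) \<delta> (K m) - z t) \<le> C * c"
        using C(2)[of "scheme (\<psi> 0) \<delta> (K m) - z t"] C(1)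
        by (meson less_imp_le mult_left_mono order_trans)
      also have "\<dots> < r" using C r by (simp add: c_def)
      finally show "norm (scheme (\<psi> 0) (\<lambda>k. \<psi> (real (Suc k) * h m) - \<psi> (real k * h m)) (K m) - z t) < r"
        by (simp add: \<delta>_def[abs_def])
    qed
  qed
qed

end

context set_B
begin

section \<open>Discretisation of the derivative path\<close>

fun dscheme :: "real^'n \<Rightarrow> (nat \<Rightarrow> 'n set) \<Rightarrow> (nat \<Rightarrow> real^'n) \<Rightarrow> nat \<Rightarrow> real^'n" where
  "dscheme y H \<delta> 0 = y"
| "dscheme y H \<delta> (Suc k) = oblique (H k) (dscheme y H \<delta> k + \<delta> k)"

text \<open>An error made at the end of a grid interval is harmless unless the interval meets a face
  for which the derivative path has a large normal component at the end of the interval. Such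
  intervals accumulate only from the left at a time where the path meets a lower-dimensional face,
  and there the projection resets the error.\<close>

lemma dscheme_limit:
  fixes K :: "nat \<Rightarrow> nat"
  assumes z: "continuous_on {0..} z" "\<And>t. 0 \<le> t \<Longrightarrow> z t \<in> polyhedron_G n"
    and \<phi>: "derivative_path z h \<phi>" and t: "0 \<le> t"
    and step: "\<And>m. real (K m) * \<rho> m = t" "\<And>m. 0 < \<rho> m" "\<rho> \<longlonglongrightarrow> 0"
  shows "(\<lambda>m. dscheme (\<phi> 0) (\<lambda>k. hits z {real k * \<rho> m..real (Suc k) * \<rho> m})
           (\<lambda>k. h (real (Suc k) * \<rho> m) - h (real k * \<rho> m)) (K m)) \<longlonglongrightarrow> \<phi> t"
proof -
  obtain C where C: "C > 0" "\<And>v. norm v \<le> C * N v" using N_equiv by metis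
  define H where "H m k = hits z {real k * \<rho> m..real (Suc k) * \<rho> m}" for m k
  define q where "q m = dscheme (\<phi> 0) (H m) (\<lambda>k. h (real (Suc k) * \<rho> m) - h (real k * \<rho> m))" for m
  define E where "E m k = q m k - \<phi> (real k * \<rho> m)" for m k
  \<comment> \<open>The first grid index at or after \<open>u\<close>. The interval ending there
    contains \<open>u\<close>, so its face set includes every face active at
    \<open>u\<close>.\<close>
  define L where "L m u = nat \<lceil>u / \<rho> m\<rceil>" for m u
  have inc: "\<phi> v - \<phi> u - (h v - h u) \<in> span (d ` hits z {u<..v})" if "0 \<le> u" "u < v" for u v
    using \<phi> that by (auto simp: derivative_path_def)
  have \<phi>0: "\<phi> u \<bullet> n i = 0" if "0 \<le> u" "i \<in> active n (z u)" for u i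
    using \<phi> that by (auto simp: derivative_path_def)
  have rc: "(\<phi> \<longlongrightarrow> \<phi> u) (at_right u)" if "0 \<le> u" for u using \<phi> that by (auto simp: derivative_path_def)
  have Estep: "E m (Suc k) - E m k \<in> span (d ` H m k)" for m k
  proof -
    let ?a = "real k * \<rho> m" let ?b = "real (Suc k) * \<rho> m"
    have ab: "0 \<le> ?a" "?a < ?b" using step(2)[of m] by (simp_all add: less_imp_le)
    have "hits z {?a<..?b} \<subseteq> H m k" unfolding H_def hits_def by (rule UN_mono) auto
    then have "\<phi> ?b - \<phi> ?a - (h ?b - h ?a) \<in> span (d ` H m k)" using inc[OF ab] span_d_mono by blast
    then have "(q m (Suc k) - (q m k + (h ?b - h ?a))) - (\<phi> ?b - \<phi> ?a - (h ?b - h ?a)) \<in> span (d ` H m k)"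
      unfolding q_def dscheme.simps by (rule span_diff[OF oblique_span])
    moreover have "(q m (Suc k) - (q m k + (h ?b - h ?a))) - (\<phi> ?b - \<phi> ?a - (h ?b - h ?a)) = E m (Suc k) - E m k"
      by (simp only: E_def) (simp only: algebra_simps)
    ultimately show ?thesis by simp
  qed
  have Enormal: "E m (Suc k) \<bullet> n i = - (\<phi> (real (Suc k) * \<rho> m) \<bullet> n i)" if "i \<in> H m k" for m k i
    using that by (simp add: E_def q_def inner_diff_left oblique_normal)
  have Lge: "u \<le> real (L m u) * \<rho> m" if "0 \<le> u" for m u
  proof -
    have "u / \<rho> m \<le> real (L m u)" unfolding L_def by (rule real_nat_ceiling_ge)
    then show ?thesis using step(2)[of m] by (simp add: pos_divide_le_eq)
  qed
  have Llt: "real (L m u) * \<rho> m < u + \<rho> m" if "0 \<le> u" for m u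
  proof -
    have "0 \<le> u / \<rho> m" using that step(2)[of m] by simp
    then have "real (L m u) < u / \<rho> m + 1" unfolding L_def by linarith
    then show ?thesis using step(2)[of m] by (simp add: field_simps)
  qed
  have small: "\<forall>\<^sub>F m in sequentially. \<rho> m < r" if "0 < r" for r
    using order_tendstoD(2)[OF step(3) that] .
  have Lmono: "L m u \<le> L m v" if "u \<le> v" for m u v
    unfolding L_def using that step(2)[of m] by (intro nat_mono ceiling_mono divide_right_mono) auto
  \<comment> \<open>Continuous induction on the time, for all sufficiently fine grids; how fine may
    depend on the time.\<close>
  have main: "\<forall>\<^sub>F m in sequentially. N (E m (L m u)) \<le> c" if c: "0 < c" and u: "0 \<le> u" for c u
  proof (rule real_creep[of "\<lambda>u. \<forall>\<^sub>F m in sequentially. N (E m (L m u)) \<le> c", OF _ _ u])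
    fix u :: real assume u: "0 \<le> u"
    obtain r where r: "r > 0" "\<And>v. 0 \<le> v \<Longrightarrow> \<bar>v - u\<bar> < r \<Longrightarrow> active n (z v) \<subseteq> active n (z u)"
      using near_active[OF z u] by blast
    define \<eta> where "\<eta> = \<theta> * c / 2"
    have \<eta>: "0 < \<eta>" "\<eta> < \<theta> * c" using c \<theta>_pos by (auto simp: \<eta>_def)
    have "\<forall>\<^sub>F s in at_right u. \<forall>i. i \<in> active n (z u) \<longrightarrow> \<bar>\<phi> s \<bullet> n i\<bar> < \<eta>"
    proof (rule eventually_all_finite)
      fix i
      have "((\<lambda>s. \<bar>\<phi> s \<bullet> n i\<bar>) \<longlongrightarrow> \<bar>\<phi> u \<bullet> n i\<bar>) (at_right u)" by (intro tendsto_intros rc u)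
      then show "\<forall>\<^sub>F s in at_right u. i \<in> active n (z u) \<longrightarrow> \<bar>\<phi> s \<bullet> n i\<bar> < \<eta>"
        using \<phi>0[OF u, of i] \<eta>(1) order_tendstoD(2)[of "\<lambda>s. \<bar>\<phi> s \<bullet> n i\<bar>" _ _ \<eta>]
        by (cases "i \<in> active n (z u)") auto
    qed
    then obtain b where b: "b > u" "\<And>s i. u < s \<Longrightarrow> s < b \<Longrightarrow> i \<in> active n (z u) \<Longrightarrow> \<bar>\<phi> s \<bullet> n i\<bar> < \<eta>"
      unfolding eventually_at_right_field by metis
    then have b': "\<bar>\<phi> s \<bullet> n i\<bar> \<le> \<eta>" if "u \<le> s" "s < b" "i \<in> active n (z u)" for s i
      using that \<phi>0[OF u, of i] \<eta>(1) by (cases "s = u") (auto intro: less_imp_le)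
    define r' where "r' = min r (b - u)"
    have r': "0 < r'" using r b by (simp add: r'_def)
    have Hsub: "H m k \<subseteq> active n (z u)" if "u - r < real k * \<rho> m" "real (Suc k) * \<rho> m < u + r" for m k
      unfolding H_def hits_def
    proof (rule UN_least)
      fix v assume "v \<in> {real k * \<rho> m..real (Suc k) * \<rho> m}"
      moreover have "0 \<le> real k * \<rho> m" using step(2)[of m] by simp
      ultimately have "0 \<le> v" "\<bar>v - u\<bar> < r" using that by auto
      then show "active n (z v) \<subseteq> active n (z u)" by (rule r(2))
    qed
    show "\<forall>\<^sub>F m in sequentially. N (E m (L m u)) \<le> c"
      if IH: "\<And>s. 0 \<le> s \<Longrightarrow> s < u \<Longrightarrow> \<forall>\<^sub>F m in sequentially. N (E m (L m s)) \<le> c"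
    proof (cases "u = 0")
      case True
      have "E m (L m u) = 0" for m by (simp add: True L_def E_def q_def)
      then show ?thesis using c by simp
    next
      case False
      define s where "s = max 0 (u - r / 2)"
      have s: "0 \<le> s" "s < u" "u - r < s" using u False r by (auto simp: s_def)
      have e1: "\<forall>\<^sub>F m in sequentially. \<rho> m < min (u - s) r'" using s r' by (intro small) simp
      from e1 IH[OF s(1,2)] show ?thesis
      proof eventually_elim
        case (elim m)
        have \<rho>: "\<rho> m < u - s" "\<rho> m < r" "\<rho> m < b - u" using elim(1) by (auto simp: r'_def)
        have Lu: "u \<le> real (L m u) * \<rho> m" "real (L m u) * \<rho> m < u + \<rho> m" using Lge Llt u by auto
        have Ls: "s \<le> real (L m s) * \<rho> m" "real (L m s) * \<rho> m < s + \<rho> m" using Lge Llt s by auto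
        have "real (L m s) * \<rho> m < real (L m u) * \<rho> m" using Lu Ls \<rho> by linarith
        then have lt: "L m s < L m u" using step(2)[of m] by simp
        \<comment> \<open>Everything from \<open>s\<close> to \<open>u\<close> is treated as one
          jump in the span for the faces active at \<open>u\<close>; the errors in between are not
          examined.\<close>
        have "E m (L m s + k) - E m (L m s) \<in> span (d ` active n (z u))" if "L m s + k \<le> L m u" for k
          using that
        proof (induction k)
          case (Suc k)
          have "real (L m s) * \<rho> m \<le> real (L m s + k) * \<rho> m" using step(2)[of m] by (intro mult_right_mono) auto
          moreover have "real (Suc (L m s + k)) * \<rho> m \<le> real (L m u) * \<rho> m"
            using Suc.prems step(2)[of m] by (intro mult_right_mono) auto
          ultimately have "H m (L m s + k) \<subseteq> active n (z u)" using Lu Ls s \<rho> by (intro Hsub) linarith+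
          then have "E m (Suc (L m s + k)) - E m (L m s + k) \<in> span (d ` active n (z u))"
            using Estep span_d_mono by blast
          from span_add[OF this Suc.IH] Suc.prems show ?case by simp
        qed (simp add: span_zero)
        from this[of "L m u - L m s"] lt have 1: "E m (L m u) - E m (L m s) \<in> span (d ` active n (z u))" by simp
        obtain k where k: "L m u = Suc k" using lt by (cases "L m u") auto
        have "real k * \<rho> m \<le> u" "u \<le> real (Suc k) * \<rho> m" using Lu by (simp_all add: k algebra_simps)
        then have sub: "active n (z u) \<subseteq> H m k" by (auto simp: H_def hits_def)
        have "\<bar>E m (L m u) \<bullet> n i\<bar> \<le> \<eta>" if "i \<in> active n (z u)" for i
        proof -
          have "\<bar>E m (L m u) \<bullet> n i\<bar> = \<bar>\<phi> (real (L m u) * \<rho> m) \<bullet> n i\<bar>"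
            unfolding k using Enormal[of i m k] sub that by (simp add: subset_iff)
          also have "\<dots> \<le> \<eta>" using Lu \<rho> that by (intro b') auto
          finally show ?thesis .
        qed
        then show ?case by (rule N_add_span_le[OF _ 1 \<eta>(2) elim(2)])
      qed
    qed
    show "\<exists>e>0. \<forall>s. u < s \<and> s < u + e \<longrightarrow> (\<forall>\<^sub>F m in sequentially. N (E m (L m s)) \<le> c)"
      if IH: "\<forall>\<^sub>F m in sequentially. N (E m (L m u)) \<le> c"
    proof (intro exI conjI allI impI)
      show "0 < r'" by (rule r')
      fix s assume s: "u < s \<and> s < u + r'"
      have e1: "\<forall>\<^sub>F m in sequentially. \<rho> m < u + r' - s" using s by (intro small) simp
      from e1 IH show "\<forall>\<^sub>F m in sequentially. N (E m (L m s)) \<le> c"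
      proof eventually_elim
        case (elim m)
        have Lu: "u \<le> real (L m u) * \<rho> m" using Lge u by auto
        have Ls: "real (L m s) * \<rho> m < s + \<rho> m" using Llt[of s m] s u by auto
        \<comment> \<open>To the right of \<open>u\<close> the grid steps are taken one by one:
          every face hit is active at \<open>u\<close>, and right continuity makes the components of
          the path on it small.\<close>
        have "N (E m (L m u + k)) \<le> c" if "L m u + k \<le> L m s" for k
          using that
        proof (induction k)
          case (Suc k)
          have 1: "real (L m u) * \<rho> m \<le> real (L m u + k) * \<rho> m" "real (L m u + k) * \<rho> m \<le> real (Suc (L m u + k)) * \<rho> m"
            using step(2)[of m] by (auto intro!: mult_right_mono)
          have 2: "real (Suc (L m u + k)) * \<rho> m \<le> real (L m s) * \<rho> m"
            using Suc.prems step(2)[of m] by (intro mult_right_mono) auto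
          have lt: "real (Suc (L m u + k)) * \<rho> m < u + r'" using 2 Ls elim(1) by linarith
          then have sub: "H m (L m u + k) \<subseteq> active n (z u)" using 1 Lu r(1) by (intro Hsub) (auto simp: r'_def)
          have "\<bar>E m (Suc (L m u + k)) \<bullet> n i\<bar> \<le> \<eta>" if "i \<in> H m (L m u + k)" for i
            unfolding Enormal[OF that] abs_minus_cancel using that sub lt 1 Lu
            by (intro b') (auto simp: r'_def)
          from N_add_span_le[OF this Estep \<eta>(2)] Suc show ?case by simp
        qed (use elim in simp)
        from this[of "L m s - L m u"] Lmono[of u s m] s show ?case by simp
      qed
    qed
  qed
  have LK: "L m t = K m" for m
  proof -
    have "t / \<rho> m = real (K m)" using step(1)[of m] step(2)[of m] by (simp add: field_simps)
    then show ?thesis by (simp add: L_def)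
  qed
  show ?thesis
  proof (rule LIMSEQ_I)
    fix e :: real assume e: "0 < e"
    have "0 < e / (2 * C)" using e C by simp
    from main[OF this t] obtain m0 where m0: "\<And>m. m0 \<le> m \<Longrightarrow> N (E m (K m)) \<le> e / (2 * C)"
      unfolding eventually_sequentially LK by blast
    show "\<exists>m0. \<forall>m\<ge>m0. norm (dscheme (\<phi> 0) (\<lambda>k. hits z {real k * \<rho> m..real (Suc k) * \<rho> m})
           (\<lambda>k. h (real (Suc k) * \<rho> m) - h (real k * \<rho> m)) (K m) - \<phi> t) < e"
    proof (intro exI allI impI)
      fix m assume "m0 \<le> m"
      then have "norm (E m (K m)) \<le> C * (e / (2 * C))"
        using m0[of m] C(2)[of "E m (K m)"] mult_left_mono[of "N (E m (K m))" "e / (2 * C)" C] C(1) by linarith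
      also have "\<dots> < e" using C e by simp
      finally show "norm (dscheme (\<phi> 0) (\<lambda>k. hits z {real k * \<rho> m..real (Suc k) * \<rho> m})
           (\<lambda>k. h (real (Suc k) * \<rho> m) - h (real k * \<rho> m)) (K m) - \<phi> t) < e"
        by (simp only: E_def q_def H_def[abs_def] step(1))
    qed
  qed
qed

end

subsection \<open>Stability\<close>

locale rbm_data = skorokhod n d B \<theta> pr
  for n d :: "'n::finite \<Rightarrow> real^'n" and B :: "(real^'n) set" and \<theta> :: real and pr +
  fixes b :: "real^'n" and sig :: "real^'n^'n" and b' :: "real^'n" and sig' R' :: "real^'n^'n"
  assumes b_interior: "b \<in> interior (fin_cone (range (\<lambda>i. - d i)))"
begin

text \<open>A small multiple of \<open>d i\<close> can be added to \<open>b\<close> without leaving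
  the cone, on which all coordinates are nonpositive.\<close>

lemma co_b_neg: "co i b < 0"
proof -
  obtain e where e: "e > 0" "cball b e \<subseteq> fin_cone (range (\<lambda>i. - d i))"
    using b_interior mem_interior_cball by blast
  have "d i \<noteq> 0" using d_n[of i] by auto
  let ?s = "e / norm (d i)"
  have "b + ?s *\<^sub>R d i \<in> fin_cone (range (\<lambda>i. - d i))"
    using e \<open>d i \<noteq> 0\<close> by (intro subsetD[OF e(2)]) (auto simp: dist_norm)
  then obtain S c where S: "finite S" "S \<subseteq> range (\<lambda>i. - d i)" "\<forall>u\<in>S. 0 \<le> c u" "b + ?s *\<^sub>R d i = (\<Sum>u\<in>S. c u *\<^sub>R u)"
    by (auto simp: fin_cone_def)
  have "co i (\<Sum>u\<in>S. c u *\<^sub>R u) = (\<Sum>u\<in>S. c u * co i u)"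
    using S(1) by (induction S rule: finite_induct) (auto simp: co_add co_scale)
  also have "\<dots> \<le> 0" using S by (auto intro!: sum_nonpos simp: mult_le_0_iff co_minus co_d)
  finally have "co i b + ?s \<le> 0" unfolding S(4)[symmetric] by (simp add: co_add co_scale co_d)
  moreover have "0 < ?s" using e \<open>d i \<noteq> 0\<close> by simp
  ultimately show ?thesis by linarith
qed

definition \<beta> :: real where "\<beta> = Min (range (\<lambda>i. - co i b))"

lemma \<beta>: "0 < \<beta>" "co i b \<le> - \<beta>"
proof -
  show "0 < \<beta>" unfolding \<beta>_def using co_b_neg by (subst Min_gr_iff) auto
  have "\<beta> \<le> - co i b" unfolding \<beta>_def by (intro Min_le) auto
  then show "co i b \<le> - \<beta>" by simp
qed

subsection \<open>The discrete fluid model\<close>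

text \<open>The noise is dropped and time runs in unit steps. So the fluid is an instance of the
  projected scheme and \<open>scheme_close\<close> compares it directly with the reflected
  path.\<close>

definition fluid :: "real^'n \<Rightarrow> nat \<Rightarrow> real^'n" where "fluid x k = scheme x (\<lambda>_. b) k"

lemma fluid_0 [simp]: "fluid x 0 = x" by (simp add: fluid_def)

lemma fluid_Suc: "fluid x (Suc k) = pr (fluid x k + b)" by (simp add: fluid_def)

lemma fluid_add: "fluid x (j + k) = fluid (fluid x j) k"
  by (simp add: fluid_def scheme_add)

lemma fluid_in: "x \<in> polyhedron_G n \<Longrightarrow> fluid x k \<in> polyhedron_G n"
  unfolding fluid_def by (rule scheme_in)

lemma fluid_nonexpansive: "N (fluid x k - fluid x' k) \<le> N (x - x')"
  unfolding fluid_def by (rule scheme_nonexpansive)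

text \<open>The drift lowers every coordinate, so a coordinate can rise only by a push, which
  happens on the corresponding face.\<close>

lemma fluid_step: "N (fluid x (Suc k)) \<le> N (fluid x k)"
proof (rule N_jump0)
  fix i
  have eq: "fluid x (Suc k) - fluid x k = (pr (fluid x k + b) - (fluid x k + b)) + b" by (simp add: fluid_Suc)
  show "fluid x (Suc k) \<bullet> n i \<le> 0" if "0 < co i (fluid x (Suc k) - fluid x k)"
  proof -
    have "0 < co i (pr (fluid x k + b) - (fluid x k + b))"
      using that co_b_neg[of i] unfolding eq co_add[of i "pr (fluid x k + b) - (fluid x k + b)"] by linarith
    then have "pr (fluid x k + b) \<bullet> n i = 0" using pr_co_zero by fastforce
    then show ?thesis by (simp add: fluid_Suc)
  qed
  show "0 \<le> fluid x (Suc k) \<bullet> n i" by (simp add: fluid_Suc pr_normal)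
qed

lemma fluid_decreasing: "j \<le> k \<Longrightarrow> N (fluid x k) \<le> N (fluid x j)"
  using lift_Suc_antimono_le[of "\<lambda>k. N (fluid x k)" j k] fluid_step by auto

lemma fluid_co:
  assumes "j \<le> k"
  shows "(\<And>l. j < l \<Longrightarrow> l \<le> k \<Longrightarrow> fluid x l \<bullet> n i \<noteq> 0) \<Longrightarrow> co i (fluid x k - fluid x j) \<le> - \<beta> * (k - j)"
  using assms
proof (induction k)
  case (Suc k)
  show ?case
  proof (cases "j = Suc k")
    case False
    then have jk: "j \<le> k" using Suc by simp
    have "co i (pr (fluid x k + b) - (fluid x k + b)) = 0"
      using Suc.prems(1)[of "Suc k"] jk by (intro pr_co_zero) (auto simp: fluid_Suc)
    moreover have "fluid x (Suc k) - fluid x j = (pr (fluid x k + b) - (fluid x k + b)) + b + (fluid x k - fluid x j)"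
      by (simp add: fluid_Suc)
    ultimately have "co i (fluid x (Suc k) - fluid x j) = co i b + co i (fluid x k - fluid x j)"
      by (simp only: co_add)
    also have "\<dots> \<le> - \<beta> + - \<beta> * (k - j)" using Suc jk \<beta>(2)[of i] by (intro add_mono Suc.IH) auto
    finally show ?thesis using jk by (simp add: algebra_simps of_nat_diff)
  qed simp
qed simp

text \<open>While face \<open>i\<close> is not visited, coordinate \<open>i\<close> falls at rate
  \<open>\<beta>\<close>, but its total change is at most \<open>2 * C * N x\<close>. So within a
  time proportional to \<open>N x\<close> all faces are visited, and the contraction applies with
  the positions at the last visits.\<close>

lemma fluid_contraction:
  obtains C where "C > 0"
    "\<And>x k. x \<in> polyhedron_G n \<Longrightarrow> C * N x < real k \<Longrightarrow> N (fluid x k) \<le> (1 - contr) * N x"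
proof -
  obtain C where C: "C > 0" "\<And>i v. \<bar>co i v\<bar> \<le> C * N v" using co_bound by blast
  show thesis
  proof (rule that[of "2 * C / \<beta>"])
    show "2 * C / \<beta> > 0" using C \<beta> by simp
    fix x k assume x: "x \<in> polyhedron_G n" and k: "2 * C / \<beta> * N x < real k"
    have "\<exists>l\<in>{0<..k}. fluid x l \<bullet> n i = 0" for i
    proof (rule ccontr)
      assume "\<not> ?thesis"
      then have "co i (fluid x k - fluid x 0) \<le> - \<beta> * (k - 0)" by (intro fluid_co) auto
      then have "\<beta> * real k \<le> C * N (fluid x k - x)" using C(2)[of i "fluid x k - x"] by simp
      also have "\<dots> \<le> C * (2 * N x)"
        using N_diff_le[of "fluid x k" x] fluid_decreasing[of 0 k x] C(1) by (intro mult_left_mono) auto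
      finally show False using k \<beta>(1) by (simp add: field_simps)
    qed
    then have ne: "{l \<in> {0<..k}. fluid x l \<bullet> n i = 0} \<noteq> {}" for i by blast
    define \<tau> where "\<tau> i = Max {l \<in> {0<..k}. fluid x l \<bullet> n i = 0}" for i
    have \<tau>: "\<tau> i \<le> k" "fluid x (\<tau> i) \<bullet> n i = 0" for i
      using Max_in[OF _ ne[of i]] by (auto simp: \<tau>_def)
    have \<tau>max: "fluid x l \<bullet> n i \<noteq> 0" if "\<tau> i < l" "l \<le> k" for l i
    proof
      assume "fluid x l \<bullet> n i = 0"
      then have "l \<le> \<tau> i" unfolding \<tau>_def using that by (intro Max_ge) auto
      with that show False by simp
    qed
    show "N (fluid x k) \<le> (1 - contr) * N x"
    proof (rule contr_contraction[of "\<lambda>i. fluid x (\<tau> i)" _ _ "\<lambda>i. real (\<tau> i)"])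
      show "N (fluid x (\<tau> i)) \<le> N x" for i using fluid_decreasing[of 0 "\<tau> i" x] by simp
      show "N (fluid x k) \<le> N x" using fluid_decreasing[of 0 k x] by simp
      show "fluid x (\<tau> i) \<bullet> n i = 0" for i by (rule \<tau>)
      fix i j assume "real (\<tau> j) \<le> real (\<tau> i)"
      then have "co j (fluid x k - fluid x (\<tau> i)) \<le> - \<beta> * (k - \<tau> i)"
        using \<tau>max by (intro fluid_co \<tau>) auto
      also have "\<dots> \<le> 0" using \<beta>(1) \<tau>(1)[of i] by (simp add: mult_nonneg_nonpos)
      finally have "co j (fluid x k - fluid x (\<tau> i)) \<le> 0" .
      moreover have "0 \<le> fluid x k \<bullet> n j" using fluid_in[OF x, of k] by (auto simp: polyhedron_G_def)
      ultimately show "co j (fluid x k - fluid x (\<tau> i)) * (fluid x k \<bullet> n j) \<le> 0" by (rule mult_nonpos_nonneg)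
    qed
  qed
qed

subsection \<open>The Lyapunov function\<close>

text \<open>\<open>lyap C x\<close> is comparable with the time at which the fluid started at \<open>x\<close> becomes small, but,
  unlike that time, it is Lipschitz by construction.\<close>

definition lyap :: "real \<Rightarrow> real^'n \<Rightarrow> real" where
  "lyap C x = (INF k. real k + C * N (fluid x k))"

lemma lyap_bdd: "0 \<le> C \<Longrightarrow> bdd_below (range (\<lambda>k. real k + C * N (fluid x k)))"
  by (intro bdd_belowI[of _ 0]) (auto simp: N_nonneg)

lemma lyap_le: "0 \<le> C \<Longrightarrow> lyap C x \<le> real k + C * N (fluid x k)"
  unfolding lyap_def by (intro cINF_lower lyap_bdd) auto

lemma lyap_nonneg: "0 \<le> C \<Longrightarrow> 0 \<le> lyap C x"
  unfolding lyap_def by (intro cINF_greatest) (auto simp: N_nonneg)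

lemma lyap_lipschitz: assumes "0 \<le> C" shows "lyap C x \<le> lyap C x' + C * N (x - x')"
proof -
  have "lyap C x - C * N (x - x') \<le> lyap C x'"
    unfolding lyap_def[of C x']
  proof (rule cINF_greatest)
    fix k
    have "N (fluid x k) \<le> N (fluid x' k) + N (x - x')"
      using N_triangle[of "fluid x k - fluid x' k" "fluid x' k"] fluid_nonexpansive[of x k x'] by simp
    from mult_left_mono[OF this assms] lyap_le[OF assms, of x k]
    show "lyap C x - C * N (x - x') \<le> real k + C * N (fluid x' k)" by (simp add: algebra_simps)
  qed simp
  then show ?thesis by simp
qed

text \<open>The fluid loses at most \<open>N b\<close> per step, so a large state cannot be drained
  quickly.\<close>

lemma lyap_coercive:
  assumes "x \<in> polyhedron_G n" "1 \<le> C * (N b + 1)" shows "N x \<le> (N b + 1) * lyap C x"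
proof -
  have C: "0 < C" using assms(2) N_nonneg[of b] by (smt (verit) mult_nonpos_nonneg)
  have dec: "N x \<le> N (fluid x k) + real k * (N b + 1)" for k
  proof (induction k)
    case (Suc k)
    have "N (fluid x k - fluid x (Suc k)) \<le> N (fluid x k - (fluid x k + b))"
      using pr_nonexpansive[of "fluid x k" "fluid x k + b"] pr_id[OF fluid_in[OF assms(1)], of k] by (simp add: fluid_Suc)
    then have "N (fluid x k) \<le> N (fluid x (Suc k)) + N b"
      using N_triangle[of "fluid x k - fluid x (Suc k)" "fluid x (Suc k)"] by simp
    with Suc show ?case by (simp add: algebra_simps)
  qed simp
  have "N x / (N b + 1) \<le> lyap C x"
    unfolding lyap_def
  proof (rule cINF_greatest)
    fix k
    have p: "0 < N b + 1" using N_nonneg[of b] by simp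
    have "N x / (N b + 1) \<le> real k + N (fluid x k) / (N b + 1)"
    proof -
      have "N x / (N b + 1) \<le> (N (fluid x k) + real k * (N b + 1)) / (N b + 1)"
        using dec[of k] p by (intro divide_right_mono) auto
      then show ?thesis using p by (simp add: add_divide_distrib)
    qed
    also have "N (fluid x k) / (N b + 1) \<le> C * N (fluid x k)"
    proof -
      have "N (fluid x k) * 1 \<le> N (fluid x k) * (C * (N b + 1))" by (intro mult_left_mono assms N_nonneg)
      then show ?thesis using p by (simp add: field_simps)
    qed
    finally show "N x / (N b + 1) \<le> real k + C * N (fluid x k)" by simp
  qed simp
  then show ?thesis using N_nonneg[of b] by (simp add: field_simps)
qed

text \<open>\<open>C\<close> is so large that at a point with \<open>N w > 1\<close> waiting for the
  next contraction pays: it takes at most \<open>(C2 + 1) * N w\<close> steps and gains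
  \<open>C * contr * N w\<close>. Hence in the infimum the index may be moved beyond the time
  considered, unless the fluid has become small before; that case is covered by the value
  \<open>C\<close> in the maximum.\<close>

lemma lyap_exists:
  obtains C where "0 < C" "1 \<le> C * (N b + 1)"
    "\<And>x k. x \<in> polyhedron_G n \<Longrightarrow> lyap C (fluid x k) \<le> max (lyap C x - real k) C"
proof -
  obtain C2 where C2: "C2 > 0"
    "\<And>x k. x \<in> polyhedron_G n \<Longrightarrow> C2 * N x < real k \<Longrightarrow> N (fluid x k) \<le> (1 - contr) * N x"
    using fluid_contraction by blast
  define C where "C = max ((C2 + 1) / contr) 1"
  have C: "0 < C" "1 \<le> C" "C2 + 1 \<le> C * contr"
  proof -
    show "0 < C" "1 \<le> C" by (simp_all add: C_def)
    have "(C2 + 1) / contr * contr \<le> C * contr" unfolding C_def using contr by (intro mult_right_mono) auto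
    then show "C2 + 1 \<le> C * contr" using contr by simp
  qed
  show thesis
  proof (rule that[of C])
    show "0 < C" by (rule C)
    show "1 \<le> C * (N b + 1)" using C N_nonneg[of b] by (simp add: distrib_left add_increasing)
    fix x T assume x: "x \<in> polyhedron_G n"
    have main: "lyap C (fluid x T) \<le> max (real k + C * N (fluid x k) - real T) C" for k
    proof (induction "T - k" arbitrary: k rule: less_induct)
      case less
      show ?case
      proof (cases "T \<le> k")
        case True
        then have "lyap C (fluid x T) \<le> real (k - T) + C * N (fluid (fluid x T) (k - T))"
          using C by (intro lyap_le) simp
        then show ?thesis using True fluid_add[of x T "k - T"] by (simp add: of_nat_diff)
      next
        case False
        define w where "w = fluid x k"
        show ?thesis
        proof (cases "N w \<le> 1")
          case True
          have "lyap C (fluid x T) \<le> C * N (fluid x T)" using lyap_le[of C "fluid x T" 0] C by simp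
          also have "\<dots> \<le> C * 1" using fluid_decreasing[of k T x] False True C
            by (intro mult_left_mono) (auto simp: w_def)
          finally show ?thesis by simp
        next
          case w1: False
          define j where "j = Suc (nat \<lfloor>C2 * N w\<rfloor>)"
          have "0 \<le> C2 * N w" using C2 N_nonneg by simp
          then have j: "C2 * N w < real j" "real j \<le> C2 * N w + 1" unfolding j_def by linarith+
          have "N (fluid x (k + j)) \<le> (1 - contr) * N w"
            unfolding fluid_add w_def[symmetric] using j by (intro C2) (auto simp: w_def fluid_in x)
          then have "C * N (fluid x (k + j)) \<le> C * ((1 - contr) * N w)" using C by (intro mult_left_mono) auto
          moreover have "real j \<le> (C2 + 1) * N w" using j w1 by (simp add: algebra_simps)
          moreover have "(C2 + 1) * N w \<le> C * contr * N w" using C N_nonneg by (intro mult_right_mono) auto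
          ultimately have "real (k + j) + C * N (fluid x (k + j)) \<le> real k + C * N w"
            by (simp add: algebra_simps)
          moreover have "lyap C (fluid x T) \<le> max (real (k + j) + C * N (fluid x (k + j)) - real T) C"
            using False by (intro less) (auto simp: j_def)
          ultimately show ?thesis by (simp add: w_def)
        qed
      qed
    qed
    show "lyap C (fluid x T) \<le> max (lyap C x - real T) C"
    proof (cases "lyap C (fluid x T) \<le> C")
      case False
      have "lyap C (fluid x T) + real T \<le> lyap C x"
        unfolding lyap_def[of C x]
      proof (rule cINF_greatest)
        fix k show "lyap C (fluid x T) + real T \<le> real k + C * N (fluid x k)" using main[of k] False by linarith
      qed simp
      then show ?thesis by simp
    qed simp
  qed
qed

subsection \<open>Bounds in terms of the driving path\<close>

definition driver :: "real^'n \<Rightarrow> (real \<Rightarrow> real^'n) \<Rightarrow> real \<Rightarrow> real^'n" where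
  "driver x w t = x + t *\<^sub>R b + sig *v w t"

definition ddriver :: "(real \<Rightarrow> real^'n) \<Rightarrow> (real \<Rightarrow> real^'n) \<Rightarrow> real \<Rightarrow> real^'n" where
  "ddriver w y t = t *\<^sub>R b' + sig' *v w t + R' *v (matrix_inv (refl_matrix (\<lambda>i _. d i) 0) *v y t)"

definition driven :: "real^'n \<Rightarrow> (real \<Rightarrow> real^'n) \<Rightarrow> (real \<Rightarrow> real^'n) \<Rightarrow> (real \<Rightarrow> real^'n) \<Rightarrow> nat \<Rightarrow> real \<Rightarrow> bool" where
  "driven x w z y T S \<longleftrightarrow> skorokhod_path (driver x w) z y \<and> x \<in> polyhedron_G n \<and> w 0 = 0 \<and>
    (\<forall>s. 0 \<le> s \<and> s \<le> real T \<longrightarrow> norm (w s) \<le> S)"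

lemma matrix_norm_bound: obtains K where "0 < K" "\<And>v. norm (A *v (v :: real^'n)) \<le> K * norm v"
  using bounded_linear.pos_bounded[OF matrix_vector_mul_bounded_linear, of A] by (metis mult.commute)

text \<open>The constant depends neither on the horizon nor on the initial state: the drivers of
  path and fluid differ by at most \<open>norm b + K * S\<close>, the first term coming from the
  unit time step, and \<open>scheme_close\<close> does not accumulate errors.\<close>

lemma path_close:
  obtains C where "0 < C"
    "\<And>x w z y T S. driven x w z y T S \<Longrightarrow>
       N (z (real T) - fluid x T) \<le> C * (1 + S)"
proof -
  obtain K where K: "0 < K" "\<And>v. norm (sig *v v) \<le> K * norm v" using matrix_norm_bound[of sig] by blast
  obtain C where C: "C > 0" "\<And>z. N z \<le> C * norm z" using N_equiv by metis
  define C1 where "C1 = (norm b + 1) / \<theta> + K / \<theta> + C * K"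
  show thesis
  proof (rule that[of C1])
    show "0 < C1" unfolding C1_def using K C \<theta>_pos by (intro add_pos_pos divide_pos_pos add_nonneg_pos) auto
    fix x w z y T S
    assume dr: "driven x w z y T S"
    from dr have z: "skorokhod_path (driver x w) z y" and x: "x \<in> polyhedron_G n" and w0: "w 0 = 0"
      and w: "\<And>s. 0 \<le> s \<Longrightarrow> s \<le> real T \<Longrightarrow> norm (w s) \<le> S" by (auto simp: driven_def)
    have S: "0 \<le> S" using w[of 0] w0 by simp
    define \<eta> where "\<eta> = norm b + K * S"
    have \<eta>0: "0 \<le> \<eta>" using K S by (simp add: \<eta>_def)
    have sum_b: "(\<Sum>j<k. b) = real k *\<^sub>R b" for k :: nat by (simp only: sum_constant_scaleR card_lessThan)
    have bnd: "\<bar>(driver x w t - (x + (\<Sum>j<k. b))) \<bullet> n i\<bar> \<le> \<eta>"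
      if "0 \<le> t" "t \<le> real T" "\<bar>t - real k\<bar> \<le> 1" for t i and k :: nat
    proof -
      have eq: "driver x w t - (x + (\<Sum>j<k. b)) = (t - real k) *\<^sub>R b + sig *v w t"
        unfolding sum_b by (simp add: driver_def algebra_simps)
      have "\<bar>(driver x w t - (x + (\<Sum>j<k. b))) \<bullet> n i\<bar> \<le> norm (driver x w t - (x + (\<Sum>j<k. b)))"
        using Cauchy_Schwarz_ineq2[of _ "n i"] norm_n[of i] by (metis mult.right_neutral)
      also have "\<dots> \<le> \<bar>t - real k\<bar> * norm b + norm (sig *v w t)" unfolding eq by (metis norm_scaleR norm_triangle_ineq)
      also have "\<dots> \<le> 1 * norm b + K * S"
        using that w[of t] K by (intro add_mono mult_right_mono order_trans[OF K(2)] mult_left_mono) auto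
      finally show ?thesis by (simp add: \<eta>_def)
    qed
    have "N (y (real T * 1) - (scheme x (\<lambda>_. b) T - (x + (\<Sum>j<T. b)))) \<le> (\<eta> + 1) / \<theta>"
    proof (rule scheme_close[OF z x, where K = T and \<eta> = \<eta>])
      show "\<eta> < \<theta> * ((\<eta> + 1) / \<theta>)" "0 \<le> (\<eta> + 1) / \<theta>" using \<theta>_pos \<eta>0 by auto
      show "\<bar>(driver x w (real k * 1) - (x + (\<Sum>j<k. b))) \<bullet> n i\<bar> \<le> \<eta>" if "k \<le> T" for k i
        using that by (intro bnd) auto
      show "\<bar>(driver x w t - (x + (\<Sum>j<k. b))) \<bullet> n i\<bar> \<le> \<eta>"
        if "k < T" "real k * 1 \<le> t" "t \<le> real (Suc k) * 1" for k t i
        using that by (intro bnd) auto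
    qed simp_all
    then have 1: "N (y (real T) - (fluid x T - x - real T *\<^sub>R b)) \<le> (\<eta> + 1) / \<theta>"
      unfolding sum_b by (simp add: fluid_def algebra_simps)
    have eq: "z (real T) - fluid x T = (y (real T) - (fluid x T - x - real T *\<^sub>R b)) + sig *v w (real T)"
      using skorokhod_pathD(5)[OF z, of "real T"] by (simp add: driver_def)
    have "N (z (real T) - fluid x T) \<le> (\<eta> + 1) / \<theta> + N (sig *v w (real T))"
      unfolding eq using N_triangle[of "y (real T) - (fluid x T - x - real T *\<^sub>R b)" "sig *v w (real T)"] 1 by linarith
    also have "N (sig *v w (real T)) \<le> C * (K * S)"
      using w[of "real T"] K C by (intro order_trans[OF C(2)] mult_left_mono order_trans[OF K(2)]) auto
    also have "(\<eta> + 1) / \<theta> + C * (K * S) = (norm b + 1) / \<theta> + (K / \<theta> + C * K) * S"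
      by (simp add: \<eta>_def add_divide_distrib algebra_simps)
    also have "\<dots> \<le> C1 + C1 * S"
      unfolding C1_def using K C S \<theta>_pos by (intro add_mono mult_right_mono) auto
    finally show "N (z (real T) - fluid x T) \<le> C1 * (1 + S)" by (simp add: algebra_simps)
  qed
qed

lemma push_final:
  assumes z: "skorokhod_path (driver x w) z y"
  shows "y (real T) = z (real T) - x - real T *\<^sub>R b - sig *v w (real T)"
  using skorokhod_pathD(5)[OF z, of "real T"] by (simp add: driver_def)

text \<open>Without a visit to face \<open>i\<close>, coordinate \<open>i\<close> of the path
  follows the drift, which moves it by at least \<open>\<beta> * real T\<close>. But the path stays
  near the fluid, which does not grow in \<open>N\<close>.\<close>

lemma hit_faces:
  obtains C where "0 < C"
    "\<And>x w z y T S i. driven x w z y T S \<Longrightarrow> C * (1 + N x + S) < \<beta> * real T \<Longrightarrow>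
       \<exists>u\<in>{0..real T}. z u \<bullet> n i = 0"
proof -
  obtain K where K: "0 < K" "\<And>v. norm (sig *v v) \<le> K * norm v" using matrix_norm_bound[of sig] by blast
  obtain C where C: "C > 0" "\<And>z. N z \<le> C * norm z" using N_equiv by metis
  obtain Cc where Cc: "Cc > 0" "\<And>i v. \<bar>co i v\<bar> \<le> Cc * N v" using co_bound by blast
  obtain C1 where C1: "0 < C1"
    "\<And>x w z y T S. driven x w z y T S \<Longrightarrow>
       N (z (real T) - fluid x T) \<le> C1 * (1 + S)" using path_close by metis
  show thesis
  proof (rule that[of "Cc * (C1 + C * K + 2)"])
    show "0 < Cc * (C1 + C * K + 2)" using Cc C1 C K by (simp add: add_pos_pos)
    fix x w z y T S i
    assume dr: "driven x w z y T S" and T: "Cc * (C1 + C * K + 2) * (1 + N x + S) < \<beta> * real T"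
    from dr have z: "skorokhod_path (driver x w) z y" and x: "x \<in> polyhedron_G n" and w0: "w 0 = 0"
      and w: "\<And>s. 0 \<le> s \<Longrightarrow> s \<le> real T \<Longrightarrow> norm (w s) \<le> S" by (auto simp: driven_def)
    have S: "0 \<le> S" using w[of 0] w0 by simp
    show "\<exists>u\<in>{0..real T}. z u \<bullet> n i = 0"
    proof (rule ccontr)
      assume a: "\<not> ?thesis"
      have "co i (y (real T) - y 0) = 0" by (rule push_const[OF z]) (use a in auto)
      then have "co i (y (real T)) = 0" using skorokhod_pathD(3)[OF z] by simp
      then have "- co i b * real T = - co i (z (real T) - x - sig *v w (real T))"
        unfolding push_final[OF z] co_diff co_scale by algebra
      also have "\<dots> \<le> Cc * N (z (real T) - x - sig *v w (real T))" using Cc(2) abs_le_D2 by blast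
      also have "\<dots> \<le> Cc * ((C1 + C * K + 2) * (1 + N x + S))"
      proof (rule mult_left_mono)
        have "N (z (real T) - x - sig *v w (real T)) \<le> N (z (real T) - x) + N (sig *v w (real T))" by (rule N_diff_le)
        also have "N (sig *v w (real T)) \<le> C * (K * S)"
          using w[of "real T"] K C by (intro order_trans[OF C(2)] mult_left_mono order_trans[OF K(2)]) auto
        also have "N (z (real T) - x) \<le> N (z (real T) - fluid x T) + N (fluid x T - x)" by (rule N_triangle_diff)
        also have "N (z (real T) - fluid x T) \<le> C1 * (1 + S)" by (rule C1(2)[OF dr])
        also have "N (fluid x T - x) \<le> 2 * N x" using N_diff_le[of "fluid x T" x] fluid_decreasing[of 0 T x] by simp
        finally have "N (z (real T) - x - sig *v w (real T)) \<le> C1 * (1 + S) + 2 * N x + C * (K * S)" by simp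
        also have "\<dots> \<le> (C1 + C * K + 2) * (1 + N x + S)"
        proof -
          have "0 \<le> (C1 + C * K) * N x" "0 \<le> C * K" "0 \<le> S * 2" using C1 C K N_nonneg[of x] S by auto
          then show ?thesis by (simp add: algebra_simps)
        qed
        finally show "N (z (real T) - x - sig *v w (real T)) \<le> (C1 + C * K + 2) * (1 + N x + S)" .
      qed (use Cc in simp)
      also have "\<dots> < \<beta> * real T" using T by (simp add: mult.assoc)
      also have "\<dots> \<le> - co i b * real T" using \<beta>(2)[of i] by (intro mult_right_mono) auto
      finally show False by simp
    qed
  qed
qed

text \<open>The local times are nondecreasing, so on the whole interval they are controlled by the
  final push, and this by the equation for \<open>z\<close>. The driver of the derivative is then
  bounded and \<open>derivative_bound\<close> applies.\<close>

lemma path_bound: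
  obtains C where "0 < C"
    "\<And>x w z y T S \<phi>. driven x w z y T S \<Longrightarrow> continuous_on {0..} w \<Longrightarrow> derivative_path z (ddriver w y) \<phi> \<Longrightarrow>
       N (z (real T) - x) + N (\<phi> (real T)) \<le> N (\<phi> 0) + C * (1 + real T + N x + S)"
proof -
  let ?Ri = "matrix_inv (refl_matrix (\<lambda>i _. d i) 0)"
  obtain K where K: "0 < K" "\<And>v. norm (sig *v v) \<le> K * norm v" using matrix_norm_bound[of sig] by blast
  obtain K' where K': "0 < K'" "\<And>v. norm (sig' *v v) \<le> K' * norm v" using matrix_norm_bound[of sig'] by blast
  obtain K2 where K2: "0 < K2" "\<And>v. norm (R' *v v) \<le> K2 * norm v" using matrix_norm_bound[of R'] by blast
  obtain C where C: "C > 0" "\<And>z. N z \<le> C * norm z" using N_equiv by metis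
  obtain Cc where Cc: "Cc > 0" "\<And>i v. \<bar>co i v\<bar> \<le> Cc * N v" using co_bound by blast
  obtain C1 where C1: "0 < C1"
    "\<And>x w z y T S. driven x w z y T S \<Longrightarrow>
       N (z (real T) - fluid x T) \<le> C1 * (1 + S)" using path_close by metis
  define A where "A = C1 + C * K + 2 + N b"
  define J where "J = real CARD('n)"
  have A: "0 < A" using C1 C K N_nonneg[of b] by (simp add: A_def add_pos_pos add_pos_nonneg)
  define A2 where "A2 = norm b' + K' + K2 * (J * (Cc * A))"
  have A2: "0 \<le> A2" using A K' K2 Cc by (simp add: A2_def J_def)
  define A3 where "A3 = A + A2 / \<theta> + 1 + C * A2"
  have A3: "0 < A3" using A A2 \<theta>_pos C by (simp add: A3_def add_pos_nonneg)
  show thesis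
  proof (rule that[OF A3])
    fix x w z y T S \<phi>
    assume dr: "driven x w z y T S" and wc: "continuous_on {0..} w" and \<phi>: "derivative_path z (ddriver w y) \<phi>"
    from dr have z: "skorokhod_path (driver x w) z y" and x: "x \<in> polyhedron_G n" and w0: "w 0 = 0"
      and w: "\<And>s. 0 \<le> s \<Longrightarrow> s \<le> real T \<Longrightarrow> norm (w s) \<le> S" by (auto simp: driven_def)
    have S: "0 \<le> S" using w[of 0] w0 by simp
    define Q where "Q = 1 + real T + N x + S"
    have Q: "1 \<le> Q" "S \<le> Q" "real T \<le> Q" "N x \<le> Q" "1 + S \<le> Q" using S N_nonneg[of x] by (auto simp: Q_def)
    have zx: "N (z (real T) - x) \<le> C1 * Q + 2 * Q"
    proof -
      have "N (z (real T) - x) \<le> N (z (real T) - fluid x T) + N (fluid x T - x)" by (rule N_triangle_diff)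
      also have "N (z (real T) - fluid x T) \<le> C1 * (1 + S)" by (rule C1(2)[OF dr])
      also have "N (fluid x T - x) \<le> 2 * N x" using N_diff_le[of "fluid x T" x] fluid_decreasing[of 0 T x] by simp
      also have "C1 * (1 + S) + 2 * N x \<le> C1 * Q + 2 * Q" using C1 Q by (intro add_mono mult_left_mono) auto
      finally show ?thesis by simp
    qed
    have yT: "N (y (real T)) \<le> A * Q"
    proof -
      have "N (y (real T)) \<le> N (z (real T) - x - real T *\<^sub>R b) + N (sig *v w (real T))"
        unfolding push_final[OF z] by (rule N_diff_le)
      also have "N (z (real T) - x - real T *\<^sub>R b) \<le> N (z (real T) - x) + N (real T *\<^sub>R b)" by (rule N_diff_le)
      also have "N (real T *\<^sub>R b) = real T * N b" by (rule N_scale) simp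
      also have "real T * N b \<le> Q * N b" using Q N_nonneg by (intro mult_right_mono) auto
      also have "N (sig *v w (real T)) \<le> C * (K * Q)"
        using w[of "real T"] K C Q by (intro order_trans[OF C(2)] mult_left_mono order_trans[OF K(2)]) auto
      finally have "N (y (real T)) \<le> C1 * Q + 2 * Q + Q * N b + C * (K * Q)" using zx by simp
      then show ?thesis by (simp add: A_def algebra_simps)
    qed
    have Riy: "norm (?Ri *v y s) \<le> J * (Cc * A) * Q" if "0 \<le> s" "s \<le> real T" for s
    proof -
      have "\<bar>(?Ri *v y s) $ i\<bar> \<le> Cc * (A * Q)" for i
      proof -
        have "0 \<le> co i (y s)" using push_mono[OF z, of 0 s i] that skorokhod_pathD(3)[OF z] by simp
        moreover have "co i (y s) \<le> co i (y (real T))" using push_mono[OF z, of s "real T" i] that by (simp add: co_diff)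
        ultimately have "\<bar>co i (y s)\<bar> \<le> Cc * N (y (real T))" using Cc(2)[of i "y (real T)"] by simp
        also have "\<dots> \<le> Cc * (A * Q)" using yT Cc by (intro mult_left_mono) auto
        finally show ?thesis by (simp add: co_def)
      qed
      then have "(\<Sum>i\<in>UNIV. \<bar>(?Ri *v y s) $ i\<bar>) \<le> J * (Cc * (A * Q))"
        unfolding J_def by (rule sum_bounded_above[of UNIV, simplified])
      then show ?thesis using norm_le_l1_cart[of "?Ri *v y s"] by (simp add: mult.assoc)
    qed
    have h0: "ddriver w y 0 = 0" by (simp add: ddriver_def w0 skorokhod_pathD(3)[OF z])
    have hb: "norm (ddriver w y s) \<le> A2 * Q" if s: "0 \<le> s" "s \<le> real T" for s
    proof -
      have "norm (ddriver w y s) \<le> norm (s *\<^sub>R b' + sig' *v w s) + norm (R' *v (?Ri *v y s))"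
        unfolding ddriver_def by (rule norm_triangle_ineq)
      also have "norm (s *\<^sub>R b' + sig' *v w s) \<le> norm (s *\<^sub>R b') + norm (sig' *v w s)" by (rule norm_triangle_ineq)
      also have "norm (s *\<^sub>R b') \<le> Q * norm b'" using s Q by (auto intro!: mult_right_mono)
      also have "norm (sig' *v w s) \<le> K' * Q"
        using w[OF s] Q K' by (intro order_trans[OF K'(2)] mult_left_mono) auto
      also have "norm (R' *v (?Ri *v y s)) \<le> K2 * (J * (Cc * A) * Q)"
        using Riy[OF s] K2 by (intro order_trans[OF K2(2)] mult_left_mono) auto
      finally show ?thesis by (simp add: A2_def algebra_simps)
    qed
    have hc: "continuous_on {0..} (ddriver w y)" unfolding ddriver_def
      by (intro continuous_intros wc skorokhod_pathD(2)[OF z]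
          bounded_linear.continuous_on[OF matrix_vector_mul_bounded_linear])
    have "N (\<phi> (real T)) \<le> N (\<phi> 0) + A2 * Q / \<theta> + 1 + N (ddriver w y (real T) - ddriver w y 0)"
      using hb h0 by (intro derivative_bound[OF skorokhod_pathD(1)[OF z] skorokhod_pathD(4)[OF z] \<phi> hc]) auto
    also have "N (ddriver w y (real T) - ddriver w y 0) \<le> C * (A2 * Q)"
      using hb[of "real T"] C h0 by (intro order_trans[OF C(2)] mult_left_mono) auto
    finally have "N (z (real T) - x) + N (\<phi> (real T)) \<le> C1 * Q + 2 * Q + (N (\<phi> 0) + A2 * Q / \<theta> + Q + C * (A2 * Q))"
      using zx Q by linarith
    also have "\<dots> = N (\<phi> 0) + (C1 + 2 + A2 / \<theta> + 1 + C * A2) * Q" by (simp add: algebra_simps)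
    also have "\<dots> \<le> N (\<phi> 0) + A3 * Q"
      unfolding A3_def A_def using C K N_nonneg[of b] Q by (intro add_left_mono mult_right_mono) auto
    finally show "N (z (real T) - x) + N (\<phi> (real T)) \<le> N (\<phi> 0) + A3 * (1 + real T + N x + S)" by (simp add: Q_def)
  qed
qed

end

context rbm_data
begin

subsection \<open>Measurable representation of the joint process\<close>

text \<open>In the following \<open>g (m, k)\<close> stands for the value of the driving path at the time
  \<open>t * k / 2 ^ m\<close>. The guards in \<open>zstep\<close> and \<open>dstep\<close> only serve to make the representation take its values
  in \<open>joint_space n\<close> for every \<open>g\<close>, including those that come from no path.\<close>

definition zapprox :: "real \<Rightarrow> real^'n \<Rightarrow> (nat \<times> nat \<Rightarrow> real^'n) \<Rightarrow> nat \<Rightarrow> nat \<Rightarrow> real^'n" where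
  "zapprox t x g m k = scheme x (\<lambda>j. (t / 2 ^ m) *\<^sub>R b + sig *v (g (m, Suc j) - g (m, j))) k"

text \<open>The grid time with index \<open>k\<close> at level \<open>m\<close> has index
  \<open>k * 2 ^ M\<close> at level \<open>m + M\<close>; the scheme is refined while the time stays
  fixed.\<close>

definition zrep :: "real \<Rightarrow> real^'n \<Rightarrow> (nat \<times> nat \<Rightarrow> real^'n) \<Rightarrow> nat \<Rightarrow> nat \<Rightarrow> real^'n" where
  "zrep t x g m k = lim (\<lambda>M. zapprox t x g (m + M) (k * 2 ^ M))"

text \<open>By compactness the path meets face \<open>i\<close> during the interval iff its normal
  component comes arbitrarily close to 0 there; at dyadic points this is a countable
  condition.\<close>

definition hrep :: "real \<Rightarrow> real^'n \<Rightarrow> (nat \<times> nat \<Rightarrow> real^'n) \<Rightarrow> nat \<Rightarrow> nat \<Rightarrow> 'n set" where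
  "hrep t x g m k = {i. \<forall>p. \<exists>M. \<exists>j\<le>2 ^ M. zrep t x g (m + M) (k * 2 ^ M + j) \<bullet> n i < 1 / real (Suc p)}"

text \<open>The push is recovered from the equation of the reflected path, so only
  \<open>zrep\<close> and \<open>g\<close> enter.\<close>

definition ddrep :: "real \<Rightarrow> real^'n \<Rightarrow> (nat \<times> nat \<Rightarrow> real^'n) \<Rightarrow> nat \<Rightarrow> nat \<Rightarrow> real^'n" where
  "ddrep t x g m k = (t * real k / 2 ^ m) *\<^sub>R b' + sig' *v g (m, k) +
     R' *v (matrix_inv (refl_matrix (\<lambda>i _. d i) 0) *v
       (zrep t x g m k - x - (t * real k / 2 ^ m) *\<^sub>R b - sig *v g (m, k)))"

definition drep :: "real \<Rightarrow> real^'n \<Rightarrow> real^'n \<Rightarrow> (nat \<times> nat \<Rightarrow> real^'n) \<Rightarrow> real^'n" where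
  "drep t x y g = lim (\<lambda>m. dscheme y (hrep t x g m) (\<lambda>k. ddrep t x g m (Suc k) - ddrep t x g m k) (2 ^ m))"

definition grid :: "(real \<Rightarrow> real^'n) \<Rightarrow> real \<Rightarrow> nat \<times> nat \<Rightarrow> real^'n" where
  "grid w t = (\<lambda>(m, k). w (t * real k / 2 ^ m))"

lemma step_tendsto: "(\<lambda>M. t / 2 ^ (m + M)) \<longlonglongrightarrow> (0::real)"
proof -
  have "(\<lambda>M. (t / 2 ^ m) * (1 / 2) ^ M) \<longlonglongrightarrow> (t / 2 ^ m) * 0"
    by (intro tendsto_intros LIMSEQ_realpow_zero) auto
  then show ?thesis by (simp add: power_add power_one_over field_simps)
qed

lemma zrep:
  assumes z: "skorokhod_path (driver x w) z y" and w: "continuous_on {0..} w" "w 0 = 0" and t: "0 \<le> t"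
  shows "zrep t x (grid w t) m k = z (t * real k / 2 ^ m)"
proof -
  have cont: "continuous_on {0..} (driver x w)" unfolding driver_def
    by (intro continuous_intros w bounded_linear.continuous_on[OF matrix_vector_mul_bounded_linear])
  have d0: "driver x w 0 = x" by (simp add: driver_def w)
  have "(\<lambda>M. scheme (driver x w 0) (\<lambda>j. driver x w (real (Suc j) * (t / 2 ^ (m + M))) - driver x w (real j * (t / 2 ^ (m + M)))) (k * 2 ^ M))
     \<longlonglongrightarrow> z (t * real k / 2 ^ m)"
  proof (rule scheme_limit[OF z cont])
    show "real (k * 2 ^ M) * (t / 2 ^ (m + M)) = t * real k / 2 ^ m" for M by (simp add: power_add)
  qed (use t step_tendsto in auto)
  also have "(\<lambda>M. scheme (driver x w 0) (\<lambda>j. driver x w (real (Suc j) * (t / 2 ^ (m + M))) - driver x w (real j * (t / 2 ^ (m + M)))) (k * 2 ^ M))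
    = (\<lambda>M. zapprox t x (grid w t) (m + M) (k * 2 ^ M))"
    unfolding zapprox_def d0
    by (intro ext arg_cong[where f="\<lambda>f. scheme x f _"])
      (simp add: driver_def grid_def algebra_simps matrix_vector_mult_diff_distrib add_divide_distrib)
  finally show ?thesis unfolding zrep_def by (rule limI)
qed

lemma hrep:
  assumes z: "skorokhod_path (driver x w) z y" and w: "continuous_on {0..} w" "w 0 = 0" and t: "0 < t"
  shows "hrep t x (grid w t) m k = hits z {real k * (t / 2 ^ m)..real (Suc k) * (t / 2 ^ m)}"
proof (intro set_eqI iffI)
  define h where "h = t / 2 ^ m"
  have h: "0 < h" using t by (simp add: h_def)
  let ?I = "{real k * h..real (Suc k) * h}"
  have I0: "u \<in> ?I \<Longrightarrow> 0 \<le> u" for u using h by (auto intro: order_trans[rotated])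
  have pt: "t * real (k * 2 ^ M + j) / 2 ^ (m + M) = real k * h + real j * (h / 2 ^ M)" for M j
    by (simp add: h_def power_add field_simps)
  have contn: "continuous_on ?I (\<lambda>u. z u \<bullet> n i)" for i
    using I0 by (intro continuous_intros continuous_on_subset[OF skorokhod_pathD(1)[OF z]]) auto
  note zr = zrep[OF z w less_imp_le[OF t]]
  fix i
  show "i \<in> hits z {real k * (t / 2 ^ m)..real (Suc k) * (t / 2 ^ m)}" if i: "i \<in> hrep t x (grid w t) m k"
  proof -
    obtain u where u: "u \<in> ?I" "\<And>v. v \<in> ?I \<Longrightarrow> z u \<bullet> n i \<le> z v \<bullet> n i"
      using continuous_attains_inf[OF _ _ contn, of i] h by force
    have "z u \<bullet> n i \<le> 1 / real (Suc p)" for p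
    proof -
      obtain M j where Mj: "j \<le> 2 ^ M" "z (real k * h + real j * (h / 2 ^ M)) \<bullet> n i < 1 / real (Suc p)"
        using i unfolding hrep_def zr pt by blast
      have "real j * (h / 2 ^ M) \<le> real (2 ^ M) * (h / 2 ^ M)" using Mj(1) h by (intro mult_right_mono of_nat_mono) auto
      then have "real k * h + real j * (h / 2 ^ M) \<in> ?I" using h by (auto simp: algebra_simps)
      with u(2) Mj(2) show ?thesis by fastforce
    qed
    then have "z u \<bullet> n i \<le> 0"
      using LIMSEQ_le_const[OF LIMSEQ_inverse_real_of_nat, of "z u \<bullet> n i"] by (simp add: inverse_eq_divide)
    then have "z u \<bullet> n i = 0" using skorokhod_pathD(6)[OF z I0[OF u(1)], of i] by simp
    then have "i \<in> active n (z u)" using active_iff skorokhod_pathD(4)[OF z I0[OF u(1)]] by blast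
    then show ?thesis using u(1) by (auto simp: hits_def h_def)
  qed
  show "i \<in> hrep t x (grid w t) m k" if i: "i \<in> hits z {real k * (t / 2 ^ m)..real (Suc k) * (t / 2 ^ m)}"
  proof -
    obtain u where u: "u \<in> ?I" "i \<in> active n (z u)" using i by (auto simp: hits_def h_def)
    then have zu: "z u \<bullet> n i = 0" using active_iff skorokhod_pathD(4)[OF z I0[OF u(1)]] by blast
    show ?thesis unfolding hrep_def zr pt
    proof safe
      fix p
      have "((\<lambda>v. z v \<bullet> n i) \<longlongrightarrow> z u \<bullet> n i) (at u within ?I)" using contn u(1) by (auto simp: continuous_on_def)
      then have "\<forall>\<^sub>F v in at u within ?I. z v \<bullet> n i < 1 / real (Suc p)"
        using zu by (intro order_tendstoD(2)) auto
      then obtain e where e: "e > 0" "\<And>v. v \<in> ?I \<Longrightarrow> v \<noteq> u \<Longrightarrow> dist v u < e \<Longrightarrow> z v \<bullet> n i < 1 / real (Suc p)"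
        unfolding eventually_at by metis
      then have e': "z v \<bullet> n i < 1 / real (Suc p)" if "v \<in> ?I" "dist v u < e" for v
        using that zu by (cases "v = u") auto
      obtain M where M: "h / 2 ^ M < e"
        using order_tendstoD(2)[OF step_tendsto[of h 0] e(1)] unfolding eventually_sequentially by auto
      define j where "j = nat \<lfloor>(u - real k * h) / (h / 2 ^ M)\<rfloor>"
      have q0: "0 \<le> (u - real k * h) / (h / 2 ^ M)" using u(1) h by simp
      then have j: "real j \<le> (u - real k * h) / (h / 2 ^ M)" "(u - real k * h) / (h / 2 ^ M) < real j + 1"
        unfolding j_def by linarith+
      have hM: "0 < h / 2 ^ M" using h by simp
      have j1: "real j * (h / 2 ^ M) \<le> u - real k * h" using j(1) hM by (simp only: pos_le_divide_eq)
      have j2: "u - real k * h < (real j + 1) * (h / 2 ^ M)" using j(2) hM by (simp only: pos_divide_less_eq)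
      have "real j \<le> 2 ^ M"
      proof -
        have "real j * (h / 2 ^ M) \<le> h" using j1 u(1) by (simp add: algebra_simps)
        then show ?thesis using h by (simp add: field_simps)
      qed
      then have jM: "j \<le> 2 ^ M" by (metis of_nat_le_iff of_nat_numeral of_nat_power)
      have "z (real k * h + real j * (h / 2 ^ M)) \<bullet> n i < 1 / real (Suc p)"
      proof (rule e')
        have "0 \<le> real j * (h / 2 ^ M)" by (rule mult_nonneg_nonneg[OF of_nat_0_le_iff less_imp_le[OF hM]])
        then show "real k * h + real j * (h / 2 ^ M) \<in> ?I" using j1 u(1) by auto
        show "dist (real k * h + real j * (h / 2 ^ M)) u < e"
          using j1 j2 M e(1) unfolding dist_real_def distrib_right mult_1 abs_less_iff
          by (intro conjI; linarith)
      qed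
      with jM show "\<exists>M. \<exists>j\<le>2 ^ M. z (real k * h + real j * (h / 2 ^ M)) \<bullet> n i < 1 / real (Suc p)" by blast
    qed
  qed
qed

lemma drep:
  assumes z: "skorokhod_path (driver x w) z y" and w: "continuous_on {0..} w" "w 0 = 0" and t: "0 < t"
    and \<phi>: "derivative_path z (ddriver w y) \<phi>"
  shows "drep t x (\<phi> 0) (grid w t) = \<phi> t"
proof -
  have dd: "ddrep t x (grid w t) m k = ddriver w y (real k * (t / 2 ^ m))" for m k
  proof -
    have time: "t * real k / 2 ^ m = real k * (t / 2 ^ m)" by simp
    have "z (real k * (t / 2 ^ m)) - x - (real k * (t / 2 ^ m)) *\<^sub>R b - sig *v w (real k * (t / 2 ^ m)) = y (real k * (t / 2 ^ m))"
      using skorokhod_pathD(5)[OF z, of "real k * (t / 2 ^ m)"] t by (simp add: driver_def)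
    then show ?thesis unfolding ddrep_def zrep[OF z w less_imp_le[OF t]] time by (simp add: ddriver_def grid_def time)
  qed
  have "(\<lambda>m. dscheme (\<phi> 0) (\<lambda>k. hits z {real k * (t / 2 ^ m)..real (Suc k) * (t / 2 ^ m)})
      (\<lambda>k. ddriver w y (real (Suc k) * (t / 2 ^ m)) - ddriver w y (real k * (t / 2 ^ m))) (2 ^ m)) \<longlonglongrightarrow> \<phi> t"
  proof (rule dscheme_limit[OF skorokhod_pathD(1)[OF z] skorokhod_pathD(4)[OF z] \<phi>])
    show "real (2 ^ m) * (t / 2 ^ m) = t" for m by simp
  qed (use t step_tendsto[of t 0] in auto)
  then show ?thesis unfolding drep_def dd hrep[OF z w t, abs_def] by (intro limI) simp
qed

section \<open>One time step as a map of the joint space\<close>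

lemma closed_tangent: "closed (tangent_H n x)"
proof -
  have "tangent_H n x = (\<Inter>i\<in>active n x. {y. n i \<bullet> y = 0})" by (auto simp: tangent_H_def inner_commute)
  then show ?thesis by (auto intro!: closed_INT simp: closed_hyperplane)
qed

lemma joint_iff: "(x, y) \<in> joint_space n \<longleftrightarrow> x \<in> polyhedron_G n \<and> (\<forall>i. x \<bullet> n i = 0 \<longrightarrow> y \<bullet> n i = 0)"
  by (auto simp: joint_space_def tangent_H_def active_iff)

definition zstep :: "real \<Rightarrow> real^'n \<Rightarrow> (nat \<times> nat \<Rightarrow> real^'n) \<Rightarrow> real^'n" where
  "zstep t x g = (if zrep t x g 0 1 \<in> polyhedron_G n then zrep t x g 0 1 else 0)"

definition dstep :: "real \<Rightarrow> real^'n \<Rightarrow> real^'n \<Rightarrow> (nat \<times> nat \<Rightarrow> real^'n) \<Rightarrow> real^'n" where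
  "dstep t x y g = (if (zstep t x g, drep t x y g) \<in> joint_space n then drep t x y g else 0)"

lemma zstep_in: "zstep t x g \<in> polyhedron_G n" by (simp add: zstep_def zero_polyhedron)

lemma step_in: "(zstep t x g, dstep t x y g) \<in> joint_space n"
  by (auto simp: dstep_def joint_iff zstep_in)

lemma zstep_eq:
  assumes "skorokhod_path (driver x w) z y" "continuous_on {0..} w" "w 0 = 0" "0 \<le> t"
  shows "zstep t x (grid w t) = z t"
  unfolding zstep_def zrep[OF assms] using skorokhod_pathD(4)[OF assms(1)] assms(4) by simp

lemma dstep_eq:
  assumes "skorokhod_path (driver x w) z y" "continuous_on {0..} w" "w 0 = 0" "0 < t"
    "derivative_path z (ddriver w y) \<phi>"
  shows "dstep t x (\<phi> 0) (grid w t) = \<phi> t"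
proof -
  have "(z t, \<phi> t) \<in> joint_space n"
    using assms skorokhod_pathD(4)[OF assms(1), of t] by (auto simp: joint_iff derivative_path_def active_iff)
  then show ?thesis unfolding dstep_def drep[OF assms] zstep_eq[OF assms(1-3) less_imp_le[OF assms(4)]] by simp
qed

section \<open>Measurability of the step in state and noise\<close>

lemma measurable_matrix_mult [measurable (raw)]:
  fixes A :: "real^'n^'n"
  shows "f \<in> borel_measurable P \<Longrightarrow> (\<lambda>x. A *v f x) \<in> borel_measurable P"
  by (rule borel_measurable_continuous_on[OF linear_continuous_on[OF matrix_vector_mul_bounded_linear]])

lemma measurable_pr [measurable (raw)]: "f \<in> borel_measurable P \<Longrightarrow> (\<lambda>x. pr (f x)) \<in> borel_measurable P"
  by (rule borel_measurable_continuous_on[OF continuous_pr])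

lemma measurable_oblique [measurable (raw)]: "f \<in> borel_measurable P \<Longrightarrow> (\<lambda>x. oblique I (f x)) \<in> borel_measurable P"
  by (rule borel_measurable_continuous_on[OF continuous_oblique])

lemma measurable_N [measurable (raw)]: "f \<in> borel_measurable P \<Longrightarrow> (\<lambda>x. N (f x)) \<in> borel_measurable P"
  by (rule borel_measurable_continuous_on[OF continuous_on_N[OF continuous_on_id]])

lemma polyhedron_borel [measurable]: "polyhedron_G n \<in> sets borel"
  by (rule borel_closed[OF closed_polyhedron])

lemma joint_borel [measurable]: "joint_space n \<in> sets borel"
proof -
  have [measurable]: "fst \<in> borel_measurable (borel :: ((real^'n) \<times> (real^'n)) measure)"
    "snd \<in> borel_measurable (borel :: ((real^'n) \<times> (real^'n)) measure)"
    by (auto intro!: borel_measurable_continuous_onI continuous_intros)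
  have "joint_space n = {p \<in> space borel. fst p \<in> polyhedron_G n \<and> (\<forall>i. fst p \<bullet> n i = 0 \<longrightarrow> snd p \<bullet> n i = 0)}"
    using joint_iff by (auto simp: set_eq_iff)
  also have "\<dots> \<in> sets borel" by measurable
  finally show ?thesis .
qed

context
  fixes P :: "'a measure" and X Y :: "'a \<Rightarrow> real^'n" and g :: "'a \<Rightarrow> nat \<times> nat \<Rightarrow> real^'n"
  assumes [measurable]: "X \<in> borel_measurable P" "Y \<in> borel_measurable P"
    and g[measurable]: "\<And>j. (\<lambda>\<omega>. g \<omega> j) \<in> borel_measurable P"
begin

lemma measurable_zapprox: "(\<lambda>\<omega>. zapprox t (X \<omega>) (g \<omega>) m k) \<in> borel_measurable P"
  unfolding zapprox_def by (induction k) auto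

lemma measurable_zrep: "(\<lambda>\<omega>. zrep t (X \<omega>) (g \<omega>) m k) \<in> borel_measurable P"
  unfolding zrep_def by (intro borel_measurable_lim_metric measurable_zapprox)

text \<open>There are finitely many face sets. A projection along a random face set is therefore
  measurable as soon as each level set of \<open>hrep\<close> is.\<close>

lemma measurable_hrep: "(\<lambda>\<omega>. hrep t (X \<omega>) (g \<omega>) m k) \<in> measurable P (count_space UNIV)"
proof -
  note measurable_zrep[measurable]
  have "{\<omega> \<in> space P. hrep t (X \<omega>) (g \<omega>) m k = A} \<in> sets P" for A
  proof -
    have "{\<omega> \<in> space P. hrep t (X \<omega>) (g \<omega>) m k = A} =
      {\<omega> \<in> space P. \<forall>i. i \<in> A \<longleftrightarrow> (\<forall>p. \<exists>M. \<exists>j\<in>{..2 ^ M}. zrep t (X \<omega>) (g \<omega>) (m + M) (k * 2 ^ M + j) \<bullet> n i < 1 / real (Suc p))}"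
      by (auto simp: hrep_def set_eq_iff Bex_def)
    also have "\<dots> \<in> sets P" by measurable
    finally show ?thesis .
  qed
  then show ?thesis
    by (subst measurable_count_space_eq2) (auto simp: vimage_def Int_def conj_commute)
qed

lemma measurable_drep: "(\<lambda>\<omega>. drep t (X \<omega>) (Y \<omega>) (g \<omega>)) \<in> borel_measurable P"
proof -
  note measurable_zrep[measurable] measurable_hrep[measurable]
  have dd[measurable]: "(\<lambda>\<omega>. ddrep t (X \<omega>) (g \<omega>) m k) \<in> borel_measurable P" for m k
    unfolding ddrep_def by measurable
  have "(\<lambda>\<omega>. dscheme (Y \<omega>) (hrep t (X \<omega>) (g \<omega>) m) (\<lambda>k. ddrep t (X \<omega>) (g \<omega>) m (Suc k) - ddrep t (X \<omega>) (g \<omega>) m k) k)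
    \<in> borel_measurable P" for m k
  proof (induction k)
    case (Suc k)
    note Suc[measurable]
    show ?case unfolding dscheme.simps
      by (rule measurable_compose_countable[OF _ measurable_hrep]) measurable
  qed simp
  then show ?thesis unfolding drep_def by (intro borel_measurable_lim_metric)
qed

lemma measurable_zstep: "(\<lambda>\<omega>. zstep t (X \<omega>) (g \<omega>)) \<in> borel_measurable P"
proof -
  note measurable_zrep[measurable]
  show ?thesis unfolding zstep_def by measurable
qed

lemma measurable_dstep: "(\<lambda>\<omega>. dstep t (X \<omega>) (Y \<omega>) (g \<omega>)) \<in> borel_measurable P"
proof -
  note measurable_zstep[measurable] measurable_drep[measurable]
  have [measurable]: "Measurable.pred P (\<lambda>\<omega>. (zstep t (X \<omega>) (g \<omega>), drep t (X \<omega>) (Y \<omega>) (g \<omega>)) \<in> joint_space n)"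
    by (rule pred_sets2[OF joint_borel]) measurable
  show ?thesis unfolding dstep_def by measurable
qed

end

end

subsection \<open>Brownian motion\<close>

lemma (in prob_space) distr_pair_indep:
  assumes [measurable]: "X \<in> measurable M S" "Y \<in> measurable M T"
    and ind: "\<And>A B. A \<in> sets S \<Longrightarrow> B \<in> sets T \<Longrightarrow>
      prob ((X -` A \<inter> space M) \<inter> (Y -` B \<inter> space M)) = prob (X -` A \<inter> space M) * prob (Y -` B \<inter> space M)"
  shows "distr M S X \<Otimes>\<^sub>M distr M T Y = distr M (S \<Otimes>\<^sub>M T) (\<lambda>\<omega>. (X \<omega>, Y \<omega>))"
proof (rule pair_measure_eqI)
  show "sigma_finite_measure (distr M S X)" "sigma_finite_measure (distr M T Y)"
    by (auto intro!: prob_space_imp_sigma_finite prob_space_distr)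
  show "sets (distr M S X \<Otimes>\<^sub>M distr M T Y) = sets (distr M (S \<Otimes>\<^sub>M T) (\<lambda>\<omega>. (X \<omega>, Y \<omega>)))"
    by (simp cong: sets_pair_measure_cong)
  fix A B assume "A \<in> sets (distr M S X)" "B \<in> sets (distr M T Y)"
  then have AB[measurable]: "A \<in> sets S" "B \<in> sets T" by simp_all
  have "(\<lambda>\<omega>. (X \<omega>, Y \<omega>)) -` (A \<times> B) \<inter> space M = (X -` A \<inter> space M) \<inter> (Y -` B \<inter> space M)" by auto
  then show "emeasure (distr M S X) A * emeasure (distr M T Y) B = emeasure (distr M (S \<Otimes>\<^sub>M T) (\<lambda>\<omega>. (X \<omega>, Y \<omega>))) (A \<times> B)"
    using ind[OF AB] by (simp add: emeasure_distr emeasure_eq_measure ennreal_mult)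
qed

section \<open>Moments and symmetry of the Gaussian law\<close>

definition gauss :: "real \<Rightarrow> (real^'n) measure" where
  "gauss \<tau> = density lborel (\<lambda>x. ennreal (\<Prod>i\<in>UNIV. normal_density 0 (sqrt \<tau>) (x $ i)))"

lemma sets_gauss [simp, measurable_cong]: "sets (gauss \<tau>) = sets borel"
  by (simp add: gauss_def)

lemma space_gauss [simp]: "space (gauss \<tau>) = UNIV" by (simp add: gauss_def)

lemma nn_integral_gauss:
  assumes [measurable]: "f \<in> borel_measurable borel"
  shows "(\<integral>\<^sup>+x. f x \<partial>gauss \<tau>) = (\<integral>\<^sup>+x. ennreal (\<Prod>i\<in>UNIV. normal_density 0 (sqrt \<tau>) (x $ i)) * f x \<partial>lborel)"
  unfolding gauss_def by (rule nn_integral_density) measurable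

lemma nn_integral_gauss_prod:
  fixes h :: "'n::finite \<Rightarrow> real \<Rightarrow> real"
  assumes [measurable]: "\<And>i. h i \<in> borel_measurable borel" and nn: "\<And>i r. 0 \<le> h i r"
  shows "(\<integral>\<^sup>+x. ennreal (\<Prod>i\<in>UNIV. h i (x $ i)) \<partial>gauss \<tau>) =
    (\<Prod>i\<in>UNIV. \<integral>\<^sup>+r. ennreal (normal_density 0 (sqrt \<tau>) r * h i r) \<partial>lborel)"
proof -
  \<comment> \<open>Inverse of the enumeration of the basis by \<open>axis\<close>; the product
    formula for Lebesgue measure runs over basis vectors instead of indices.\<close>
  define ix :: "real^'n \<Rightarrow> 'n" where "ix e = (THE i. e = axis i 1)" for e
  have ix: "ix (axis i 1) = i" for i unfolding ix_def by (auto simp: axis_eq_axis)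
  have bij: "bij_betw (\<lambda>i. axis i (1::real)) (UNIV :: 'n set) (Basis :: (real^'n) set)"
    by (auto simp: bij_betw_def inj_on_def axis_eq_axis Basis_vec_def)
  have re: "(\<Prod>e\<in>(Basis :: (real^'n) set). G e) = (\<Prod>i\<in>UNIV. G (axis i 1))" for G :: "real^'n \<Rightarrow> 'c::comm_monoid_mult"
    by (rule prod.reindex_bij_betw[OF bij, symmetric])
  have "(\<integral>\<^sup>+x. ennreal (\<Prod>i\<in>UNIV. h i (x $ i)) \<partial>gauss \<tau>) =
    (\<integral>\<^sup>+x. ennreal (\<Prod>i\<in>UNIV. normal_density 0 (sqrt \<tau>) (x $ i)) * ennreal (\<Prod>i\<in>UNIV. h i (x $ i)) \<partial>lborel)"
    by (rule nn_integral_gauss) measurable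
  also have "\<dots> = (\<integral>\<^sup>+x. (\<Prod>e\<in>(Basis :: (real^'n) set). ennreal (normal_density 0 (sqrt \<tau>) (x \<bullet> e) * h (ix e) (x \<bullet> e))) \<partial>lborel)"
    by (intro nn_integral_cong)
      (simp add: re ix prod_ennreal ennreal_mult[symmetric] prod_nonneg nn prod.distrib[symmetric] inner_axis)
  also have "\<dots> = (\<integral>\<^sup>+x. ennreal (\<Prod>e\<in>(Basis :: (real^'n) set). normal_density 0 (sqrt \<tau>) (x \<bullet> e) * h (ix e) (x \<bullet> e)) \<partial>lborel)"
    by (simp add: prod_ennreal nn)
  also have "\<dots> = (\<Prod>e\<in>(Basis :: (real^'n) set). \<integral>\<^sup>+r. ennreal (normal_density 0 (sqrt \<tau>) r * h (ix e) r) \<partial>lborel)"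
    using nn by (subst prod_ennreal[symmetric]) (auto intro!: nn_integral_lborel_prod)
  also have "\<dots> = (\<Prod>i\<in>UNIV. \<integral>\<^sup>+r. ennreal (normal_density 0 (sqrt \<tau>) r * h i r) \<partial>lborel)"
    by (simp add: re ix)
  finally show ?thesis .
qed

text \<open>Completing the square: the exponential shifts the mean to
  \<open>c * \<tau>\<close>.\<close>

lemma nn_integral_normal_exp:
  assumes "0 < \<tau>"
  shows "(\<integral>\<^sup>+r. ennreal (normal_density 0 (sqrt \<tau>) r * exp (c * r)) \<partial>lborel) = ennreal (exp (c\<^sup>2 * \<tau> / 2))"
proof -
  have eq: "normal_density 0 (sqrt \<tau>) r * exp (c * r) = exp (c\<^sup>2 * \<tau> / 2) * normal_density (c * \<tau>) (sqrt \<tau>) r" for r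
  proof -
    have "- (r - 0)\<^sup>2 / (2 * (sqrt \<tau>)\<^sup>2) + c * r = c\<^sup>2 * \<tau> / 2 + - (r - c * \<tau>)\<^sup>2 / (2 * (sqrt \<tau>)\<^sup>2)"
      using assms by (simp add: field_simps power2_eq_square)
    from arg_cong[OF this, of exp] show ?thesis
      unfolding normal_density_def exp_add mult.assoc by (simp only: mult.left_commute)
  qed
  have "(\<integral>\<^sup>+r. ennreal (normal_density (c * \<tau>) (sqrt \<tau>) r) \<partial>lborel) = 1"
    using prob_space.emeasure_space_1[OF prob_space_normal_density[of "sqrt \<tau>" "c * \<tau>"]] assms
    by (simp add: emeasure_density)
  then show ?thesis unfolding eq by (simp add: ennreal_mult nn_integral_cmult)
qed

text \<open>The norm is at most the sum of the absolute coordinates, and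
  \<open>exp (c * \<bar>r\<bar>) \<le> exp (c * r) + exp (- c * r)\<close>; the resulting product
  integrates coordinate by coordinate.\<close>

lemma gauss_exp_moment:
  fixes \<tau> c :: real
  assumes \<tau>: "0 < \<tau>" and c: "0 \<le> c"
  shows "(\<integral>\<^sup>+x. ennreal (exp (c * norm x)) \<partial>(gauss \<tau> :: (real^'n::finite) measure)) \<le> ennreal ((2 * exp (c\<^sup>2 * \<tau> / 2)) ^ CARD('n))"
proof -
  have "(\<integral>\<^sup>+x. ennreal (exp (c * norm x)) \<partial>(gauss \<tau> :: (real^'n) measure)) \<le>
     (\<integral>\<^sup>+x. ennreal (\<Prod>i\<in>UNIV. (exp (c * (x $ i)) + exp (- c * (x $ i)))) \<partial>(gauss \<tau> :: (real^'n) measure))"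
  proof (rule nn_integral_mono)
    fix x :: "real^'n"
    have "exp (c * norm x) \<le> exp (c * (\<Sum>i\<in>UNIV. \<bar>x $ i\<bar>))"
      using c norm_le_l1_cart[of x] by (simp add: mult_left_mono)
    also have "\<dots> = (\<Prod>i\<in>UNIV. exp (c * \<bar>x $ i\<bar>))" by (simp add: sum_distrib_left exp_sum)
    also have "\<dots> \<le> (\<Prod>i\<in>UNIV. (exp (c * (x $ i)) + exp (- c * (x $ i))))"
      by (intro prod_mono) (auto simp: abs_if)
    finally show "ennreal (exp (c * norm x)) \<le> ennreal (\<Prod>i\<in>UNIV. (exp (c * (x $ i)) + exp (- c * (x $ i))))"
      by (rule ennreal_leI)
  qed
  also have "\<dots> = (\<Prod>i\<in>(UNIV::'n set). \<integral>\<^sup>+r. ennreal (normal_density 0 (sqrt \<tau>) r * (exp (c * r) + exp (- c * r))) \<partial>lborel)"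
    by (rule nn_integral_gauss_prod) auto
  also have "(\<integral>\<^sup>+r. ennreal (normal_density 0 (sqrt \<tau>) r * (exp (c * r) + exp (- c * r))) \<partial>lborel) =
     (\<integral>\<^sup>+r. ennreal (normal_density 0 (sqrt \<tau>) r * exp (c * r)) + ennreal (normal_density 0 (sqrt \<tau>) r * exp (- c * r)) \<partial>lborel)"
    by (intro nn_integral_cong) (simp add: distrib_left ennreal_plus)
  also have "\<dots> = (\<integral>\<^sup>+r. ennreal (normal_density 0 (sqrt \<tau>) r * exp (c * r)) \<partial>lborel) + (\<integral>\<^sup>+r. ennreal (normal_density 0 (sqrt \<tau>) r * exp (- c * r)) \<partial>lborel)"
    by (rule nn_integral_add) measurable
  also have "\<dots> = ennreal (2 * exp (c\<^sup>2 * \<tau> / 2))"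
    unfolding nn_integral_normal_exp[OF \<tau>] by (simp add: ennreal_plus[symmetric] del: ennreal_plus)
  finally show ?thesis by (simp add: ennreal_power)
qed

text \<open>A vector \<open>v\<close> that shortens \<open>x\<close> lies in the half-space
  \<open>x \<bullet> v < 0\<close>, which by symmetry has the same mass as its mirror image,
  disjoint from it.\<close>

lemma gauss_half:
  fixes x :: "real^'n::finite"
  assumes prob: "emeasure (gauss \<tau> :: (real^'n) measure) UNIV = 1"
  shows "2 * emeasure (gauss \<tau>) {v. norm (x + v) < norm x} \<le> 1"
proof -
  have refl: "emeasure (gauss \<tau>) {v :: real^'n. x \<bullet> v < 0} = emeasure (gauss \<tau>) {v. 0 < x \<bullet> v}"
  proof -
    have "emeasure (gauss \<tau>) {v :: real^'n. x \<bullet> v < 0} = (\<integral>\<^sup>+v. indicator {v. x \<bullet> v < 0} v \<partial>gauss \<tau>)"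
      by (subst nn_integral_indicator) auto
    also have "\<dots> = (\<integral>\<^sup>+v. ennreal (\<Prod>i\<in>UNIV. normal_density 0 (sqrt \<tau>) (v $ i)) * indicator {v. x \<bullet> v < 0} v \<partial>lborel)"
      by (rule nn_integral_gauss) simp
    also have "\<dots> = (\<integral>\<^sup>+v. ennreal (\<Prod>i\<in>UNIV. normal_density 0 (sqrt \<tau>) ((- v) $ i)) * indicator {v. x \<bullet> v < 0} (- v) \<partial>lborel)"
      by (subst lborel_affine[of "-1 :: real" "0 :: real^'n"]) (simp_all add: nn_integral_density nn_integral_distr)
    also have "\<dots> = (\<integral>\<^sup>+v. ennreal (\<Prod>i\<in>UNIV. normal_density 0 (sqrt \<tau>) (v $ i)) * indicator {v. 0 < x \<bullet> v} v \<partial>lborel)"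
      by (intro nn_integral_cong arg_cong2[where f="(*)"] arg_cong[where f=ennreal] prod.cong)
        (auto simp: normal_density_def indicator_def)
    also have "\<dots> = (\<integral>\<^sup>+v. indicator {v. 0 < x \<bullet> v} v \<partial>gauss \<tau>)"
      by (rule nn_integral_gauss[symmetric]) simp
    also have "\<dots> = emeasure (gauss \<tau>) {v. 0 < x \<bullet> v}"
      by (subst nn_integral_indicator) auto
    finally show ?thesis .
  qed
  have "{v. norm (x + v) < norm x} \<subseteq> {v. x \<bullet> v < 0}"
  proof safe
    fix v assume "norm (x + v) < norm x"
    then have "(norm (x + v))\<^sup>2 < (norm x)\<^sup>2" by (simp add: power_strict_mono)
    then have "2 * (x \<bullet> v) + v \<bullet> v < 0" by (simp add: power2_norm_eq_inner inner_simps inner_commute)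
    then show "x \<bullet> v < 0" using inner_ge_zero[of v] by linarith
  qed
  then have "emeasure (gauss \<tau>) {v. norm (x + v) < norm x} \<le> emeasure (gauss \<tau>) {v. x \<bullet> v < 0}"
    by (rule emeasure_mono) simp
  then have "2 * emeasure (gauss \<tau>) {v. norm (x + v) < norm x} \<le> emeasure (gauss \<tau>) {v. x \<bullet> v < 0} + emeasure (gauss \<tau>) {v. x \<bullet> v < 0}"
    unfolding mult_2 by (intro add_mono)
  also have "\<dots> = emeasure (gauss \<tau>) {v. x \<bullet> v < 0} + emeasure (gauss \<tau>) {v. 0 < x \<bullet> v}" by (simp only: refl)
  also have "\<dots> = emeasure (gauss \<tau>) ({v. x \<bullet> v < 0} \<union> {v. 0 < x \<bullet> v})"
    by (rule plus_emeasure) auto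
  also have "\<dots> \<le> emeasure (gauss \<tau>) (UNIV :: (real^'n) set)" by (rule emeasure_mono) simp_all
  finally show ?thesis by (simp add: prob)
qed

section \<open>Increments and maxima of Brownian motion\<close>

locale brownian =
  fixes M :: "'w measure" and F :: "real \<Rightarrow> 'w measure" and W :: "real \<Rightarrow> 'w \<Rightarrow> real^'n::finite"
  assumes filtered: "usual_filtered_prob_space M F" and bm: "brownian_motion M F W"
begin

sublocale prob_space M using filtered unfolding usual_filtered_prob_space_def by (elim conjE)

lemma space_F: "0 \<le> t \<Longrightarrow> space (F t) = space M"
  and sets_F: "0 \<le> t \<Longrightarrow> sets (F t) \<subseteq> sets M"
proof -
  have "\<forall>t\<ge>0. subalgebra M (F t)" using filtered unfolding usual_filtered_prob_space_def by (elim conjE)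
  then show "0 \<le> t \<Longrightarrow> space (F t) = space M" "0 \<le> t \<Longrightarrow> sets (F t) \<subseteq> sets M"
    by (simp_all add: subalgebra_def)
qed

lemma measurable_F: assumes "0 \<le> t" "X \<in> measurable (F t) S" shows "X \<in> measurable M S"
  by (rule measurable_from_subalg[OF _ assms(2)]) (use assms space_F sets_F in \<open>simp add: subalgebra_def\<close>)

lemma measurable_F_mono:
  assumes "0 \<le> s" "s \<le> t" "X \<in> measurable (F s) S" shows "X \<in> measurable (F t) S"
proof (rule measurable_from_subalg[OF _ assms(3)])
  have "\<forall>s\<ge>0. \<forall>t\<ge>s. sets (F s) \<subseteq> sets (F t)"
    using filtered unfolding usual_filtered_prob_space_def by (elim conjE)
  then have "sets (F s) \<subseteq> sets (F t)" using assms by simp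
  then show "subalgebra (F t) (F s)" using assms space_F by (simp add: subalgebra_def)
qed

lemma W_F: "0 \<le> t \<Longrightarrow> W t \<in> borel_measurable (F t)"
  using bm by (auto simp: brownian_motion_def adapted_process_def)

lemma W_F_le: "0 \<le> s \<Longrightarrow> s \<le> t \<Longrightarrow> W s \<in> borel_measurable (F t)"
  by (rule measurable_F_mono[OF _ _ W_F])

lemma W_measurable: "0 \<le> t \<Longrightarrow> W t \<in> borel_measurable M"
  by (rule measurable_F[OF _ W_F])

lemma W_0: "AE \<omega> in M. W 0 \<omega> = 0" using bm by (auto simp: brownian_motion_def)

lemma W_continuous: "\<omega> \<in> space M \<Longrightarrow> continuous_on {0..} (\<lambda>t. W t \<omega>)"
  using bm by (auto simp: brownian_motion_def continuous_process_def)

text \<open>Independence turns the joint law of past and increment into a product; the increment can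
  then be integrated out with the past frozen.\<close>

lemma increment:
  assumes st: "0 \<le> s" "s < t" and X: "X \<in> measurable (F s) S"
    and \<Phi>[measurable]: "\<Phi> \<in> borel_measurable (S \<Otimes>\<^sub>M borel)"
  shows "(\<integral>\<^sup>+\<omega>. \<Phi> (X \<omega>, W t \<omega> - W s \<omega>) \<partial>M) = (\<integral>\<^sup>+\<omega>. (\<integral>\<^sup>+v. \<Phi> (X \<omega>, v) \<partial>gauss (t - s)) \<partial>M)"
proof -
  have [measurable]: "X \<in> measurable M S" by (rule measurable_F[OF st(1) X])
  have [measurable]: "W s \<in> borel_measurable M" "W t \<in> borel_measurable M" using W_measurable st by auto
  have dist: "distributed M lborel (\<lambda>\<omega>. W t \<omega> - W s \<omega>) (\<lambda>x. ennreal (\<Prod>i\<in>UNIV. normal_density 0 (sqrt (t - s)) (x $ i)))"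
    and ind: "indep_set (sets (F s)) {(\<lambda>\<omega>. W t \<omega> - W s \<omega>) -` A \<inter> space M | A. A \<in> sets borel}"
    using bm st by (auto simp: brownian_motion_def)
  have d: "distr M borel (\<lambda>\<omega>. W t \<omega> - W s \<omega>) = gauss (t - s)"
  proof -
    have "distr M borel (\<lambda>\<omega>. W t \<omega> - W s \<omega>) = distr M lborel (\<lambda>\<omega>. W t \<omega> - W s \<omega>)"
      by (rule distr_cong) simp_all
    then show ?thesis using distributed_distr_eq_density[OF dist] by (simp only: gauss_def)
  qed
  have iv: "distr M S X \<Otimes>\<^sub>M distr M borel (\<lambda>\<omega>. W t \<omega> - W s \<omega>) = distr M (S \<Otimes>\<^sub>M borel) (\<lambda>\<omega>. (X \<omega>, W t \<omega> - W s \<omega>))"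
  proof (rule distr_pair_indep)
    fix A B assume AB: "A \<in> sets S" "B \<in> sets (borel :: (real^'n) measure)"
    have "X -` A \<inter> space M \<in> sets (F s)" using measurable_sets[OF X AB(1)] space_F st by simp
    then show "prob ((X -` A \<inter> space M) \<inter> ((\<lambda>\<omega>. W t \<omega> - W s \<omega>) -` B \<inter> space M)) =
      prob (X -` A \<inter> space M) * prob ((\<lambda>\<omega>. W t \<omega> - W s \<omega>) -` B \<inter> space M)"
      using ind AB(2) unfolding indep_sets2_eq by blast
  qed measurable
  interpret G: sigma_finite_measure "gauss (t - s) :: (real^'n) measure"
    unfolding d[symmetric] by (intro prob_space_imp_sigma_finite prob_space_distr) measurable
  have "(\<integral>\<^sup>+\<omega>. \<Phi> (X \<omega>, W t \<omega> - W s \<omega>) \<partial>M) = (\<integral>\<^sup>+p. \<Phi> p \<partial>distr M (S \<Otimes>\<^sub>M borel) (\<lambda>\<omega>. (X \<omega>, W t \<omega> - W s \<omega>)))"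
    by (subst nn_integral_distr) auto
  also have "\<dots> = (\<integral>\<^sup>+p. \<Phi> p \<partial>(distr M S X \<Otimes>\<^sub>M gauss (t - s)))"
    unfolding iv[symmetric] d ..
  also have "\<dots> = (\<integral>\<^sup>+x. (\<integral>\<^sup>+v. \<Phi> (x, v) \<partial>gauss (t - s)) \<partial>distr M S X)"
    by (rule G.nn_integral_fst[symmetric]) (simp cong: measurable_cong_sets)
  also have "\<dots> = (\<integral>\<^sup>+\<omega>. (\<integral>\<^sup>+v. \<Phi> (X \<omega>, v) \<partial>gauss (t - s)) \<partial>M)"
    by (rule nn_integral_distr) (auto intro!: G.borel_measurable_nn_integral simp: split_def cong: measurable_cong_sets)
  finally show ?thesis .
qed

text \<open>The total mass is read off from the law of an increment; no Gaussian integral is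
  computed.\<close>

lemma gauss_prob: assumes "0 < \<tau>" shows "emeasure (gauss \<tau> :: (real^'n) measure) UNIV = 1"
proof -
  have "(\<integral>\<^sup>+\<omega>. (\<lambda>_. 1) (0::real, W \<tau> \<omega> - W 0 \<omega>) \<partial>M) = (\<integral>\<^sup>+\<omega>. (\<integral>\<^sup>+v. (\<lambda>_. 1) (0::real, v) \<partial>(gauss (\<tau> - 0) :: (real^'n) measure)) \<partial>M)"
    by (rule increment[of 0 \<tau> "\<lambda>_. 0::real" borel]) (use assms in auto)
  then show ?thesis by (simp add: emeasure_space_1)
qed

lemma W_exp_moment:
  assumes "0 \<le> t" "t \<le> T" "0 \<le> c"
  shows "(\<integral>\<^sup>+\<omega>. ennreal (exp (c * norm (W t \<omega>))) \<partial>M) \<le> ennreal ((2 * exp (c\<^sup>2 * T / 2)) ^ CARD('n))"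
proof (cases "t = 0")
  case True
  have "(\<integral>\<^sup>+\<omega>. ennreal (exp (c * norm (W t \<omega>))) \<partial>M) = (\<integral>\<^sup>+\<omega>. 1 \<partial>M)"
    unfolding True by (rule nn_integral_cong_AE) (use W_0 in auto)
  also have "\<dots> \<le> ennreal ((2 * exp (c\<^sup>2 * T / 2)) ^ CARD('n))"
  proof -
    have "1 \<le> exp (c\<^sup>2 * T / 2)" using assms by simp
    then have "1 \<le> 2 * exp (c\<^sup>2 * T / 2)" by linarith
    from one_le_power[OF this, of "CARD('n)"] show ?thesis by (simp only: nn_integral_const emeasure_space_1 mult_1 ennreal_1[symmetric] ennreal_le_iff) simp
  qed
  finally show ?thesis .
next
  case False
  then have t: "0 < t" using assms by simp
  have "(\<integral>\<^sup>+\<omega>. ennreal (exp (c * norm (W t \<omega>))) \<partial>M) = (\<integral>\<^sup>+\<omega>. ennreal (exp (c * norm (W t \<omega> - W 0 \<omega>))) \<partial>M)"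
    by (rule nn_integral_cong_AE) (use W_0 in \<open>eventually_elim, simp\<close>)
  also have "\<dots> = (\<integral>\<^sup>+\<omega>. (\<integral>\<^sup>+v. ennreal (exp (c * norm v)) \<partial>(gauss (t - 0) :: (real^'n) measure)) \<partial>M)"
    using increment[of 0 t "\<lambda>_. 0::real" borel "\<lambda>(_, v). ennreal (exp (c * norm v))"] t by simp
  also have "\<dots> \<le> ennreal ((2 * exp (c\<^sup>2 * t / 2)) ^ CARD('n))"
    using gauss_exp_moment[OF t assms(3), where 'n='n] by (simp add: emeasure_space_1)
  also have "\<dots> \<le> ennreal ((2 * exp (c\<^sup>2 * T / 2)) ^ CARD('n))"
    using assms by (intro ennreal_leI power_mono) (auto intro!: mult_left_mono divide_right_mono)
  finally show ?thesis .
qed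

text \<open>Levy's maximal inequality. At the first time at which the running maximum grows to
  \<open>norm (W s)\<close>, the final value is, by symmetry, at least as large with probability at least one half.\<close>

lemma max_inequality:
  fixes c T :: real and K :: nat
  assumes c: "0 \<le> c" and T: "0 < T" and K: "0 < K"
  defines "U \<equiv> \<lambda>k \<omega>. Max ((\<lambda>j. norm (W (T * real j / real K) \<omega>)) ` {..k})"
  shows "(\<integral>\<^sup>+\<omega>. ennreal (exp (c * U K \<omega>)) \<partial>M) \<le> 2 * ennreal ((2 * exp (c\<^sup>2 * T / 2)) ^ CARD('n))"
proof -
  define S where "S k \<omega> = W (T * real k / real K) \<omega>" for k \<omega>
  define G where "G u = exp (c * u)" for u
  have G0: "0 \<le> G u" for u by (simp add: G_def)
  have Gmono: "u \<le> v \<Longrightarrow> G u \<le> G v" for u v using c by (simp add: G_def mult_left_mono)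
  have tk: "0 \<le> T * real k / real K" "k \<le> K \<Longrightarrow> T * real k / real K \<le> T" for k using T K by (auto simp: field_simps)
  have U: "U k = (\<lambda>\<omega>. Max ((\<lambda>j. norm (S j \<omega>)) ` {..k}))" for k by (simp add: U_def S_def)
  have USuc: "U (Suc k) \<omega> = max (norm (S (Suc k) \<omega>)) (U k \<omega>)" for k \<omega>
    unfolding U atMost_Suc by simp
  have UF: "U k \<in> borel_measurable (F (T * real k / real K))" for k
    unfolding U S_def
    by (intro borel_measurable_Max measurable_compose[OF W_F_le borel_measurable_norm])
      (use T K in \<open>auto intro!: divide_right_mono mult_left_mono\<close>)
  have Um[measurable]: "U k \<in> borel_measurable M" for k using measurable_F[OF tk(1) UF] .
  have Sm[measurable]: "S k \<in> borel_measurable M" for k unfolding S_def using W_measurable[OF tk(1)] .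
  define Dk where "Dk k \<omega> = G (U (Suc k) \<omega>) - G (U k \<omega>)" for k \<omega>
  have Dk0: "0 \<le> Dk k \<omega>" for k \<omega> unfolding Dk_def using Gmono USuc by simp
  have Dm[measurable]: "Dk k \<in> borel_measurable M" for k unfolding Dk_def G_def by measurable
  \<comment> \<open>A step after which the path is longer than at the end is charged with its growth
    \<open>Dk\<close> of the maximum; at any other step the new value does not exceed the final
    one.\<close>
  have point: "G (U k \<omega>) \<le> G (max (U 0 \<omega>) (norm (S K \<omega>))) + (\<Sum>j<k. Dk j \<omega> * indicator {\<omega>. norm (S K \<omega>) < norm (S (Suc j) \<omega>)} \<omega>)" for k \<omega>
  proof (induction k)
    case 0 then show ?case by (simp add: Gmono)
  next
    case (Suc k)
    let ?R = "\<lambda>k. \<Sum>j<k. Dk j \<omega> * indicator {\<omega>. norm (S K \<omega>) < norm (S (Suc j) \<omega>)} \<omega>"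
    have R0: "0 \<le> ?R k" by (intro sum_nonneg mult_nonneg_nonneg Dk0) auto
    show ?case
    proof (cases "norm (S K \<omega>) < norm (S (Suc k) \<omega>)")
      case True
      then show ?thesis using Suc by (simp add: Dk_def)
    next
      case False
      have "G (U (Suc k) \<omega>) \<le> max (G (norm (S (Suc k) \<omega>))) (G (U k \<omega>))"
        unfolding USuc by (auto simp: max_def)
      moreover have "G (norm (S (Suc k) \<omega>)) \<le> G (max (U 0 \<omega>) (norm (S K \<omega>)))" using False by (intro Gmono) auto
      ultimately show ?thesis using False Suc R0 by simp
    qed
  qed
  \<comment> \<open>\<open>Dk j\<close> and the position after step \<open>Suc j\<close> belong to
    the past, and the remaining increment shortens that position with probability at most one
    half.\<close>
  have half: "2 * (\<integral>\<^sup>+\<omega>. ennreal (Dk j \<omega> * indicator {\<omega>. norm (S K \<omega>) < norm (S (Suc j) \<omega>)} \<omega>) \<partial>M) \<le> (\<integral>\<^sup>+\<omega>. ennreal (Dk j \<omega>) \<partial>M)"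
    if j: "j < K" for j
  proof (cases "Suc j = K")
    case True
    then have "(\<integral>\<^sup>+\<omega>. ennreal (Dk j \<omega> * indicator {\<omega>. norm (S K \<omega>) < norm (S (Suc j) \<omega>)} \<omega>) \<partial>M) = 0" by simp
    then show ?thesis by (simp only: mult_zero_right zero_le)
  next
    case False
    let ?s = "T * real (Suc j) / real K" and ?t = "T * real K / real K"
    have st: "0 \<le> ?s" "?s < ?t"
    proof -
      show "0 \<le> ?s" by (rule tk(1))
      have "real (Suc j) < real K" using j False by simp
      then show "?s < ?t" using T K by (intro divide_strict_right_mono mult_strict_left_mono) simp_all
    qed
    have XF: "(\<lambda>\<omega>. (Dk j \<omega>, S (Suc j) \<omega>)) \<in> measurable (F ?s) (borel \<Otimes>\<^sub>M borel)"
    proof (rule measurable_Pair)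
      have [measurable]: "U (Suc j) \<in> borel_measurable (F ?s)" by (rule UF)
      have [measurable]: "U j \<in> borel_measurable (F ?s)"
        by (rule measurable_F_mono[OF tk(1) _ UF]) (use T K in \<open>auto intro!: divide_right_mono mult_left_mono\<close>)
      show "Dk j \<in> borel_measurable (F ?s)" unfolding Dk_def G_def by measurable
      show "S (Suc j) \<in> borel_measurable (F ?s)" unfolding S_def by (rule W_F[OF tk(1)])
    qed
    define \<Phi> where "\<Phi> p = ennreal (fst (fst p) * (if norm (snd (fst p) + snd p) < norm (snd (fst p)) then 1 else 0))"
      for p :: "(real \<times> (real^'n)) \<times> (real^'n)"
    have \<Phi>[measurable]: "\<Phi> \<in> borel_measurable ((borel \<Otimes>\<^sub>M borel) \<Otimes>\<^sub>M borel)"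
      unfolding \<Phi>_def by measurable
    have "(\<integral>\<^sup>+\<omega>. ennreal (Dk j \<omega> * indicator {\<omega>. norm (S K \<omega>) < norm (S (Suc j) \<omega>)} \<omega>) \<partial>M)
        = (\<integral>\<^sup>+\<omega>. \<Phi> ((Dk j \<omega>, S (Suc j) \<omega>), W ?t \<omega> - W ?s \<omega>) \<partial>M)"
      by (intro nn_integral_cong) (simp add: \<Phi>_def S_def indicator_def)
    also have "\<dots> = (\<integral>\<^sup>+\<omega>. (\<integral>\<^sup>+v. \<Phi> ((Dk j \<omega>, S (Suc j) \<omega>), v) \<partial>gauss (?t - ?s)) \<partial>M)"
      by (rule increment[OF st XF \<Phi>])
    also have "\<dots> = (\<integral>\<^sup>+\<omega>. ennreal (Dk j \<omega>) * emeasure (gauss (?t - ?s)) {v. norm (S (Suc j) \<omega> + v) < norm (S (Suc j) \<omega>)} \<partial>M)"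
    proof (rule nn_integral_cong)
      fix \<omega>
      have "(\<integral>\<^sup>+v. \<Phi> ((Dk j \<omega>, S (Suc j) \<omega>), v) \<partial>gauss (?t - ?s)) =
        (\<integral>\<^sup>+v. ennreal (Dk j \<omega>) * indicator {v. norm (S (Suc j) \<omega> + v) < norm (S (Suc j) \<omega>)} v \<partial>gauss (?t - ?s))"
        by (intro nn_integral_cong) (auto simp: \<Phi>_def indicator_def)
      then show "(\<integral>\<^sup>+v. \<Phi> ((Dk j \<omega>, S (Suc j) \<omega>), v) \<partial>gauss (?t - ?s)) =
        ennreal (Dk j \<omega>) * emeasure (gauss (?t - ?s)) {v. norm (S (Suc j) \<omega> + v) < norm (S (Suc j) \<omega>)}"
        by (simp add: nn_integral_cmult_indicator)
    qed
    finally have eq: "(\<integral>\<^sup>+\<omega>. ennreal (Dk j \<omega> * indicator {\<omega>. norm (S K \<omega>) < norm (S (Suc j) \<omega>)} \<omega>) \<partial>M) =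
      (\<integral>\<^sup>+\<omega>. ennreal (Dk j \<omega>) * emeasure (gauss (?t - ?s)) {v. norm (S (Suc j) \<omega> + v) < norm (S (Suc j) \<omega>)} \<partial>M)" .
    interpret Gs: sigma_finite_measure "gauss (?t - ?s) :: (real^'n) measure"
      by (intro prob_space_imp_sigma_finite prob_spaceI) (use gauss_prob[of "?t - ?s"] st in simp)
    have em[measurable]: "(\<lambda>\<omega>. emeasure (gauss (?t - ?s)) {v. norm (S (Suc j) \<omega> + v) < norm (S (Suc j) \<omega>)}) \<in> borel_measurable M"
    proof -
      have "{p \<in> space (M \<Otimes>\<^sub>M gauss (?t - ?s)). norm (S (Suc j) (fst p) + snd p) < norm (S (Suc j) (fst p))} \<in> sets (M \<Otimes>\<^sub>M gauss (?t - ?s))"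
        by measurable
      from Gs.measurable_emeasure_Pair[OF this]
      show ?thesis by (rule measurable_cong[THEN iffD1, rotated]) (auto simp: space_pair_measure intro!: arg_cong2[where f=emeasure])
    qed
    have "2 * (\<integral>\<^sup>+\<omega>. ennreal (Dk j \<omega>) * emeasure (gauss (?t - ?s)) {v. norm (S (Suc j) \<omega> + v) < norm (S (Suc j) \<omega>)} \<partial>M)
      = (\<integral>\<^sup>+\<omega>. 2 * (ennreal (Dk j \<omega>) * emeasure (gauss (?t - ?s)) {v. norm (S (Suc j) \<omega> + v) < norm (S (Suc j) \<omega>)}) \<partial>M)"
      by (rule nn_integral_cmult[symmetric]) measurable
    also have "\<dots> \<le> (\<integral>\<^sup>+\<omega>. ennreal (Dk j \<omega>) \<partial>M)"
    proof (rule nn_integral_mono)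
      fix \<omega>
      have "ennreal (Dk j \<omega>) * (2 * emeasure (gauss (?t - ?s)) {v. norm (S (Suc j) \<omega> + v) < norm (S (Suc j) \<omega>)}) \<le> ennreal (Dk j \<omega>) * 1"
        using st by (intro mult_left_mono gauss_half gauss_prob) auto
      then show "2 * (ennreal (Dk j \<omega>) * emeasure (gauss (?t - ?s)) {v. norm (S (Suc j) \<omega> + v) < norm (S (Suc j) \<omega>)}) \<le> ennreal (Dk j \<omega>)"
        by (simp add: mult_ac)
    qed
    finally show ?thesis unfolding eq .
  qed
  define A where "A = (\<integral>\<^sup>+\<omega>. ennreal (G (U K \<omega>)) \<partial>M)"
  define Q where "Q = (\<integral>\<^sup>+\<omega>. ennreal (G (norm (S K \<omega>))) \<partial>M)"
  let ?bnd = "ennreal ((2 * exp (c\<^sup>2 * T / 2)) ^ CARD('n))"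
  have Sk: "(\<integral>\<^sup>+\<omega>. ennreal (G (norm (S k \<omega>))) \<partial>M) \<le> ?bnd" if "k \<le> K" for k
    unfolding S_def G_def using tk that by (intro W_exp_moment c) auto
  \<comment> \<open>Finiteness allows \<open>A\<close> to be cancelled in
    \<open>A + A \<le> A + 2 * Q\<close> at the end.\<close>
  have Afin: "A < top"
  proof -
    have "A \<le> (\<integral>\<^sup>+\<omega>. (\<Sum>k\<le>K. ennreal (G (norm (S k \<omega>)))) \<partial>M)"
      unfolding A_def
    proof (rule nn_integral_mono)
      fix \<omega>
      have "U K \<omega> \<in> (\<lambda>j. norm (S j \<omega>)) ` {..K}" unfolding U by (intro Max_in) auto
      then obtain j where "j \<le> K" "U K \<omega> = norm (S j \<omega>)" by auto
      then show "ennreal (G (U K \<omega>)) \<le> (\<Sum>k\<le>K. ennreal (G (norm (S k \<omega>))))"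
        using member_le_sum[of j "{..K}" "\<lambda>k. ennreal (G (norm (S k \<omega>)))"] by auto
    qed
    also have "\<dots> = (\<Sum>k\<le>K. \<integral>\<^sup>+\<omega>. ennreal (G (norm (S k \<omega>))) \<partial>M)"
      by (rule nn_integral_sum) (simp add: G_def)
    also have "\<dots> \<le> (\<Sum>k\<le>K. ?bnd)" by (intro sum_mono Sk) auto
    also have "\<dots> < top" by (simp only: sum_constant ennreal_mult_less_top) (simp add: of_nat_less_top)
    finally show ?thesis .
  qed
  have "A \<le> (\<integral>\<^sup>+\<omega>. (ennreal (G (norm (S K \<omega>))) + (\<Sum>j<K. ennreal (Dk j \<omega> * indicator {\<omega>. norm (S K \<omega>) < norm (S (Suc j) \<omega>)} \<omega>))) \<partial>M)"
    unfolding A_def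
  proof (rule nn_integral_mono_AE)
    show "AE \<omega> in M. ennreal (G (U K \<omega>)) \<le> ennreal (G (norm (S K \<omega>))) + (\<Sum>j<K. ennreal (Dk j \<omega> * indicator {\<omega>. norm (S K \<omega>) < norm (S (Suc j) \<omega>)} \<omega>))"
      using W_0
    proof eventually_elim
      case (elim \<omega>)
      have "U 0 \<omega> = 0" using elim by (simp add: U S_def)
      then have "G (U K \<omega>) \<le> G (norm (S K \<omega>)) + (\<Sum>j<K. Dk j \<omega> * indicator {\<omega>. norm (S K \<omega>) < norm (S (Suc j) \<omega>)} \<omega>)"
        using point[of K \<omega>] by simp
      then have "ennreal (G (U K \<omega>)) \<le> ennreal (G (norm (S K \<omega>)) + (\<Sum>j<K. Dk j \<omega> * indicator {\<omega>. norm (S K \<omega>) < norm (S (Suc j) \<omega>)} \<omega>))"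
        by (rule ennreal_leI)
      also have "\<dots> = ennreal (G (norm (S K \<omega>))) + ennreal (\<Sum>j<K. Dk j \<omega> * indicator {\<omega>. norm (S K \<omega>) < norm (S (Suc j) \<omega>)} \<omega>)"
        by (intro ennreal_plus G0 sum_nonneg mult_nonneg_nonneg Dk0) auto
      also have "ennreal (\<Sum>j<K. Dk j \<omega> * indicator {\<omega>. norm (S K \<omega>) < norm (S (Suc j) \<omega>)} \<omega>) =
        (\<Sum>j<K. ennreal (Dk j \<omega> * indicator {\<omega>. norm (S K \<omega>) < norm (S (Suc j) \<omega>)} \<omega>))"
        by (intro sum_ennreal[symmetric] mult_nonneg_nonneg Dk0) auto
      finally show ?case .
    qed
  qed
  also have "\<dots> = Q + (\<Sum>j<K. \<integral>\<^sup>+\<omega>. ennreal (Dk j \<omega> * indicator {\<omega>. norm (S K \<omega>) < norm (S (Suc j) \<omega>)} \<omega>) \<partial>M)"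
    unfolding Q_def by (subst nn_integral_add, simp add: G_def, simp, subst nn_integral_sum, simp, simp)
  finally have A1: "A \<le> Q + (\<Sum>j<K. \<integral>\<^sup>+\<omega>. ennreal (Dk j \<omega> * indicator {\<omega>. norm (S K \<omega>) < norm (S (Suc j) \<omega>)} \<omega>) \<partial>M)" .
  have "2 * A \<le> 2 * Q + (\<Sum>j<K. 2 * (\<integral>\<^sup>+\<omega>. ennreal (Dk j \<omega> * indicator {\<omega>. norm (S K \<omega>) < norm (S (Suc j) \<omega>)} \<omega>) \<partial>M))"
    using mult_left_mono[OF A1, of 2] by (simp add: distrib_left sum_distrib_left)
  also have "\<dots> \<le> 2 * Q + (\<Sum>j<K. \<integral>\<^sup>+\<omega>. ennreal (Dk j \<omega>) \<partial>M)" by (intro add_left_mono sum_mono half) auto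
  also have "(\<Sum>j<K. \<integral>\<^sup>+\<omega>. ennreal (Dk j \<omega>) \<partial>M) = (\<integral>\<^sup>+\<omega>. (\<Sum>j<K. ennreal (Dk j \<omega>)) \<partial>M)"
    by (rule nn_integral_sum[symmetric]) simp
  also have "\<dots> \<le> A" unfolding A_def
  proof (rule nn_integral_mono)
    fix \<omega>
    have "(\<Sum>j<K. Dk j \<omega>) = G (U K \<omega>) - G (U 0 \<omega>)" unfolding Dk_def by (rule sum_lessThan_telescope)
    then have "(\<Sum>j<K. Dk j \<omega>) \<le> G (U K \<omega>)" using G0 by simp
    moreover have "(\<Sum>j<K. ennreal (Dk j \<omega>)) = ennreal (\<Sum>j<K. Dk j \<omega>)" by (intro sum_ennreal Dk0)
    ultimately show "(\<Sum>j<K. ennreal (Dk j \<omega>)) \<le> ennreal (G (U K \<omega>))" by (simp add: ennreal_leI)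
  qed
  finally have "A + A \<le> A + 2 * Q" by (simp add: mult_2 add_ac)
  then have "A \<le> 2 * Q" using Afin by (auto simp: ennreal_add_left_cancel_le)
  also have "\<dots> \<le> 2 * ?bnd" unfolding Q_def using Sk[of K] by (intro mult_left_mono) auto
  finally show ?thesis by (simp add: A_def G_def)
qed

section \<open>The supremum of the path over a bounded interval\<close>

definition wmax :: "real \<Rightarrow> nat \<Rightarrow> 'w \<Rightarrow> real" where
  "wmax T m \<omega> = Max ((\<lambda>j. norm (W (T * real j / 2 ^ m) \<omega>)) ` {..2 ^ m})"

text \<open>A limit of maxima over dyadic times, hence measurable; by continuity of the paths it
  dominates all times.\<close>

definition wsup :: "real \<Rightarrow> 'w \<Rightarrow> real" where "wsup T \<omega> = lim (\<lambda>m. wmax T m \<omega>)"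

lemma wmax_measurable [measurable]: "0 \<le> T \<Longrightarrow> wmax T m \<in> borel_measurable M"
  unfolding wmax_def[abs_def]
  by (intro borel_measurable_Max measurable_compose[OF W_measurable borel_measurable_norm]) auto

lemma wsup_measurable [measurable]: "0 \<le> T \<Longrightarrow> wsup T \<in> borel_measurable M"
  unfolding wsup_def[abs_def] by (intro borel_measurable_lim_metric wmax_measurable)

lemma wmax_tendsto:
  assumes \<omega>: "\<omega> \<in> space M" and T: "0 < T"
  shows "(\<lambda>m. wmax T m \<omega>) \<longlonglongrightarrow> wsup T \<omega>" "wmax T m \<omega> \<le> wsup T \<omega>"
proof -
  have cont: "continuous_on {0..T} (\<lambda>t. norm (W t \<omega>))"
    by (intro continuous_intros continuous_on_subset[OF W_continuous[OF \<omega>]]) auto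
  obtain u where u: "u \<in> {0..T}" "\<And>t. t \<in> {0..T} \<Longrightarrow> norm (W t \<omega>) \<le> norm (W u \<omega>)"
    using continuous_attains_sup[OF _ _ cont] T by force
  have pt: "T * real j / 2 ^ m \<in> {0..T}" if "j \<le> 2 ^ m" for j m
  proof -
    have "real j \<le> 2 ^ m" using that by (metis of_nat_le_iff of_nat_numeral of_nat_power)
    then show ?thesis using T by (simp add: field_simps)
  qed
  have bnd: "wmax T m \<omega> \<le> norm (W u \<omega>)" for m
    unfolding wmax_def by (rule Max.boundedI) (use u pt in auto)
  have mono: "incseq (\<lambda>m. wmax T m \<omega>)"
  proof (rule incseq_SucI)
    fix m
    show "wmax T m \<omega> \<le> wmax T (Suc m) \<omega>"
      unfolding wmax_def
    proof (rule Max_mono)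
      show "(\<lambda>j. norm (W (T * real j / 2 ^ m) \<omega>)) ` {..2 ^ m} \<subseteq> (\<lambda>j. norm (W (T * real j / 2 ^ Suc m) \<omega>)) ` {..2 ^ Suc m}"
      proof (rule image_subsetI)
        fix j :: nat assume "j \<in> {..2 ^ m}"
        then show "norm (W (T * real j / 2 ^ m) \<omega>) \<in> (\<lambda>j. norm (W (T * real j / 2 ^ Suc m) \<omega>)) ` {..2 ^ Suc m}"
          by (intro image_eqI[of _ _ "2 * j"]) auto
      qed
    qed auto
  qed
  obtain L where L: "(\<lambda>m. wmax T m \<omega>) \<longlonglongrightarrow> L"
    using incseq_convergent[OF mono, of "norm (W u \<omega>)"] bnd by blast
  then have "wsup T \<omega> = L" unfolding wsup_def by (rule limI)
  with L show lim: "(\<lambda>m. wmax T m \<omega>) \<longlonglongrightarrow> wsup T \<omega>" by simp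
  show "wmax T m \<omega> \<le> wsup T \<omega>" by (rule incseq_le[OF mono lim])
qed

lemma wsup_ge:
  assumes \<omega>: "\<omega> \<in> space M" and T: "0 < T" and s: "0 \<le> s" "s \<le> T"
  shows "norm (W s \<omega>) \<le> wsup T \<omega>"
proof -
  define j where "j m = nat \<lfloor>s * 2 ^ m / T\<rfloor>" for m :: nat
  define q where "q m = T * real (j m) / 2 ^ m" for m
  have jb: "real (j m) \<le> s * 2 ^ m / T" "s * 2 ^ m / T < real (j m) + 1" for m
  proof -
    have "0 \<le> s * 2 ^ m / T" using s T by simp
    then show "real (j m) \<le> s * 2 ^ m / T" "s * 2 ^ m / T < real (j m) + 1" unfolding j_def by linarith+
  qed
  have q: "q m \<le> s" "s - T / 2 ^ m \<le> q m" for m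
  proof -
    have p: "(0 :: real) < 2 ^ m" by simp
    have "T * real (j m) \<le> s * 2 ^ m" using jb(1)[of m] T by (simp add: field_simps)
    then show "q m \<le> s" unfolding q_def using p by (simp add: pos_divide_le_eq)
    have "s * 2 ^ m \<le> T * real (j m) + T" using jb(2)[of m] T by (simp add: field_simps)
    then have "s \<le> (T * real (j m) + T) / 2 ^ m" using p by (simp only: pos_le_divide_eq)
    then show "s - T / 2 ^ m \<le> q m" unfolding q_def add_divide_distrib by linarith
  qed
  have q0: "0 \<le> q m" for m using T by (simp add: q_def)
  have "j m \<le> 2 ^ m" for m
  proof -
    have "real (j m) \<le> 2 ^ m"
    proof (rule order_trans[OF jb(1)])
      have "s * 2 ^ m \<le> T * 2 ^ m" using s by (intro mult_right_mono) auto
      then show "s * 2 ^ m / T \<le> 2 ^ m" using T by (simp add: field_simps)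
    qed
    then show ?thesis by (metis of_nat_le_iff of_nat_numeral of_nat_power)
  qed
  then have "norm (W (q m) \<omega>) \<le> wmax T m \<omega>" for m
    unfolding wmax_def q_def by (intro Max_ge) auto
  then have le: "norm (W (q m) \<omega>) \<le> wsup T \<omega>" for m using wmax_tendsto(2)[OF \<omega> T] order_trans by blast
  have "(\<lambda>m. T / 2 ^ m) \<longlonglongrightarrow> 0"
    using tendsto_mult_right_zero[OF LIMSEQ_realpow_zero[of "1/2 :: real"], of T] by (simp add: power_one_over field_simps)
  from tendsto_diff[OF tendsto_const[of s] this] have "(\<lambda>m. s - T / 2 ^ m) \<longlonglongrightarrow> s" by simp
  then have qs: "q \<longlonglongrightarrow> s" by (rule tendsto_sandwich[rotated 2, OF _ tendsto_const]) (use q in auto)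
  have "((\<lambda>t. norm (W t \<omega>)) \<longlongrightarrow> norm (W s \<omega>)) (at s within {0..})"
    using W_continuous[OF \<omega>] s by (intro tendsto_norm) (auto simp: continuous_on_def)
  moreover have "continuous_on {0..} (\<lambda>t. norm (W t \<omega>))" by (intro continuous_intros W_continuous[OF \<omega>])
  ultimately have "(\<lambda>m. norm (W (q m) \<omega>)) \<longlonglongrightarrow> norm (W s \<omega>)"
    using qs q0 s by (intro continuous_on_tendsto_compose[of "{0..}" "\<lambda>t. norm (W t \<omega>)"]) auto
  then show ?thesis by (rule LIMSEQ_le_const2) (use le in auto)
qed

text \<open>The bound in \<open>max_inequality\<close> does not depend on the number of grid points,
  so Fatou's lemma carries it to the limit.\<close>

lemma wsup_exp_moment:
  assumes c: "0 \<le> c" and T: "0 < T"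
  shows "(\<integral>\<^sup>+\<omega>. ennreal (exp (c * wsup T \<omega>)) \<partial>M) \<le> 2 * ennreal ((2 * exp (c\<^sup>2 * T / 2)) ^ CARD('n))"
proof -
  note [measurable] = wmax_measurable[OF less_imp_le[OF T]]
  have "(\<integral>\<^sup>+\<omega>. ennreal (exp (c * wsup T \<omega>)) \<partial>M) = (\<integral>\<^sup>+\<omega>. liminf (\<lambda>m. ennreal (exp (c * wmax T m \<omega>))) \<partial>M)"
  proof (rule nn_integral_cong)
    fix \<omega> assume \<omega>: "\<omega> \<in> space M"
    have "(\<lambda>m. ennreal (exp (c * wmax T m \<omega>))) \<longlonglongrightarrow> ennreal (exp (c * wsup T \<omega>))"
      by (intro tendsto_intros wmax_tendsto \<omega> T)
    then show "ennreal (exp (c * wsup T \<omega>)) = liminf (\<lambda>m. ennreal (exp (c * wmax T m \<omega>)))"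
      by (intro lim_imp_Liminf[symmetric]) auto
  qed
  also have "\<dots> \<le> liminf (\<lambda>m. \<integral>\<^sup>+\<omega>. ennreal (exp (c * wmax T m \<omega>)) \<partial>M)"
    by (rule nn_integral_liminf) measurable
  also have "\<dots> \<le> 2 * ennreal ((2 * exp (c\<^sup>2 * T / 2)) ^ CARD('n))"
  proof (rule Liminf_le)
    show "\<forall>\<^sub>F m in sequentially. (\<integral>\<^sup>+\<omega>. ennreal (exp (c * wmax T m \<omega>)) \<partial>M) \<le> 2 * ennreal ((2 * exp (c\<^sup>2 * T / 2)) ^ CARD('n))"
      using max_inequality[OF c T, of "2 ^ m" for m] by (simp add: wmax_def)
  qed simp
  finally show ?thesis .
qed

subsection \<open>The law of the increments after a fixed time\<close>

text \<open>Iterated Gaussian integrals for a random walk from 0, where \<open>X l\<close> restricts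
  the position after \<open>l\<close> steps, the start included. Neither the starting time nor the
  past occurs, so stationarity and independence of the increments follow together.\<close>

primrec cyl :: "real \<Rightarrow> (nat \<Rightarrow> (real^'n) set) \<Rightarrow> nat \<Rightarrow> ((real^'n) \<Rightarrow> ennreal) \<Rightarrow> ennreal" where
  "cyl \<delta> X 0 r = r 0"
| "cyl \<delta> X (Suc N) r = cyl \<delta> X N (\<lambda>x. indicator (X N) x * (\<integral>\<^sup>+v. r (x + v) \<partial>gauss \<delta>))"

lemma sigma_finite_gauss: "0 < \<tau> \<Longrightarrow> sigma_finite_measure (gauss \<tau> :: (real^'n) measure)"
  by (intro prob_space_imp_sigma_finite prob_spaceI) (simp add: gauss_prob)

text \<open>The last increment is integrated out first, everything before it belonging to the
  past.\<close>

lemma cylinder: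
  assumes s: "0 \<le> s" and \<delta>: "0 < \<delta>" and A: "A \<in> sets (F s)" and X[measurable]: "\<And>k. X k \<in> sets borel"
  defines "D \<equiv> \<lambda>k \<omega>. W (s + real k * \<delta>) \<omega> - W s \<omega>"
  shows "r \<in> borel_measurable borel \<Longrightarrow>
    (\<integral>\<^sup>+\<omega>. indicator A \<omega> * (\<Prod>l<N. indicator (X l) (D l \<omega>)) * r (D N \<omega>) \<partial>M) = emeasure M A * cyl \<delta> X N r"
proof (induction N arbitrary: r)
  case 0
  have "A \<in> sets M" using A sets_F[OF s] by blast
  then show ?case by (simp add: D_def nn_integral_multc)
next
  case (Suc N)
  note [measurable] = Suc.prems
  interpret G: sigma_finite_measure "gauss \<delta> :: (real^'n) measure" by (rule sigma_finite_gauss[OF \<delta>])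
  let ?t = "s + real N * \<delta>"
  have t: "0 \<le> ?t" "s \<le> ?t" using s \<delta> by simp_all
  have DF: "D l \<in> borel_measurable (F ?t)" if "l \<le> N" for l
    unfolding D_def using s \<delta> that by (intro borel_measurable_diff W_F_le) (auto intro!: mult_right_mono)
  define H where "H \<omega> = indicator A \<omega> * (\<Prod>l<Suc N. indicator (X l) (D l \<omega>) :: ennreal)" for \<omega>
  have "A \<in> sets (F ?t)"
    using A filtered s t unfolding usual_filtered_prob_space_def by blast
  then have [measurable]: "H \<in> borel_measurable (F ?t)" unfolding H_def
    using DF by (intro borel_measurable_times_ennreal borel_measurable_prod_ennreal borel_measurable_indicator
        measurable_compose[OF _ borel_measurable_indicator[OF X]]) auto
  have [measurable]: "D N \<in> borel_measurable (F ?t)" by (rule DF) simp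
  have HD: "(\<lambda>\<omega>. (H \<omega>, D N \<omega>)) \<in> measurable (F ?t) (borel \<Otimes>\<^sub>M borel)" by measurable
  have lt: "?t < s + real (Suc N) * \<delta>" using \<delta> by (simp add: algebra_simps)
  define \<Phi> where "\<Phi> p = fst (fst p) * r (snd (fst p) + snd p)" for p :: "(ennreal \<times> (real^'n)) \<times> (real^'n)"
  have \<Phi>: "\<Phi> \<in> borel_measurable ((borel \<Otimes>\<^sub>M borel) \<Otimes>\<^sub>M borel)" unfolding \<Phi>_def by measurable
  have rm[measurable]: "(\<lambda>x. \<integral>\<^sup>+v. r (x + v) \<partial>gauss \<delta>) \<in> borel_measurable borel"
    by (rule G.borel_measurable_nn_integral) (simp add: split_def cong: measurable_cong_sets)
  have "(\<integral>\<^sup>+\<omega>. indicator A \<omega> * (\<Prod>l<Suc N. indicator (X l) (D l \<omega>)) * r (D (Suc N) \<omega>) \<partial>M) =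
     (\<integral>\<^sup>+\<omega>. \<Phi> ((H \<omega>, D N \<omega>), W (s + real (Suc N) * \<delta>) \<omega> - W ?t \<omega>) \<partial>M)"
    by (intro nn_integral_cong) (simp add: \<Phi>_def H_def D_def)
  also have "\<dots> = (\<integral>\<^sup>+\<omega>. (\<integral>\<^sup>+v. \<Phi> ((H \<omega>, D N \<omega>), v) \<partial>gauss (s + real (Suc N) * \<delta> - ?t)) \<partial>M)"
    by (rule increment[OF t(1) lt HD \<Phi>])
  also have "s + real (Suc N) * \<delta> - ?t = \<delta>" by (simp add: algebra_simps)
  also have "(\<integral>\<^sup>+\<omega>. (\<integral>\<^sup>+v. \<Phi> ((H \<omega>, D N \<omega>), v) \<partial>gauss \<delta>) \<partial>M) =
    (\<integral>\<^sup>+\<omega>. indicator A \<omega> * (\<Prod>l<N. indicator (X l) (D l \<omega>)) * (indicator (X N) (D N \<omega>) * (\<integral>\<^sup>+v. r (D N \<omega> + v) \<partial>gauss \<delta>)) \<partial>M)"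
  proof (rule nn_integral_cong)
    fix \<omega>
    have "(\<integral>\<^sup>+v. \<Phi> ((H \<omega>, D N \<omega>), v) \<partial>gauss \<delta>) = H \<omega> * (\<integral>\<^sup>+v. r (D N \<omega> + v) \<partial>gauss \<delta>)"
      unfolding \<Phi>_def fst_conv snd_conv by (rule nn_integral_cmult) (simp cong: measurable_cong_sets)
    then show "(\<integral>\<^sup>+v. \<Phi> ((H \<omega>, D N \<omega>), v) \<partial>gauss \<delta>) =
      indicator A \<omega> * (\<Prod>l<N. indicator (X l) (D l \<omega>)) * (indicator (X N) (D N \<omega>) * (\<integral>\<^sup>+v. r (D N \<omega> + v) \<partial>gauss \<delta>))"
      by (simp add: H_def mult_ac)
  qed
  also have "\<dots> = emeasure M A * cyl \<delta> X N (\<lambda>x. indicator (X N) x * (\<integral>\<^sup>+v. r (x + v) \<partial>gauss \<delta>))"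
    by (rule Suc.IH) measurable
  finally show ?case by simp
qed

definition wgrid :: "real \<Rightarrow> real \<Rightarrow> 'w \<Rightarrow> nat \<times> nat \<Rightarrow> real^'n" where
  "wgrid s t \<omega> = (\<lambda>(m, k). W (s + t * real k / 2 ^ m) \<omega> - W s \<omega>)"

abbreviation PG :: "(nat \<times> nat \<Rightarrow> real^'n) measure" where "PG \<equiv> PiM UNIV (\<lambda>_. borel)"

lemma wgrid_measurable: assumes "0 \<le> s" "0 \<le> t" shows "wgrid s t \<in> measurable M PG"
proof (rule measurable_PiM_single')
  show "(\<lambda>\<omega>. wgrid s t \<omega> i) \<in> borel_measurable M" for i
    unfolding wgrid_def using assms by (cases i) (auto intro!: borel_measurable_diff W_measurable)
qed auto

text \<open>Both sides are measures in \<open>E\<close>, so it is enough to compare them on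
  cylinders. The finitely many times of a cylinder lie on a common dyadic grid, where
  \<open>cylinder\<close> evaluates both sides.\<close>

lemma wgrid_law:
  assumes s: "0 \<le> s" and t: "0 < t" and A: "A \<in> sets (F s)" and E: "E \<in> sets PG"
  shows "emeasure M (A \<inter> (wgrid s t -` E \<inter> space M)) = emeasure M A * emeasure M (wgrid 0 t -` E \<inter> space M)"
proof -
  have AM[measurable]: "A \<in> sets M" using A sets_F[OF s] by blast
  note [measurable] = wgrid_measurable[OF s less_imp_le[OF t]] wgrid_measurable[OF order_refl less_imp_le[OF t]]
  define \<mu>1 where "\<mu>1 = distr (density M (indicator A)) PG (wgrid s t)"
  define \<mu>2 where "\<mu>2 = density (distr M PG (wgrid 0 t)) (\<lambda>_. emeasure M A)"
  have wm: "wgrid s t \<in> measurable (density M (indicator A)) PG" by simp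
  have e1: "emeasure \<mu>1 E = emeasure M (A \<inter> (wgrid s t -` E \<inter> space M))" if [measurable]: "E \<in> sets PG" for E
  proof -
    have "emeasure \<mu>1 E = emeasure (density M (indicator A)) (wgrid s t -` E \<inter> space M)"
      unfolding \<mu>1_def by (subst emeasure_distr[OF wm that]) simp
    also have "\<dots> = (\<integral>\<^sup>+\<omega>. indicator A \<omega> * indicator (wgrid s t -` E \<inter> space M) \<omega> \<partial>M)"
      by (rule emeasure_density) measurable
    also have "\<dots> = (\<integral>\<^sup>+\<omega>. indicator (A \<inter> (wgrid s t -` E \<inter> space M)) \<omega> \<partial>M)"
      by (intro nn_integral_cong) (simp add: indicator_def)
    also have "\<dots> = emeasure M (A \<inter> (wgrid s t -` E \<inter> space M))" by (rule nn_integral_indicator) measurable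
    finally show ?thesis .
  qed
  have e2: "emeasure \<mu>2 E = emeasure M A * emeasure M (wgrid 0 t -` E \<inter> space M)" if [measurable]: "E \<in> sets PG" for E
    unfolding \<mu>2_def by (simp add: emeasure_density nn_integral_cmult_indicator emeasure_distr)
  have "\<mu>1 = \<mu>2"
  proof (rule measure_eqI_PiM_infinite[of \<mu>1 UNIV "\<lambda>_. borel" \<mu>2])
    show "sets \<mu>1 = sets PG" "sets \<mu>2 = sets PG" by (simp_all add: \<mu>1_def \<mu>2_def)
    have "emeasure \<mu>1 (space \<mu>1) \<le> 1"
      using e1[OF sets.top] measure_le_1 by (simp add: \<mu>1_def emeasure_eq_measure)
    then show "finite_measure \<mu>1" by (intro finite_measureI) (auto simp: top_unique)
    fix B :: "nat \<times> nat \<Rightarrow> (real^'n) set" and J :: "(nat \<times> nat) set"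
    assume J: "finite J" and B: "\<And>i. i \<in> J \<Longrightarrow> B i \<in> sets borel"
    \<comment> \<open>The finest level that occurs. Below, \<open>e\<close> converts an index pair
      into a step number on that grid, and \<open>X\<close> collects all conditions on one step,
      since different pairs may denote the same time.\<close>
    define m0 where "m0 = Max (insert 0 (fst ` J))"
    define e where "e = (\<lambda>(m :: nat, k :: nat). k * 2 ^ (m0 - m))"
    define N where "N = Max (insert 0 (e ` J))"
    define \<delta> where "\<delta> = t / 2 ^ m0"
    define X where "X l = (\<Inter>i\<in>{i \<in> J. e i = l}. B i)" for l
    have \<delta>: "0 < \<delta>" using t by (simp add: \<delta>_def)
    have X: "X l \<in> sets borel" for l
    proof (cases "{i \<in> J. e i = l} = {}")
      case False
      then show ?thesis unfolding X_def using B J by (intro sets.finite_INT) auto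
    next
      case True
      then have "X l = UNIV" unfolding X_def by (simp only: INT_empty)
      then show ?thesis by simp
    qed
    have time: "t * real k / 2 ^ m = real (e (m, k)) * \<delta>" if "(m, k) \<in> J" for m k
    proof -
      have "m \<in> insert 0 (fst ` J)" using that by force
      then have "m \<le> m0" unfolding m0_def using J by (intro Max_ge) auto
      then have "(2 :: real) ^ m0 = 2 ^ (m0 - m) * 2 ^ m" by (simp add: power_add[symmetric])
      then show ?thesis by (simp add: e_def \<delta>_def)
    qed
    have eN: "e i \<le> N" if "i \<in> J" for i unfolding N_def using J that by (intro Max_ge) auto
    have iff: "wgrid u t \<omega> \<in> prod_emb UNIV (\<lambda>_. borel) J (Pi\<^sub>E J B) \<longleftrightarrow> (\<forall>l\<le>N. W (u + real l * \<delta>) \<omega> - W u \<omega> \<in> X l)" for u \<omega>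
    proof -
      have "wgrid u t \<omega> \<in> prod_emb UNIV (\<lambda>_. borel) J (Pi\<^sub>E J B) \<longleftrightarrow> (\<forall>i\<in>J. wgrid u t \<omega> i \<in> B i)"
        by (simp add: prod_emb_def PiE_def Pi_iff)
      also have "\<dots> \<longleftrightarrow> (\<forall>i\<in>J. W (u + real (e i) * \<delta>) \<omega> - W u \<omega> \<in> B i)"
        using time by (auto simp: wgrid_def split_def)
      also have "\<dots> \<longleftrightarrow> (\<forall>l\<le>N. W (u + real l * \<delta>) \<omega> - W u \<omega> \<in> X l)"
        using eN by (auto simp: X_def)
      finally show ?thesis .
    qed
    have cylf: "emeasure M (A \<inter> (wgrid u t -` prod_emb UNIV (\<lambda>_. borel) J (Pi\<^sub>E J B) \<inter> space M)) = emeasure M A * cyl \<delta> X N (indicator (X N))"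
      if u: "0 \<le> u" and A: "A \<in> sets (F u)" for u A
    proof -
      have AM[measurable]: "A \<in> sets M" using A sets_F[OF u] by blast
      have sub: "A \<subseteq> space M" using sets.sets_into_space[OF AM] .
      have [measurable]: "wgrid u t \<in> measurable M PG" using u t by (intro wgrid_measurable) auto
      have [measurable]: "prod_emb UNIV (\<lambda>_. borel) J (Pi\<^sub>E J B) \<in> sets PG"
        using J B by (intro sets_PiM_I) auto
      have "emeasure M (A \<inter> (wgrid u t -` prod_emb UNIV (\<lambda>_. borel) J (Pi\<^sub>E J B) \<inter> space M)) =
        (\<integral>\<^sup>+\<omega>. indicator (A \<inter> (wgrid u t -` prod_emb UNIV (\<lambda>_. borel) J (Pi\<^sub>E J B) \<inter> space M)) \<omega> \<partial>M)"
        by (rule nn_integral_indicator[symmetric]) measurable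
      also have "\<dots> = (\<integral>\<^sup>+\<omega>. indicator A \<omega> * (\<Prod>l<N. indicator (X l) (W (u + real l * \<delta>) \<omega> - W u \<omega>)) * indicator (X N) (W (u + real N * \<delta>) \<omega> - W u \<omega>) \<partial>M)"
      proof (rule nn_integral_cong)
        fix \<omega> assume \<omega>: "\<omega> \<in> space M"
        let ?D = "\<lambda>l. W (u + real l * \<delta>) \<omega> - W u \<omega>"
        have "(\<Prod>l<N. indicator (X l) (?D l)) * indicator (X N) (?D N) = (\<Prod>l<Suc N. indicator (X l) (?D l) :: ennreal)" by simp
        also have "\<dots> = (if \<forall>l\<le>N. ?D l \<in> X l then 1 else 0)"
        proof (cases "\<forall>l\<le>N. ?D l \<in> X l")
          case True
          then have "(\<Prod>l<Suc N. indicator (X l) (?D l) :: ennreal) = 1" by (intro prod.neutral) auto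
          with True show ?thesis by simp
        next
          case False
          then obtain l where "l < Suc N" "?D l \<notin> X l" by (auto simp: less_Suc_eq_le)
          then have "(\<Prod>l<Suc N. indicator (X l) (?D l) :: ennreal) = 0" by (intro prod_zero bexI[of _ l]) auto
          with False show ?thesis by simp
        qed
        finally show "indicator (A \<inter> (wgrid u t -` prod_emb UNIV (\<lambda>_. borel) J (Pi\<^sub>E J B) \<inter> space M)) \<omega> =
          indicator A \<omega> * (\<Prod>l<N. indicator (X l) (?D l)) * (indicator (X N) (?D N) :: ennreal)"
          using \<omega> iff[of u \<omega>] by (simp add: indicator_def mult.assoc)
      qed
      also have "\<dots> = emeasure M A * cyl \<delta> X N (indicator (X N))"
        by (rule cylinder[OF u \<delta> A X]) (use X in measurable)
      finally show ?thesis .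
    qed
    have meas: "prod_emb UNIV (\<lambda>_. borel) J (Pi\<^sub>E J B) \<in> sets PG" using J B by (intro sets_PiM_I) auto
    have "space M \<in> sets (F 0)" using sets.top[of "F 0"] space_F[of 0] by simp
    from cylf[OF order_refl this]
    have "emeasure M (wgrid 0 t -` prod_emb UNIV (\<lambda>_. borel) J (Pi\<^sub>E J B) \<inter> space M) = cyl \<delta> X N (indicator (X N))"
      by (simp add: Int_absorb1 emeasure_space_1)
    then show "emeasure \<mu>1 (prod_emb UNIV (\<lambda>_. borel) J (Pi\<^sub>E J B)) = emeasure \<mu>2 (prod_emb UNIV (\<lambda>_. borel) J (Pi\<^sub>E J B))"
      unfolding e1[OF meas] e2[OF meas] cylf[OF s A] by simp
  qed
  with e1[OF E] e2[OF E] show ?thesis by simp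
qed

text \<open>The Markov property in the form needed for transition operators: the noise after
  \<open>s\<close> is independent of \<open>F s\<close> and has the law of the noise from time 0, so
  an independent copy may replace it.\<close>

lemma wgrid_markov:
  assumes s: "0 \<le> s" and t: "0 < t" and X: "X \<in> measurable (F s) S"
    and \<Phi>[measurable]: "\<Phi> \<in> borel_measurable (S \<Otimes>\<^sub>M PG)"
  shows "(\<integral>\<^sup>+\<omega>. \<Phi> (X \<omega>, wgrid s t \<omega>) \<partial>M) = (\<integral>\<^sup>+\<omega>. (\<integral>\<^sup>+\<omega>'. \<Phi> (X \<omega>, wgrid 0 t \<omega>') \<partial>M) \<partial>M)"
proof -
  have [measurable]: "X \<in> measurable M S" by (rule measurable_F[OF s X])
  note [measurable] = wgrid_measurable[OF s less_imp_le[OF t]] wgrid_measurable[OF order_refl less_imp_le[OF t]]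
  have law: "prob (A \<inter> (wgrid s t -` E \<inter> space M)) = prob A * prob (wgrid 0 t -` E \<inter> space M)"
    if "A \<in> sets (F s)" "E \<in> sets PG" for A E
    using wgrid_law[OF s t that] by (simp add: emeasure_eq_measure ennreal_mult[symmetric])
  have top: "space M \<in> sets (F s)" using sets.top[of "F s"] space_F[OF s] by simp
  have same: "prob (wgrid s t -` E \<inter> space M) = prob (wgrid 0 t -` E \<inter> space M)" if "E \<in> sets PG" for E
    using law[OF top that] by (simp add: Int_absorb1 prob_space)
  have d: "distr M PG (wgrid s t) = distr M PG (wgrid 0 t)"
    by (rule measure_eqI) (simp_all add: emeasure_distr emeasure_eq_measure same)
  have iv: "distr M S X \<Otimes>\<^sub>M distr M PG (wgrid s t) = distr M (S \<Otimes>\<^sub>M PG) (\<lambda>\<omega>. (X \<omega>, wgrid s t \<omega>))"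
  proof (rule distr_pair_indep)
    fix A E assume AE: "A \<in> sets S" "E \<in> sets PG"
    have "X -` A \<inter> space M \<in> sets (F s)" using measurable_sets[OF X AE(1)] space_F[OF s] by simp
    from law[OF this AE(2)] same[OF AE(2)]
    show "prob ((X -` A \<inter> space M) \<inter> (wgrid s t -` E \<inter> space M)) = prob (X -` A \<inter> space M) * prob (wgrid s t -` E \<inter> space M)" by simp
  qed measurable
  interpret G: sigma_finite_measure "distr M PG (wgrid 0 t)"
    by (intro prob_space_imp_sigma_finite prob_space_distr) measurable
  have "(\<integral>\<^sup>+\<omega>. \<Phi> (X \<omega>, wgrid s t \<omega>) \<partial>M) = (\<integral>\<^sup>+p. \<Phi> p \<partial>distr M (S \<Otimes>\<^sub>M PG) (\<lambda>\<omega>. (X \<omega>, wgrid s t \<omega>)))"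
    by (subst nn_integral_distr) auto
  also have "\<dots> = (\<integral>\<^sup>+p. \<Phi> p \<partial>(distr M S X \<Otimes>\<^sub>M distr M PG (wgrid 0 t)))"
    unfolding iv[symmetric] d ..
  also have "\<dots> = (\<integral>\<^sup>+x. (\<integral>\<^sup>+g. \<Phi> (x, g) \<partial>distr M PG (wgrid 0 t)) \<partial>distr M S X)"
    by (rule G.nn_integral_fst[symmetric]) (simp cong: measurable_cong_sets)
  also have "\<dots> = (\<integral>\<^sup>+\<omega>. (\<integral>\<^sup>+g. \<Phi> (X \<omega>, g) \<partial>distr M PG (wgrid 0 t)) \<partial>M)"
    by (rule nn_integral_distr) (auto intro!: G.borel_measurable_nn_integral simp: split_def cong: measurable_cong_sets)
  also have "\<dots> = (\<integral>\<^sup>+\<omega>. (\<integral>\<^sup>+\<omega>'. \<Phi> (X \<omega>, wgrid 0 t \<omega>') \<partial>M) \<partial>M)"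
    by (intro nn_integral_cong nn_integral_distr) (auto dest: measurable_space)
  finally show ?thesis .
qed

end

subsection \<open>Random iterations\<close>

text \<open>With the head integrated inside, the tail plays the past and the head the new noise;
  each later use is one step of the iteration.\<close>

lemma (in prob_space) nn_integral_stream_space_swap:
  assumes [measurable]: "f \<in> borel_measurable (stream_space M)"
  shows "(\<integral>\<^sup>+X. f X \<partial>stream_space M) = (\<integral>\<^sup>+X. (\<integral>\<^sup>+w. f (w ## X) \<partial>M) \<partial>stream_space M)"
proof -
  interpret S: prob_space "stream_space M" by (rule prob_space_stream_space)
  interpret P: pair_sigma_finite M "stream_space M" ..
  have "(\<integral>\<^sup>+X. f X \<partial>stream_space M) = (\<integral>\<^sup>+w. (\<integral>\<^sup>+X. f (w ## X) \<partial>stream_space M) \<partial>M)"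
    by (rule nn_integral_stream_space) simp
  also have "\<dots> = (\<integral>\<^sup>+X. (\<integral>\<^sup>+w. f (w ## X) \<partial>M) \<partial>stream_space M)"
    by (rule P.Fubini'[symmetric]) measurable
  finally show ?thesis .
qed

lemma ennreal_double: "2 * ennreal a = ennreal (2 * a)"
  using ennreal_mult'[of 2 a] by simp

lemma ennreal_swap: "0 \<le> a \<Longrightarrow> 0 \<le> b \<Longrightarrow> ennreal a * ennreal (b * u) = ennreal b * ennreal (a * u)"
  by (simp add: ennreal_mult' mult_ac)

text \<open>The sum of the increments has finite expectation, so the telescoping series converges
  absolutely almost surely.\<close>

lemma AE_convergent_of_geometric:
  fixes X :: "nat \<Rightarrow> 'b \<Rightarrow> 'a::euclidean_space"
  assumes [measurable]: "\<And>n. X n \<in> borel_measurable P"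
    and bnd: "\<And>n. (\<integral>\<^sup>+\<omega>. ennreal (norm (X (Suc n) \<omega> - X n \<omega>)) \<partial>P) \<le> c * ennreal (\<rho> ^ n)"
    and c: "c < top" and \<rho>: "0 \<le> \<rho>" "\<rho> < 1"
  shows "AE \<omega> in P. convergent (\<lambda>n. X n \<omega>)"
proof -
  have "(\<integral>\<^sup>+\<omega>. (\<Sum>n. ennreal (norm (X (Suc n) \<omega> - X n \<omega>))) \<partial>P) = (\<Sum>n. \<integral>\<^sup>+\<omega>. ennreal (norm (X (Suc n) \<omega> - X n \<omega>)) \<partial>P)"
    by (rule nn_integral_suminf) measurable
  also have "\<dots> \<le> (\<Sum>n. c * ennreal (\<rho> ^ n))" by (intro suminf_le bnd summableI)
  also have "\<dots> = c * (\<Sum>n. ennreal (\<rho> ^ n))" by simp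
  also have "(\<Sum>n. ennreal (\<rho> ^ n)) = ennreal (\<Sum>n. \<rho> ^ n)"
    using \<rho> by (intro suminf_ennreal2) (auto intro!: summable_geometric)
  also have "c * \<dots> < top" using c by (simp add: ennreal_mult_less_top)
  finally have "(\<integral>\<^sup>+\<omega>. (\<Sum>n. ennreal (norm (X (Suc n) \<omega> - X n \<omega>))) \<partial>P) \<noteq> \<infinity>" by simp
  then have "AE \<omega> in P. (\<Sum>n. ennreal (norm (X (Suc n) \<omega> - X n \<omega>))) \<noteq> \<infinity>"
    by (intro nn_integral_PInf_AE) auto
  then show ?thesis
  proof eventually_elim
    case (elim \<omega>)
    have "summable (\<lambda>n. norm (X (Suc n) \<omega> - X n \<omega>))"
      by (rule summable_suminf_not_top) (use elim in auto)
    then have "summable (\<lambda>n. X (Suc n) \<omega> - X n \<omega>)" by (rule summable_norm_cancel)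
    then have "convergent (\<lambda>n. \<Sum>i<n. X (Suc i) \<omega> - X i \<omega>)" by (simp add: summable_iff_convergent)
    then have "convergent (\<lambda>n. X n \<omega> - X 0 \<omega>)" by (simp only: sum_lessThan_telescope[of "\<lambda>n. X n \<omega>"])
    then have "convergent (\<lambda>n. (X n \<omega> - X 0 \<omega>) + X 0 \<omega>)" by (intro convergent_add convergent_const)
    then show ?case by simp
  qed
qed

text \<open>The indicator of a nonempty closed set is the limit of the Lipschitz functions
  \<open>max 0 (1 - real k * infdist x A)\<close>, and the closed sets generate the Borel sets and
  are stable under intersection.\<close>

lemma measure_eqI_lipschitz:
  fixes \<mu> \<mu>' :: "'a::metric_space measure"
  assumes \<mu>: "prob_space \<mu>" "prob_space \<mu>'" and [measurable_cong, simp]: "sets \<mu> = sets borel" "sets \<mu>' = sets borel"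
    and eq: "\<And>f L. f \<in> borel_measurable borel \<Longrightarrow> (\<And>x. 0 \<le> f x) \<Longrightarrow> (\<And>x. f x \<le> (1 :: real)) \<Longrightarrow>
       (\<And>x y. \<bar>f x - f y\<bar> \<le> L * dist x y) \<Longrightarrow> integral\<^sup>L \<mu> f = integral\<^sup>L \<mu>' f"
  shows "\<mu> = \<mu>'"
proof -
  interpret \<mu>: prob_space \<mu> by fact
  interpret \<mu>': prob_space \<mu>' by fact
  have closed: "emeasure \<mu> A = emeasure \<mu>' A" if A: "closed A" for A
  proof (cases "A = {}")
    case False
    have [measurable]: "A \<in> sets borel" using A by (rule borel_closed)
    define f where "f k x = max 0 (1 - real k * infdist x A)" for k x
    have fm[measurable]: "f k \<in> borel_measurable borel" for k
      unfolding f_def by (intro borel_measurable_continuous_onI continuous_intros)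
    have f01: "0 \<le> f k x" "f k x \<le> 1" for k x unfolding f_def using infdist_nonneg[of x A] by (auto intro: mult_nonneg_nonneg)
    have flip: "\<bar>f k x - f k y\<bar> \<le> real k * dist x y" for k x y
    proof -
      have "\<bar>f k x - f k y\<bar> \<le> \<bar>real k * infdist x A - real k * infdist y A\<bar>" unfolding f_def by linarith
      also have "\<dots> = real k * \<bar>infdist x A - infdist y A\<bar>" by (simp add: right_diff_distrib[symmetric] abs_mult)
      also have "\<dots> \<le> real k * dist x y" by (intro mult_left_mono infdist_triangle_abs) auto
      finally show ?thesis .
    qed
    have lim: "(\<lambda>k. f k x) \<longlonglongrightarrow> indicator A x" for x
    proof (cases "x \<in> A")
      case True
      then show ?thesis by (simp add: f_def)
    next
      case F: False
      then have pos: "0 < infdist x A" using A False infdist_nonneg[of x A] in_closed_iff_infdist_zero[OF A False] by fastforce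
      obtain K where K: "1 / infdist x A < real K" using reals_Archimedean2 by blast
      have "\<forall>\<^sub>F k in sequentially. f k x = 0"
        unfolding eventually_sequentially
      proof (intro exI allI impI)
        fix k assume "K \<le> k"
        then have "1 / infdist x A < real k" using K by linarith
        then have "1 < real k * infdist x A" using pos by (simp add: field_simps)
        then show "f k x = 0" by (simp add: f_def)
      qed
      then have "(\<lambda>k. f k x) \<longlonglongrightarrow> 0" by (rule tendsto_eventually)
      then show ?thesis using F by simp
    qed
    have l1: "(\<lambda>k. integral\<^sup>L \<mu> (f k)) \<longlonglongrightarrow> integral\<^sup>L \<mu> (indicator A)"
      by (rule integral_dominated_convergence[where w="\<lambda>_. 1"]) (use f01 lim in auto)
    have l2: "(\<lambda>k. integral\<^sup>L \<mu>' (f k)) \<longlonglongrightarrow> integral\<^sup>L \<mu>' (indicator A)"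
      by (rule integral_dominated_convergence[where w="\<lambda>_. 1"]) (use f01 lim in auto)
    have l3: "integral\<^sup>L \<mu> (f k) = integral\<^sup>L \<mu>' (f k)" for k by (rule eq[OF fm f01 flip])
    have "integral\<^sup>L \<mu> (indicator A :: 'a \<Rightarrow> real) = integral\<^sup>L \<mu>' (indicator A)"
      by (rule LIMSEQ_unique[OF l1[unfolded l3] l2])
    then have "measure \<mu> A = measure \<mu>' A" by simp
    then show ?thesis by (simp add: \<mu>.emeasure_eq_measure \<mu>'.emeasure_eq_measure)
  qed simp
  show ?thesis
  proof (rule measure_eqI_generator_eq[where E="Collect closed" and \<Omega>=UNIV and A="\<lambda>_. UNIV"])
    show "Int_stable (Collect closed)" by (auto simp: Int_stable_def)
    show "sets \<mu> = sigma_sets UNIV (Collect closed)" "sets \<mu>' = sigma_sets UNIV (Collect closed)"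
      by (simp_all add: borel_eq_closed)
  qed (use closed in auto)
qed

text \<open>The iteration \<open>(x, y) \<mapsto> (\<Gamma> x \<omega>, \<Delta> x y \<omega>)\<close> with independent noise \<open>\<omega>\<close> contracts in \<open>x\<close>, and for
  fixed \<open>x\<close> in \<open>y\<close>, by the random factor \<open>r\<close>. No continuity of \<open>\<Delta>\<close> in \<open>x\<close> is available. Therefore
  the \<open>y\<close>-component is only compared along the same \<open>x\<close>-component, first in the stationary regime
  (existence) and then by replacing \<open>y\<close> with \<open>0\<close> (uniqueness).\<close>

locale random_iteration = prob_space M for M :: "'w measure" +
  fixes G :: "'a::euclidean_space set" and J :: "('a \<times> 'a) set"
    and \<Gamma> :: "'a \<Rightarrow> 'w \<Rightarrow> 'a" and \<Delta> :: "'a \<Rightarrow> 'a \<Rightarrow> 'w \<Rightarrow> 'a"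
    and N :: "'a \<Rightarrow> real" and CN :: real
    and U H :: "'a \<Rightarrow> real" and r :: "'a \<Rightarrow> 'a \<Rightarrow> 'w \<Rightarrow> real" and \<rho> q c :: real
  assumes \<Gamma>_measurable: "(\<lambda>(x, \<omega>). \<Gamma> x \<omega>) \<in> borel_measurable (borel \<Otimes>\<^sub>M M)"
    and \<Delta>_measurable: "(\<lambda>((x, y), \<omega>). \<Delta> x y \<omega>) \<in> borel_measurable ((borel \<Otimes>\<^sub>M borel) \<Otimes>\<^sub>M M)"
    and closed_G: "closed G" and zero_G: "0 \<in> G" and \<Gamma>_in: "\<And>x \<omega>. \<Gamma> x \<omega> \<in> G"
    and step_in_J: "\<And>x y \<omega>. (\<Gamma> x \<omega>, \<Delta> x y \<omega>) \<in> J"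
    and J_G: "\<And>x y. (x, y) \<in> J \<Longrightarrow> x \<in> G" and J_0: "\<And>x. x \<in> G \<Longrightarrow> (x, 0) \<in> J"
    and J_closed: "\<And>x. closed {y. (x, y) \<in> J}" and J_borel: "J \<in> sets borel"
    and N_measurable: "N \<in> borel_measurable borel" and N_0: "N 0 = 0" and CN: "0 < CN"
    and N_le: "\<And>x. N x \<le> CN * norm x" and norm_le: "\<And>x. norm x \<le> CN * N x"
    and U_measurable: "U \<in> borel_measurable borel" and U_ge: "\<And>x. 1 / 2 \<le> U x"
    and r_measurable: "\<And>x x'. r x x' \<in> borel_measurable M" and r_0: "\<And>x x' \<omega>. 0 \<le> r x x' \<omega>" and r_1: "\<And>x x' \<omega>. r x x' \<omega> \<le> 1"
    and \<Gamma>_contract: "\<And>x x'. x \<in> G \<Longrightarrow> x' \<in> G \<Longrightarrow> AE \<omega> in M. N (\<Gamma> x \<omega> - \<Gamma> x' \<omega>) \<le> r x x' \<omega> * N (x - x')"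
    and \<Delta>_contract: "\<And>x y y'. (x, y) \<in> J \<Longrightarrow> (x, y') \<in> J \<Longrightarrow> AE \<omega> in M. N (\<Delta> x y \<omega> - \<Delta> x y' \<omega>) \<le> r x x \<omega> * N (y - y')"
    and \<rho>: "0 \<le> \<rho>" "\<rho> < 1"
    and weight: "\<And>x x'. x \<in> G \<Longrightarrow> x' \<in> G \<Longrightarrow>
       (\<integral>\<^sup>+\<omega>. ennreal (r x x' \<omega> * (U (\<Gamma> x \<omega>) + U (\<Gamma> x' \<omega>))) \<partial>M) \<le> ennreal (\<rho> * (U x + U x'))"
    and H_cont: "continuous_on UNIV H" and q: "0 \<le> q" "q < 1" and c: "0 \<le> c" and H_0: "\<And>x. 0 \<le> H x"
    and moment: "\<And>x. x \<in> G \<Longrightarrow> (\<integral>\<^sup>+\<omega>. ennreal ((N (\<Gamma> x \<omega> - x) + N (\<Delta> x 0 \<omega>)) * U (\<Gamma> x \<omega>)) \<partial>M) \<le> ennreal (H x)"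
    and drift: "\<And>x. x \<in> G \<Longrightarrow> (\<integral>\<^sup>+\<omega>. ennreal (H (\<Gamma> x \<omega>)) \<partial>M) \<le> ennreal (q * H x + c)"
begin

lemma N_nonneg: "0 \<le> N x"
  using norm_le[of x] CN norm_ge_zero[of x] by (smt (verit) mult_pos_neg)

lemma U_pos: "0 \<le> U x" using U_ge[of x] by linarith

lemma measurable_\<Gamma> [measurable (raw)]:
  assumes [measurable]: "f \<in> borel_measurable P" "g \<in> measurable P M"
  shows "(\<lambda>x. \<Gamma> (f x) (g x)) \<in> borel_measurable P"
  using measurable_compose[OF _ \<Gamma>_measurable, of "\<lambda>x. (f x, g x)" P] by simp

lemma measurable_\<Delta> [measurable (raw)]:
  assumes [measurable]: "f \<in> borel_measurable P" "h \<in> borel_measurable P" "g \<in> measurable P M"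
  shows "(\<lambda>x. \<Delta> (f x) (h x) (g x)) \<in> borel_measurable P"
  using measurable_compose[OF _ \<Delta>_measurable, of "\<lambda>x. ((f x, h x), g x)" P] by simp

declare N_measurable [measurable] U_measurable [measurable] r_measurable [measurable]

lemma H_measurable [measurable]: "H \<in> borel_measurable borel"
  by (rule borel_measurable_continuous_onI[OF H_cont])

lemma J_sets [measurable]: "J \<in> sets (borel \<Otimes>\<^sub>M borel)" using J_borel by (simp only: borel_prod)

lemma weight_single: assumes "x \<in> G"
  shows "(\<integral>\<^sup>+\<omega>. ennreal (r x x \<omega> * U (\<Gamma> x \<omega>)) \<partial>M) \<le> ennreal (\<rho> * U x)"
proof -
  have "2 * (\<integral>\<^sup>+\<omega>. ennreal (r x x \<omega> * U (\<Gamma> x \<omega>)) \<partial>M) = (\<integral>\<^sup>+\<omega>. 2 * ennreal (r x x \<omega> * U (\<Gamma> x \<omega>)) \<partial>M)"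
    by (rule nn_integral_cmult[symmetric]) measurable
  also have "\<dots> = (\<integral>\<^sup>+\<omega>. ennreal (r x x \<omega> * (U (\<Gamma> x \<omega>) + U (\<Gamma> x \<omega>))) \<partial>M)"
    by (intro nn_integral_cong) (simp add: mult_2[symmetric] ennreal_double mult.left_commute)
  also have "\<dots> \<le> ennreal (\<rho> * (U x + U x))" by (rule weight[OF assms assms])
  also have "\<dots> = 2 * ennreal (\<rho> * U x)"
    by (simp add: mult_2[symmetric] ennreal_double mult.left_commute)
  finally show ?thesis by (simp add: mult_2[symmetric] ennreal_mult_le_mult_iff)
qed

section \<open>Existence of an invariant law by coupling from the past\<close>

abbreviation "\<Omega> \<equiv> stream_space M"

text \<open>The head of the stream is the most recent noise and is applied last. For a fixed stream,
  one more iteration adds noise in the remote past, whose influence the contraction removes;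
  therefore \<open>X n \<omega>\<close> converges for almost every stream and not only in
  law.\<close>

primrec X :: "nat \<Rightarrow> 'w stream \<Rightarrow> 'a" where
  "X 0 \<omega> = 0"
| "X (Suc n) \<omega> = \<Gamma> (X n (stl \<omega>)) (shd \<omega>)"

lemma X_measurable [measurable]: "X n \<in> borel_measurable \<Omega>"
proof (induction n)
  case (Suc n)
  note [measurable] = Suc
  show ?case unfolding X.simps[abs_def] by measurable
qed simp

lemma X_in: "X n \<omega> \<in> G" by (cases n) (auto simp: zero_G \<Gamma>_in)

text \<open>The default value 0 lies in \<open>G\<close>, so \<open>Xi_in\<close> holds without an
  exceptional set.\<close>

definition Xi :: "'w stream \<Rightarrow> 'a" where "Xi \<omega> = (if convergent (\<lambda>n. X n \<omega>) then lim (\<lambda>n. X n \<omega>) else 0)"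

lemma Xi_limit: "convergent (\<lambda>n. X n \<omega>) \<Longrightarrow> (\<lambda>n. X n \<omega>) \<longlonglongrightarrow> Xi \<omega>"
  by (simp add: Xi_def convergent_LIMSEQ_iff)

lemma Xi_eq: "(\<lambda>n. X n \<omega>) \<longlonglongrightarrow> x \<Longrightarrow> Xi \<omega> = x"
  unfolding Xi_def by (auto simp: limI convergent_def)

lemma Xi_measurable [measurable]: "Xi \<in> borel_measurable \<Omega>"
proof -
  have "{\<omega> \<in> space \<Omega>. convergent (\<lambda>n. X n \<omega>)} \<in> sets \<Omega>"
    by (simp add: Cauchy_convergent_iff[symmetric]) measurable
  then have [measurable]: "Measurable.pred \<Omega> (\<lambda>\<omega>. convergent (\<lambda>n. X n \<omega>))" by (simp add: pred_def)
  show ?thesis unfolding Xi_def[abs_def] by measurable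
qed

lemma Xi_in: "Xi \<omega> \<in> G"
proof (cases "convergent (\<lambda>n. X n \<omega>)")
  case True
  show ?thesis by (rule closed_sequentially[OF closed_G _ Xi_limit[OF True]]) (simp add: X_in)
qed (simp add: Xi_def zero_G)

text \<open>The contraction factor and the weights at the new points depend on the same noise; they
  are integrated together, and \<open>weight\<close> is a hypothesis on just this product.\<close>

lemma pair_weight_step:
  assumes ab: "a \<in> G" "b \<in> G"
  shows "(\<integral>\<^sup>+w. ennreal (N (\<Gamma> a w - \<Gamma> b w) * (U (\<Gamma> a w) + U (\<Gamma> b w))) \<partial>M) \<le> ennreal \<rho> * ennreal (N (a - b) * (U a + U b))"
proof -
  have "(\<integral>\<^sup>+w. ennreal (N (\<Gamma> a w - \<Gamma> b w) * (U (\<Gamma> a w) + U (\<Gamma> b w))) \<partial>M) \<le>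
    (\<integral>\<^sup>+w. ennreal (N (a - b)) * ennreal (r a b w * (U (\<Gamma> a w) + U (\<Gamma> b w))) \<partial>M)"
  proof (rule nn_integral_mono_AE)
    show "AE w in M. ennreal (N (\<Gamma> a w - \<Gamma> b w) * (U (\<Gamma> a w) + U (\<Gamma> b w))) \<le> ennreal (N (a - b)) * ennreal (r a b w * (U (\<Gamma> a w) + U (\<Gamma> b w)))"
      using \<Gamma>_contract[OF ab]
    proof eventually_elim
      case (elim w)
      have "N (\<Gamma> a w - \<Gamma> b w) * (U (\<Gamma> a w) + U (\<Gamma> b w)) \<le> (r a b w * N (a - b)) * (U (\<Gamma> a w) + U (\<Gamma> b w))"
        by (rule mult_right_mono[OF elim add_nonneg_nonneg[OF U_pos U_pos]])
      also have "\<dots> = N (a - b) * (r a b w * (U (\<Gamma> a w) + U (\<Gamma> b w)))" by simp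
      finally show ?case unfolding ennreal_mult'[OF N_nonneg, symmetric] by (rule ennreal_leI)
    qed
  qed
  also have "\<dots> = ennreal (N (a - b)) * (\<integral>\<^sup>+w. ennreal (r a b w * (U (\<Gamma> a w) + U (\<Gamma> b w))) \<partial>M)"
    by (rule nn_integral_cmult) measurable
  also have "\<dots> \<le> ennreal (N (a - b)) * ennreal (\<rho> * (U a + U b))" by (intro mult_left_mono weight ab) auto
  also have "\<dots> = ennreal \<rho> * ennreal (N (a - b) * (U a + U b))"
    by (rule ennreal_swap[OF N_nonneg \<rho>(1)])
  finally show ?thesis .
qed

text \<open>The expected weighted distances of successive iterates decay like
  \<open>\<rho> ^ n\<close>. As the two weights add up to at least 1, they dominate the distances in
  \<open>N\<close>.\<close>

lemma X_convergent: "AE \<omega> in \<Omega>. convergent (\<lambda>n. X n \<omega>)"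
proof -
  define f where "f n = (\<integral>\<^sup>+\<omega>. ennreal (N (X (Suc n) \<omega> - X n \<omega>) * (U (X (Suc n) \<omega>) + U (X n \<omega>))) \<partial>\<Omega>)" for n
  have step: "f (Suc n) \<le> ennreal \<rho> * f n" for n
  proof -
    have "f (Suc n) = (\<integral>\<^sup>+\<omega>. (\<integral>\<^sup>+w. ennreal (N (\<Gamma> (X (Suc n) \<omega>) w - \<Gamma> (X n \<omega>) w) * (U (\<Gamma> (X (Suc n) \<omega>) w) + U (\<Gamma> (X n \<omega>) w))) \<partial>M) \<partial>\<Omega>)"
      unfolding f_def by (subst nn_integral_stream_space_swap, measurable, simp?)
    also have "\<dots> \<le> (\<integral>\<^sup>+\<omega>. ennreal \<rho> * ennreal (N (X (Suc n) \<omega> - X n \<omega>) * (U (X (Suc n) \<omega>) + U (X n \<omega>))) \<partial>\<Omega>)"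
      by (intro nn_integral_mono pair_weight_step X_in)
    also have "\<dots> = ennreal \<rho> * f n" unfolding f_def by (rule nn_integral_cmult) measurable
    finally show ?thesis .
  qed
  have f0: "f 0 < top"
  proof -
    have "f 0 = (\<integral>\<^sup>+\<omega>. (\<integral>\<^sup>+w. ennreal (N (\<Gamma> 0 w - 0) * (U (\<Gamma> 0 w) + U 0)) \<partial>M) \<partial>\<Omega>)"
      unfolding f_def by (subst nn_integral_stream_space_swap, measurable, simp?)
    also have "\<dots> = (\<integral>\<^sup>+w. ennreal (N (\<Gamma> 0 w - 0) * (U (\<Gamma> 0 w) + U 0)) \<partial>M)"
      by (simp add: prob_space.emeasure_space_1[OF prob_space_stream_space])
    also have "\<dots> \<le> (\<integral>\<^sup>+w. ennreal (1 + 2 * U 0) * ennreal ((N (\<Gamma> 0 w - 0) + N (\<Delta> 0 0 w)) * U (\<Gamma> 0 w)) \<partial>M)"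
    proof (rule nn_integral_mono)
      fix w
      \<comment> \<open>The weight at the starting point is absorbed into the weight at the new
        point, the only one that occurs in \<open>moment\<close>.\<close>
      have "U 0 * 1 \<le> U 0 * (2 * U (\<Gamma> 0 w))" using U_ge[of "\<Gamma> 0 w"] U_pos by (intro mult_left_mono) auto
      then have "U (\<Gamma> 0 w) + U 0 \<le> (1 + 2 * U 0) * U (\<Gamma> 0 w)" by (simp add: algebra_simps)
      then have "N (\<Gamma> 0 w - 0) * (U (\<Gamma> 0 w) + U 0) \<le> (N (\<Gamma> 0 w - 0) + N (\<Delta> 0 0 w)) * ((1 + 2 * U 0) * U (\<Gamma> 0 w))"
        using N_nonneg U_pos by (intro mult_mono) (auto intro!: add_nonneg_nonneg)
      then show "ennreal (N (\<Gamma> 0 w - 0) * (U (\<Gamma> 0 w) + U 0)) \<le> ennreal (1 + 2 * U 0) * ennreal ((N (\<Gamma> 0 w - 0) + N (\<Delta> 0 0 w)) * U (\<Gamma> 0 w))"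
        using U_pos by (subst ennreal_mult'[symmetric]) (auto intro!: ennreal_leI simp: mult_ac)
    qed
    also have "\<dots> = ennreal (1 + 2 * U 0) * (\<integral>\<^sup>+w. ennreal ((N (\<Gamma> 0 w - 0) + N (\<Delta> 0 0 w)) * U (\<Gamma> 0 w)) \<partial>M)"
      by (rule nn_integral_cmult) measurable
    also have "\<dots> \<le> ennreal (1 + 2 * U 0) * ennreal (H 0)" by (intro mult_left_mono moment zero_G) auto
    also have "\<dots> < top" by (simp add: ennreal_mult_less_top)
    finally show ?thesis .
  qed
  have fn: "f n \<le> f 0 * ennreal (\<rho> ^ n)" for n
  proof (induction n)
    case (Suc n)
    have "f (Suc n) \<le> ennreal \<rho> * (f 0 * ennreal (\<rho> ^ n))"
      by (rule order_trans[OF step mult_left_mono[OF Suc]]) simp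
    then show ?case using \<rho> by (simp add: ennreal_mult mult_ac)
  qed simp
  show ?thesis
  proof (rule AE_convergent_of_geometric[where c="ennreal CN * f 0", OF _ _ _ \<rho>])
    fix n
    have "(\<integral>\<^sup>+\<omega>. ennreal (norm (X (Suc n) \<omega> - X n \<omega>)) \<partial>\<Omega>) \<le>
      (\<integral>\<^sup>+\<omega>. ennreal CN * ennreal (N (X (Suc n) \<omega> - X n \<omega>) * (U (X (Suc n) \<omega>) + U (X n \<omega>))) \<partial>\<Omega>)"
    proof (rule nn_integral_mono)
      fix \<omega>
      have "norm (X (Suc n) \<omega> - X n \<omega>) \<le> CN * N (X (Suc n) \<omega> - X n \<omega>)" by (rule norm_le)
      also have "\<dots> \<le> CN * (N (X (Suc n) \<omega> - X n \<omega>) * (U (X (Suc n) \<omega>) + U (X n \<omega>)))"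
      proof (rule mult_left_mono)
        have "1 \<le> U (X (Suc n) \<omega>) + U (X n \<omega>)" using U_ge[of "X (Suc n) \<omega>"] U_ge[of "X n \<omega>"] by linarith
        from mult_left_mono[OF this N_nonneg[of "X (Suc n) \<omega> - X n \<omega>"]]
        show "N (X (Suc n) \<omega> - X n \<omega>) \<le> N (X (Suc n) \<omega> - X n \<omega>) * (U (X (Suc n) \<omega>) + U (X n \<omega>))" by simp
      qed (use CN in simp)
      finally show "ennreal (norm (X (Suc n) \<omega> - X n \<omega>)) \<le> ennreal CN * ennreal (N (X (Suc n) \<omega> - X n \<omega>) * (U (X (Suc n) \<omega>) + U (X n \<omega>)))"
        using CN by (subst ennreal_mult'[symmetric]) (auto intro: ennreal_leI)
    qed
    also have "\<dots> = ennreal CN * f n" unfolding f_def by (rule nn_integral_cmult) measurable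
    also have "\<dots> \<le> ennreal CN * (f 0 * ennreal (\<rho> ^ n))" by (intro mult_left_mono fn) simp
    finally show "(\<integral>\<^sup>+\<omega>. ennreal (norm (X (Suc n) \<omega> - X n \<omega>)) \<partial>\<Omega>) \<le> ennreal CN * f 0 * ennreal (\<rho> ^ n)" by (simp add: mult.assoc)
    show "ennreal CN * f 0 < top" using f0 by (simp add: ennreal_mult_less_top)
  qed simp
qed

lemma tendsto_N: "(\<lambda>n. N (u n - a)) \<longlonglongrightarrow> 0" if "u \<longlonglongrightarrow> a" for u :: "nat \<Rightarrow> 'a"
proof (rule tendsto_sandwich[OF _ _ tendsto_const])
  have "(\<lambda>n. CN * norm (u n - a)) \<longlonglongrightarrow> CN * norm (a - a)" by (intro tendsto_intros that)
  then show "(\<lambda>n. CN * norm (u n - a)) \<longlonglongrightarrow> 0" by simp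
qed (auto simp: N_le N_nonneg)

lemma tendsto_of_N: "u \<longlonglongrightarrow> a" if "\<And>n. N (u n - a) \<le> e n" "e \<longlonglongrightarrow> 0" for u :: "nat \<Rightarrow> 'a"
proof -
  have "(\<lambda>n. norm (u n - a)) \<longlonglongrightarrow> 0"
  proof (rule tendsto_sandwich[OF _ _ tendsto_const])
    have "(\<lambda>n. CN * e n) \<longlonglongrightarrow> CN * 0" by (intro tendsto_intros that)
    then show "(\<lambda>n. CN * e n) \<longlonglongrightarrow> 0" by simp
    have "norm (u n - a) \<le> CN * e n" for n
      using norm_le[of "u n - a"] mult_left_mono[OF that(1)[of n] less_imp_le[OF CN]] by linarith
    then show "\<forall>\<^sub>F n in sequentially. norm (u n - a) \<le> CN * e n" by simp
  qed simp
  then show ?thesis using LIM_zero_iff tendsto_norm_zero_iff by blast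
qed

lemma r_contract: "r x x' \<omega> * a \<le> a" if "0 \<le> a" for a :: real
  using mult_right_mono[OF r_1[of x x' \<omega>] that] by simp

text \<open>The contraction holds almost surely for each pair of states separately; for a fixed
  stream only the countably many pairs of \<open>X n \<omega>\<close> and \<open>Xi \<omega>\<close>
  are involved.\<close>

lemma Xi_step:
  assumes "convergent (\<lambda>n. X n \<omega>)"
  shows "AE w in M. Xi (w ## \<omega>) = \<Gamma> (Xi \<omega>) w"
proof -
  have "AE w in M. \<forall>n. N (\<Gamma> (X n \<omega>) w - \<Gamma> (Xi \<omega>) w) \<le> r (X n \<omega>) (Xi \<omega>) w * N (X n \<omega> - Xi \<omega>)"
    unfolding AE_all_countable using \<Gamma>_contract X_in Xi_in by blast
  then show ?thesis
  proof eventually_elim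
    case (elim w)
    have "(\<lambda>n. X (Suc n) (w ## \<omega>)) \<longlonglongrightarrow> \<Gamma> (Xi \<omega>) w"
    proof (rule tendsto_of_N)
      show "N (X (Suc n) (w ## \<omega>) - \<Gamma> (Xi \<omega>) w) \<le> N (X n \<omega> - Xi \<omega>)" for n
        using elim[rule_format, of n] r_contract[OF N_nonneg, of "X n \<omega>" "Xi \<omega>" w "X n \<omega> - Xi \<omega>"] by simp
      show "(\<lambda>n. N (X n \<omega> - Xi \<omega>)) \<longlonglongrightarrow> 0" by (rule tendsto_N[OF Xi_limit[OF assms]])
    qed
    then show ?case by (intro Xi_eq LIMSEQ_imp_Suc[of "\<lambda>n. X n (w ## \<omega>)"])
  qed
qed

text \<open>The drift condition keeps the expectation of \<open>H\<close> along \<open>X\<close>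
  below a level \<open>B\<close> with \<open>q * B + c \<le> B\<close>, and Fatou's lemma passes to
  the limit.\<close>

lemma H_Xi: "(\<integral>\<^sup>+\<omega>. ennreal (H (Xi \<omega>)) \<partial>\<Omega>) < top"
proof -
  define B where "B = H 0 + c / (1 - q)"
  have B: "0 \<le> B" "H 0 \<le> B" "q * B + c \<le> B"
  proof -
    show "0 \<le> B" "H 0 \<le> B" using H_0 c q by (auto simp: B_def)
    have "q * (c / (1 - q)) + c = c / (1 - q)" using q by (simp add: field_simps)
    moreover have "q * H 0 \<le> H 0" using q H_0[of 0] by (simp add: mult_left_le_one_le)
    ultimately show "q * B + c \<le> B" unfolding B_def distrib_left by linarith
  qed
  have hn: "(\<integral>\<^sup>+\<omega>. ennreal (H (X n \<omega>)) \<partial>\<Omega>) \<le> ennreal B" for n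
  proof (induction n)
    case 0
    then show ?case using B by (simp add: prob_space.emeasure_space_1[OF prob_space_stream_space] ennreal_leI)
  next
    case (Suc n)
    have "(\<integral>\<^sup>+\<omega>. ennreal (H (X (Suc n) \<omega>)) \<partial>\<Omega>) = (\<integral>\<^sup>+\<omega>. (\<integral>\<^sup>+w. ennreal (H (\<Gamma> (X n \<omega>) w)) \<partial>M) \<partial>\<Omega>)"
      by (subst nn_integral_stream_space_swap, measurable, simp?)
    also have "\<dots> \<le> (\<integral>\<^sup>+\<omega>. (ennreal q * ennreal (H (X n \<omega>)) + ennreal c) \<partial>\<Omega>)"
    proof (rule nn_integral_mono)
      fix \<omega>
      have "ennreal (q * H (X n \<omega>) + c) = ennreal q * ennreal (H (X n \<omega>)) + ennreal c"
        using q c H_0 by (simp add: ennreal_mult)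
      then show "(\<integral>\<^sup>+w. ennreal (H (\<Gamma> (X n \<omega>) w)) \<partial>M) \<le> ennreal q * ennreal (H (X n \<omega>)) + ennreal c"
        using drift[OF X_in[of n \<omega>]] by simp
    qed
    also have "\<dots> = ennreal q * (\<integral>\<^sup>+\<omega>. ennreal (H (X n \<omega>)) \<partial>\<Omega>) + ennreal c"
      by (simp add: nn_integral_add nn_integral_cmult prob_space.emeasure_space_1[OF prob_space_stream_space])
    also have "\<dots> \<le> ennreal q * ennreal B + ennreal c" by (intro add_right_mono mult_left_mono Suc) simp
    also have "\<dots> = ennreal (q * B + c)" using q c B by (simp add: ennreal_mult)
    also have "\<dots> \<le> ennreal B" by (intro ennreal_leI B)
    finally show ?case .
  qed
  have "(\<integral>\<^sup>+\<omega>. ennreal (H (Xi \<omega>)) \<partial>\<Omega>) \<le> (\<integral>\<^sup>+\<omega>. liminf (\<lambda>n. ennreal (H (X n \<omega>))) \<partial>\<Omega>)"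
  proof (rule nn_integral_mono_AE)
    show "AE \<omega> in \<Omega>. ennreal (H (Xi \<omega>)) \<le> liminf (\<lambda>n. ennreal (H (X n \<omega>)))"
      using X_convergent
    proof eventually_elim
      case (elim \<omega>)
      have "isCont H (Xi \<omega>)" using H_cont by (simp add: continuous_on_eq_continuous_at)
      then have "(\<lambda>n. ennreal (H (X n \<omega>))) \<longlonglongrightarrow> ennreal (H (Xi \<omega>))"
        by (intro tendsto_ennrealI isCont_tendsto_compose[OF _ Xi_limit[OF elim]])
      then have "liminf (\<lambda>n. ennreal (H (X n \<omega>))) = ennreal (H (Xi \<omega>))" by (intro lim_imp_Liminf) auto
      then show ?case by simp
    qed
  qed
  also have "\<dots> \<le> liminf (\<lambda>n. \<integral>\<^sup>+\<omega>. ennreal (H (X n \<omega>)) \<partial>\<Omega>)" by (rule nn_integral_liminf) measurable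
  also have "\<dots> \<le> ennreal B" by (rule Liminf_le) (use hn in auto)
  finally show ?thesis using le_less_trans by fastforce
qed

text \<open>Iterated along the stationary \<open>Xi\<close> and not along \<open>X\<close>:
  successive iterates then almost surely share their first component, so the contraction in the
  second component applies.\<close>

primrec Y :: "nat \<Rightarrow> 'w stream \<Rightarrow> 'a" where
  "Y 0 \<omega> = 0"
| "Y (Suc n) \<omega> = \<Delta> (Xi (stl \<omega>)) (Y n (stl \<omega>)) (shd \<omega>)"

lemma Y_measurable [measurable]: "Y n \<in> borel_measurable \<Omega>"
proof (induction n)
  case (Suc n)
  note [measurable] = Suc
  show ?case unfolding Y.simps[abs_def] by measurable
qed simp

definition Yi :: "'w stream \<Rightarrow> 'a" where "Yi \<omega> = (if convergent (\<lambda>n. Y n \<omega>) then lim (\<lambda>n. Y n \<omega>) else 0)"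

lemma Yi_limit: "convergent (\<lambda>n. Y n \<omega>) \<Longrightarrow> (\<lambda>n. Y n \<omega>) \<longlonglongrightarrow> Yi \<omega>"
  by (simp add: Yi_def convergent_LIMSEQ_iff)

lemma Yi_eq: "(\<lambda>n. Y n \<omega>) \<longlonglongrightarrow> x \<Longrightarrow> Yi \<omega> = x"
  unfolding Yi_def by (auto simp: limI convergent_def)

lemma Yi_measurable [measurable]: "Yi \<in> borel_measurable \<Omega>"
proof -
  have "{\<omega> \<in> space \<Omega>. convergent (\<lambda>n. Y n \<omega>)} \<in> sets \<Omega>"
    by (simp add: Cauchy_convergent_iff[symmetric]) measurable
  then have [measurable]: "Measurable.pred \<Omega> (\<lambda>\<omega>. convergent (\<lambda>n. Y n \<omega>))" by (simp add: pred_def)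
  show ?thesis unfolding Yi_def[abs_def] by measurable
qed

lemma AE_stream_swap:
  assumes [measurable]: "Measurable.pred \<Omega> P" and "AE \<omega> in \<Omega>. AE w in M. P (w ## \<omega>)"
  shows "AE \<omega> in \<Omega>. P \<omega>"
proof -
  have "(\<integral>\<^sup>+\<omega>. indicator {\<omega> \<in> space \<Omega>. \<not> P \<omega>} \<omega> \<partial>\<Omega>) = (\<integral>\<^sup>+\<omega>. (\<integral>\<^sup>+w. indicator {\<omega> \<in> space \<Omega>. \<not> P \<omega>} (w ## \<omega>) \<partial>M) \<partial>\<Omega>)"
    by (rule nn_integral_stream_space_swap) measurable
  also have "\<dots> = (\<integral>\<^sup>+\<omega>. 0 \<partial>\<Omega>)"
  proof (rule nn_integral_cong_AE)
    show "AE \<omega> in \<Omega>. (\<integral>\<^sup>+w. indicator {\<omega> \<in> space \<Omega>. \<not> P \<omega>} (w ## \<omega>) \<partial>M) = 0"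
      using assms(2)
    proof eventually_elim
      case (elim \<omega>)
      have "(\<integral>\<^sup>+w. indicator {\<omega> \<in> space \<Omega>. \<not> P \<omega>} (w ## \<omega>) \<partial>M) = (\<integral>\<^sup>+w. 0 \<partial>M)"
        by (rule nn_integral_cong_AE) (use elim in \<open>eventually_elim, simp\<close>)
      then show ?case by simp
    qed
  qed
  finally have "emeasure \<Omega> {\<omega> \<in> space \<Omega>. \<not> P \<omega>} = 0" by (simp add: nn_integral_indicator)
  then show ?thesis by (subst AE_iff_measurable[OF _ refl]) auto
qed

lemma Y_in: "AE \<omega> in \<Omega>. \<forall>n. (Xi \<omega>, Y n \<omega>) \<in> J"
proof -
  have meas: "Measurable.pred \<Omega> (\<lambda>\<omega>. (Xi \<omega>, Y n \<omega>) \<in> J)" for n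
    by (rule pred_sets2[OF J_sets]) measurable
  have "AE \<omega> in \<Omega>. (Xi \<omega>, Y n \<omega>) \<in> J" for n
  proof (cases n)
    case 0 then show ?thesis by (simp add: J_0 Xi_in)
  next
    case (Suc k)
    show ?thesis
    proof (rule AE_stream_swap[OF meas])
      show "AE \<omega> in \<Omega>. AE w in M. (Xi (w ## \<omega>), Y n (w ## \<omega>)) \<in> J"
        using X_convergent
      proof eventually_elim
        case (elim \<omega>)
        from Xi_step[OF elim] show ?case by eventually_elim (simp add: Suc step_in_J)
      qed
    qed
  qed
  then show ?thesis by (simp add: AE_all_countable)
qed

lemma single_weight_step:
  assumes "(x, y) \<in> J" "(x, y') \<in> J"
  shows "(\<integral>\<^sup>+w. ennreal (N (\<Delta> x y w - \<Delta> x y' w) * U (\<Gamma> x w)) \<partial>M) \<le> ennreal \<rho> * ennreal (N (y - y') * U x)"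
proof -
  have "(\<integral>\<^sup>+w. ennreal (N (\<Delta> x y w - \<Delta> x y' w) * U (\<Gamma> x w)) \<partial>M) \<le> (\<integral>\<^sup>+w. ennreal (N (y - y')) * ennreal (r x x w * U (\<Gamma> x w)) \<partial>M)"
  proof (rule nn_integral_mono_AE)
    show "AE w in M. ennreal (N (\<Delta> x y w - \<Delta> x y' w) * U (\<Gamma> x w)) \<le> ennreal (N (y - y')) * ennreal (r x x w * U (\<Gamma> x w))"
      using \<Delta>_contract[OF assms]
    proof eventually_elim
      case (elim w)
      have "N (\<Delta> x y w - \<Delta> x y' w) * U (\<Gamma> x w) \<le> (r x x w * N (y - y')) * U (\<Gamma> x w)"
        by (rule mult_right_mono[OF elim U_pos])
      also have "\<dots> = N (y - y') * (r x x w * U (\<Gamma> x w))" by simp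
      finally show ?case unfolding ennreal_mult'[OF N_nonneg, symmetric] by (rule ennreal_leI)
    qed
  qed
  also have "\<dots> = ennreal (N (y - y')) * (\<integral>\<^sup>+w. ennreal (r x x w * U (\<Gamma> x w)) \<partial>M)"
    by (rule nn_integral_cmult) measurable
  also have "\<dots> \<le> ennreal (N (y - y')) * ennreal (\<rho> * U x)" by (intro mult_left_mono weight_single J_G[OF assms(1)]) auto
  also have "\<dots> = ennreal \<rho> * ennreal (N (y - y') * U x)"
    by (rule ennreal_swap[OF N_nonneg \<rho>(1)])
  finally show ?thesis .
qed

text \<open>The argument for \<open>X\<close> with the single weight \<open>U (Xi \<omega>)\<close>.
  The first distance now starts from a random state and is finite because
  \<open>H (Xi \<omega>)\<close> is integrable.\<close>

lemma Y_convergent: "AE \<omega> in \<Omega>. convergent (\<lambda>n. Y n \<omega>)"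
proof -
  define f where "f n = (\<integral>\<^sup>+\<omega>. ennreal (N (Y (Suc n) \<omega> - Y n \<omega>) * U (Xi \<omega>)) \<partial>\<Omega>)" for n
  have step: "f (Suc n) \<le> ennreal \<rho> * f n" for n
  proof -
    have "f (Suc n) = (\<integral>\<^sup>+\<omega>. (\<integral>\<^sup>+w. ennreal (N (\<Delta> (Xi \<omega>) (Y (Suc n) \<omega>) w - \<Delta> (Xi \<omega>) (Y n \<omega>) w) * U (Xi (w ## \<omega>))) \<partial>M) \<partial>\<Omega>)"
      unfolding f_def by (subst nn_integral_stream_space_swap, measurable, simp?)
    also have "\<dots> \<le> (\<integral>\<^sup>+\<omega>. ennreal \<rho> * ennreal (N (Y (Suc n) \<omega> - Y n \<omega>) * U (Xi \<omega>)) \<partial>\<Omega>)"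
    proof (rule nn_integral_mono_AE)
      show "AE \<omega> in \<Omega>. (\<integral>\<^sup>+w. ennreal (N (\<Delta> (Xi \<omega>) (Y (Suc n) \<omega>) w - \<Delta> (Xi \<omega>) (Y n \<omega>) w) * U (Xi (w ## \<omega>))) \<partial>M)
        \<le> ennreal \<rho> * ennreal (N (Y (Suc n) \<omega> - Y n \<omega>) * U (Xi \<omega>))"
        using X_convergent Y_in
      proof eventually_elim
        case (elim \<omega>)
        have "(\<integral>\<^sup>+w. ennreal (N (\<Delta> (Xi \<omega>) (Y (Suc n) \<omega>) w - \<Delta> (Xi \<omega>) (Y n \<omega>) w) * U (Xi (w ## \<omega>))) \<partial>M)
          = (\<integral>\<^sup>+w. ennreal (N (\<Delta> (Xi \<omega>) (Y (Suc n) \<omega>) w - \<Delta> (Xi \<omega>) (Y n \<omega>) w) * U (\<Gamma> (Xi \<omega>) w)) \<partial>M)"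
          by (rule nn_integral_cong_AE) (use Xi_step[OF elim(1)] in \<open>eventually_elim, simp\<close>)
        also have "\<dots> \<le> ennreal \<rho> * ennreal (N (Y (Suc n) \<omega> - Y n \<omega>) * U (Xi \<omega>))"
          by (intro single_weight_step elim(2)[rule_format])
        finally show ?case .
      qed
    qed
    also have "\<dots> = ennreal \<rho> * f n" unfolding f_def by (rule nn_integral_cmult) measurable
    finally show ?thesis .
  qed
  have "f 0 = (\<integral>\<^sup>+\<omega>. (\<integral>\<^sup>+w. ennreal (N (\<Delta> (Xi \<omega>) 0 w) * U (Xi (w ## \<omega>))) \<partial>M) \<partial>\<Omega>)"
    unfolding f_def by (subst nn_integral_stream_space_swap, measurable, simp?)
  also have "\<dots> \<le> (\<integral>\<^sup>+\<omega>. ennreal (H (Xi \<omega>)) \<partial>\<Omega>)"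
  proof (rule nn_integral_mono_AE)
    show "AE \<omega> in \<Omega>. (\<integral>\<^sup>+w. ennreal (N (\<Delta> (Xi \<omega>) 0 w) * U (Xi (w ## \<omega>))) \<partial>M) \<le> ennreal (H (Xi \<omega>))"
      using X_convergent
    proof eventually_elim
      case (elim \<omega>)
      have "(\<integral>\<^sup>+w. ennreal (N (\<Delta> (Xi \<omega>) 0 w) * U (Xi (w ## \<omega>))) \<partial>M) \<le>
        (\<integral>\<^sup>+w. ennreal ((N (\<Gamma> (Xi \<omega>) w - Xi \<omega>) + N (\<Delta> (Xi \<omega>) 0 w)) * U (\<Gamma> (Xi \<omega>) w)) \<partial>M)"
      proof (rule nn_integral_mono_AE)
        show "AE w in M. ennreal (N (\<Delta> (Xi \<omega>) 0 w) * U (Xi (w ## \<omega>))) \<le> ennreal ((N (\<Gamma> (Xi \<omega>) w - Xi \<omega>) + N (\<Delta> (Xi \<omega>) 0 w)) * U (\<Gamma> (Xi \<omega>) w))"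
          using Xi_step[OF elim] by eventually_elim (auto intro!: ennreal_leI mult_right_mono simp: N_nonneg U_pos)
      qed
      also have "\<dots> \<le> ennreal (H (Xi \<omega>))" by (rule moment[OF Xi_in])
      finally show ?case .
    qed
  qed
  finally have f0: "f 0 < top" using H_Xi by (rule le_less_trans)
  have fn: "f n \<le> f 0 * ennreal (\<rho> ^ n)" for n
  proof (induction n)
    case (Suc n)
    have "f (Suc n) \<le> ennreal \<rho> * (f 0 * ennreal (\<rho> ^ n))"
      by (rule order_trans[OF step mult_left_mono[OF Suc]]) simp
    then show ?case using \<rho> by (simp add: ennreal_mult mult_ac)
  qed simp
  show ?thesis
  proof (rule AE_convergent_of_geometric[where c="ennreal (2 * CN) * f 0", OF _ _ _ \<rho>])
    fix n
    have "(\<integral>\<^sup>+\<omega>. ennreal (norm (Y (Suc n) \<omega> - Y n \<omega>)) \<partial>\<Omega>) \<le>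
      (\<integral>\<^sup>+\<omega>. ennreal (2 * CN) * ennreal (N (Y (Suc n) \<omega> - Y n \<omega>) * U (Xi \<omega>)) \<partial>\<Omega>)"
    proof (rule nn_integral_mono)
      fix \<omega>
      have "norm (Y (Suc n) \<omega> - Y n \<omega>) \<le> CN * N (Y (Suc n) \<omega> - Y n \<omega>)" by (rule norm_le)
      also have "\<dots> * 1 \<le> CN * N (Y (Suc n) \<omega> - Y n \<omega>) * (2 * U (Xi \<omega>))"
        using CN N_nonneg U_ge[of "Xi \<omega>"] by (intro mult_left_mono) auto
      finally show "ennreal (norm (Y (Suc n) \<omega> - Y n \<omega>)) \<le> ennreal (2 * CN) * ennreal (N (Y (Suc n) \<omega> - Y n \<omega>) * U (Xi \<omega>))"
        using CN by (subst ennreal_mult'[symmetric]) (auto intro!: ennreal_leI simp: mult_ac)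
    qed
    also have "\<dots> = ennreal (2 * CN) * f n" unfolding f_def by (rule nn_integral_cmult) measurable
    also have "\<dots> \<le> ennreal (2 * CN) * (f 0 * ennreal (\<rho> ^ n))" by (intro mult_left_mono fn) simp
    finally show "(\<integral>\<^sup>+\<omega>. ennreal (norm (Y (Suc n) \<omega> - Y n \<omega>)) \<partial>\<Omega>) \<le> ennreal (2 * CN) * f 0 * ennreal (\<rho> ^ n)" by (simp add: mult.assoc)
    show "ennreal (2 * CN) * f 0 < top" using f0 by (simp add: ennreal_mult_less_top)
  qed simp
qed

lemma Yi_in: "AE \<omega> in \<Omega>. (Xi \<omega>, Yi \<omega>) \<in> J"
  using Y_convergent Y_in
proof eventually_elim
  case (elim \<omega>)
  have "Yi \<omega> \<in> {y. (Xi \<omega>, y) \<in> J}"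
    by (rule closed_sequentially[OF J_closed _ Yi_limit[OF elim(1)]]) (use elim in simp)
  then show ?case by simp
qed

lemma Yi_step:
  assumes "convergent (\<lambda>n. Y n \<omega>)" "\<forall>n. (Xi \<omega>, Y n \<omega>) \<in> J" "(Xi \<omega>, Yi \<omega>) \<in> J"
  shows "AE w in M. Yi (w ## \<omega>) = \<Delta> (Xi \<omega>) (Yi \<omega>) w"
proof -
  have "AE w in M. \<forall>n. N (\<Delta> (Xi \<omega>) (Y n \<omega>) w - \<Delta> (Xi \<omega>) (Yi \<omega>) w) \<le> r (Xi \<omega>) (Xi \<omega>) w * N (Y n \<omega> - Yi \<omega>)"
    unfolding AE_all_countable using \<Delta>_contract assms(2,3) by blast
  then show ?thesis
  proof eventually_elim
    case (elim w)
    have "(\<lambda>n. Y (Suc n) (w ## \<omega>)) \<longlonglongrightarrow> \<Delta> (Xi \<omega>) (Yi \<omega>) w"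
    proof (rule tendsto_of_N)
      show "N (Y (Suc n) (w ## \<omega>) - \<Delta> (Xi \<omega>) (Yi \<omega>) w) \<le> N (Y n \<omega> - Yi \<omega>)" for n
        using elim[rule_format, of n] r_contract[OF N_nonneg, of "Xi \<omega>" "Xi \<omega>" w "Y n \<omega> - Yi \<omega>"] by simp
      show "(\<lambda>n. N (Y n \<omega> - Yi \<omega>)) \<longlonglongrightarrow> 0" by (rule tendsto_N[OF Yi_limit[OF assms(1)]])
    qed
    then show ?case by (intro Yi_eq LIMSEQ_imp_Suc[of "\<lambda>n. Y n (w ## \<omega>)"])
  qed
qed

text \<open>Formulated on the whole space, with \<open>J\<close> of full measure, so that the
  restricted sigma-algebra of the joint space enters only at the very end.\<close>

definition invariant :: "('a \<times> 'a) measure \<Rightarrow> bool" where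
  "invariant \<mu> \<longleftrightarrow> prob_space \<mu> \<and> sets \<mu> = sets borel \<and> (AE \<xi> in \<mu>. \<xi> \<in> J) \<and>
    (\<forall>f\<in>borel_measurable borel. (\<integral>\<^sup>+\<xi>. f \<xi> \<partial>\<mu>) = (\<integral>\<^sup>+\<xi>. (\<integral>\<^sup>+w. f (\<Gamma> (fst \<xi>) w, \<Delta> (fst \<xi>) (snd \<xi>) w) \<partial>M) \<partial>\<mu>))"

lemma step_measurable: "(\<lambda>p. (\<Gamma> (fst (fst p)) (snd p), \<Delta> (fst (fst p)) (snd (fst p)) (snd p))) \<in> borel_measurable (borel \<Otimes>\<^sub>M M)"
  unfolding borel_prod[symmetric] by measurable

lemma kernel_measurable:
  assumes [measurable]: "f \<in> borel_measurable borel"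
  shows "(\<lambda>\<xi>. \<integral>\<^sup>+w. f (\<Gamma> (fst \<xi>) w, \<Delta> (fst \<xi>) (snd \<xi>) w) \<partial>M) \<in> borel_measurable (borel :: ('a \<times> 'a) measure)"
  by (rule borel_measurable_nn_integral) (use measurable_compose[OF step_measurable assms] in \<open>simp add: split_def\<close>)

lemma invariant_exists: "\<exists>\<mu>. invariant \<mu>"
proof
  define \<mu> where "\<mu> = distr \<Omega> borel (\<lambda>\<omega>. (Xi \<omega>, Yi \<omega>))"
  interpret S: prob_space \<Omega> by (rule prob_space_stream_space)
  have XY[measurable]: "(\<lambda>\<omega>. (Xi \<omega>, Yi \<omega>)) \<in> borel_measurable \<Omega>" by (rule borel_measurable_Pair) measurable
  show "invariant \<mu>" unfolding invariant_def
  proof (intro conjI ballI)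
    show "prob_space \<mu>" unfolding \<mu>_def by (rule S.prob_space_distr) measurable
    show "sets \<mu> = sets borel" by (simp add: \<mu>_def)
    show "AE \<xi> in \<mu>. \<xi> \<in> J" unfolding \<mu>_def
      by (subst AE_distr_iff) (use Yi_in J_borel in auto)
    fix f :: "'a \<times> 'a \<Rightarrow> ennreal" assume f[measurable]: "f \<in> borel_measurable borel"
    have "(\<integral>\<^sup>+\<xi>. f \<xi> \<partial>\<mu>) = (\<integral>\<^sup>+\<omega>. f (Xi \<omega>, Yi \<omega>) \<partial>\<Omega>)" unfolding \<mu>_def by (rule nn_integral_distr) measurable
    also have "\<dots> = (\<integral>\<^sup>+\<omega>. (\<integral>\<^sup>+w. f (Xi (w ## \<omega>), Yi (w ## \<omega>)) \<partial>M) \<partial>\<Omega>)"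
      by (rule nn_integral_stream_space_swap) measurable
    also have "\<dots> = (\<integral>\<^sup>+\<omega>. (\<integral>\<^sup>+w. f (\<Gamma> (Xi \<omega>) w, \<Delta> (Xi \<omega>) (Yi \<omega>) w) \<partial>M) \<partial>\<Omega>)"
    proof (rule nn_integral_cong_AE)
      show "AE \<omega> in \<Omega>. (\<integral>\<^sup>+w. f (Xi (w ## \<omega>), Yi (w ## \<omega>)) \<partial>M) = (\<integral>\<^sup>+w. f (\<Gamma> (Xi \<omega>) w, \<Delta> (Xi \<omega>) (Yi \<omega>) w) \<partial>M)"
        using X_convergent Y_convergent Y_in Yi_in
      proof eventually_elim
        case (elim \<omega>)
        show ?case
        proof (rule nn_integral_cong_AE)
          show "AE w in M. f (Xi (w ## \<omega>), Yi (w ## \<omega>)) = f (\<Gamma> (Xi \<omega>) w, \<Delta> (Xi \<omega>) (Yi \<omega>) w)"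
            using Xi_step[OF elim(1)] Yi_step[OF elim(2,3,4)] by eventually_elim simp
        qed
      qed
    qed
    also have "\<dots> = (\<integral>\<^sup>+\<xi>. (\<integral>\<^sup>+w. f (\<Gamma> (fst \<xi>) w, \<Delta> (fst \<xi>) (snd \<xi>) w) \<partial>M) \<partial>\<mu>)"
      unfolding \<mu>_def by (subst nn_integral_distr[OF XY]) (use kernel_measurable[OF f] in auto)
    finally show "(\<integral>\<^sup>+\<xi>. f \<xi> \<partial>\<mu>) = (\<integral>\<^sup>+\<xi>. (\<integral>\<^sup>+w. f (\<Gamma> (fst \<xi>) w, \<Delta> (fst \<xi>) (snd \<xi>) w) \<partial>M) \<partial>\<mu>)" .
  qed
qed

section \<open>Uniqueness of the invariant law\<close>

definition kernel :: "('a \<times> 'a \<Rightarrow> real) \<Rightarrow> 'a \<times> 'a \<Rightarrow> real" where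
  "kernel f \<xi> = (\<integral>w. f (\<Gamma> (fst \<xi>) w, \<Delta> (fst \<xi>) (snd \<xi>) w) \<partial>M)"

definition test :: "('a \<times> 'a \<Rightarrow> real) \<Rightarrow> bool" where
  "test f \<longleftrightarrow> f \<in> borel_measurable borel \<and> (\<forall>\<xi>. 0 \<le> f \<xi> \<and> f \<xi> \<le> 1)"

lemma step_section_measurable:
  assumes "f \<in> borel_measurable borel"
  shows "(\<lambda>w. f (\<Gamma> x w, \<Delta> x y w)) \<in> borel_measurable M"
  by (rule measurable_compose[OF _ assms]) (intro borel_measurable_Pair measurable_\<Gamma> measurable_\<Delta> measurable_const measurable_ident_sets; simp)

lemma test_integrable:
  assumes "test f" shows "integrable M (\<lambda>w. f (\<Gamma> x w, \<Delta> x y w))"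
  using assms by (intro integrable_const_bound[where B=1] step_section_measurable) (auto simp: test_def)

lemma nn_integral_kernel:
  assumes "test f"
  shows "(\<integral>\<^sup>+w. ennreal (f (\<Gamma> (fst \<xi>) w, \<Delta> (fst \<xi>) (snd \<xi>) w)) \<partial>M) = ennreal (kernel f \<xi>)"
  unfolding kernel_def using assms by (intro nn_integral_eq_integral test_integrable) (auto simp: test_def)

lemma kernel_test: assumes "test f" shows "test (kernel f)"
  unfolding test_def
proof (intro conjI allI)
  fix \<xi>
  show "0 \<le> kernel f \<xi>" unfolding kernel_def using assms by (intro integral_nonneg_AE) (auto simp: test_def)
  have "kernel f \<xi> \<le> (\<integral>w. 1 \<partial>M)"
    unfolding kernel_def using assms by (intro integral_mono test_integrable) (auto simp: test_def)
  then show "kernel f \<xi> \<le> 1" by (simp add: prob_space)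
next
  have [measurable]: "f \<in> borel_measurable borel" using assms by (simp add: test_def)
  have "kernel f = (\<lambda>\<xi>. enn2real (\<integral>\<^sup>+w. ennreal (f (\<Gamma> (fst \<xi>) w, \<Delta> (fst \<xi>) (snd \<xi>) w)) \<partial>M))"
    unfolding nn_integral_kernel[OF assms] using assms by (auto simp: kernel_def test_def intro!: integral_nonneg_AE)
  also have "\<dots> \<in> borel_measurable borel"
    by (intro measurable_compose[OF kernel_measurable[where f="\<lambda>p. ennreal (f p)"] borel_measurable_enn2real]) measurable
  finally show "kernel f \<in> borel_measurable borel" .
qed

lemma kernel_iterate_test: "test f \<Longrightarrow> test ((kernel ^^ n) f)"
  by (induction n) (auto intro: kernel_test)

lemma invariant_kernel:
  assumes \<mu>: "invariant \<mu>" and f: "test f" shows "integral\<^sup>L \<mu> (kernel f) = integral\<^sup>L \<mu> f"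
proof -
  have [measurable_cong]: "sets \<mu> = sets borel" using \<mu> by (simp add: invariant_def)
  have [measurable]: "f \<in> borel_measurable borel" "kernel f \<in> borel_measurable borel"
    using f kernel_test[OF f] by (auto simp: test_def)
  have "(\<integral>\<^sup>+\<xi>. ennreal (f \<xi>) \<partial>\<mu>) = (\<integral>\<^sup>+\<xi>. ennreal (kernel f \<xi>) \<partial>\<mu>)"
  proof -
    have "(\<lambda>\<xi>. ennreal (f \<xi>)) \<in> borel_measurable borel" by measurable
    then show ?thesis using \<mu> unfolding invariant_def nn_integral_kernel[OF f, symmetric] by blast
  qed
  then show ?thesis
    using f kernel_test[OF f] by (subst (1 2) integral_eq_nn_integral) (auto simp: test_def)
qed

lemma invariant_iterate:
  assumes "invariant \<mu>" "test f" shows "integral\<^sup>L \<mu> ((kernel ^^ n) f) = integral\<^sup>L \<mu> f"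
  using assms by (induction n) (auto simp: invariant_kernel kernel_iterate_test)

text \<open>The induction step common to the two iteration bounds below: if the mean of the weighted
  distance shrinks by \<open>\<rho>\<close>, then so does the Lipschitz bound of the
  function.\<close>

lemma kernel_diff:
  assumes f: "test f" and c: "0 \<le> k"
    and le: "\<And>w. \<bar>f (\<Gamma> x w, \<Delta> x y w) - f (\<Gamma> x' w, \<Delta> x' y' w)\<bar> \<le> k * h w"
    and h: "h \<in> borel_measurable M" "(\<integral>\<^sup>+w. ennreal (h w) \<partial>M) \<le> ennreal \<rho> * ennreal b" and b: "0 \<le> b"
  shows "\<bar>kernel f (x, y) - kernel f (x', y')\<bar> \<le> \<rho> * k * b"
proof -
  let ?g = "\<lambda>w. f (\<Gamma> x w, \<Delta> x y w) - f (\<Gamma> x' w, \<Delta> x' y' w)"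
  have "kernel f (x, y) - kernel f (x', y') = (\<integral>w. ?g w \<partial>M)"
    unfolding kernel_def by (simp add: test_integrable[OF f])
  then have "ennreal \<bar>kernel f (x, y) - kernel f (x', y')\<bar> \<le> (\<integral>\<^sup>+w. ennreal \<bar>?g w\<bar> \<partial>M)"
    using integral_norm_bound_ennreal[of M ?g] test_integrable[OF f] by simp
  also have "\<dots> \<le> (\<integral>\<^sup>+w. ennreal k * ennreal (h w) \<partial>M)"
    unfolding ennreal_mult'[OF c, symmetric] by (intro nn_integral_mono ennreal_leI le)
  also have "\<dots> = ennreal k * (\<integral>\<^sup>+w. ennreal (h w) \<partial>M)" by (rule nn_integral_cmult) (use h in simp)
  also have "\<dots> \<le> ennreal k * (ennreal \<rho> * ennreal b)" by (intro mult_left_mono h) simp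
  also have "\<dots> = ennreal (\<rho> * k * b)" using c \<rho> b by (simp add: ennreal_mult mult_ac)
  finally show ?thesis using c \<rho> b by simp
qed

text \<open>Since \<open>N 0 = 0\<close>, the assumption makes \<open>f\<close> independent of the
  second component on \<open>J\<close>. The kernel preserves this because \<open>\<Gamma>\<close>
  moves the first component on its own.\<close>

lemma iterate_pair:
  assumes f: "test f" and k: "0 \<le> k"
    and le: "\<And>x y x' y'. (x, y) \<in> J \<Longrightarrow> (x', y') \<in> J \<Longrightarrow> \<bar>f (x, y) - f (x', y')\<bar> \<le> k * (N (x - x') * (U x + U x'))"
  shows "(x, y) \<in> J \<Longrightarrow> (x', y') \<in> J \<Longrightarrow>
    \<bar>(kernel ^^ n) f (x, y) - (kernel ^^ n) f (x', y')\<bar> \<le> \<rho> ^ n * k * (N (x - x') * (U x + U x'))"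
proof (induction n arbitrary: x y x' y')
  case (Suc n)
  have "\<bar>kernel ((kernel ^^ n) f) (x, y) - kernel ((kernel ^^ n) f) (x', y')\<bar> \<le> \<rho> * (\<rho> ^ n * k) * (N (x - x') * (U x + U x'))"
  proof (rule kernel_diff[OF kernel_iterate_test[OF f]])
    show "\<bar>(kernel ^^ n) f (\<Gamma> x w, \<Delta> x y w) - (kernel ^^ n) f (\<Gamma> x' w, \<Delta> x' y' w)\<bar>
      \<le> \<rho> ^ n * k * (N (\<Gamma> x w - \<Gamma> x' w) * (U (\<Gamma> x w) + U (\<Gamma> x' w)))" for w
      by (intro Suc.IH step_in_J)
    show "(\<integral>\<^sup>+w. ennreal (N (\<Gamma> x w - \<Gamma> x' w) * (U (\<Gamma> x w) + U (\<Gamma> x' w))) \<partial>M) \<le> ennreal \<rho> * ennreal (N (x - x') * (U x + U x'))"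
      by (intro pair_weight_step J_G[OF Suc.prems(1)] J_G[OF Suc.prems(2)])
  qed (use k \<rho> N_nonneg U_pos in \<open>auto intro!: mult_nonneg_nonneg add_nonneg_nonneg\<close>)
  then show ?case by (simp add: mult.assoc)
qed (use le in simp)

lemma iterate_single:
  assumes f: "test f" and k: "0 \<le> k"
    and le: "\<And>x y y'. (x, y) \<in> J \<Longrightarrow> (x, y') \<in> J \<Longrightarrow> \<bar>f (x, y) - f (x, y')\<bar> \<le> k * (N (y - y') * U x)"
  shows "(x, y) \<in> J \<Longrightarrow> (x, y') \<in> J \<Longrightarrow>
    \<bar>(kernel ^^ n) f (x, y) - (kernel ^^ n) f (x, y')\<bar> \<le> \<rho> ^ n * k * (N (y - y') * U x)"
proof (induction n arbitrary: x y y')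
  case (Suc n)
  have "\<bar>kernel ((kernel ^^ n) f) (x, y) - kernel ((kernel ^^ n) f) (x, y')\<bar> \<le> \<rho> * (\<rho> ^ n * k) * (N (y - y') * U x)"
  proof (rule kernel_diff[OF kernel_iterate_test[OF f]])
    show "\<bar>(kernel ^^ n) f (\<Gamma> x w, \<Delta> x y w) - (kernel ^^ n) f (\<Gamma> x w, \<Delta> x y' w)\<bar>
      \<le> \<rho> ^ n * k * (N (\<Delta> x y w - \<Delta> x y' w) * U (\<Gamma> x w))" for w
      by (intro Suc.IH step_in_J)
    show "(\<integral>\<^sup>+w. ennreal (N (\<Delta> x y w - \<Delta> x y' w) * U (\<Gamma> x w)) \<partial>M) \<le> ennreal \<rho> * ennreal (N (y - y') * U x)"
      by (intro single_weight_step Suc.prems)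
  qed (use k \<rho> N_nonneg U_pos in \<open>auto intro!: mult_nonneg_nonneg\<close>)
  then show ?case by (simp add: mult.assoc)
qed (use le in simp)

lemma power_tendsto: "(\<lambda>n. \<rho> ^ n * a) \<longlonglongrightarrow> 0"
  using tendsto_mult_left_zero[OF LIMSEQ_realpow_zero[OF \<rho>], of a] by simp

text \<open>The limit is computed from the state \<open>(0, 0)\<close> and hence is the same for all
  invariant laws. Since \<open>f\<close> is bounded, pointwise decay and dominated convergence are
  enough.\<close>

lemma invariant_pair_limit:
  assumes \<mu>: "invariant \<mu>" and f: "test f" and k: "0 \<le> k"
    and le: "\<And>x y x' y'. (x, y) \<in> J \<Longrightarrow> (x', y') \<in> J \<Longrightarrow> \<bar>f (x, y) - f (x', y')\<bar> \<le> k * (N (x - x') * (U x + U x'))"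
  shows "(\<lambda>n. (kernel ^^ n) f (0, 0)) \<longlonglongrightarrow> integral\<^sup>L \<mu> f"
proof -
  interpret \<mu>: prob_space \<mu> using \<mu> by (simp add: invariant_def)
  have [measurable_cong]: "sets \<mu> = sets borel" using \<mu> by (simp add: invariant_def)
  have fn: "test ((kernel ^^ n) f)" for n by (rule kernel_iterate_test[OF f])
  then have [measurable]: "(kernel ^^ n) f \<in> borel_measurable borel" for n by (simp add: test_def)
  have int: "integrable \<mu> ((kernel ^^ n) f)" for n
    using fn[of n] by (intro \<mu>.integrable_const_bound[where B=1]) (auto simp: test_def)
  have AEJ: "AE \<xi> in \<mu>. \<xi> \<in> J" using \<mu> by (simp add: invariant_def)
  have "(\<lambda>n. \<integral>\<xi>. ((kernel ^^ n) f \<xi> - (kernel ^^ n) f (0, 0)) \<partial>\<mu>) \<longlonglongrightarrow> (\<integral>\<xi>. 0 \<partial>\<mu>)"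
  proof (rule integral_dominated_convergence[where w="\<lambda>_. 1"])
    show "AE \<xi> in \<mu>. (\<lambda>n. (kernel ^^ n) f \<xi> - (kernel ^^ n) f (0, 0)) \<longlonglongrightarrow> 0"
      using AEJ
    proof eventually_elim
      case (elim \<xi>)
      then have J: "(fst \<xi>, snd \<xi>) \<in> J" by simp
      have "\<bar>(kernel ^^ n) f (fst \<xi>, snd \<xi>) - (kernel ^^ n) f (0, 0)\<bar> \<le> \<rho> ^ n * k * (N (fst \<xi> - 0) * (U (fst \<xi>) + U 0))" for n
        by (rule iterate_pair[OF f k le J J_0[OF zero_G]])
      then have "norm ((kernel ^^ n) f \<xi> - (kernel ^^ n) f (0, 0)) \<le> \<rho> ^ n * (k * (N (fst \<xi> - 0) * (U (fst \<xi>) + U 0)))" for n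
        by (simp add: mult.assoc)
      then show ?case by (rule Lim_null_comparison[OF always_eventually[OF allI] power_tendsto])
    qed
    have "\<bar>(kernel ^^ n) f \<xi> - (kernel ^^ n) f (0, 0)\<bar> \<le> 1" for n \<xi>
      using fn[of n] unfolding test_def by (smt (verit))
    then show "AE \<xi> in \<mu>. norm ((kernel ^^ n) f \<xi> - (kernel ^^ n) f (0, 0)) \<le> 1" for n by simp
  qed auto
  moreover have "(\<integral>\<xi>. ((kernel ^^ n) f \<xi> - (kernel ^^ n) f (0, 0)) \<partial>\<mu>) = integral\<^sup>L \<mu> f - (kernel ^^ n) f (0, 0)" for n
    by (simp add: int invariant_iterate[OF \<mu> f] \<mu>.prob_space)
  ultimately have "(\<lambda>n. integral\<^sup>L \<mu> f - (kernel ^^ n) f (0, 0)) \<longlonglongrightarrow> 0" by simp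
  from tendsto_diff[OF tendsto_const[of "integral\<^sup>L \<mu> f"] this] show ?thesis by simp
qed

lemma lipschitz_N:
  fixes g :: "'a \<Rightarrow> real"
  assumes "\<And>x y. \<bar>g x - g y\<bar> \<le> L * dist x y"
  shows "\<bar>g x - g y\<bar> \<le> \<bar>L\<bar> * CN * N (x - y)"
proof -
  have "\<bar>g x - g y\<bar> \<le> \<bar>L\<bar> * dist x y" using assms[of x y] by (smt (verit) mult_right_mono zero_le_dist)
  also have "\<dots> \<le> \<bar>L\<bar> * (CN * N (x - y))" using norm_le[of "x - y"] by (intro mult_left_mono) (auto simp: dist_norm)
  finally show ?thesis by (simp add: mult.assoc)
qed

lemma invariant_marginal:
  assumes "invariant \<mu>" "invariant \<mu>'" shows "distr \<mu> borel fst = distr \<mu>' borel (fst :: 'a \<times> 'a \<Rightarrow> 'a)"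
proof (rule measure_eqI_lipschitz)
  have "sets \<mu> = sets borel" "sets \<mu>' = sets borel" using assms by (simp_all add: invariant_def)
  then have [measurable_cong]: "sets \<mu> = sets (borel \<Otimes>\<^sub>M borel)" "sets \<mu>' = sets (borel \<Otimes>\<^sub>M borel)"
    by (simp_all only: borel_prod)
  show "prob_space (distr \<mu> borel fst)" "prob_space (distr \<mu>' borel fst)"
    using assms by (auto intro!: prob_space.prob_space_distr simp: invariant_def)
  fix g :: "'a \<Rightarrow> real" and L
  assume g[measurable]: "g \<in> borel_measurable borel" and g01: "\<And>x. 0 \<le> g x" "\<And>x. g x \<le> 1"
    and lip: "\<And>x y. \<bar>g x - g y\<bar> \<le> L * dist x y"
  let ?f = "\<lambda>\<xi>. g (fst \<xi>)"
  have f: "test ?f" unfolding test_def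
    using g01 by (auto simp: borel_prod[symmetric])
  have le: "\<bar>?f (x, y) - ?f (x', y')\<bar> \<le> (\<bar>L\<bar> * CN) * (N (x - x') * (U x + U x'))" for x y x' y'
  proof -
    have "\<bar>g x - g x'\<bar> \<le> \<bar>L\<bar> * CN * (N (x - x') * 1)" using lipschitz_N[OF lip] by simp
    also have "\<dots> \<le> \<bar>L\<bar> * CN * (N (x - x') * (U x + U x'))"
    proof (intro mult_left_mono)
      show "1 \<le> U x + U x'" using U_ge[of x] U_ge[of x'] by linarith
    qed (use CN N_nonneg in auto)
    finally show ?thesis by simp
  qed
  have "integral\<^sup>L \<mu> ?f = integral\<^sup>L \<mu>' ?f"
    by (rule LIMSEQ_unique[OF invariant_pair_limit[OF assms(1) f _ le] invariant_pair_limit[OF assms(2) f _ le]]) (use CN in auto)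
  then show "integral\<^sup>L (distr \<mu> borel fst) g = integral\<^sup>L (distr \<mu>' borel fst) g"
    by (simp add: integral_distr)
qed auto

text \<open>Replacing the second component by 0 changes the iterated kernel less and less. So the
  integral of \<open>f\<close> is asymptotically an integral over the first marginal, and the first
  marginals are already known to agree.\<close>

lemma invariant_unique:
  assumes \<mu>: "invariant \<mu>" and \<mu>': "invariant \<mu>'" shows "\<mu> = \<mu>'"
proof (rule measure_eqI_lipschitz)
  show "prob_space \<mu>" "prob_space \<mu>'" "sets \<mu> = sets borel" "sets \<mu>' = sets borel"
    using \<mu> \<mu>' by (simp_all add: invariant_def)
  fix f :: "'a \<times> 'a \<Rightarrow> real" and L
  assume fm[measurable]: "f \<in> borel_measurable borel" and f01: "\<And>x. 0 \<le> f x" "\<And>x. f x \<le> 1"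
    and lip: "\<And>x y. \<bar>f x - f y\<bar> \<le> L * dist x y"
  have f: "test f" using f01 by (simp add: test_def)
  define k where "k = \<bar>L\<bar> * CN * 2"
  have k: "0 \<le> k" using CN by (simp add: k_def)
  have le: "\<bar>f (x, y) - f (x, y')\<bar> \<le> k * (N (y - y') * U x)" for x y y'
  proof -
    have "\<bar>f (x, y) - f (x, y')\<bar> \<le> \<bar>L\<bar> * CN * N (y - y')"
      by (rule lipschitz_N[of "\<lambda>y. f (x, y)" L]) (use lip[of "(x, _)" "(x, _)"] in \<open>simp add: dist_Pair_Pair\<close>)
    also have "\<dots> \<le> \<bar>L\<bar> * CN * N (y - y') * (2 * U x)"
      using mult_left_mono[of 1 "2 * U x" "\<bar>L\<bar> * CN * N (y - y')"] U_ge[of x] CN N_nonneg by simp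
    finally show ?thesis by (simp add: k_def mult_ac)
  qed
  have fn: "test ((kernel ^^ n) f)" for n by (rule kernel_iterate_test[OF f])
  then have fnm[measurable]: "(kernel ^^ n) f \<in> borel_measurable borel" for n by (simp add: test_def)
  have h[measurable]: "(\<lambda>x. (kernel ^^ n) f (x, 0)) \<in> borel_measurable borel" for n
    by (rule measurable_compose[OF _ fnm]) (simp add: borel_prod[symmetric])
  have key: "(\<lambda>n. integral\<^sup>L \<mu> f - integral\<^sup>L (distr \<mu> borel fst) (\<lambda>x. (kernel ^^ n) f (x, 0))) \<longlonglongrightarrow> 0"
    if \<mu>: "invariant \<mu>" for \<mu>
  proof -
    interpret \<mu>: prob_space \<mu> using \<mu> by (simp add: invariant_def)
    have sets: "sets \<mu> = sets borel" using \<mu> by (simp add: invariant_def)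
    have [measurable_cong]: "sets \<mu> = sets (borel \<Otimes>\<^sub>M borel)" by (simp only: sets borel_prod)
    have [measurable]: "(kernel ^^ n) f \<in> borel_measurable \<mu>" for n using fnm by (simp cong: measurable_cong_sets add: sets)
    have int: "integrable \<mu> ((kernel ^^ n) f)" for n
      using fn[of n] by (intro \<mu>.integrable_const_bound[where B=1]) (auto simp: test_def)
    have int0: "integrable \<mu> (\<lambda>\<xi>. (kernel ^^ n) f (fst \<xi>, 0))" for n
      using fn[of n] by (intro \<mu>.integrable_const_bound[where B=1]) (auto simp: test_def)
    have AEJ: "AE \<xi> in \<mu>. \<xi> \<in> J" using \<mu> by (simp add: invariant_def)
    have "(\<lambda>n. \<integral>\<xi>. ((kernel ^^ n) f \<xi> - (kernel ^^ n) f (fst \<xi>, 0)) \<partial>\<mu>) \<longlonglongrightarrow> (\<integral>\<xi>. 0 \<partial>\<mu>)"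
    proof (rule integral_dominated_convergence[where w="\<lambda>_. 1"])
      show "AE \<xi> in \<mu>. (\<lambda>n. (kernel ^^ n) f \<xi> - (kernel ^^ n) f (fst \<xi>, 0)) \<longlonglongrightarrow> 0"
        using AEJ
      proof eventually_elim
        case (elim \<xi>)
        then have J: "(fst \<xi>, snd \<xi>) \<in> J" by simp
        have "\<bar>(kernel ^^ n) f (fst \<xi>, snd \<xi>) - (kernel ^^ n) f (fst \<xi>, 0)\<bar> \<le> \<rho> ^ n * k * (N (snd \<xi> - 0) * U (fst \<xi>))" for n
          by (rule iterate_single[OF f k le J J_0[OF J_G[OF J]]])
        then have "norm ((kernel ^^ n) f \<xi> - (kernel ^^ n) f (fst \<xi>, 0)) \<le> \<rho> ^ n * (k * (N (snd \<xi> - 0) * U (fst \<xi>)))" for n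
          by (simp add: mult.assoc)
        then show ?case by (rule Lim_null_comparison[OF always_eventually[OF allI] power_tendsto])
      qed
      have "\<bar>(kernel ^^ n) f \<xi> - (kernel ^^ n) f (fst \<xi>, 0)\<bar> \<le> 1" for n \<xi>
        using fn[of n] unfolding test_def by (smt (verit))
      then show "AE \<xi> in \<mu>. norm ((kernel ^^ n) f \<xi> - (kernel ^^ n) f (fst \<xi>, 0)) \<le> 1" for n by simp
    qed auto
    moreover have "(\<integral>\<xi>. ((kernel ^^ n) f \<xi> - (kernel ^^ n) f (fst \<xi>, 0)) \<partial>\<mu>) =
      integral\<^sup>L \<mu> f - integral\<^sup>L (distr \<mu> borel fst) (\<lambda>x. (kernel ^^ n) f (x, 0))" for n
      by (simp add: int int0 invariant_iterate[OF \<mu> f] integral_distr)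
    ultimately show ?thesis by simp
  qed
  from tendsto_diff[OF key[OF \<mu>] key[OF \<mu>']]
  have "(\<lambda>n. integral\<^sup>L \<mu> f - integral\<^sup>L \<mu>' f) \<longlonglongrightarrow> 0 - (0 :: real)"
    unfolding invariant_marginal[OF \<mu> \<mu>'] by simp
  then show "integral\<^sup>L \<mu> f = integral\<^sup>L \<mu>' f" by (simp add: LIMSEQ_const_iff)
qed

end

subsection \<open>The joint process as a random iteration\<close>

context rbm_data
begin

lemma greaterThanAtMost_shift: "(\<Union>u\<in>{s + a<..s + e}. f u) = (\<Union>u\<in>{a<..e}. f (s + u))" for s a e :: real
proof -
  have "{s + a<..s + e} = (\<lambda>u. s + u) ` {a<..e}" by simp
  then show ?thesis by (simp only: image_image)
qed

text \<open>The flow property: restarted at \<open>s\<close>, the path solves the same problem with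
  the increments of the noise after \<open>s\<close>.\<close>

lemma skorokhod_shift:
  assumes z: "skorokhod_path (driver x w) z y" and s: "0 \<le> s"
  shows "skorokhod_path (driver (z s) (\<lambda>u. w (s + u) - w s)) (\<lambda>u. z (s + u)) (\<lambda>u. y (s + u) - y s)"
  unfolding skorokhod_path_def
proof (intro conjI allI impI)
  have sh: "continuous_on {0..} (\<lambda>u. s + u)" "(\<lambda>u. s + u) ` {0..} \<subseteq> {0..}" using s by (auto intro!: continuous_intros)
  show "continuous_on {0..} (\<lambda>u. z (s + u))" by (rule continuous_on_compose2[OF skorokhod_pathD(1)[OF z] sh])
  show "continuous_on {0..} (\<lambda>u. y (s + u) - y s)"
    by (intro continuous_intros continuous_on_compose2[OF skorokhod_pathD(2)[OF z] sh])
  show "y (s + 0) - y s = 0" by simp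
  fix t :: real assume t: "0 \<le> t"
  show "z (s + t) \<in> polyhedron_G n" using skorokhod_pathD(4)[OF z, of "s + t"] s t by simp
  have "z (s + t) = driver x w (s + t) + y (s + t)" "z s = driver x w s + y s"
    using skorokhod_pathD(5)[OF z] s t by auto
  then show "z (s + t) = driver (z s) (\<lambda>u. w (s + u) - w s) t + (y (s + t) - y s)"
    by (simp add: driver_def matrix_vector_mult_diff_distrib scaleR_add_left)
next
  fix a t :: real assume at: "0 \<le> a \<and> a < t"
  have "\<forall>s t. 0 \<le> s \<and> s < t \<longrightarrow> y t - y s \<in> fin_cone (\<Union>u\<in>{s<..t}. fin_cone (d ` active n (z u)))"
    using z unfolding skorokhod_path_def by (elim conjE)
  from this[rule_format, of "s + a" "s + t"] at s
  have "y (s + t) - y (s + a) \<in> fin_cone (\<Union>u\<in>{s + a<..s + t}. fin_cone (d ` active n (z u)))" by simp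
  then show "y (s + t) - y s - (y (s + a) - y s) \<in> fin_cone (\<Union>u\<in>{a<..t}. fin_cone (d ` active n (z (s + u))))"
    by (simp add: greaterThanAtMost_shift)
qed

lemma derivative_shift:
  assumes \<phi>: "derivative_path z (ddriver w y) \<phi>" and s: "0 \<le> s"
  shows "derivative_path (\<lambda>u. z (s + u)) (ddriver (\<lambda>u. w (s + u) - w s) (\<lambda>u. y (s + u) - y s)) (\<lambda>u. \<phi> (s + u))"
  unfolding derivative_path_def
proof (intro conjI allI impI ballI)
  fix t :: real assume t: "0 \<le> t"
  have "(\<phi> \<longlongrightarrow> \<phi> (s + t)) (at_right (s + t))" using \<phi> s t by (simp add: derivative_path_def)
  then show "((\<lambda>u. \<phi> (s + u)) \<longlongrightarrow> \<phi> (s + t)) (at_right t)"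
    by (simp add: filterlim_at_right_to_0[of _ _ "s + t"] filterlim_at_right_to_0[of _ _ t] add.assoc add.left_commute add.commute)
  show "\<phi> (s + t) \<bullet> n i = 0" if "i \<in> active n (z (s + t))" for i
    using \<phi> s t that by (simp add: derivative_path_def)
next
  fix a t :: real assume at: "0 \<le> a \<and> a < t"
  then have "\<phi> (s + t) - \<phi> (s + a) - (ddriver w y (s + t) - ddriver w y (s + a)) \<in> span (d ` hits z {s + a<..s + t})"
    using \<phi> s unfolding derivative_path_def by simp
  moreover have "ddriver w y (s + t) - ddriver w y (s + a) =
    ddriver (\<lambda>u. w (s + u) - w s) (\<lambda>u. y (s + u) - y s) t - ddriver (\<lambda>u. w (s + u) - w s) (\<lambda>u. y (s + u) - y s) a"
    by (simp add: ddriver_def matrix_vector_mult_diff_distrib scaleR_add_left)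
  ultimately show "\<phi> (s + t) - \<phi> (s + a) - (ddriver (\<lambda>u. w (s + u) - w s) (\<lambda>u. y (s + u) - y s) t -
      ddriver (\<lambda>u. w (s + u) - w s) (\<lambda>u. y (s + u) - y s) a) \<in> span (d ` hits (\<lambda>u. z (s + u)) {a<..t})"
    by (simp add: hits_def greaterThanAtMost_shift)
qed

end

section \<open>Markov property of the joint process\<close>

locale joint_rbm = rbm_data n d B \<theta> pr b sig b' sig' R' + brownian M F W
  for n d :: "'n::finite \<Rightarrow> real^'n" and B \<theta> pr b sig b' sig' R'
    and M :: "'w measure" and F and W :: "real \<Rightarrow> 'w \<Rightarrow> real^'n" +
  fixes Z Y :: "real^'n \<Rightarrow> real \<Rightarrow> 'w \<Rightarrow> real^'n" and D :: "(real^'n) \<times> (real^'n) \<Rightarrow> real \<Rightarrow> 'w \<Rightarrow> real^'n"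
  assumes Z_path: "\<And>x. x \<in> polyhedron_G n \<Longrightarrow>
      AE \<omega> in M. skorokhod_path (driver x (\<lambda>t. W t \<omega>)) (\<lambda>t. Z x t \<omega>) (\<lambda>t. Y x t \<omega>)"
    and Z_adapted: "\<And>x t. x \<in> polyhedron_G n \<Longrightarrow> 0 \<le> t \<Longrightarrow> Z x t \<in> borel_measurable (F t)"
    and D_path: "\<And>x y. (x, y) \<in> joint_space n \<Longrightarrow> AE \<omega> in M.
      derivative_path (\<lambda>t. Z x t \<omega>) (ddriver (\<lambda>t. W t \<omega>) (\<lambda>t. Y x t \<omega>)) (\<lambda>t. D (x, y) t \<omega>) \<and> D (x, y) 0 \<omega> = y"
    and D_adapted: "\<And>x y t. (x, y) \<in> joint_space n \<Longrightarrow> 0 \<le> t \<Longrightarrow> D (x, y) t \<in> borel_measurable (F t)"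
begin

text \<open>\<open>zs\<close> and \<open>ds\<close> are measurable in initial state and noise
  together, and by \<open>rep\<close> they agree with \<open>Z\<close> and \<open>D\<close> almost
  surely for each single initial state. Integrals over the initial state are formed with
  them.\<close>

definition zs :: "real \<Rightarrow> real^'n \<Rightarrow> 'w \<Rightarrow> real^'n" where "zs t x \<omega> = zstep t x (wgrid 0 t \<omega>)"

definition ds :: "real \<Rightarrow> real^'n \<Rightarrow> real^'n \<Rightarrow> 'w \<Rightarrow> real^'n" where "ds t x y \<omega> = dstep t x y (wgrid 0 t \<omega>)"

lemma joint_G: "(x, y) \<in> joint_space n \<Longrightarrow> x \<in> polyhedron_G n" by (simp add: joint_iff)

lemma joint_0: "x \<in> polyhedron_G n \<Longrightarrow> (x, 0) \<in> joint_space n" by (simp add: joint_iff)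

lemma zs_in: "zs t x \<omega> \<in> polyhedron_G n" by (simp add: zs_def zstep_in)

lemma zs_ds_in: "(zs t x \<omega>, ds t x y \<omega>) \<in> joint_space n" by (simp add: zs_def ds_def step_in)

lemma rep_shift:
  assumes xy: "(x, y) \<in> joint_space n" and s: "0 \<le> s" and t: "0 < t"
  shows "AE \<omega> in M. Z x (s + t) \<omega> = zstep t (Z x s \<omega>) (wgrid s t \<omega>) \<and>
    D (x, y) (s + t) \<omega> = dstep t (Z x s \<omega>) (D (x, y) s \<omega>) (wgrid s t \<omega>)"
  using Z_path[OF joint_G[OF xy]] D_path[OF xy] AE_space
proof eventually_elim
  case (elim \<omega>)
  let ?w = "\<lambda>u. W (s + u) \<omega> - W s \<omega>"
  have g: "wgrid s t \<omega> = grid ?w t" by (simp add: wgrid_def grid_def)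
  have cont: "continuous_on {0..} ?w"
    using s by (intro continuous_intros continuous_on_compose2[OF W_continuous[OF elim(3)]]) auto
  note sk = skorokhod_shift[OF elim(1) s]
  note de = derivative_shift[OF conjunct1[OF elim(2)] s]
  show ?case
    using zstep_eq[OF sk cont _ less_imp_le[OF t]] dstep_eq[OF sk cont _ t de] by (simp add: g)
qed

lemma Z_0: "x \<in> polyhedron_G n \<Longrightarrow> AE \<omega> in M. Z x 0 \<omega> = x"
proof -
  assume "x \<in> polyhedron_G n"
  from Z_path[OF this] W_0 show ?thesis
  proof eventually_elim
    case (elim \<omega>)
    then show ?case using skorokhod_pathD(5)[OF elim(1), of 0] skorokhod_pathD(3)[OF elim(1)] by (simp add: driver_def)
  qed
qed

lemma rep:
  assumes xy: "(x, y) \<in> joint_space n" and t: "0 < t"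
  shows "AE \<omega> in M. Z x t \<omega> = zs t x \<omega> \<and> D (x, y) t \<omega> = ds t x y \<omega>"
  using rep_shift[OF xy order_refl t] Z_0[OF joint_G[OF xy]] D_path[OF xy]
  by eventually_elim (simp add: zs_def ds_def)

lemma wgrid_component: "0 \<le> t \<Longrightarrow> (\<lambda>\<omega>. wgrid 0 t \<omega> j) \<in> borel_measurable M"
  using measurable_component_singleton[of j UNIV "\<lambda>_. borel"] wgrid_measurable[OF order_refl, of t]
  by (auto intro: measurable_compose)

lemma zs_measurable:
  assumes "0 \<le> t" "f \<in> borel_measurable P" "g \<in> measurable P M"
  shows "(\<lambda>p. zs t (f p) (g p)) \<in> borel_measurable P"
  unfolding zs_def using assms
  by (intro measurable_zstep[where Y="\<lambda>_. 0"]) (auto intro: measurable_compose[OF _ wgrid_component])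

lemma ds_measurable:
  assumes "0 \<le> t" "f \<in> borel_measurable P" "h \<in> borel_measurable P" "g \<in> measurable P M"
  shows "(\<lambda>p. ds t (f p) (h p) (g p)) \<in> borel_measurable P"
  unfolding ds_def using assms
  by (intro measurable_dstep) (auto intro: measurable_compose[OF _ wgrid_component])

lemma step_joint:
  assumes "0 \<le> t"
  shows "(\<lambda>p. (zs t (fst (fst p)) (snd p), ds t (fst (fst p)) (snd (fst p)) (snd p))) \<in> borel_measurable (borel \<Otimes>\<^sub>M M)"
  unfolding borel_prod[symmetric]
  by (intro measurable_Pair zs_measurable[OF assms] ds_measurable[OF assms]) measurable

definition Pt :: "real \<Rightarrow> ((real^'n) \<times> (real^'n) \<Rightarrow> ennreal) \<Rightarrow> (real^'n) \<times> (real^'n) \<Rightarrow> ennreal" where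
  "Pt t f \<xi> = (\<integral>\<^sup>+\<omega>. f (zs t (fst \<xi>) \<omega>, ds t (fst \<xi>) (snd \<xi>) \<omega>) \<partial>M)"

lemma Pt_measurable:
  assumes "0 \<le> t" and f: "f \<in> borel_measurable borel" shows "Pt t f \<in> borel_measurable borel"
  unfolding Pt_def
  by (rule borel_measurable_nn_integral) (use measurable_compose[OF step_joint[OF assms(1)] f] in \<open>simp add: split_def\<close>)

text \<open>The state at time \<open>s\<close> is known to \<open>F s\<close>, and the state at
  \<open>s + t\<close> is a function of it and of the noise after \<open>s\<close>, so
  \<open>wgrid_markov\<close> applies. Its purpose is that \<open>Pt s\<close> and
  \<open>Pt t\<close> commute on the joint space.\<close>

lemma chapman_kolmogorov:
  assumes xy: "(x, y) \<in> joint_space n" and s: "0 < s" and t: "0 < t" and f[measurable]: "f \<in> borel_measurable borel"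
  shows "Pt (s + t) f (x, y) = Pt s (Pt t f) (x, y)"
proof -
  have s0: "0 \<le> s" using s by simp
  define \<Phi> where "\<Phi> p = f (zstep t (fst (fst p)) (snd p), dstep t (fst (fst p)) (snd (fst p)) (snd p))"
    for p :: "((real^'n) \<times> (real^'n)) \<times> (nat \<times> nat \<Rightarrow> real^'n)"
  have comp: "(\<lambda>p. snd p j) \<in> borel_measurable ((borel \<Otimes>\<^sub>M borel) \<Otimes>\<^sub>M PG)" for j
    by (rule measurable_compose[OF measurable_snd measurable_component_singleton]) simp
  have \<Phi>: "\<Phi> \<in> borel_measurable ((borel \<Otimes>\<^sub>M borel) \<Otimes>\<^sub>M PG)"
    unfolding \<Phi>_def
    by (intro measurable_compose[OF _ f] borel_measurable_Pair measurable_zstep[where Y="\<lambda>_. 0"] measurable_dstep comp) measurable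
  have XF: "(\<lambda>\<omega>. (Z x s \<omega>, D (x, y) s \<omega>)) \<in> measurable (F s) (borel \<Otimes>\<^sub>M borel)"
    by (intro measurable_Pair Z_adapted D_adapted joint_G[OF xy] xy s0)
  have "Pt (s + t) f (x, y) = (\<integral>\<^sup>+\<omega>. \<Phi> ((Z x s \<omega>, D (x, y) s \<omega>), wgrid s t \<omega>) \<partial>M)"
    unfolding Pt_def
  proof (rule nn_integral_cong_AE)
    have "0 < s + t" using s t by simp
    from rep[OF xy this] rep_shift[OF xy s0 t]
    show "AE \<omega> in M. f (zs (s + t) (fst (x, y)) \<omega>, ds (s + t) (fst (x, y)) (snd (x, y)) \<omega>) = \<Phi> ((Z x s \<omega>, D (x, y) s \<omega>), wgrid s t \<omega>)"
      by eventually_elim (simp add: \<Phi>_def)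
  qed
  also have "\<dots> = (\<integral>\<^sup>+\<omega>. (\<integral>\<^sup>+\<omega>'. \<Phi> ((Z x s \<omega>, D (x, y) s \<omega>), wgrid 0 t \<omega>') \<partial>M) \<partial>M)"
    by (rule wgrid_markov[OF s0 t XF \<Phi>])
  also have "\<dots> = Pt s (Pt t f) (x, y)"
    unfolding Pt_def
  proof (rule nn_integral_cong_AE)
    show "AE \<omega> in M. (\<integral>\<^sup>+\<omega>'. \<Phi> ((Z x s \<omega>, D (x, y) s \<omega>), wgrid 0 t \<omega>') \<partial>M) =
      (\<integral>\<^sup>+\<omega>'. f (zs t (fst (zs s (fst (x, y)) \<omega>, ds s (fst (x, y)) (snd (x, y)) \<omega>)) \<omega>',
        ds t (fst (zs s (fst (x, y)) \<omega>, ds s (fst (x, y)) (snd (x, y)) \<omega>)) (snd (zs s (fst (x, y)) \<omega>, ds s (fst (x, y)) (snd (x, y)) \<omega>)) \<omega>') \<partial>M)"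
      using rep[OF xy s] by eventually_elim (simp add: \<Phi>_def zs_def ds_def)
  qed
  finally show ?thesis .
qed

text \<open>Collects the almost sure facts about one initial state, so that later estimates concern
  a single path.\<close>

lemma driven_path:
  assumes xy: "(x, y) \<in> joint_space n" and T: "0 < T"
  shows "AE \<omega> in M. driven x (\<lambda>t. W t \<omega>) (\<lambda>t. Z x t \<omega>) (\<lambda>t. Y x t \<omega>) T (wsup (real T) \<omega>) \<and>
    continuous_on {0..} (\<lambda>t. W t \<omega>) \<and>
    derivative_path (\<lambda>t. Z x t \<omega>) (ddriver (\<lambda>t. W t \<omega>) (\<lambda>t. Y x t \<omega>)) (\<lambda>t. D (x, y) t \<omega>) \<and> D (x, y) 0 \<omega> = y \<and>
    Z x 0 \<omega> = x \<and> Z x (real T) \<omega> = zs (real T) x \<omega> \<and> D (x, y) (real T) \<omega> = ds (real T) x y \<omega>"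
proof -
  have T': "0 < real T" using T by simp
  from Z_path[OF joint_G[OF xy]] D_path[OF xy] W_0 AE_space Z_0[OF joint_G[OF xy]] rep[OF xy T'] show ?thesis
  proof eventually_elim
    case (elim \<omega>)
    then show ?case using joint_G[OF xy] wsup_ge[OF elim(4) T'] W_continuous[OF elim(4)] by (simp add: driven_def)
  qed
qed

end

subsection \<open>Drift and contraction on average\<close>

lemma eventually_exp_decay: "0 < a \<Longrightarrow> 0 < e \<Longrightarrow> \<forall>\<^sub>F T in sequentially. A * exp (- (a * real T)) \<le> (e :: real)"
proof -
  assume a: "0 < a" and e: "0 < e"
  have "(\<lambda>T. A * exp (- a) ^ T) \<longlonglongrightarrow> A * 0"
    using a by (intro tendsto_intros LIMSEQ_realpow_zero) auto
  moreover have "exp (- a) ^ T = exp (- (a * real T))" for T by (simp add: exp_of_nat_mult[symmetric] mult.commute)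
  ultimately have "(\<lambda>T. A * exp (- (a * real T))) \<longlonglongrightarrow> 0" by simp
  from order_tendstoD(2)[OF this e] show ?thesis by eventually_elim simp
qed

lemma eventually_linear: "0 < a \<Longrightarrow> \<forall>\<^sub>F T in sequentially. (m :: real) \<le> a * real T"
proof -
  assume a: "0 < a"
  obtain K where K: "m / a \<le> real K" using real_arch_simple by blast
  show ?thesis unfolding eventually_sequentially
  proof (intro exI allI impI)
    fix T assume "K \<le> T"
    then have "m / a \<le> real T" using K by linarith
    then show "m \<le> a * real T" using a by (simp add: field_simps)
  qed
qed

context joint_rbm
begin

lemma continuous_lyap: assumes "0 \<le> C" shows "continuous_on UNIV (lyap C)"
proof -
  obtain CN where CN: "CN > 0" "\<And>z. N z \<le> CN * norm z" using N_equiv by metis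
  have "(C * CN)-lipschitz_on UNIV (lyap C)"
  proof (rule lipschitz_onI)
    fix x y :: "real^'n"
    have "\<bar>lyap C x - lyap C y\<bar> \<le> C * N (x - y)"
      using lyap_lipschitz[OF assms, of x y] lyap_lipschitz[OF assms, of y x] N_diff_commute[of x y] by simp
    also have "\<dots> \<le> C * (CN * norm (x - y))" by (intro mult_left_mono CN assms)
    finally show "dist (lyap C x) (lyap C y) \<le> C * CN * dist x y" by (simp add: dist_norm dist_real_def mult.assoc)
  qed (use assms CN in simp)
  then show ?thesis by (rule lipschitz_on_continuous_on)
qed

lemma wsup_moment:
  assumes "0 \<le> c" "0 < T"
  shows "(\<integral>\<^sup>+\<omega>. ennreal (exp (c * wsup T \<omega>)) \<partial>M) \<le> ennreal (2 * 2 ^ CARD('n) * exp (real CARD('n) * c\<^sup>2 * T / 2))"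
proof -
  have "2 * ennreal ((2 * exp (c\<^sup>2 * T / 2)) ^ CARD('n)) = ennreal (2 * 2 ^ CARD('n) * exp (real CARD('n) * c\<^sup>2 * T / 2))"
    by (simp add: ennreal_double power_mult_distrib exp_of_nat_mult[symmetric] mult.assoc)
  then show ?thesis using wsup_exp_moment[OF assms] by simp
qed

text \<open>A Chernoff bound; the exponent \<open>a = \<eta> / J\<close> minimises
  \<open>- (a * \<eta> * T) + J * a ^ 2 * T / 2\<close>.\<close>

lemma wsup_small:
  assumes \<eta>: "0 < \<eta>" and T: "0 < T"
    and small: "2 * 2 ^ CARD('n) * exp (- (\<eta>\<^sup>2 / (2 * real CARD('n)) * T)) \<le> 1 / 2"
  shows "1 / 2 \<le> prob {\<omega> \<in> space M. wsup T \<omega> \<le> \<eta> * T}"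
proof -
  define J where "J = real CARD('n)"
  have J: "0 < J" by (simp add: J_def)
  define a where "a = \<eta> / J"
  have a: "0 \<le> a" using \<eta> J by (simp add: a_def)
  note [measurable] = wsup_measurable[OF less_imp_le[OF T]]
  have "emeasure M {\<omega> \<in> space M. \<not> wsup T \<omega> \<le> \<eta> * T} = (\<integral>\<^sup>+\<omega>. indicator {\<omega> \<in> space M. \<not> wsup T \<omega> \<le> \<eta> * T} \<omega> \<partial>M)"
    by (rule nn_integral_indicator[symmetric]) measurable
  also have "\<dots> \<le> (\<integral>\<^sup>+\<omega>. ennreal (exp (- (a * \<eta> * T))) * ennreal (exp (a * wsup T \<omega>)) \<partial>M)"
  proof (rule nn_integral_mono)
    fix \<omega>
    have "ennreal (exp (- (a * \<eta> * T))) * ennreal (exp (a * wsup T \<omega>)) = ennreal (exp (a * (wsup T \<omega> - \<eta> * T)))"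
      by (subst ennreal_mult'[symmetric]) (simp_all add: exp_add[symmetric] algebra_simps)
    moreover have "1 \<le> exp (a * (wsup T \<omega> - \<eta> * T))" if "\<not> wsup T \<omega> \<le> \<eta> * T"
      using that a by simp
    ultimately show "indicator {\<omega> \<in> space M. \<not> wsup T \<omega> \<le> \<eta> * T} \<omega> \<le> ennreal (exp (- (a * \<eta> * T))) * ennreal (exp (a * wsup T \<omega>))"
      by (auto simp: indicator_def ennreal_1[symmetric] simp del: ennreal_1 intro!: ennreal_leI)
  qed
  also have "\<dots> = ennreal (exp (- (a * \<eta> * T))) * (\<integral>\<^sup>+\<omega>. ennreal (exp (a * wsup T \<omega>)) \<partial>M)"
    by (rule nn_integral_cmult) measurable
  also have "\<dots> \<le> ennreal (exp (- (a * \<eta> * T))) * ennreal (2 * 2 ^ CARD('n) * exp (J * a\<^sup>2 * T / 2))"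
    unfolding J_def by (intro mult_left_mono wsup_moment a T) simp
  also have "\<dots> = ennreal (2 * 2 ^ CARD('n) * exp (- (\<eta>\<^sup>2 / (2 * J) * T)))"
  proof -
    have "- (a * \<eta> * T) + J * a\<^sup>2 * T / 2 = - (\<eta>\<^sup>2 / (2 * J) * T)"
      using J by (simp add: a_def field_simps power2_eq_square)
    then have "exp (- (a * \<eta> * T)) * exp (J * a\<^sup>2 * T / 2) = exp (- (\<eta>\<^sup>2 / (2 * J) * T))" by (simp only: exp_add[symmetric])
    then show ?thesis by (simp add: ennreal_mult'[symmetric] mult.left_commute)
  qed
  also have "\<dots> \<le> ennreal (1 / 2)" using small unfolding J_def by (intro ennreal_leI)
  finally have "prob {\<omega> \<in> space M. \<not> wsup T \<omega> \<le> \<eta> * T} \<le> 1 / 2" unfolding emeasure_eq_measure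
    by (subst (asm) ennreal_le_iff) simp_all
  then show ?thesis by (subst (asm) prob_neg) simp_all
qed

text \<open>\<open>T\<close> is so large that the Lyapunov function decreases on average, that from
  good states all faces are visited with probability at least one half, and that all states with
  \<open>V x < 8 * K\<close> are good. The last point is delicate, since the bound for
  \<open>K\<close> grows exponentially in \<open>T\<close>; \<open>lam\<close> is so small that
  these states still satisfy \<open>N x \<le> \<eta> * real T\<close>.\<close>

lemma iteration_exists:
  obtains T U H r \<rho> q c CN where "0 < T"
    "random_iteration M (polyhedron_G n) (joint_space n) (zs (real T)) (ds (real T)) N CN U H r \<rho> q c"
proof -
  obtain CN where CN: "CN > 0" "\<And>z. N z \<le> CN * norm z" "\<And>z. norm z \<le> CN * N z" using N_equiv by blast
  obtain CL where CL: "0 < CL" "1 \<le> CL * (N b + 1)"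
    "\<And>x k. x \<in> polyhedron_G n \<Longrightarrow> lyap CL (fluid x k) \<le> max (lyap CL x - real k) CL" using lyap_exists by metis
  obtain C1 where C1: "0 < C1" "\<And>x w z y T S. driven x w z y T S \<Longrightarrow> N (z (real T) - fluid x T) \<le> C1 * (1 + S)"
    using path_close by metis
  obtain C2 where C2: "0 < C2" "\<And>x w z y T S i. driven x w z y T S \<Longrightarrow> C2 * (1 + N x + S) < \<beta> * real T \<Longrightarrow>
     \<exists>u\<in>{0..real T}. z u \<bullet> n i = 0" using hit_faces by metis
  obtain C3 where C3: "0 < C3" "\<And>x w z y T S \<phi>. driven x w z y T S \<Longrightarrow> continuous_on {0..} w \<Longrightarrow>
     derivative_path z (ddriver w y) \<phi> \<Longrightarrow>
     N (z (real T) - x) + N (\<phi> (real T)) \<le> N (\<phi> 0) + C3 * (1 + real T + N x + S)" using path_bound by metis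
  define C4 where "C4 = CL * C1"
  define cb where "cb = N b + 1"
  define J where "J = real CARD('n)"
  define A where "A = 2 * (2 :: real) ^ CARD('n)"
  \<comment> \<open>For good states and good noise each of the three terms in
    \<open>C2 * (1 + N x + S)\<close> is at most \<open>C2 * \<eta> * real T\<close>, together
    \<open>3 / 4\<close> of \<open>\<beta> * real T\<close>.\<close>
  define \<eta> where "\<eta> = \<beta> / (4 * C2)"
  define Q where "Q = C4\<^sup>2 * J + 1"
  \<comment> \<open>The first bound lets the drift \<open>l * real T\<close> beat the Gaussian term
    \<open>J * (l * C4) ^ 2 * real T / 2\<close> for both exponents \<open>lam\<close> and
    \<open>2 * lam\<close>; the second is for the level set in \<open>goodV\<close>.\<close>
  define lam where "lam = min (1 / (2 * Q)) (\<eta> / (cb * Q))"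
  \<comment> \<open>The level \<open>8 * K\<close> on the scale of the Lyapunov function, without
    the part proportional to \<open>T\<close>.\<close>
  define c0 where "c0 = (ln (8 * A) + lam * C4 + lam * CL) / lam"
  have C4: "0 < C4" using CL C1 by (simp add: C4_def)
  have cb: "1 \<le> cb" using N_nonneg[of b] by (simp add: cb_def)
  have J: "0 < J" by (simp add: J_def)
  have A: "0 < A" by (simp add: A_def)
  have \<eta>: "0 < \<eta>" using \<beta> C2 by (simp add: \<eta>_def)
  have Q: "0 < Q" "C4\<^sup>2 * J \<le> Q" using J by (simp_all add: Q_def add_nonneg_pos)
  have lam: "0 < lam" using Q \<eta> cb by (simp add: lam_def)
  have lam1: "2 * lam * (C4\<^sup>2 * J) \<le> 1"
  proof -
    have "2 * lam * (C4\<^sup>2 * J) \<le> 2 * (1 / (2 * Q)) * Q"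
      using Q lam J by (intro mult_mono) (auto simp: lam_def)
    then show ?thesis using Q by simp
  qed
  have lam2: "cb * (lam * (C4\<^sup>2 * J)) \<le> \<eta>"
  proof -
    have "cb * (lam * (C4\<^sup>2 * J)) \<le> cb * (\<eta> / (cb * Q) * Q)"
      using Q lam J cb \<eta> by (intro mult_left_mono mult_mono) (auto simp: lam_def)
    then show ?thesis using Q cb by simp
  qed
  have ev1: "\<forall>\<^sub>F T in sequentially. 1 \<le> \<eta> * real T" by (rule eventually_linear[OF \<eta>])
  have ev2: "\<forall>\<^sub>F T in sequentially. cb * c0 \<le> (\<eta> / 2) * real T" using \<eta> by (intro eventually_linear) simp
  have ev3: "\<forall>\<^sub>F T in sequentially. (A * exp (lam * C4)) * exp (- (lam / 2 * real T)) \<le> 1 / 2"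
    using lam by (intro eventually_exp_decay) simp_all
  have ev4: "\<forall>\<^sub>F T in sequentially. (A * exp (2 * lam * C4)) * exp (- (lam * real T)) \<le> 1 / 2"
    using lam by (intro eventually_exp_decay) simp_all
  have "0 < \<eta>\<^sup>2 / (2 * J)" using \<eta> J by simp
  then have ev5: "\<forall>\<^sub>F T in sequentially. A * exp (- (\<eta>\<^sup>2 / (2 * J) * real T)) \<le> 1 / 2"
    by (rule eventually_exp_decay) simp
  obtain T where T: "0 < T" and t1: "1 \<le> \<eta> * real T" and t2: "cb * c0 \<le> (\<eta> / 2) * real T"
    and t3: "(A * exp (lam * C4)) * exp (- (lam / 2 * real T)) \<le> 1 / 2"
    and t4: "(A * exp (2 * lam * C4)) * exp (- (lam * real T)) \<le> 1 / 2"
    and t5: "A * exp (- (\<eta>\<^sup>2 / (2 * J) * real T)) \<le> 1 / 2"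
    using eventually_happens[OF eventually_conj[OF eventually_gt_at_top[of 0] eventually_conj[OF ev1 eventually_conj[OF ev2 eventually_conj[OF ev3
      eventually_conj[OF ev4 ev5]]]]]] by (elim disjE exE conjE) simp_all
  have T0: "0 < real T" "0 \<le> real T" using T by simp_all
  define S where "S = wsup (real T)"
  have Sm[measurable]: "S \<in> borel_measurable M" unfolding S_def using T0 by measurable
  define \<Lambda> where "\<Lambda> = lyap CL"
  have \<Lambda>0: "0 \<le> \<Lambda> x" for x unfolding \<Lambda>_def using CL by (intro lyap_nonneg) simp
  have \<Lambda>c: "continuous_on UNIV \<Lambda>" unfolding \<Lambda>_def using CL by (intro continuous_lyap) simp
  have \<Lambda>m[measurable]: "\<Lambda> \<in> borel_measurable borel" by (rule borel_measurable_continuous_onI[OF \<Lambda>c])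
  have coer: "N x \<le> cb * \<Lambda> x" if "x \<in> polyhedron_G n" for x
    unfolding cb_def \<Lambda>_def by (rule lyap_coercive[OF that CL(2)])
  have zm[measurable]: "zs (real T) x \<in> borel_measurable M" for x
    using zs_measurable[OF T0(2), of "\<lambda>_. x" M "\<lambda>\<omega>. \<omega>"] by simp
  have dm[measurable]: "ds (real T) x y \<in> borel_measurable M" for x y
    using ds_measurable[OF T0(2), of "\<lambda>_. x" M "\<lambda>_. y" "\<lambda>\<omega>. \<omega>"] by simp
  \<comment> \<open>The random path inherits the drift of the fluid, up to an error that is linear
    in the maximum of the noise and does not grow with \<open>T\<close> otherwise.\<close>
  have L1: "AE \<omega> in M. \<Lambda> (zs (real T) x \<omega>) \<le> max (\<Lambda> x - real T) CL + C4 * (1 + S \<omega>) \<and> 0 \<le> S \<omega>"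
    if x: "x \<in> polyhedron_G n" for x
    using driven_path[OF joint_0[OF x] T]
  proof eventually_elim
    case (elim \<omega>)
    then have dr: "driven x (\<lambda>t. W t \<omega>) (\<lambda>t. Z x t \<omega>) (\<lambda>t. Y x t \<omega>) T (S \<omega>)" and z: "Z x (real T) \<omega> = zs (real T) x \<omega>"
      by (auto simp: S_def)
    have "0 \<le> S \<omega>" using dr T0 unfolding driven_def by (metis norm_ge_zero order_refl order_trans)
    moreover have "\<Lambda> (zs (real T) x \<omega>) \<le> \<Lambda> (fluid x T) + CL * N (Z x (real T) \<omega> - fluid x T)"
      unfolding \<Lambda>_def z[symmetric] using CL by (intro lyap_lipschitz) simp
    moreover have "CL * N (Z x (real T) \<omega> - fluid x T) \<le> CL * (C1 * (1 + S \<omega>))"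
      using CL by (intro mult_left_mono C1(2)[OF dr]) simp
    moreover have "\<Lambda> (fluid x T) \<le> max (\<Lambda> x - real T) CL" unfolding \<Lambda>_def by (rule CL(3)[OF x])
    ultimately show ?case by (simp add: C4_def mult.assoc)
  qed
  define E where "E l = A * exp (l * C4) * exp (J * (l * C4)\<^sup>2 * real T / 2)" for l
  have L2: "(\<integral>\<^sup>+\<omega>. ennreal (exp (l * \<Lambda> (zs (real T) x \<omega>))) \<partial>M) \<le> ennreal (E l * exp (- (l * real T)) * exp (l * \<Lambda> x) + E l * exp (l * CL))"
    if x: "x \<in> polyhedron_G n" and l: "0 < l" for x l
  proof -
    define R where "R = (exp (- (l * real T)) * exp (l * \<Lambda> x) + exp (l * CL)) * exp (l * C4)"
    have R: "0 \<le> R" by (simp add: R_def)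
    have "(\<integral>\<^sup>+\<omega>. ennreal (exp (l * \<Lambda> (zs (real T) x \<omega>))) \<partial>M) \<le> (\<integral>\<^sup>+\<omega>. ennreal R * ennreal (exp (l * C4 * S \<omega>)) \<partial>M)"
    proof (rule nn_integral_mono_AE)
      show "AE \<omega> in M. ennreal (exp (l * \<Lambda> (zs (real T) x \<omega>))) \<le> ennreal R * ennreal (exp (l * C4 * S \<omega>))"
        using L1[OF x]
      proof eventually_elim
        case (elim \<omega>)
        have "exp (l * \<Lambda> (zs (real T) x \<omega>)) \<le> exp (l * (max (\<Lambda> x - real T) CL + C4 * (1 + S \<omega>)))"
          using elim l by (simp add: mult_left_mono)
        also have "\<dots> = exp (l * max (\<Lambda> x - real T) CL) * exp (l * C4) * exp (l * C4 * S \<omega>)"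
          by (simp add: exp_add[symmetric] algebra_simps)
        also have "exp (l * max (\<Lambda> x - real T) CL) \<le> exp (l * (\<Lambda> x - real T)) + exp (l * CL)"
          by (auto simp: max_def)
        also have "exp (l * (\<Lambda> x - real T)) = exp (- (l * real T)) * exp (l * \<Lambda> x)"
          by (simp add: exp_add[symmetric] algebra_simps)
        finally have "exp (l * \<Lambda> (zs (real T) x \<omega>)) \<le> R * exp (l * C4 * S \<omega>)" by (simp add: R_def)
        then show ?case unfolding ennreal_mult'[OF R, symmetric] by (rule ennreal_leI)
      qed
    qed
    also have "\<dots> = ennreal R * (\<integral>\<^sup>+\<omega>. ennreal (exp (l * C4 * S \<omega>)) \<partial>M)" by (rule nn_integral_cmult) measurable
    also have "\<dots> \<le> ennreal R * ennreal (A * exp (J * (l * C4)\<^sup>2 * real T / 2))"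
      unfolding A_def J_def S_def using l C4 T0 by (intro mult_left_mono wsup_moment) auto
    also have "\<dots> = ennreal (R * (A * exp (J * (l * C4)\<^sup>2 * real T / 2)))" by (rule ennreal_mult'[OF R, symmetric])
    also have "R * (A * exp (J * (l * C4)\<^sup>2 * real T / 2)) = E l * exp (- (l * real T)) * exp (l * \<Lambda> x) + E l * exp (l * CL)"
      by (simp add: R_def E_def algebra_simps)
    finally show ?thesis .
  qed
  have E0: "0 < E l" for l using A by (simp add: E_def)
  have q1: "E lam * exp (- (lam * real T)) \<le> 1 / 2"
  proof -
    have "J * (lam * C4)\<^sup>2 * real T / 2 = (2 * lam * (C4\<^sup>2 * J)) * (lam / 4 * real T)" by (simp add: power2_eq_square)
    also have "\<dots> \<le> 1 * (lam / 4 * real T)" using lam by (intro mult_right_mono lam1) simp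
    finally have e: "J * (lam * C4)\<^sup>2 * real T / 2 + - (lam * real T) \<le> - (lam / 2 * real T)" using lam T0 by (simp add: field_simps)
    have "E lam * exp (- (lam * real T)) = A * exp (lam * C4) * exp (J * (lam * C4)\<^sup>2 * real T / 2 + - (lam * real T))"
      by (simp only: E_def exp_add mult.assoc)
    also have "\<dots> \<le> A * exp (lam * C4) * exp (- (lam / 2 * real T))" using A e by (intro mult_left_mono) auto
    finally show ?thesis using t3 by simp
  qed
  have q2: "E (2 * lam) * exp (- (2 * lam * real T)) \<le> 1 / 2"
  proof -
    have "J * (2 * lam * C4)\<^sup>2 * real T / 2 = (2 * lam * (C4\<^sup>2 * J)) * (lam * real T)" by (simp add: power2_eq_square)
    also have "\<dots> \<le> 1 * (lam * real T)" using lam by (intro mult_right_mono lam1) simp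
    finally have e: "J * (2 * lam * C4)\<^sup>2 * real T / 2 + - (2 * lam * real T) \<le> - (lam * real T)" by simp
    have "E (2 * lam) * exp (- (2 * lam * real T)) = A * exp (2 * lam * C4) * exp (J * (2 * lam * C4)\<^sup>2 * real T / 2 + - (2 * lam * real T))"
      by (simp only: E_def exp_add mult.assoc)
    also have "\<dots> \<le> A * exp (2 * lam * C4) * exp (- (lam * real T))" using A e by (intro mult_left_mono) auto
    finally show ?thesis using t4 by simp
  qed
  define V where "V x = exp (lam * \<Lambda> x)" for x
  define K where "K = E lam * exp (lam * CL)"
  \<comment> \<open>With the divisor 24, the constants of the drift for two states contribute
    \<open>2 * \<delta> * K = contr / 12\<close>, and the threshold \<open>8 * K\<close> becomes
    \<open>\<delta> * v = contr / 3\<close>.\<close>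
  define \<delta> where "\<delta> = contr / (24 * K)"
  define U where "U x = 1 / 2 + \<delta> * V x" for x
  define good where "good x \<longleftrightarrow> N x \<le> \<eta> * real T" for x
  define r where "r x x' \<omega> = (if good x \<and> good x' \<and> S \<omega> \<le> \<eta> * real T then 1 - contr else 1)" for x x' \<omega>
  \<comment> \<open>The second entry is for small \<open>v\<close>, where
    \<open>1 - contr / 2 + contr / 6 + contr / 12 = 1 - contr / 4\<close>. The first is for large
    \<open>v\<close>: the ratio \<open>(1 + 3 / 4 * u) / (1 + u)\<close> decreases in
    \<open>u\<close>, and \<open>u = \<delta> * v\<close> is at least
    \<open>contr / 3\<close>.\<close>
  define \<rho> where "\<rho> = max ((1 + contr / 4) / (1 + contr / 3)) (1 - contr / 4)"
  define A4 where "A4 = C3 * (2 + real T + cb / lam) * (1 + \<delta>) * exp (lam * (CL + C4)) * (A * exp (J * (lam * C4 + 1)\<^sup>2 * real T / 2))"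
  \<comment> \<open>The exponent is doubled because one factor \<open>V x\<close> bounds the
    displacement and another the weight at the new point.\<close>
  define H where "H x = A4 * exp (2 * lam * \<Lambda> x)" for x
  define c where "c = A4 * (E (2 * lam) * exp (2 * lam * CL))"
  have K: "0 < K" using E0 by (simp add: K_def)
  have \<delta>: "0 < \<delta>" "\<delta> * K = contr / 24" using contr K by (simp_all add: \<delta>_def)
  have V1: "1 \<le> V x" for x using \<Lambda>0[of x] lam by (simp add: V_def)
  have Vm[measurable]: "V \<in> borel_measurable borel" unfolding V_def[abs_def] by measurable
  have A4: "0 \<le> A4" using C3 \<delta> A cb lam by (simp add: A4_def)
  have drV: "(\<integral>\<^sup>+\<omega>. ennreal (V (zs (real T) x \<omega>)) \<partial>M) \<le> ennreal (V x / 2 + K)" if x: "x \<in> polyhedron_G n" for x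
  proof -
    have "E lam * exp (- (lam * real T)) * V x \<le> 1 / 2 * V x" using V1[of x] by (intro mult_right_mono q1) simp
    then show ?thesis using L2[OF x lam] unfolding V_def K_def by (elim order_trans) (intro ennreal_leI, simp)
  qed
  have goodV: "good x" if x: "x \<in> polyhedron_G n" and v: "V x < 8 * K" for x
  proof -
    have "V x < 8 * A * exp (lam * C4 + lam * CL + J * (lam * C4)\<^sup>2 * real T / 2)"
      using v by (simp add: K_def E_def exp_add mult_ac)
    also have "\<dots> = exp (ln (8 * A) + (lam * C4 + lam * CL + J * (lam * C4)\<^sup>2 * real T / 2))" using A by (simp add: exp_add)
    finally have "lam * \<Lambda> x < ln (8 * A) + (lam * C4 + lam * CL + J * (lam * C4)\<^sup>2 * real T / 2)" by (simp add: V_def)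
    also have "\<dots> = lam * (c0 + lam * (C4\<^sup>2 * J) / 2 * real T)"
      using lam by (simp add: c0_def field_simps power2_eq_square)
    finally have "\<Lambda> x < c0 + lam * (C4\<^sup>2 * J) / 2 * real T" using lam by simp
    then have "cb * \<Lambda> x \<le> cb * (c0 + lam * (C4\<^sup>2 * J) / 2 * real T)" using cb by (intro mult_left_mono) auto
    also have "\<dots> = cb * c0 + cb * (lam * (C4\<^sup>2 * J)) / 2 * real T" by (simp add: algebra_simps)
    also have "\<dots> \<le> (\<eta> / 2) * real T + \<eta> / 2 * real T"
      using lam2 by (intro add_mono t2 mult_right_mono divide_right_mono) auto
    finally show ?thesis using coer[OF x] by (simp add: good_def)
  qed
  have Er: "(\<integral>\<^sup>+\<omega>. ennreal (r x x' \<omega>) \<partial>M) \<le> ennreal (1 - contr / 2)" if g: "good x" "good x'" for x x'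
  proof -
    have p: "1 / 2 \<le> prob {\<omega> \<in> space M. S \<omega> \<le> \<eta> * real T}"
      unfolding S_def using t5 by (intro wsup_small \<eta> T0) (simp add: A_def J_def)
    have "(\<integral>\<^sup>+\<omega>. ennreal (r x x' \<omega>) \<partial>M) = (\<integral>\<^sup>+\<omega>. ennreal (1 - contr * indicator {\<omega> \<in> space M. S \<omega> \<le> \<eta> * real T} \<omega>) \<partial>M)"
      by (intro nn_integral_cong) (use g in \<open>auto simp: r_def indicator_def\<close>)
    also have "\<dots> = ennreal (\<integral>\<omega>. (1 - contr * indicator {\<omega> \<in> space M. S \<omega> \<le> \<eta> * real T} \<omega>) \<partial>M)"
    proof (rule nn_integral_eq_integral)
      show "integrable M (\<lambda>\<omega>. 1 - contr * indicator {\<omega> \<in> space M. S \<omega> \<le> \<eta> * real T} \<omega>)"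
      proof (rule integrable_const_bound[where B = 1])
        show "AE \<omega> in M. norm (1 - contr * indicator {\<omega> \<in> space M. S \<omega> \<le> \<eta> * real T} \<omega>) \<le> 1"
          using contr by (auto simp: indicator_def)
      qed measurable
    qed (use contr in \<open>auto simp: indicator_def\<close>)
    also have "(\<integral>\<omega>. (1 - contr * indicator {\<omega> \<in> space M. S \<omega> \<le> \<eta> * real T} \<omega>) \<partial>M) = 1 - contr * prob {\<omega> \<in> space M. S \<omega> \<le> \<eta> * real T}"
    proof -
      have e: "{\<omega> \<in> space M. S \<omega> \<le> \<eta> * real T} \<in> events" by measurable
      have i: "integrable M (\<lambda>\<omega>. contr * indicator {\<omega> \<in> space M. S \<omega> \<le> \<eta> * real T} \<omega>)"
        using e by (intro integrable_mult_right integrable_real_indicator) (auto simp: emeasure_eq_measure)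
      show ?thesis
        by (subst Bochner_Integration.integral_diff[OF _ i]) (use e in \<open>simp_all add: prob_space\<close>)
    qed
    also have "ennreal \<dots> \<le> ennreal (1 - contr / 2)"
      using mult_left_mono[OF p less_imp_le[OF contr(1)]] by (intro ennreal_leI) simp
    finally show ?thesis .
  qed
  have rm: "r x x' \<in> borel_measurable M" for x x' unfolding r_def[abs_def] by measurable
  have r01: "0 \<le> r x x' \<omega>" "r x x' \<omega> \<le> 1" for x x' \<omega> using contr by (auto simp: r_def)
  have hit: "\<exists>u\<in>{0..real T}. z u \<bullet> n i = 0"
    if dr: "driven x w z y T s" and g: "good x" and s: "s \<le> \<eta> * real T" for x w z y s i
  proof (rule C2(2)[OF dr])
    have "C2 * (1 + N x + s) \<le> C2 * (3 * (\<eta> * real T))" using g s t1 C2 by (intro mult_left_mono) (auto simp: good_def)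
    also have "\<dots> = 3 / 4 * (\<beta> * real T)" using C2 by (simp add: \<eta>_def)
    also have "\<dots> < \<beta> * real T" using \<beta> T0 by simp
    finally show "C2 * (1 + N x + s) < \<beta> * real T" .
  qed
  have "random_iteration M (polyhedron_G n) (joint_space n) (zs (real T)) (ds (real T)) N CN U H r \<rho> (1 / 2) c"
  proof
    show "(\<lambda>(x, \<omega>). zs (real T) x \<omega>) \<in> borel_measurable (borel \<Otimes>\<^sub>M M)"
      unfolding split_def by (intro zs_measurable T0) measurable
    show "(\<lambda>((x, y), \<omega>). ds (real T) x y \<omega>) \<in> borel_measurable ((borel \<Otimes>\<^sub>M borel) \<Otimes>\<^sub>M M)"
      unfolding split_def by (intro ds_measurable T0) measurable
    show "closed (polyhedron_G n)" by (rule closed_polyhedron)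
    show "0 \<in> polyhedron_G n" by (rule zero_polyhedron)
    show "zs (real T) x \<omega> \<in> polyhedron_G n" for x \<omega> by (rule zs_in)
    show "(zs (real T) x \<omega>, ds (real T) x y \<omega>) \<in> joint_space n" for x y \<omega> by (rule zs_ds_in)
    show "x \<in> polyhedron_G n" if "(x, y) \<in> joint_space n" for x y using that by (rule joint_G)
    show "(x, 0) \<in> joint_space n" if "x \<in> polyhedron_G n" for x using that by (rule joint_0)
    show "closed {y. (x, y) \<in> joint_space n}" for x
    proof (cases "x \<in> polyhedron_G n")
      case True
      then have "{y. (x, y) \<in> joint_space n} = tangent_H n x" by (auto simp: joint_space_def)
      then show ?thesis by (simp add: closed_tangent)
    qed (simp add: joint_iff)
    show "joint_space n \<in> sets borel" by (rule joint_borel)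
    show "N \<in> borel_measurable borel" using measurable_N[of "\<lambda>x. x" borel] by simp
    show "N 0 = 0" "0 < CN" "N x \<le> CN * norm x" "norm x \<le> CN * N x" for x using CN by auto
    show "U \<in> borel_measurable borel" unfolding U_def[abs_def] by measurable
    show "1 / 2 \<le> U x" for x using V1[of x] \<delta> by (simp add: U_def)
    show "r x x' \<in> borel_measurable M" for x x' by (rule rm)
    show "0 \<le> r x x' \<omega>" "r x x' \<omega> \<le> 1" for x x' \<omega> by (rule r01)+
    show "0 \<le> \<rho>" using contr by (simp add: \<rho>_def le_max_iff_disj)
    show "\<rho> < 1" using contr by (simp add: \<rho>_def)
    show "AE \<omega> in M. N (zs (real T) x \<omega> - zs (real T) x' \<omega>) \<le> r x x' \<omega> * N (x - x')"
      if x: "x \<in> polyhedron_G n" "x' \<in> polyhedron_G n" for x x'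
      using driven_path[OF joint_0[OF x(1)] T] driven_path[OF joint_0[OF x(2)] T]
    proof eventually_elim
      case (elim \<omega>)
      from elim(1) have dr: "driven x (\<lambda>t. W t \<omega>) (\<lambda>t. Z x t \<omega>) (\<lambda>t. Y x t \<omega>) T (S \<omega>)"
        and z: "Z x (real T) \<omega> = zs (real T) x \<omega>" "Z x 0 \<omega> = x" by (auto simp: S_def)
      from elim(2) have dr': "driven x' (\<lambda>t. W t \<omega>) (\<lambda>t. Z x' t \<omega>) (\<lambda>t. Y x' t \<omega>) T (S \<omega>)"
        and z': "Z x' (real T) \<omega> = zs (real T) x' \<omega>" "Z x' 0 \<omega> = x'" by (auto simp: S_def)
      from dr have sk: "skorokhod_path (driver x (\<lambda>t. W t \<omega>)) (\<lambda>t. Z x t \<omega>) (\<lambda>t. Y x t \<omega>)" by (simp add: driven_def)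
      from dr' have sk': "skorokhod_path (driver x' (\<lambda>t. W t \<omega>)) (\<lambda>t. Z x' t \<omega>) (\<lambda>t. Y x' t \<omega>)" by (simp add: driven_def)
      have diff: "driver x (\<lambda>t. W t \<omega>) t - driver x' (\<lambda>t. W t \<omega>) t = driver x (\<lambda>t. W t \<omega>) 0 - driver x' (\<lambda>t. W t \<omega>) 0" for t
        by (simp add: driver_def)
      show ?case
      proof (cases "good x \<and> good x' \<and> S \<omega> \<le> \<eta> * real T")
        case True
        have "N (Z x (real T) \<omega> - Z x' (real T) \<omega>) \<le> (1 - contr) * N (Z x 0 \<omega> - Z x' 0 \<omega>)"
          using True by (intro pair_contraction[OF sk sk' diff] hit[OF dr] hit[OF dr']) auto
        then show ?thesis using True z z' by (simp add: r_def)
      next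
        case False
        have "N (Z x (real T) \<omega> - Z x' (real T) \<omega>) \<le> N (Z x 0 \<omega> - Z x' 0 \<omega>)"
          by (rule pair_nonexpansive[OF sk sk' diff T0(2)])
        moreover have "r x x' \<omega> = 1" unfolding r_def by (rule if_not_P[OF False])
        ultimately show ?thesis using z z' by simp
      qed
    qed
    show "AE \<omega> in M. N (ds (real T) x y \<omega> - ds (real T) x y' \<omega>) \<le> r x x \<omega> * N (y - y')"
      if xy: "(x, y) \<in> joint_space n" "(x, y') \<in> joint_space n" for x y y'
      using driven_path[OF xy(1) T] driven_path[OF xy(2) T]
    proof eventually_elim
      case (elim \<omega>)
      from elim(1) have dr: "driven x (\<lambda>t. W t \<omega>) (\<lambda>t. Z x t \<omega>) (\<lambda>t. Y x t \<omega>) T (S \<omega>)"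
        and \<phi>: "derivative_path (\<lambda>t. Z x t \<omega>) (ddriver (\<lambda>t. W t \<omega>) (\<lambda>t. Y x t \<omega>)) (\<lambda>t. D (x, y) t \<omega>)"
        and e: "D (x, y) (real T) \<omega> = ds (real T) x y \<omega>" "D (x, y) 0 \<omega> = y" by (auto simp: S_def)
      from elim(2) have \<phi>': "derivative_path (\<lambda>t. Z x t \<omega>) (ddriver (\<lambda>t. W t \<omega>) (\<lambda>t. Y x t \<omega>)) (\<lambda>t. D (x, y') t \<omega>)"
        and e': "D (x, y') (real T) \<omega> = ds (real T) x y' \<omega>" "D (x, y') 0 \<omega> = y'" by auto
      from dr have sk: "skorokhod_path (driver x (\<lambda>t. W t \<omega>)) (\<lambda>t. Z x t \<omega>) (\<lambda>t. Y x t \<omega>)" by (simp add: driven_def)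
      show ?case
      proof (cases "good x \<and> S \<omega> \<le> \<eta> * real T")
        case True
        have "N (D (x, y) (real T) \<omega> - D (x, y') (real T) \<omega>) \<le> (1 - contr) * N (D (x, y) 0 \<omega> - D (x, y') 0 \<omega>)"
          using True by (intro derivative_contraction[OF skorokhod_pathD(1)[OF sk] skorokhod_pathD(4)[OF sk] \<phi> \<phi>'] hit[OF dr]) auto
        then show ?thesis using True e e' by (simp add: r_def)
      next
        case False
        have "N (D (x, y) (real T) \<omega> - D (x, y') (real T) \<omega>) \<le> N (D (x, y) 0 \<omega> - D (x, y') 0 \<omega>)"
          by (rule derivative_nonexpansive[OF skorokhod_pathD(1)[OF sk] skorokhod_pathD(4)[OF sk] \<phi> \<phi>' T0(2)])
        moreover have "r x x \<omega> = 1" using False by (auto simp: r_def)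
        ultimately show ?thesis using e e' by simp
      qed
    qed
    show "(\<integral>\<^sup>+\<omega>. ennreal (r x x' \<omega> * (U (zs (real T) x \<omega>) + U (zs (real T) x' \<omega>))) \<partial>M) \<le> ennreal (\<rho> * (U x + U x'))"
      if x: "x \<in> polyhedron_G n" "x' \<in> polyhedron_G n" for x x'
    proof -
      define v where "v = V x + V x'"
      define er where "er = (if v < 8 * K then 1 - contr / 2 else 1)"
      have er0: "0 \<le> er" using contr by (simp add: er_def)
      have er: "(\<integral>\<^sup>+\<omega>. ennreal (r x x' \<omega>) \<partial>M) \<le> ennreal er"
      proof (cases "v < 8 * K")
        case True
        then have "V x < 8 * K" "V x' < 8 * K" using V1[of x] V1[of x'] by (auto simp: v_def)
        then show ?thesis using Er[of x x'] goodV x True by (simp add: er_def)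
      next
        case False
        have "(\<integral>\<^sup>+\<omega>. ennreal (r x x' \<omega>) \<partial>M) \<le> (\<integral>\<^sup>+\<omega>. 1 \<partial>M)"
          by (intro nn_integral_mono) (simp add: r01 ennreal_le_1)
        then show ?thesis using False by (simp add: er_def emeasure_space_1)
      qed
      have "(\<integral>\<^sup>+\<omega>. ennreal (r x x' \<omega> * (U (zs (real T) x \<omega>) + U (zs (real T) x' \<omega>))) \<partial>M) \<le>
        (\<integral>\<^sup>+\<omega>. ennreal (r x x' \<omega>) + (ennreal \<delta> * ennreal (V (zs (real T) x \<omega>)) + ennreal \<delta> * ennreal (V (zs (real T) x' \<omega>))) \<partial>M)"
      proof (rule nn_integral_mono)
        fix \<omega>
        let ?a = "V (zs (real T) x \<omega>)" and ?e = "V (zs (real T) x' \<omega>)"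
        have p: "0 \<le> ?a" "0 \<le> ?e" using V1 by (meson order_trans zero_le_one)+
        \<comment> \<open>The gain in \<open>r\<close> is kept for the constant part of the weights;
          on the part with \<open>V\<close> it is given up, as \<open>r\<close> and \<open>V\<close>
          depend on the same noise.\<close>
        have "r x x' \<omega> * (\<delta> * ?a + \<delta> * ?e) \<le> 1 * (\<delta> * ?a + \<delta> * ?e)"
          using r01 p \<delta> by (intro mult_right_mono) auto
        then have "r x x' \<omega> * (U (zs (real T) x \<omega>) + U (zs (real T) x' \<omega>)) \<le> r x x' \<omega> + (\<delta> * ?a + \<delta> * ?e)"
          by (simp add: U_def algebra_simps)
        then show "ennreal (r x x' \<omega> * (U (zs (real T) x \<omega>) + U (zs (real T) x' \<omega>))) \<le> ennreal (r x x' \<omega>) + (ennreal \<delta> * ennreal ?a + ennreal \<delta> * ennreal ?e)"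
          using p \<delta> r01 by (simp add: ennreal_mult'[symmetric] ennreal_plus[symmetric] del: ennreal_plus)
      qed
      also have "\<dots> = (\<integral>\<^sup>+\<omega>. ennreal (r x x' \<omega>) \<partial>M) + (ennreal \<delta> * (\<integral>\<^sup>+\<omega>. ennreal (V (zs (real T) x \<omega>)) \<partial>M) + ennreal \<delta> * (\<integral>\<^sup>+\<omega>. ennreal (V (zs (real T) x' \<omega>)) \<partial>M))"
        using rm by (simp add: nn_integral_add nn_integral_cmult)
      also have "\<dots> \<le> ennreal er + (ennreal \<delta> * ennreal (V x / 2 + K) + ennreal \<delta> * ennreal (V x' / 2 + K))"
        by (intro add_mono mult_left_mono er drV x) auto
      also have "\<dots> = ennreal (er + (\<delta> * (V x / 2 + K) + \<delta> * (V x' / 2 + K)))"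
      proof -
        have "0 \<le> V x / 2 + K" "0 \<le> V x' / 2 + K" using V1[of x] V1[of x'] K by auto
        then show ?thesis using er0 \<delta> by (simp add: ennreal_mult'[symmetric] ennreal_plus[symmetric] del: ennreal_plus)
      qed
      also have "\<dots> \<le> ennreal (\<rho> * (U x + U x'))"
      proof (rule ennreal_leI)
        have lhs: "er + (\<delta> * (V x / 2 + K) + \<delta> * (V x' / 2 + K)) = er + \<delta> * v / 2 + contr / 12"
          using \<delta>(2) by (simp add: v_def algebra_simps add_divide_distrib)
        have rhs: "U x + U x' = 1 + \<delta> * v" by (simp add: U_def v_def algebra_simps)
        have v0: "0 \<le> v" using V1[of x] V1[of x'] by (simp add: v_def)
        have dv: "0 \<le> \<delta> * v" using v0 \<delta> by simp
        have "er + \<delta> * v / 2 + contr / 12 \<le> \<rho> * (1 + \<delta> * v)"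
        proof (cases "v < 8 * K")
          case True
          have "\<delta> * v \<le> \<delta> * (8 * K)" using True \<delta> by (intro mult_left_mono) auto
          then have "\<delta> * v \<le> contr / 3" using \<delta>(2) by simp
          then have "er + \<delta> * v / 2 + contr / 12 \<le> (1 - contr / 4) * 1" using True by (simp add: er_def)
          also have "\<dots> \<le> \<rho> * (1 + \<delta> * v)" using dv contr by (intro mult_mono) (auto simp: \<rho>_def)
          finally show ?thesis .
        next
          case False
          have "\<delta> * (8 * K) \<le> \<delta> * v" using False \<delta> by (intro mult_left_mono) auto
          then have ge: "contr / 3 \<le> \<delta> * v" using \<delta>(2) by simp
          have "(er + \<delta> * v / 2 + contr / 12) * (1 + contr / 3) \<le> (1 + 3 / 4 * (\<delta> * v)) * (1 + contr / 3)"
            using False ge contr by (intro mult_right_mono) (auto simp: er_def)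
          also have "\<dots> \<le> (1 + contr / 4) * (1 + \<delta> * v)" using ge by (simp add: algebra_simps add_divide_distrib)
          finally have "er + \<delta> * v / 2 + contr / 12 \<le> (1 + contr / 4) / (1 + contr / 3) * (1 + \<delta> * v)"
            using contr by (simp add: pos_le_divide_eq)
          also have "\<dots> \<le> \<rho> * (1 + \<delta> * v)" using dv by (intro mult_right_mono) (auto simp: \<rho>_def)
          finally show ?thesis .
        qed
        then show "er + (\<delta> * (V x / 2 + K) + \<delta> * (V x' / 2 + K)) \<le> \<rho> * (U x + U x')" unfolding lhs rhs .
      qed
      finally show ?thesis .
    qed
    show "continuous_on UNIV H" unfolding H_def[abs_def] by (intro continuous_intros \<Lambda>c)
    show "(0 :: real) \<le> 1 / 2" "1 / 2 < (1 :: real)" by simp_all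
    show "0 \<le> c" unfolding c_def using A4 E0 by (simp add: less_imp_le)
    show "0 \<le> H x" for x unfolding H_def using A4 by simp
    show "(\<integral>\<^sup>+\<omega>. ennreal ((N (zs (real T) x \<omega> - x) + N (ds (real T) x 0 \<omega>)) * U (zs (real T) x \<omega>)) \<partial>M) \<le> ennreal (H x)"
      if x: "x \<in> polyhedron_G n" for x
    proof -
      define R where "R = C3 * (2 + real T + cb / lam) * (1 + \<delta>) * exp (lam * (CL + C4)) * exp (2 * lam * \<Lambda> x)"
      have R: "0 \<le> R" using C3 cb lam \<delta> by (simp add: R_def)
      have "(\<integral>\<^sup>+\<omega>. ennreal ((N (zs (real T) x \<omega> - x) + N (ds (real T) x 0 \<omega>)) * U (zs (real T) x \<omega>)) \<partial>M) \<le>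
        (\<integral>\<^sup>+\<omega>. ennreal R * ennreal (exp ((lam * C4 + 1) * S \<omega>)) \<partial>M)"
      proof (rule nn_integral_mono_AE)
        show "AE \<omega> in M. ennreal ((N (zs (real T) x \<omega> - x) + N (ds (real T) x 0 \<omega>)) * U (zs (real T) x \<omega>)) \<le> ennreal R * ennreal (exp ((lam * C4 + 1) * S \<omega>))"
          using L1[OF x] driven_path[OF joint_0[OF x] T]
        proof eventually_elim
          case (elim \<omega>)
          have S0: "0 \<le> S \<omega>" using elim(1) by simp
          from elim(2) have dr: "driven x (\<lambda>t. W t \<omega>) (\<lambda>t. Z x t \<omega>) (\<lambda>t. Y x t \<omega>) T (S \<omega>)" and wc: "continuous_on {0..} (\<lambda>t. W t \<omega>)"
            and \<phi>: "derivative_path (\<lambda>t. Z x t \<omega>) (ddriver (\<lambda>t. W t \<omega>) (\<lambda>t. Y x t \<omega>)) (\<lambda>t. D (x, 0) t \<omega>)"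
            and e: "Z x (real T) \<omega> = zs (real T) x \<omega>" "D (x, 0) (real T) \<omega> = ds (real T) x 0 \<omega>" "D (x, 0) 0 \<omega> = 0" by (auto simp: S_def)
          have b1: "N (zs (real T) x \<omega> - x) + N (ds (real T) x 0 \<omega>) \<le> C3 * (1 + real T + N x + S \<omega>)"
            using C3(2)[OF dr wc \<phi>] e by simp
          have Nx: "N x \<le> cb / lam * V x"
          proof -
            have "lam * \<Lambda> x \<le> V x" unfolding V_def using exp_ge_add_one_self[of "lam * \<Lambda> x"] by linarith
            then have "\<Lambda> x \<le> V x / lam" using lam by (simp add: field_simps)
            then have "cb * \<Lambda> x \<le> cb * (V x / lam)" using cb by (intro mult_left_mono) auto
            then show ?thesis using coer[OF x] by simp
          qed
          have VE: "1 \<le> V x * exp (S \<omega>)" "V x \<le> V x * exp (S \<omega>)" "exp (S \<omega>) \<le> V x * exp (S \<omega>)"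
          proof -
            have e: "1 \<le> exp (S \<omega>)" using S0 by simp
            have v: "0 \<le> V x" using V1[of x] by linarith
            show 2: "V x \<le> V x * exp (S \<omega>)" using mult_left_mono[OF e v] by simp
            show "exp (S \<omega>) \<le> V x * exp (S \<omega>)" using mult_right_mono[OF V1[of x], of "exp (S \<omega>)"] by simp
            show "1 \<le> V x * exp (S \<omega>)" using 2 V1[of x] by (rule order_trans[rotated])
          qed
          have "1 + real T + N x + S \<omega> \<le> (2 + real T + cb / lam) * (V x * exp (S \<omega>))"
          proof -
            have "real T * 1 \<le> real T * (V x * exp (S \<omega>))" by (rule mult_left_mono[OF VE(1) T0(2)])
            moreover have "cb / lam * V x \<le> cb / lam * (V x * exp (S \<omega>))" using cb lam by (intro mult_left_mono[OF VE(2)]) auto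
            moreover have "S \<omega> \<le> V x * exp (S \<omega>)" using VE exp_ge_add_one_self[of "S \<omega>"] by linarith
            ultimately show ?thesis using VE Nx unfolding distrib_right by linarith
          qed
          then have b2: "C3 * (1 + real T + N x + S \<omega>) \<le> C3 * ((2 + real T + cb / lam) * (V x * exp (S \<omega>)))"
            using C3 by (intro mult_left_mono) auto
          have "\<Lambda> (zs (real T) x \<omega>) \<le> \<Lambda> x + (CL + C4) + C4 * S \<omega>"
          proof -
            have "max (\<Lambda> x - real T) CL \<le> \<Lambda> x + CL" using \<Lambda>0[of x] CL(1) T0 by simp
            then show ?thesis using conjunct1[OF elim(1)] unfolding distrib_left by linarith
          qed
          then have "lam * \<Lambda> (zs (real T) x \<omega>) \<le> lam * (\<Lambda> x + (CL + C4) + C4 * S \<omega>)" using lam by (intro mult_left_mono) auto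
          then have "V (zs (real T) x \<omega>) \<le> exp (lam * (\<Lambda> x + (CL + C4) + C4 * S \<omega>))" by (simp add: V_def)
          also have "\<dots> = V x * exp (lam * (CL + C4)) * exp (lam * C4 * S \<omega>)" by (simp add: V_def exp_add[symmetric] algebra_simps)
          finally have VZ: "V (zs (real T) x \<omega>) \<le> V x * exp (lam * (CL + C4)) * exp (lam * C4 * S \<omega>)" .
          have "U (zs (real T) x \<omega>) \<le> (1 + \<delta>) * V (zs (real T) x \<omega>)" using V1[of "zs (real T) x \<omega>"] by (simp add: U_def distrib_right)
          also have "\<dots> \<le> (1 + \<delta>) * (V x * exp (lam * (CL + C4)) * exp (lam * C4 * S \<omega>))" using VZ \<delta> by (intro mult_left_mono) auto
          finally have b3: "U (zs (real T) x \<omega>) \<le> (1 + \<delta>) * (V x * exp (lam * (CL + C4)) * exp (lam * C4 * S \<omega>))" .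
          have "(N (zs (real T) x \<omega> - x) + N (ds (real T) x 0 \<omega>)) * U (zs (real T) x \<omega>) \<le>
            (C3 * ((2 + real T + cb / lam) * (V x * exp (S \<omega>)))) * ((1 + \<delta>) * (V x * exp (lam * (CL + C4)) * exp (lam * C4 * S \<omega>)))"
          proof (rule mult_mono)
            show "0 \<le> C3 * ((2 + real T + cb / lam) * (V x * exp (S \<omega>)))" using C3 cb lam V1[of x] by simp
            show "0 \<le> U (zs (real T) x \<omega>)" using V1[of "zs (real T) x \<omega>"] \<delta> by (simp add: U_def)
          qed (use b1 b2 b3 in linarith)+
          also have "\<dots> = C3 * (2 + real T + cb / lam) * (1 + \<delta>) * exp (lam * (CL + C4)) * (V x * V x) * (exp (S \<omega>) * exp (lam * C4 * S \<omega>))"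
            by (simp only: mult_ac)
          also have "V x * V x = exp (2 * lam * \<Lambda> x)" by (simp add: V_def exp_add[symmetric])
          also have "exp (S \<omega>) * exp (lam * C4 * S \<omega>) = exp ((lam * C4 + 1) * S \<omega>)" by (simp add: exp_add[symmetric] algebra_simps)
          finally have "(N (zs (real T) x \<omega> - x) + N (ds (real T) x 0 \<omega>)) * U (zs (real T) x \<omega>) \<le> R * exp ((lam * C4 + 1) * S \<omega>)"
            unfolding R_def .
          then show ?case unfolding ennreal_mult'[OF R, symmetric] by (rule ennreal_leI)
        qed
      qed
      also have "\<dots> = ennreal R * (\<integral>\<^sup>+\<omega>. ennreal (exp ((lam * C4 + 1) * S \<omega>)) \<partial>M)" by (rule nn_integral_cmult) measurable
      also have "\<dots> \<le> ennreal R * ennreal (A * exp (J * (lam * C4 + 1)\<^sup>2 * real T / 2))"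
        unfolding A_def J_def S_def using lam C4 T0 by (intro mult_left_mono wsup_moment) auto
      also have "\<dots> = ennreal (R * (A * exp (J * (lam * C4 + 1)\<^sup>2 * real T / 2)))" by (rule ennreal_mult'[OF R, symmetric])
      also have "R * (A * exp (J * (lam * C4 + 1)\<^sup>2 * real T / 2)) = H x" by (simp add: R_def H_def A4_def mult_ac)
      finally show ?thesis .
    qed
    show "(\<integral>\<^sup>+\<omega>. ennreal (H (zs (real T) x \<omega>)) \<partial>M) \<le> ennreal (1 / 2 * H x + c)"
      if x: "x \<in> polyhedron_G n" for x
    proof -
      have "(\<integral>\<^sup>+\<omega>. ennreal (H (zs (real T) x \<omega>)) \<partial>M) = (\<integral>\<^sup>+\<omega>. ennreal A4 * ennreal (exp (2 * lam * \<Lambda> (zs (real T) x \<omega>))) \<partial>M)"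
        unfolding H_def ennreal_mult'[OF A4] ..
      also have "\<dots> = ennreal A4 * (\<integral>\<^sup>+\<omega>. ennreal (exp (2 * lam * \<Lambda> (zs (real T) x \<omega>))) \<partial>M)" by (rule nn_integral_cmult) measurable
      also have "\<dots> \<le> ennreal A4 * ennreal (1 / 2 * exp (2 * lam * \<Lambda> x) + E (2 * lam) * exp (2 * lam * CL))"
      proof (rule mult_left_mono)
        have "E (2 * lam) * exp (- (2 * lam * real T)) * exp (2 * lam * \<Lambda> x) \<le> 1 / 2 * exp (2 * lam * \<Lambda> x)"
          by (intro mult_right_mono q2) simp
        then have "ennreal (E (2 * lam) * exp (- (2 * lam * real T)) * exp (2 * lam * \<Lambda> x) + E (2 * lam) * exp (2 * lam * CL))
            \<le> ennreal (1 / 2 * exp (2 * lam * \<Lambda> x) + E (2 * lam) * exp (2 * lam * CL))"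
          by (intro ennreal_leI add_right_mono)
        moreover have "0 < 2 * lam" using lam by simp
        ultimately show "(\<integral>\<^sup>+\<omega>. ennreal (exp (2 * lam * \<Lambda> (zs (real T) x \<omega>))) \<partial>M) \<le> ennreal (1 / 2 * exp (2 * lam * \<Lambda> x) + E (2 * lam) * exp (2 * lam * CL))"
          using L2[OF x] order_trans by blast
      qed simp
      also have "\<dots> = ennreal (1 / 2 * H x + c)"
        unfolding ennreal_mult'[OF A4, symmetric] by (simp add: H_def c_def algebra_simps)
      finally show ?thesis .
    qed
  qed
  then show thesis by (rule that[OF T])
qed

end

subsection \<open>Stationary distributions\<close>

context joint_rbm
begin

definition push :: "real \<Rightarrow> ((real^'n) \<times> (real^'n)) measure \<Rightarrow> ((real^'n) \<times> (real^'n)) measure" where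
  "push t \<mu> = distr (\<mu> \<Otimes>\<^sub>M M) borel (\<lambda>p. (zs t (fst (fst p)) (snd p), ds t (fst (fst p)) (snd (fst p)) (snd p)))"

lemma push:
  assumes \<mu>: "prob_space \<mu>" "sets \<mu> = sets borel" and t: "0 \<le> t"
  shows "prob_space (push t \<mu>)" "sets (push t \<mu>) = sets borel" "AE \<xi> in push t \<mu>. \<xi> \<in> joint_space n"
    and nn_integral_push: "f \<in> borel_measurable borel \<Longrightarrow> (\<integral>\<^sup>+\<xi>. f \<xi> \<partial>push t \<mu>) = (\<integral>\<^sup>+\<xi>. Pt t f \<xi> \<partial>\<mu>)"
proof -
  interpret \<mu>: prob_space \<mu> by fact
  interpret P: pair_prob_space \<mu> M ..
  let ?s = "\<lambda>p. (zs t (fst (fst p)) (snd p), ds t (fst (fst p)) (snd (fst p)) (snd p))"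
  have s: "?s \<in> borel_measurable (\<mu> \<Otimes>\<^sub>M M)"
    using step_joint[OF t] by (subst measurable_cong_sets[OF sets_pair_measure_cong[OF \<mu>(2) refl] refl])
  show "prob_space (push t \<mu>)" unfolding push_def by (rule P.prob_space_distr[OF s])
  show "sets (push t \<mu>) = sets borel" by (simp add: push_def)
  show "AE \<xi> in push t \<mu>. \<xi> \<in> joint_space n"
    unfolding push_def using joint_borel by (subst AE_distr_iff[OF s]) (simp_all add: zs_ds_in)
  assume f: "f \<in> borel_measurable borel"
  have "(\<integral>\<^sup>+\<xi>. f \<xi> \<partial>push t \<mu>) = (\<integral>\<^sup>+p. f (?s p) \<partial>(\<mu> \<Otimes>\<^sub>M M))"
    unfolding push_def by (rule nn_integral_distr[OF s]) (simp add: f)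
  also have "\<dots> = (\<integral>\<^sup>+\<xi>. \<integral>\<^sup>+\<omega>. f (?s (\<xi>, \<omega>)) \<partial>M \<partial>\<mu>)"
    by (rule nn_integral_fst[symmetric]) (rule measurable_compose[OF s f])
  finally show "(\<integral>\<^sup>+\<xi>. f \<xi> \<partial>push t \<mu>) = (\<integral>\<^sup>+\<xi>. Pt t f \<xi> \<partial>\<mu>)" by (simp add: Pt_def)
qed

lemma emeasure_push:
  assumes "prob_space \<mu>" "sets \<mu> = sets borel" "0 \<le> t" "A \<in> sets borel"
  shows "emeasure (push t \<mu>) A = (\<integral>\<^sup>+\<xi>. Pt t (indicator A) \<xi> \<partial>\<mu>)"
  using nn_integral_push[OF assms(1-3), of "indicator A"] push(2)[OF assms(1-3)] assms(4) by simp

lemma transition_pos: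
  assumes xi: "\<xi> \<in> joint_space n" and t: "0 < t" and A: "A \<in> sets borel"
  shows "ennreal (transition_function M (joint_process Z D) t \<xi> A) = Pt t (indicator A) \<xi>"
proof -
  obtain x y where e: "\<xi> = (x, y)" by (cases \<xi>)
  note xy = xi[unfolded e]
  have m: "(\<lambda>\<omega>. (Z x t \<omega>, D (x, y) t \<omega>)) \<in> borel_measurable M"
    using t by (intro borel_measurable_Pair measurable_F[of t] Z_adapted[OF joint_G[OF xy]] D_adapted[OF xy]) auto
  have S: "{\<omega> \<in> space M. (Z x t \<omega>, D (x, y) t \<omega>) \<in> A} \<in> events"
    using measurable_sets[OF m A] by (simp add: vimage_def Int_def conj_commute)
  have "ennreal (transition_function M (joint_process Z D) t \<xi> A) = emeasure M {\<omega> \<in> space M. (Z x t \<omega>, D (x, y) t \<omega>) \<in> A}"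
    by (simp add: transition_function_def joint_process_def e emeasure_eq_measure)
  also have "\<dots> = (\<integral>\<^sup>+\<omega>. indicator {\<omega> \<in> space M. (Z x t \<omega>, D (x, y) t \<omega>) \<in> A} \<omega> \<partial>M)"
    by (rule nn_integral_indicator[OF S, symmetric])
  also have "\<dots> = (\<integral>\<^sup>+\<omega>. indicator A (zs t x \<omega>, ds t x y \<omega>) \<partial>M)"
  proof (rule nn_integral_cong_AE)
    show "AE \<omega> in M. indicator {\<omega> \<in> space M. (Z x t \<omega>, D (x, y) t \<omega>) \<in> A} \<omega> = (indicator A (zs t x \<omega>, ds t x y \<omega>) :: ennreal)"
      using rep[OF xy t] AE_space by eventually_elim (simp add: indicator_def)
  qed
  finally show ?thesis by (simp add: Pt_def e)
qed

text \<open>Time 0 is treated separately: \<open>rep\<close> concerns positive times, while at time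
  0 the processes sit at their initial state almost surely.\<close>

lemma transition_0:
  assumes xi: "\<xi> \<in> joint_space n" and A: "A \<in> sets borel"
  shows "ennreal (transition_function M (joint_process Z D) 0 \<xi> A) = indicator A \<xi>"
proof -
  obtain x y where e: "\<xi> = (x, y)" by (cases \<xi>)
  note xy = xi[unfolded e]
  have m: "(\<lambda>\<omega>. (Z x 0 \<omega>, D (x, y) 0 \<omega>)) \<in> borel_measurable M"
    by (intro borel_measurable_Pair measurable_F[of 0] Z_adapted[OF joint_G[OF xy]] D_adapted[OF xy]) auto
  have S: "{\<omega> \<in> space M. (Z x 0 \<omega>, D (x, y) 0 \<omega>) \<in> A} \<in> events"
    using measurable_sets[OF m A] by (simp add: vimage_def Int_def conj_commute)
  have "ennreal (transition_function M (joint_process Z D) 0 \<xi> A) = emeasure M {\<omega> \<in> space M. (Z x 0 \<omega>, D (x, y) 0 \<omega>) \<in> A}"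
    by (simp add: transition_function_def joint_process_def e emeasure_eq_measure)
  also have "\<dots> = (\<integral>\<^sup>+\<omega>. indicator {\<omega> \<in> space M. (Z x 0 \<omega>, D (x, y) 0 \<omega>) \<in> A} \<omega> \<partial>M)"
    by (rule nn_integral_indicator[OF S, symmetric])
  also have "\<dots> = (\<integral>\<^sup>+\<omega>. indicator A \<xi> \<partial>M)"
  proof (rule nn_integral_cong_AE)
    show "AE \<omega> in M. indicator {\<omega> \<in> space M. (Z x 0 \<omega>, D (x, y) 0 \<omega>) \<in> A} \<omega> = (indicator A \<xi> :: ennreal)"
      using Z_0[OF joint_G[OF xy]] D_path[OF xy] AE_space by eventually_elim (simp add: indicator_def e)
  qed
  finally show ?thesis by (simp add: emeasure_space_1)
qed

lemma sets_restrict_joint: "sets (restrict_space borel (joint_space n)) = {A \<in> sets borel. A \<subseteq> joint_space n}"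
  by (rule set_eqI) (use joint_borel in \<open>auto simp: sets_restrict_space_iff\<close>)

text \<open>Stationary laws live on the Borel sets of the joint space, invariant laws on the whole
  space with the joint space of full measure. The passage between them is restriction for existence
  and the image under the inclusion for uniqueness.\<close>

lemma stationary_unique_existence: "\<exists>!\<mu>. stationary_distribution M (joint_space n) (joint_process Z D) \<mu>"
proof -
  let ?J = "joint_space n"
  obtain T0 U H r \<rho> q c CN where T0: "0 < (T0 :: nat)"
    and it: "random_iteration M (polyhedron_G n) ?J (zs (real T0)) (ds (real T0)) N CN U H r \<rho> q c"
    by (rule iteration_exists)
  interpret R: random_iteration M "polyhedron_G n" ?J "zs (real T0)" "ds (real T0)" N CN U H r \<rho> q c by (rule it)
  define T where "T = real T0"
  have T: "0 < T" "0 \<le> T" using T0 by (simp_all add: T_def)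
  have inv_iff: "R.invariant \<mu> \<longleftrightarrow> prob_space \<mu> \<and> sets \<mu> = sets borel \<and> (AE \<xi> in \<mu>. \<xi> \<in> ?J) \<and>
      (\<forall>f\<in>borel_measurable borel. (\<integral>\<^sup>+\<xi>. f \<xi> \<partial>\<mu>) = (\<integral>\<^sup>+\<xi>. Pt T f \<xi> \<partial>\<mu>))" for \<mu>
    unfolding R.invariant_def Pt_def T_def ..
  obtain \<mu>0 where inv: "R.invariant \<mu>0" using R.invariant_exists ..
  then have p0: "prob_space \<mu>0" "sets \<mu>0 = sets borel" and J0: "AE \<xi> in \<mu>0. \<xi> \<in> ?J"
    and i0: "\<And>f. f \<in> borel_measurable borel \<Longrightarrow> (\<integral>\<^sup>+\<xi>. f \<xi> \<partial>\<mu>0) = (\<integral>\<^sup>+\<xi>. Pt T f \<xi> \<partial>\<mu>0)"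
    unfolding inv_iff by auto
  have sp0: "space \<mu>0 = UNIV" using sets_eq_imp_space_eq[OF p0(2)] by simp
  have push_eq: "push t \<mu>0 = \<mu>0" if t: "0 < t" for t
  proof (rule R.invariant_unique[OF _ inv])
    note pt = push[OF p0 less_imp_le[OF t]]
    show "R.invariant (push t \<mu>0)" unfolding inv_iff
    proof (intro conjI ballI pt(1-3))
      fix f :: "(real^'n) \<times> (real^'n) \<Rightarrow> ennreal" assume f: "f \<in> borel_measurable borel"
      have ck: "AE \<xi> in \<mu>0. Pt T (Pt t f) \<xi> = Pt t (Pt T f) \<xi>"
        using J0
      proof eventually_elim
        case (elim \<xi>)
        obtain x y where e: "\<xi> = (x, y)" by (cases \<xi>)
        show ?case
          using chapman_kolmogorov[OF elim[unfolded e] T(1) t f] chapman_kolmogorov[OF elim[unfolded e] t T(1) f]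
          by (simp add: e add.commute)
      qed
      have "(\<integral>\<^sup>+\<xi>. f \<xi> \<partial>push t \<mu>0) = (\<integral>\<^sup>+\<xi>. Pt t f \<xi> \<partial>\<mu>0)" by (rule pt(4)[OF f])
      also have "\<dots> = (\<integral>\<^sup>+\<xi>. Pt T (Pt t f) \<xi> \<partial>\<mu>0)" by (rule i0[OF Pt_measurable[OF less_imp_le[OF t] f]])
      also have "\<dots> = (\<integral>\<^sup>+\<xi>. Pt t (Pt T f) \<xi> \<partial>\<mu>0)" by (rule nn_integral_cong_AE[OF ck])
      also have "\<dots> = (\<integral>\<^sup>+\<xi>. Pt T f \<xi> \<partial>push t \<mu>0)" by (rule pt(4)[OF Pt_measurable[OF T(2) f], symmetric])
      finally show "(\<integral>\<^sup>+\<xi>. f \<xi> \<partial>push t \<mu>0) = (\<integral>\<^sup>+\<xi>. Pt T f \<xi> \<partial>push t \<mu>0)" .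
    qed
  qed
  have Jm: "?J \<inter> space \<mu>0 \<in> sets \<mu>0" using joint_borel by (simp add: p0 sp0)
  define \<nu> where "\<nu> = restrict_space \<mu>0 ?J"
  have "stationary_distribution M ?J (joint_process Z D) \<nu>" unfolding stationary_distribution_def
  proof (intro conjI ballI allI impI)
    have "emeasure \<mu>0 ?J = 1"
      using prob_space.emeasure_eq_1_AE[OF p0(1) _ J0] joint_borel by (simp add: p0)
    then show "prob_space \<nu>" unfolding \<nu>_def using joint_borel by (intro prob_space_restrict_space) (simp_all add: p0)
    show "sets \<nu> = sets (restrict_space borel ?J)" unfolding \<nu>_def by (rule sets_restrict_space_cong[OF p0(2)])
    fix A t assume A: "A \<in> sets (restrict_space borel ?J)" and t: "0 \<le> (t :: real)"
    from A have Ab: "A \<in> sets borel" and AJ: "A \<subseteq> ?J" unfolding sets_restrict_joint by auto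
    have "emeasure \<nu> A = emeasure \<mu>0 A" unfolding \<nu>_def by (rule emeasure_restrict_space[OF Jm AJ])
    also have "\<dots> = (\<integral>\<^sup>+\<xi>. ennreal (transition_function M (joint_process Z D) t \<xi> A) * indicator ?J \<xi> \<partial>\<mu>0)"
    proof (cases "t = 0")
      case True
      have "AE \<xi> in \<mu>0. indicator A \<xi> = ennreal (transition_function M (joint_process Z D) t \<xi> A) * indicator ?J \<xi>"
        using J0 by eventually_elim (simp add: True transition_0[OF _ Ab])
      from nn_integral_cong_AE[OF this] show ?thesis using Ab by (simp add: p0)
    next
      case False
      then have t: "0 < t" using t by simp
      have "AE \<xi> in \<mu>0. Pt t (indicator A) \<xi> = ennreal (transition_function M (joint_process Z D) t \<xi> A) * indicator ?J \<xi>"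
        using J0 by eventually_elim (simp add: transition_pos[OF _ t Ab])
      from nn_integral_cong_AE[OF this] show ?thesis
        using emeasure_push[OF p0 less_imp_le[OF t] Ab] push_eq[OF t] by simp
    qed
    also have "\<dots> = (\<integral>\<^sup>+\<xi>. ennreal (transition_function M (joint_process Z D) t \<xi> A) \<partial>\<nu>)"
      unfolding \<nu>_def by (rule nn_integral_restrict_space[OF Jm, symmetric])
    finally show "emeasure \<nu> A = (\<integral>\<^sup>+\<xi>. ennreal (transition_function M (joint_process Z D) t \<xi> A) \<partial>\<nu>)" .
  qed
  moreover have "emeasure \<mu> A = emeasure \<mu>0 A"
    if st: "stationary_distribution M ?J (joint_process Z D) \<mu>" and A: "A \<in> sets (restrict_space borel ?J)" for \<mu> A
  proof -
    from st have p: "prob_space \<mu>" and s: "sets \<mu> = sets (restrict_space borel ?J)"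
      and eq: "\<forall>A\<in>sets (restrict_space borel ?J). \<forall>t\<ge>0. emeasure \<mu> A = (\<integral>\<^sup>+\<xi>. ennreal (transition_function M (joint_process Z D) t \<xi> A) \<partial>\<mu>)"
      unfolding stationary_distribution_def by simp_all
    have sp: "space \<mu> = ?J" using sets_eq_imp_space_eq[OF s] by (simp add: space_restrict_space)
    have id: "(\<lambda>x. x) \<in> measurable \<mu> borel"
      by (subst measurable_cong_sets[OF s refl]) (rule measurable_restrict_space1, simp)
    define \<mu>1 where "\<mu>1 = distr \<mu> borel (\<lambda>x. x)"
    have p1: "prob_space \<mu>1" "sets \<mu>1 = sets borel" using prob_space.prob_space_distr[OF p id] by (simp_all add: \<mu>1_def)
    have e1: "emeasure \<mu>1 B = emeasure \<mu> (B \<inter> ?J)" if "B \<in> sets borel" for B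
      unfolding \<mu>1_def by (subst emeasure_distr[OF id that]) (simp add: sp)
    have "\<mu>1 = push T \<mu>1"
    proof (rule measure_eqI)
      show "sets \<mu>1 = sets (push T \<mu>1)" using push(2)[OF p1 T(2)] p1 by simp
      fix B assume "B \<in> sets \<mu>1"
      then have B: "B \<in> sets borel" by (simp add: p1)
      have BJ: "B \<inter> ?J \<in> sets borel" using B joint_borel by simp
      have "emeasure \<mu>1 B = emeasure \<mu> (B \<inter> ?J)" by (rule e1[OF B])
      also have "\<dots> = (\<integral>\<^sup>+\<xi>. ennreal (transition_function M (joint_process Z D) T \<xi> (B \<inter> ?J)) \<partial>\<mu>)"
        using BJ T by (intro eq[rule_format]) (simp_all add: sets_restrict_joint)
      \<comment> \<open>The step never leaves the joint space, so the intersection with it may be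
        dropped.\<close>
      also have "\<dots> = (\<integral>\<^sup>+\<xi>. Pt T (indicator B) \<xi> \<partial>\<mu>)"
        using zs_ds_in by (intro nn_integral_cong)
          (simp add: transition_pos[OF _ T(1) BJ] sp Pt_def indicator_def)
      also have "\<dots> = (\<integral>\<^sup>+\<xi>. Pt T (indicator B) \<xi> \<partial>\<mu>1)"
        unfolding \<mu>1_def using Pt_measurable[OF T(2) borel_measurable_indicator[OF B]]
        by (intro nn_integral_distr[OF id, symmetric]) simp
      also have "\<dots> = emeasure (push T \<mu>1) B" by (rule emeasure_push[OF p1 T(2) B, symmetric])
      finally show "emeasure \<mu>1 B = emeasure (push T \<mu>1) B" .
    qed
    then have pu: "push T \<mu>1 = \<mu>1" by (rule sym)
    have "R.invariant \<mu>1"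
      unfolding inv_iff using push(3)[OF p1 T(2)] nn_integral_push[OF p1 T(2)] p1 unfolding pu by simp
    then have "\<mu>1 = \<mu>0" using inv by (rule R.invariant_unique)
    moreover have "A \<in> sets borel" "A \<inter> ?J = A" using A by (auto simp: sets_restrict_joint)
    ultimately show ?thesis using e1[of A] by simp
  qed
  moreover have "sets \<mu> = sets (restrict_space borel ?J)" if "stationary_distribution M ?J (joint_process Z D) \<mu>" for \<mu>
    using that unfolding stationary_distribution_def by (elim conjE)
  ultimately show ?thesis
    by (intro ex1I[of _ \<nu>] measure_eqI) simp_all
qed

end

theorem theorem3p6:
  fixes n :: "'n::finite \<Rightarrow> real^'n"
    and U :: "real set"
    and d :: "'n \<Rightarrow> real \<Rightarrow> real^'n"
    and a \<sigma> :: "real \<Rightarrow> real^'n^'n"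
    and b :: "real \<Rightarrow> real^'n"
    and M :: "'w measure"
    and F :: "real \<Rightarrow> 'w measure"
    and W :: "real \<Rightarrow> 'w \<Rightarrow> real^'n"
    and Z Y :: "real \<Rightarrow> real^'n \<Rightarrow> real \<Rightarrow> 'w \<Rightarrow> real^'n"
    and D :: "real \<Rightarrow> (real^'n) \<times> (real^'n) \<Rightarrow> real \<Rightarrow> 'w \<Rightarrow> real^'n"
  assumes normals: "lin_indep_family n" "\<And>i. norm (n i) = 1"
    and U: "open U"
    and d: "\<And>i. d i C1_differentiable_on U" "\<And>i \<alpha>. \<alpha> \<in> U \<Longrightarrow> d i \<alpha> \<bullet> n i = 1"
    and a: "a C1_differentiable_on U" "\<And>\<alpha>. \<alpha> \<in> U \<Longrightarrow> sym_posdef (a \<alpha>)"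
    and b: "b C1_differentiable_on U"
    and \<sigma>: "\<sigma> = (\<lambda>\<alpha>. posdef_sqrt (a \<alpha>))"
    and lin_indep: "lin_indep_condition U d"
    and set_B: "set_B_condition U n d"
    and projection: "projection_condition U n d"
    and holder: "holder_condition U d b \<sigma>"
    and stability: "stability_condition U d b"
    and filtered: "usual_filtered_prob_space M F"
    and W: "brownian_motion M F W"
    and Z: "\<And>\<alpha> x. \<alpha> \<in> U \<Longrightarrow> x \<in> polyhedron_G n \<Longrightarrow>
              reflected_BM M F W n d b \<sigma> \<alpha> (Z \<alpha> x) (Y \<alpha> x) \<and> (AE \<omega> in M. Z \<alpha> x 0 \<omega> = x)"
    and D: "\<And>\<alpha> x y. \<alpha> \<in> U \<Longrightarrow> (x, y) \<in> joint_space n \<Longrightarrow>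
              derivative_process M F W n d b \<sigma> \<alpha> (Z \<alpha> x) (Y \<alpha> x) (D \<alpha> (x, y)) \<and>
              (AE \<omega> in M. D \<alpha> (x, y) 0 \<omega> = y)"
  shows "\<forall>\<alpha>\<in>U. \<exists>!\<mu>. stationary_distribution M (joint_space n) (joint_process (Z \<alpha>) (D \<alpha>)) \<mu>"
proof
  fix \<alpha> assume \<alpha>: "\<alpha> \<in> U"
  let ?d = "\<lambda>i. d i \<alpha>"
  let ?b' = "vector_derivative b (at \<alpha>)" and ?\<sigma>' = "vector_derivative \<sigma> (at \<alpha>)"
  let ?R' = "vector_derivative (refl_matrix d) (at \<alpha>)"
  \<comment> \<open>At a fixed parameter the directions form a constant family, the form in which
    the coordinates \<open>co\<close> and the drivers were set up.\<close>
  have R: "refl_matrix d \<alpha> = refl_matrix (\<lambda>i _. ?d i) 0" by (simp add: refl_matrix_def)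
  from set_B obtain \<theta> B where "\<forall>\<alpha>\<in>U. 0 < \<theta> \<alpha> \<and> compact (B \<alpha>) \<and> convex (B \<alpha>) \<and> (\<forall>z\<in>B \<alpha>. - z \<in> B \<alpha>) \<and>
        0 \<in> interior (B \<alpha>) \<and>
        (\<forall>i. \<forall>z\<in>frontier (B \<alpha>). \<bar>z \<bullet> n i\<bar> < \<theta> \<alpha> \<longrightarrow>
          (\<forall>\<nu>. norm \<nu> = 1 \<and> (\<forall>y\<in>B \<alpha>. 0 \<le> \<nu> \<bullet> (y - z)) \<longrightarrow> \<nu> \<bullet> d i \<alpha> = 0))"
    unfolding set_B_condition_def by (elim exE conjE)
  from bspec[OF this \<alpha>] have B: "0 < \<theta> \<alpha>" "compact (B \<alpha>)" "convex (B \<alpha>)" "\<forall>z\<in>B \<alpha>. - z \<in> B \<alpha>" "0 \<in> interior (B \<alpha>)"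
    "\<forall>i. \<forall>z\<in>frontier (B \<alpha>). \<bar>z \<bullet> n i\<bar> < \<theta> \<alpha> \<longrightarrow>
          (\<forall>\<nu>. norm \<nu> = 1 \<and> (\<forall>y\<in>B \<alpha>. 0 \<le> \<nu> \<bullet> (y - z)) \<longrightarrow> \<nu> \<bullet> d i \<alpha> = 0)" by simp_all
  from projection \<alpha> obtain pr where pr: "\<forall>x. pr x \<in> polyhedron_G n" "\<forall>x\<in>polyhedron_G n. pr x = x"
    "\<forall>x. x \<notin> polyhedron_G n \<longrightarrow> pr x - x \<in> refl_cone n d \<alpha> (pr x)"
    unfolding projection_condition_def by blast
  interpret br: brownian M F W using filtered W by unfold_locales
  interpret rd: rbm_data n ?d "B \<alpha>" "\<theta> \<alpha>" pr "b \<alpha>" "\<sigma> \<alpha>" ?b' ?\<sigma>' ?R'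
  proof
    show "lin_indep_family ?d" using lin_indep \<alpha> by (simp add: lin_indep_condition_def)
    show "b \<alpha> \<in> interior (fin_cone (range (\<lambda>i. - d i \<alpha>)))" using stability \<alpha> by (simp add: stability_condition_def)
    show "pr x - x \<in> fin_cone (?d ` active n (pr x))" if "x \<notin> polyhedron_G n" for x
      using pr(3) that by (simp add: refl_cone_def)
    show "\<nu> \<bullet> ?d i = 0" if "z \<in> frontier (B \<alpha>)" "\<bar>z \<bullet> n i\<bar> < \<theta> \<alpha>" "norm \<nu> = 1" "\<And>y. y \<in> B \<alpha> \<Longrightarrow> 0 \<le> \<nu> \<bullet> (y - z)" for i z \<nu>
      using B(6) that by simp
  qed (use normals d(2)[OF \<alpha>] B pr in simp_all)
  have W0: "AE \<omega> in M. W 0 \<omega> = 0" using W unfolding brownian_motion_def by (elim conjE)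
  have Zp: "AE \<omega> in M. rd.skorokhod_path (rd.driver x (\<lambda>t. W t \<omega>)) (\<lambda>t. Z \<alpha> x t \<omega>) (\<lambda>t. Y \<alpha> x t \<omega>)"
    and Za: "adapted_process F (Z \<alpha> x)" if x: "x \<in> polyhedron_G n" for x
  proof -
    from Z[OF \<alpha> x] have c: "continuous_process M (Z \<alpha> x)" "continuous_process M (Y \<alpha> x)" and "adapted_process F (Z \<alpha> x)"
      and z: "AE \<omega> in M. \<forall>t\<ge>0. Z \<alpha> x t \<omega> \<in> polyhedron_G n \<and> Z \<alpha> x t \<omega> = Z \<alpha> x 0 \<omega> + t *\<^sub>R b \<alpha> + \<sigma> \<alpha> *v W t \<omega> + Y \<alpha> x t \<omega>"
      and y: "AE \<omega> in M. \<forall>s t. 0 \<le> s \<and> s < t \<longrightarrow>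
        Y \<alpha> x t \<omega> - Y \<alpha> x s \<omega> \<in> fin_cone (\<Union>u\<in>{s<..t}. refl_cone n d \<alpha> (Z \<alpha> x u \<omega>))"
      and z0: "AE \<omega> in M. Z \<alpha> x 0 \<omega> = x"
      unfolding reflected_BM_def by simp_all
    show "adapted_process F (Z \<alpha> x)" by fact
    show "AE \<omega> in M. rd.skorokhod_path (rd.driver x (\<lambda>t. W t \<omega>)) (\<lambda>t. Z \<alpha> x t \<omega>) (\<lambda>t. Y \<alpha> x t \<omega>)"
      using z y z0 W0 AE_space
    proof eventually_elim
      case (elim \<omega>)
      \<comment> \<open>The equation at time 0 forces the push to start at 0, because
        \<open>W\<close> does.\<close>
      have "Y \<alpha> x 0 \<omega> = 0" using spec[OF elim(1), of 0] elim(4) by simp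
      moreover have "continuous_on {0..} (\<lambda>t. Z \<alpha> x t \<omega>)" "continuous_on {0..} (\<lambda>t. Y \<alpha> x t \<omega>)"
        using c elim(5) by (simp_all add: continuous_process_def)
      moreover have "\<forall>t\<ge>0. Z \<alpha> x t \<omega> \<in> polyhedron_G n \<and> Z \<alpha> x t \<omega> = rd.driver x (\<lambda>t. W t \<omega>) t + Y \<alpha> x t \<omega>"
        using elim(1) unfolding rd.driver_def elim(3) .
      ultimately show ?case using elim(2) unfolding rd.skorokhod_path_def refl_cone_def by blast
    qed
  qed
  have Dp: "AE \<omega> in M. rd.derivative_path (\<lambda>t. Z \<alpha> x t \<omega>) (rd.ddriver (\<lambda>t. W t \<omega>) (\<lambda>t. Y \<alpha> x t \<omega>)) (\<lambda>t. D \<alpha> (x, y) t \<omega>)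
      \<and> D \<alpha> (x, y) 0 \<omega> = y"
    and Da: "adapted_process F (D \<alpha> (x, y))" if xy: "(x, y) \<in> joint_space n" for x y
  proof -
    from D[OF \<alpha> xy] obtain K where rc: "rcll_process M (D \<alpha> (x, y))" and "adapted_process F (D \<alpha> (x, y))"
      and D1: "AE \<omega> in M. \<forall>t\<ge>0. D \<alpha> (x, y) t \<omega> \<in> tangent_H n (Z \<alpha> x t \<omega>) \<and>
        D \<alpha> (x, y) t \<omega> = D \<alpha> (x, y) 0 \<omega> + t *\<^sub>R ?b' + ?\<sigma>' *v W t \<omega>
          + ?R' *v (matrix_inv (refl_matrix d \<alpha>) *v Y \<alpha> x t \<omega>) + K t \<omega>"
      and K: "AE \<omega> in M. \<forall>s t. 0 \<le> s \<and> s < t \<longrightarrow> K t \<omega> - K s \<omega> \<in> span (\<Union>u\<in>{s<..t}. refl_cone n d \<alpha> (Z \<alpha> x u \<omega>))"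
      and D0: "AE \<omega> in M. D \<alpha> (x, y) 0 \<omega> = y"
      unfolding derivative_process_def by (elim exE conjE)
    show "adapted_process F (D \<alpha> (x, y))" by fact
    show "AE \<omega> in M. rd.derivative_path (\<lambda>t. Z \<alpha> x t \<omega>) (rd.ddriver (\<lambda>t. W t \<omega>) (\<lambda>t. Y \<alpha> x t \<omega>)) (\<lambda>t. D \<alpha> (x, y) t \<omega>)
      \<and> D \<alpha> (x, y) 0 \<omega> = y"
      using D1 K D0 AE_space
    proof eventually_elim
      case (elim \<omega>)
      have "D \<alpha> (x, y) t \<omega> - D \<alpha> (x, y) s \<omega> - (rd.ddriver (\<lambda>t. W t \<omega>) (\<lambda>t. Y \<alpha> x t \<omega>) t - rd.ddriver (\<lambda>t. W t \<omega>) (\<lambda>t. Y \<alpha> x t \<omega>) s)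
          \<in> span (?d ` rd.hits (\<lambda>t. Z \<alpha> x t \<omega>) {s<..t})" if st: "0 \<le> s" "s < t" for s t
      proof -
        have eq: "D \<alpha> (x, y) r \<omega> = D \<alpha> (x, y) 0 \<omega> + rd.ddriver (\<lambda>t. W t \<omega>) (\<lambda>t. Y \<alpha> x t \<omega>) r + K r \<omega>" if "0 \<le> r" for r
          using conjunct2[OF elim(1)[rule_format, OF that]] unfolding rd.ddriver_def R by (simp only: add.assoc)
        have "D \<alpha> (x, y) t \<omega> - D \<alpha> (x, y) s \<omega> - (rd.ddriver (\<lambda>t. W t \<omega>) (\<lambda>t. Y \<alpha> x t \<omega>) t - rd.ddriver (\<lambda>t. W t \<omega>) (\<lambda>t. Y \<alpha> x t \<omega>) s)
            = K t \<omega> - K s \<omega>" using eq[of t] eq[of s] st by simp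
        also have "\<dots> \<in> span (\<Union>u\<in>{s<..t}. refl_cone n d \<alpha> (Z \<alpha> x u \<omega>))" using elim(2) st by blast
        \<comment> \<open>Each cone of pushing directions lies in the span of its
          generators.\<close>
        also have "\<dots> \<subseteq> span (?d ` rd.hits (\<lambda>t. Z \<alpha> x t \<omega>) {s<..t})"
        proof (rule span_minimal[OF _ subspace_span], rule UN_least)
          fix u assume u: "u \<in> {s<..t}"
          show "refl_cone n d \<alpha> (Z \<alpha> x u \<omega>) \<subseteq> span (?d ` rd.hits (\<lambda>t. Z \<alpha> x t \<omega>) {s<..t})"
          proof
            fix v assume "v \<in> refl_cone n d \<alpha> (Z \<alpha> x u \<omega>)"
            then obtain S c where S: "S \<subseteq> ?d ` active n (Z \<alpha> x u \<omega>)" and v: "v = (\<Sum>w\<in>S. c w *\<^sub>R w)"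
              unfolding refl_cone_def fin_cone_def by blast
            have "S \<subseteq> span (?d ` rd.hits (\<lambda>t. Z \<alpha> x t \<omega>) {s<..t})"
              using S u unfolding rd.hits_def by (blast intro: span_base)
            then show "v \<in> span (?d ` rd.hits (\<lambda>t. Z \<alpha> x t \<omega>) {s<..t})"
              unfolding v by (intro span_sum span_scale) blast
          qed
        qed
        finally show ?thesis .
      qed
      moreover have "\<forall>t\<ge>0. ((\<lambda>t. D \<alpha> (x, y) t \<omega>) \<longlongrightarrow> D \<alpha> (x, y) t \<omega>) (at_right t)"
        using rc elim(4) by (simp add: rcll_process_def)
      moreover have "\<forall>t\<ge>0. \<forall>i\<in>active n (Z \<alpha> x t \<omega>). D \<alpha> (x, y) t \<omega> \<bullet> n i = 0"
        using conjunct1[OF elim(1)[rule_format]] unfolding tangent_H_def by blast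
      ultimately show ?case using elim(3) unfolding rd.derivative_path_def by simp
    qed
  qed
  interpret jr: joint_rbm n ?d "B \<alpha>" "\<theta> \<alpha>" pr "b \<alpha>" "\<sigma> \<alpha>" ?b' ?\<sigma>' ?R' M F W "Z \<alpha>" "Y \<alpha>" "D \<alpha>"
    by unfold_locales (use Zp Za Dp Da in \<open>simp_all add: adapted_process_def\<close>)
  show "\<exists>!\<mu>. stationary_distribution M (joint_space n) (joint_process (Z \<alpha>) (D \<alpha>)) \<mu>"
    by (rule jr.stationary_unique_existence)
qed

end
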